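(* There exist $P_0>0$ and a family of trajectories $v(\cdot;p_0)\in PC^2[0;p_0]$, one for each $p_0\ge P_0$, such that: (a) each $v(\cdot;p_0)$ is a convex function with $v(p_0;p_0)=p_0$ which satisfies all the conditions of Pontryagin's Maximum Principle with $\lambda_0=1$ (listed in the context, with $M=v(0;p_0)$); (b) there is a point $r(p_0)\in(0;p_0)$ such that $v''(p;p_0)=0$ for $p\in[0;r(p_0)]$ (nonsingular part), while on $[r(p_0);p_0]$ the trajectory is singular, i.e. it satisfies $$v''=-\frac14\frac{(v'-1)^2}{v-p}-\frac14\frac{(v'+1)^2}{v+p}+\frac{2v v'^2}{1+v^2};$$ (c) the trajectories $v(\cdot;p_0)$ for different $p_0\ge P_0$ do not intersect one another, and they fill in a one-to-one way the subdomain of $U=\{(p,v):0\le p\le v\}$ lying above the trajectory $v(\cdot;P_0)$; (d) for each $p_0\ge P_0$, the Jacobi equation $$\frac{d}{dp}\big(f_{v'v'}\xi'+f_{v'v}\xi\big)=f_{v'v}\xi'+f_{vv}\xi$$ along $v(\cdot;p_0)$ has a unique solution with $\xi(p_0)=0$, $\xi'(p_0)=1$, and this solution satisfies $\xi(p)\neq0$ for all $p\in[0;p_0)$.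
   Context: $PC^2[0;p_0]$ is the class of $C^1$ functions on $[0;p_0]$ whose second derivative is piecewise continuous. The integrand is $$f(p,v,v')=\frac{2\sqrt{v^2-p^2}\,(v')^2}{(1+v^2)^2}-\frac{pv'-v}{v(1+v^2)\sqrt{v^2-p^2}} .$$ The optimal control problem is: minimize $J(v)=\int_0^{p_0}f(p,v,v')\,dp$ subject to $v'=w$, $w'=\theta\ge0$, $v(0)=M$, $v(p_0)=p_0<\infty$. Pontryagin's Maximum Principle with $\lambda_0=1$ for a trajectory $v$ (with $w=v'$, $\theta=v''\ge0$): there exist functions $\varphi,\psi$ with $\varphi'=f_v$, $\psi'=f_{v'}-\varphi$ along $v$, such that $\psi\le0$, $\psi$ vanishes on the support of $\theta$, $\psi(0)=0$, $\psi(p_0)=0$, and $\varphi-H\to0$ as $p\to p_0-0$, where $H=-f(p,v,w)+\varphi w+\psi\theta$. A part of the trajectory is called singular if $\psi\equiv0$ there. In the Jacobi equation, the derivatives of $f$ are evaluated along $(p,v(p;p_0),v'(p;p_0))$ on the whole interval $[0;p_0]$ (including the affine part, where the Euler–Lagrange equation is not satisfied). "Lying above $v(\cdot;P_0)$" means the set of $(p,y)$ with $0\le p\le y$ and, if $p\le P_0$, $y\ge v(p;P_0)$. *)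

theory Defs
  imports "HOL-Analysis.Analysis"
begin

definition f :: "real \<Rightarrow> real \<Rightarrow> real \<Rightarrow> real" where
  "f p v w = 2 * sqrt (v\<^sup>2 - p\<^sup>2) * w\<^sup>2 / (1 + v\<^sup>2)\<^sup>2
             - (p * w - v) / (v * (1 + v\<^sup>2) * sqrt (v\<^sup>2 - p\<^sup>2))"

text \<open>Partial derivatives of the integrand; the letter w stands for the slot of v'.\<close>

definition f_v :: "real \<Rightarrow> real \<Rightarrow> real \<Rightarrow> real" where
  "f_v p v w = deriv (\<lambda>y. f p y w) v"

definition f_w :: "real \<Rightarrow> real \<Rightarrow> real \<Rightarrow> real" where
  "f_w p v w = deriv (\<lambda>z. f p v z) w"

definition f_vv :: "real \<Rightarrow> real \<Rightarrow> real \<Rightarrow> real" where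
  "f_vv p v w = deriv (\<lambda>y. f_v p y w) v"

definition f_wv :: "real \<Rightarrow> real \<Rightarrow> real \<Rightarrow> real" where
  "f_wv p v w = deriv (\<lambda>y. f_w p y w) v"

definition f_ww :: "real \<Rightarrow> real \<Rightarrow> real \<Rightarrow> real" where
  "f_ww p v w = deriv (\<lambda>z. f_w p v z) w"

text \<open>Derivatives of a trajectory on [0, b], one-sided at the end points. Where v' is not
  differentiable, the value of D2 is unspecified.\<close>

definition D1 :: "real \<Rightarrow> (real \<Rightarrow> real) \<Rightarrow> real \<Rightarrow> real" where
  "D1 b v p = vector_derivative v (at p within {0..b})"

definition D2 :: "real \<Rightarrow> (real \<Rightarrow> real) \<Rightarrow> real \<Rightarrow> real" where
  "D2 b v = D1 b (D1 b v)"

text \<open>Piecewise continuity on [a, b] includes finite one-sided limits at every point; the function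
  need not be meaningfully defined at the finitely many exceptional points.\<close>

definition piecewise_continuous :: "real \<Rightarrow> real \<Rightarrow> (real \<Rightarrow> real) \<Rightarrow> bool" where
  "piecewise_continuous a b g \<longleftrightarrow>
     (\<exists>S. finite S \<and> continuous_on ({a..b} - S) g) \<and>
     (\<forall>s\<in>{a..<b}. \<exists>l. (g \<longlongrightarrow> l) (at_right s)) \<and>
     (\<forall>s\<in>{a<..b}. \<exists>l. (g \<longlongrightarrow> l) (at_left s))"

definition PC2 :: "real \<Rightarrow> (real \<Rightarrow> real) set" where
  "PC2 b = {v. v differentiable_on {0..b} \<and> continuous_on {0..b} (D1 b v) \<and>
               (\<exists>S. finite S \<and> D1 b v differentiable_on ({0..b} - S)) \<and>
               piecewise_continuous 0 b (D2 b v)}"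

text \<open>Strictness p < v(p) for p < b is what makes the integrand and its derivatives meaningful
  along the trajectory; at p = b they are singular, because v(b) = b.\<close>

definition admissible :: "real \<Rightarrow> (real \<Rightarrow> real) \<Rightarrow> bool" where
  "admissible b v \<longleftrightarrow>
     v \<in> PC2 b \<and> v b = b \<and> (\<forall>p\<in>{0..<b}. p < v p) \<and>
     (\<forall>p\<in>{0..b}. D1 b v differentiable (at p within {0..b}) \<longrightarrow> 0 \<le> D2 b v p)"

definition control_support :: "real \<Rightarrow> (real \<Rightarrow> real) \<Rightarrow> real set" where
  "control_support b v =
     closure {p\<in>{0..b}. D1 b v differentiable (at p within {0..b}) \<and> D2 b v p \<noteq> 0}"

definition Ham ::
    "real \<Rightarrow> (real \<Rightarrow> real) \<Rightarrow> (real \<Rightarrow> real) \<Rightarrow> (real \<Rightarrow> real) \<Rightarrow> real \<Rightarrow> real" where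
  "Ham b v \<phi> \<psi> p = - f p (v p) (D1 b v p) + \<phi> p * D1 b v p + \<psi> p * D2 b v p"

text \<open>Pontryagin's Maximum Principle with multiplier 1 of the integrand. The adjoint equations are
  imposed on [0, b) only, the integrand being singular at the end point.\<close>

definition PMP ::
    "real \<Rightarrow> (real \<Rightarrow> real) \<Rightarrow> (real \<Rightarrow> real) \<Rightarrow> (real \<Rightarrow> real) \<Rightarrow> bool" where
  "PMP b v \<phi> \<psi> \<longleftrightarrow>
     (\<forall>p\<in>{0..<b}. (\<phi> has_real_derivative f_v p (v p) (D1 b v p)) (at p within {0..b})) \<and>
     (\<forall>p\<in>{0..<b}. (\<psi> has_real_derivative f_w p (v p) (D1 b v p) - \<phi> p) (at p within {0..b})) \<and>
     continuous_on {0..b} \<psi> \<and>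
     (\<forall>p\<in>{0..b}. \<psi> p \<le> 0) \<and>
     (\<forall>p\<in>control_support b v. \<psi> p = 0) \<and>
     \<psi> 0 = 0 \<and> \<psi> b = 0 \<and>
     ((\<lambda>p. \<phi> p - Ham b v \<phi> \<psi> p) \<longlongrightarrow> 0) (at_left b)"

definition singular_on :: "real set \<Rightarrow> (real \<Rightarrow> real) \<Rightarrow> bool" where
  "singular_on A \<psi> \<longleftrightarrow> (\<forall>p\<in>A. \<psi> p = 0)"

definition singular_rhs :: "real \<Rightarrow> real \<Rightarrow> real \<Rightarrow> real" where
  "singular_rhs p v w = - (1/4) * (w - 1)\<^sup>2 / (v - p) - (1/4) * (w + 1)\<^sup>2 / (v + p)
                        + 2 * v * w\<^sup>2 / (1 + v\<^sup>2)"

definition graph_on :: "real \<Rightarrow> (real \<Rightarrow> real) \<Rightarrow> (real \<times> real) set" where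
  "graph_on b v = {(p, v p) | p. p \<in> {0..b}}"

definition region_above :: "real \<Rightarrow> (real \<Rightarrow> real) \<Rightarrow> (real \<times> real) set" where
  "region_above b v = {(p, y). 0 \<le> p \<and> p \<le> y \<and> (p \<le> b \<longrightarrow> v p \<le> y)}"

text \<open>C1 solutions on [0, b] of the Jacobi equation along v with \<xi>(b) = 0, \<xi>'(b) = 1. As the
  coefficients are singular at b, the equation itself is imposed on [0, b).\<close>

definition jacobi_solution :: "real \<Rightarrow> (real \<Rightarrow> real) \<Rightarrow> (real \<Rightarrow> real) \<Rightarrow> bool" where
  "jacobi_solution b v \<xi> \<longleftrightarrow>
     \<xi> differentiable_on {0..b} \<and> continuous_on {0..b} (D1 b \<xi>) \<and>
     (\<forall>p\<in>{0..<b}.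
        ((\<lambda>q. f_ww q (v q) (D1 b v q) * D1 b \<xi> q + f_wv q (v q) (D1 b v q) * \<xi> q)
           has_real_derivative
             f_wv p (v p) (D1 b v p) * D1 b \<xi> p + f_vv p (v p) (D1 b v p) * \<xi> p)
        (at p within {0..b})) \<and>
     \<xi> b = 0 \<and> D1 b \<xi> b = 1"

end

(* Put x = sqrt((v - p)/(v + p)), so that p/v = (1 - x^2)/(1 + x^2) = cc x and
   sqrt(v^2 - p^2)/v = 2x/(1 + x^2) = ss x. If v' = 1/(cc x + ss x b(x)), then
   ln v = ln p0 - zet b x, and up to terms of size 1/(1 + v^2) the singular equation becomes an
   equation for b on a fixed x-interval, in which p0 does not occur. For ln p0 >= 20 the error terms
   are below 10^(-9), so everything is a small perturbation of one scale-invariant picture: b is the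
   fixed point of a contraction, the singular arc is left at the angle x_r in [2/3, 7/9] where
   psi(0) = 0 holds for its tangent line, and b and x_r are Lipschitz in ln p0 with small constants.
   Hence ln v at a fixed angle x is strictly increasing and unbounded in ln p0, which gives the field.

   For the Jacobi equation on the singular part, u = v - p v' is a solution up to the failure of the
   singular equation to be homogeneous, so xi/u satisfies an integral equation with a small
   kernel; on the affine part a second integral equation takes over, and both kernels are too small
   for xi to reach zero. *)

theory Submission
  imports Defs
begin

section \<open>The integrand and its partial derivatives\<close>

text \<open>The end point p = b shapes the proof: there v = p, so \<open>kin\<close> vanishes, the
  coefficients of the singular equation and of the Jacobi equation blow up, and no initial value
  theorem applies. In the variable x the first singularity becomes a regular singular point at x = 0
  with integrating factor \<open>Wt\<close>; weighted means with weight \<open>wt\<close>, its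
  derivative, single out the bounded solution. For the second, the equation of xi/u is integrated
  from b as a double integral in which only the product of the unbounded kernel with a tail integral
  has to be estimated.

  The second obstacle is that two signs hold by narrow margins. Convexity needs b^2 + 4/(1 + v^2) <
  3 on the arc, and b^2 is only known to stay below 2.935; for the switch, the slope must be at
  least 0.532 at x = 2/3 and at most 0.5302 at x = 7/9. The order interval on which the contraction
  acts is too wide for either, so its fixed point is then squeezed between two parabolas e + x - k
  x^2. Most decimals below come from these parabolas, from the ends 2/3 and 7/9, and from exp 36 >
  10^9.\<close>

definition kin :: "real \<Rightarrow> real \<Rightarrow> real" where
  "kin p v = 4 * sqrt (v\<^sup>2 - p\<^sup>2) / (1 + v\<^sup>2)\<^sup>2"

definition lin :: "real \<Rightarrow> real \<Rightarrow> real" where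
  "lin p v = 1 / (v * (1 + v\<^sup>2) * sqrt (v\<^sup>2 - p\<^sup>2))"

definition kin_v :: "real \<Rightarrow> real \<Rightarrow> real" where
  "kin_v p v = kin p v * (v / (v\<^sup>2 - p\<^sup>2) - 4 * v / (1 + v\<^sup>2))"

definition lin_v :: "real \<Rightarrow> real \<Rightarrow> real" where
  "lin_v p v = - lin p v * (1 / v + 2 * v / (1 + v\<^sup>2) + v / (v\<^sup>2 - p\<^sup>2))"

definition singular_rhs_v :: "real \<Rightarrow> real \<Rightarrow> real \<Rightarrow> real" where
  "singular_rhs_v p v w = - (w\<^sup>2 + 1) / (2 * (v\<^sup>2 - p\<^sup>2))
     + v * (v * (w\<^sup>2 + 1) - 2 * p * w) / (v\<^sup>2 - p\<^sup>2)\<^sup>2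
     + 2 * w\<^sup>2 * (1 - v\<^sup>2) / (1 + v\<^sup>2)\<^sup>2"

text \<open>The v-derivative of \<open>kin * singular_rhs\<close>, which is minus the Euler-Lagrange
  defect on a line. Where v'' = 0 it is the whole potential in the self-adjoint form (kin xi')' =
  jac_Q xi of the Jacobi equation.\<close>

definition jac_Q :: "real \<Rightarrow> real \<Rightarrow> real \<Rightarrow> real" where
  "jac_Q p v w = kin p v * singular_rhs_v p v w + kin_v p v * singular_rhs p v w"

lemma one_plus_square_pos: "1 + (v::real)\<^sup>2 > 0" "1 + (v::real)\<^sup>2 \<noteq> 0"
  by (smt (verit) zero_le_power2)+

lemma square_less_square:
  fixes p v :: real
  assumes "0 \<le> p" "p < v"
  shows "v\<^sup>2 - p\<^sup>2 > 0"
  using assms by (simp add: power_strict_mono)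

lemma kin_pos: "0 \<le> p \<Longrightarrow> p < v \<Longrightarrow> kin p v > 0"
  unfolding kin_def using square_less_square[of p v] one_plus_square_pos[of v] by simp

text \<open>Removes the second square root: once \<open>lin\<close> is a rational multiple of
  \<open>kin\<close>, the identities between derivatives of f become polynomial after division by
  \<open>kin\<close>.\<close>

lemma lin_eq_kin:
  assumes "0 \<le> p" "p < v"
  shows "lin p v = kin p v * (1 + v\<^sup>2) / (4 * v * (v\<^sup>2 - p\<^sup>2))"
proof -
  define s where "s = sqrt (v\<^sup>2 - p\<^sup>2)"
  have s: "s > 0" "v\<^sup>2 - p\<^sup>2 = s\<^sup>2" using square_less_square[OF assms] by (auto simp: s_def)
  define N where "N = 1 + v\<^sup>2"
  have N: "N > 0" unfolding N_def by (rule one_plus_square_pos)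
  show ?thesis unfolding lin_def kin_def s_def[symmetric] s(2) N_def[symmetric]
    using s(1) N assms by (simp add: field_simps power2_eq_square)
qed

lemma f_eq: "f p v w = kin p v / 2 * w\<^sup>2 - (p * w - v) * lin p v"
  unfolding f_def kin_def lin_def by simp

lemma f_w_eq: "f_w p v w = kin p v * w - p * lin p v"
proof -
  have "((\<lambda>z. f p v z) has_real_derivative kin p v * w - p * lin p v) (at w)"
    unfolding f_eq by (auto intro!: derivative_eq_intros)
  then show ?thesis unfolding f_w_def by (rule DERIV_imp_deriv)
qed

lemma f_ww_eq: "f_ww p v w = kin p v"
proof -
  have "((\<lambda>z. f_w p v z) has_real_derivative kin p v) (at w)"
    unfolding f_w_eq by (auto intro!: derivative_eq_intros)
  then show ?thesis unfolding f_ww_def by (rule DERIV_imp_deriv)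
qed

text \<open>Derivatives are taken along a curve (x q, v q) and kept in logarithmic form, the
  function times a rational factor. With v the identity and x constant this yields the partial
  derivative in v; with x the identity it yields the derivative along a trajectory.\<close>

lemma DERIV_sqrt_along:
  assumes v: "(v has_real_derivative w) (at p within A)" and x: "(x has_real_derivative x') (at p within A)"
    and p: "0 \<le> x p" "x p < v p"
  shows "((\<lambda>q. sqrt ((v q)\<^sup>2 - (x q)\<^sup>2)) has_real_derivative
     sqrt ((v p)\<^sup>2 - (x p)\<^sup>2) * ((v p * w - x p * x') / ((v p)\<^sup>2 - (x p)\<^sup>2))) (at p within A)"
proof -
  have "(v p)\<^sup>2 - (x p)\<^sup>2 > 0" using square_less_square[OF p] .
  then show ?thesis using v x
    by (auto intro!: derivative_eq_intros simp: field_simps real_sqrt_mult_self)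
qed

lemma DERIV_kin_along:
  assumes v: "(v has_real_derivative w) (at p within A)" and x: "(x has_real_derivative x') (at p within A)"
    and p: "0 \<le> x p" "x p < v p"
  shows "((\<lambda>q. kin (x q) (v q)) has_real_derivative
     kin (x p) (v p) * ((v p * w - x p * x') / ((v p)\<^sup>2 - (x p)\<^sup>2) - 4 * v p * w / (1 + (v p)\<^sup>2))) (at p within A)"
proof -
  define S where "S q = sqrt ((v q)\<^sup>2 - (x q)\<^sup>2)" for q
  define n where "n q = 1 + (v q)\<^sup>2" for q
  define e where "e = (v p * w - x p * x') / ((v p)\<^sup>2 - (x p)\<^sup>2)"
  have S: "(S has_real_derivative S p * e) (at p within A)"
    using DERIV_sqrt_along[OF v x p] unfolding S_def e_def .
  have n: "(n has_real_derivative 2 * v p * w) (at p within A)"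
    unfolding n_def using v by (auto intro!: derivative_eq_intros)
  have np: "n p > 0" unfolding n_def by (rule one_plus_square_pos)
  have "((\<lambda>q. 4 * S q / (n q)\<^sup>2) has_real_derivative (4 * S p / (n p)\<^sup>2) * (e - 4 * v p * w / n p)) (at p within A)"
    using S n np by (auto intro!: derivative_eq_intros simp: field_simps power2_eq_square)
  then show ?thesis unfolding kin_def S_def n_def e_def .
qed

lemma DERIV_lin_along:
  assumes v: "(v has_real_derivative w) (at p within A)" and x: "(x has_real_derivative x') (at p within A)"
    and p: "0 \<le> x p" "x p < v p"
  shows "((\<lambda>q. lin (x q) (v q)) has_real_derivative
     - lin (x p) (v p) * (w / v p + 2 * v p * w / (1 + (v p)\<^sup>2) + (v p * w - x p * x') / ((v p)\<^sup>2 - (x p)\<^sup>2))) (at p within A)"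
proof -
  define S where "S q = sqrt ((v q)\<^sup>2 - (x q)\<^sup>2)" for q
  define n where "n q = 1 + (v q)\<^sup>2" for q
  define e where "e = (v p * w - x p * x') / ((v p)\<^sup>2 - (x p)\<^sup>2)"
  have S: "(S has_real_derivative S p * e) (at p within A)"
    using DERIV_sqrt_along[OF v x p] unfolding S_def e_def .
  have n: "(n has_real_derivative 2 * v p * w) (at p within A)"
    unfolding n_def using v by (auto intro!: derivative_eq_intros)
  have np: "n p > 0" unfolding n_def by (rule one_plus_square_pos)
  have Sp: "S p > 0" unfolding S_def using square_less_square[OF p] by simp
  have vp: "v p > 0" using p by simp
  have "((\<lambda>q. 1 / (v q * n q * S q)) has_real_derivative
      - (1 / (v p * n p * S p)) * (w / v p + 2 * v p * w / n p + e)) (at p within A)"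
    using S n v np Sp vp by (auto intro!: derivative_eq_intros simp: field_simps power2_eq_square)
  then show ?thesis unfolding lin_def S_def n_def e_def .
qed

lemma f_v_eq:
  assumes "0 \<le> p" "p < v"
  shows "f_v p v w = kin_v p v / 2 * w\<^sup>2 + lin p v - (p * w - v) * lin_v p v"
proof -
  have k: "((\<lambda>y. kin p y) has_real_derivative kin_v p v) (at v)"
    using DERIV_kin_along[of "\<lambda>y. y" 1 v UNIV "\<lambda>_. p" 0] assms unfolding kin_v_def by simp
  have l: "((\<lambda>y. lin p y) has_real_derivative lin_v p v) (at v)"
    using DERIV_lin_along[of "\<lambda>y. y" 1 v UNIV "\<lambda>_. p" 0] assms unfolding lin_v_def by simp
  show ?thesis unfolding f_v_def f_eq
    by (rule DERIV_imp_deriv) (auto intro!: derivative_eq_intros k l simp: algebra_simps)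
qed

lemma f_wv_eq:
  assumes "0 \<le> p" "p < v"
  shows "f_wv p v w = kin_v p v * w - p * lin_v p v"
proof -
  have k: "((\<lambda>y. kin p y) has_real_derivative kin_v p v) (at v)"
    using DERIV_kin_along[of "\<lambda>y. y" 1 v UNIV "\<lambda>_. p" 0] assms unfolding kin_v_def by simp
  have l: "((\<lambda>y. lin p y) has_real_derivative lin_v p v) (at v)"
    using DERIV_lin_along[of "\<lambda>y. y" 1 v UNIV "\<lambda>_. p" 0] assms unfolding lin_v_def by simp
  show ?thesis unfolding f_wv_def f_w_eq
    by (rule DERIV_imp_deriv) (auto intro!: derivative_eq_intros k l)
qed

lemma singular_rhs_eq:
  assumes "0 \<le> p" "p < v"
  shows "singular_rhs p v w = - (v * (w\<^sup>2 + 1) - 2 * p * w) / (2 * (v\<^sup>2 - p\<^sup>2)) + 2 * v * w\<^sup>2 / (1 + v\<^sup>2)"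
proof -
  define a b where "a = v - p" and "b = v + p"
  have ab: "a > 0" "b > 0" using assms by (auto simp: a_def b_def)
  have "- (1/4) * (w - 1)\<^sup>2 / a - (1/4) * (w + 1)\<^sup>2 / b
     = - ((w - 1)\<^sup>2 * b + (w + 1)\<^sup>2 * a) / (4 * (a * b))"
    using ab by (simp add: divide_simps)
  also have "a * b = v\<^sup>2 - p\<^sup>2" by (simp add: power2_eq_square algebra_simps a_def b_def)
  also have "(w - 1)\<^sup>2 * b + (w + 1)\<^sup>2 * a = 2 * (v * (w\<^sup>2 + 1) - 2 * p * w)"
    by (simp add: power2_eq_square algebra_simps a_def b_def)
  also have "- (2 * (v * (w\<^sup>2 + 1) - 2 * p * w)) / (4 * (v\<^sup>2 - p\<^sup>2)) = - (v * (w\<^sup>2 + 1) - 2 * p * w) / (2 * (v\<^sup>2 - p\<^sup>2))"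
    using mult_divide_mult_cancel_left[of 2 "- (v * (w\<^sup>2 + 1) - 2 * p * w)" "2 * (v\<^sup>2 - p\<^sup>2)"] by simp
  finally show ?thesis unfolding singular_rhs_def a_def b_def by simp
qed

text \<open>The Euler-Lagrange expression is \<open>kin * (v'' - singular_rhs)\<close>. So the
  singular equation is the Euler-Lagrange equation, and on a line the defect
  \<open>- kin * singular_rhs\<close> remains; it is the one that drives psi.\<close>

lemma DERIV_f_w_along:
  assumes v: "(v has_real_derivative w p) (at p within A)"
    and w: "(w has_real_derivative d) (at p within A)"
    and p: "0 \<le> p" "p < v p"
  shows "((\<lambda>q. f_w q (v q) (w q)) has_real_derivative
     f_v p (v p) (w p) + kin p (v p) * (d - singular_rhs p (v p) (w p))) (at p within A)"
proof -
  define V W k \<sigma> N where "V = v p" and "W = w p" and "k = kin p (v p)" and "\<sigma> = (v p)\<^sup>2 - p\<^sup>2" and "N = 1 + (v p)\<^sup>2"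
  have pos: "\<sigma> > 0" "N > 0" "V > 0" using square_less_square[OF p] one_plus_square_pos[of "v p"] p
    by (auto simp: \<sigma>_def N_def V_def)
  \<comment> \<open>With the square of p expressed by \<open>\<sigma>\<close> and the shared factor
    \<open>k\<close> in front, clearing denominators leaves a polynomial identity.\<close>
  have pp: "p * p = V * V - \<sigma>" "N = 1 + V * V" by (auto simp: \<sigma>_def V_def N_def power2_eq_square)
  have id: "((\<lambda>q. q) has_real_derivative 1) (at p within A)" by simp
  note D = DERIV_kin_along[OF v id, simplified] DERIV_lin_along[OF v id, simplified]
  have "((\<lambda>q. f_w q (v q) (w q)) has_real_derivative
     (k * ((V * W - p) / \<sigma> - 4 * V * W / N)) * W + k * d
      - (lin p V + p * (- lin p V * (W / V + 2 * V * W / N + (V * W - p) / \<sigma>))))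
     (at p within A)"
    unfolding f_w_eq using D p w
    by (auto intro!: derivative_eq_intros simp: V_def W_def k_def \<sigma>_def N_def)
  moreover have "(k * ((V * W - p) / \<sigma> - 4 * V * W / N)) * W + k * d
      - (lin p V + p * (- lin p V * (W / V + 2 * V * W / N + (V * W - p) / \<sigma>)))
     = f_v p (v p) (w p) + kin p (v p) * (d - singular_rhs p (v p) (w p))"
    unfolding f_v_eq[OF p] singular_rhs_eq[OF p] lin_v_def kin_v_def lin_eq_kin[OF p]
      lin_eq_kin[OF p[folded V_def]]
    unfolding V_def[symmetric] W_def[symmetric] 
    unfolding \<sigma>_def[folded V_def, symmetric] N_def[folded V_def, symmetric] k_def[folded V_def, symmetric]
    using pos pp
    apply (simp add: divide_simps power2_eq_square)
    apply algebra
    done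
  ultimately show ?thesis by simp
qed


section \<open>Second derivatives of the integrand\<close>

lemma DERIV_mult_log:
  assumes "(g has_real_derivative g p * e) (at p within A)" "(h has_real_derivative h') (at p within A)"
  shows "((\<lambda>q. g q * h q) has_real_derivative g p * (e * h p + h')) (at p within A)"
  by (rule DERIV_cong[OF DERIV_mult[OF assms]]) (simp add: algebra_simps)

lemma DERIV_mult_log_neg:
  assumes "(g has_real_derivative - g p * e) (at p within A)" "(h has_real_derivative h') (at p within A)"
  shows "((\<lambda>q. - g q * h q) has_real_derivative g p * (e * h p - h')) (at p within A)"
  by (rule DERIV_cong[OF DERIV_mult[OF DERIV_minus[OF assms(1)] assms(2)]]) (simp add: algebra_simps)

lemma DERIV_kin_v_along:
  assumes v: "(v has_real_derivative w) (at p within A)" and x: "(x has_real_derivative x') (at p within A)"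
    and p: "0 \<le> x p" "x p < v p"
    and \<sigma>: "\<sigma> = (v p)\<^sup>2 - (x p)\<^sup>2" and N: "N = 1 + (v p)\<^sup>2"
  shows "((\<lambda>q. kin_v (x q) (v q)) has_real_derivative
     kin (x p) (v p) * (((v p * w - x p * x') / \<sigma> - 4 * v p * w / N) * (v p / \<sigma> - 4 * v p / N)
       + (w / \<sigma> - 2 * v p * (v p * w - x p * x') / \<sigma>\<^sup>2 - 4 * w / N + 8 * (v p)\<^sup>2 * w / N\<^sup>2))) (at p within A)"
proof -
  define S n where "S q = (v q)\<^sup>2 - (x q)\<^sup>2" and "n q = 1 + (v q)\<^sup>2" for q
  have S: "(S has_real_derivative 2 * (v p * w - x p * x')) (at p within A)"
    unfolding S_def using v x by (auto intro!: derivative_eq_intros)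
  have n: "(n has_real_derivative 2 * v p * w) (at p within A)"
    unfolding n_def using v by (auto intro!: derivative_eq_intros)
  have np: "n p > 0" unfolding n_def by (rule one_plus_square_pos)
  have Sp: "S p > 0" unfolding S_def using square_less_square[OF p] .
  have K: "((\<lambda>q. v q / S q - 4 * v q / n q) has_real_derivative
      w / S p - 2 * v p * (v p * w - x p * x') / (S p)\<^sup>2 - 4 * w / n p + 8 * (v p)\<^sup>2 * w / (n p)\<^sup>2) (at p within A)"
    using S n v np Sp by (auto intro!: derivative_eq_intros) (simp add: divide_simps power2_eq_square, (simp add: algebra_simps)?)
  show ?thesis unfolding kin_v_def \<sigma> N
    using DERIV_mult_log[OF DERIV_kin_along[OF v x p] K] unfolding S_def n_def .
qed

lemma DERIV_lin_v_along:
  assumes v: "(v has_real_derivative w) (at p within A)" and x: "(x has_real_derivative x') (at p within A)"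
    and p: "0 \<le> x p" "x p < v p"
    and \<sigma>: "\<sigma> = (v p)\<^sup>2 - (x p)\<^sup>2" and N: "N = 1 + (v p)\<^sup>2"
  shows "((\<lambda>q. lin_v (x q) (v q)) has_real_derivative
     lin (x p) (v p) * ((w / v p + 2 * v p * w / N + (v p * w - x p * x') / \<sigma>) * (1 / v p + 2 * v p / N + v p / \<sigma>)
       - (- w / (v p)\<^sup>2 + 2 * w / N - 4 * (v p)\<^sup>2 * w / N\<^sup>2 + w / \<sigma> - 2 * v p * (v p * w - x p * x') / \<sigma>\<^sup>2)))
     (at p within A)"
proof -
  define S n where "S q = (v q)\<^sup>2 - (x q)\<^sup>2" and "n q = 1 + (v q)\<^sup>2" for q
  have S: "(S has_real_derivative 2 * (v p * w - x p * x')) (at p within A)"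
    unfolding S_def using v x by (auto intro!: derivative_eq_intros)
  have n: "(n has_real_derivative 2 * v p * w) (at p within A)"
    unfolding n_def using v by (auto intro!: derivative_eq_intros)
  have np: "n p > 0" unfolding n_def by (rule one_plus_square_pos)
  have Sp: "S p > 0" unfolding S_def using square_less_square[OF p] .
  have vp: "v p > 0" using p by simp
  have K: "((\<lambda>q. 1 / v q + 2 * v q / n q + v q / S q) has_real_derivative
      - w / (v p)\<^sup>2 + 2 * w / n p - 4 * (v p)\<^sup>2 * w / (n p)\<^sup>2 + w / S p - 2 * v p * (v p * w - x p * x') / (S p)\<^sup>2) (at p within A)"
    using S n v np Sp vp by (auto intro!: derivative_eq_intros) (simp add: divide_simps power2_eq_square, (simp add: algebra_simps)?)
  show ?thesis unfolding lin_v_def \<sigma> N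
    using DERIV_mult_log_neg[OF DERIV_lin_along[OF v x p] K] unfolding S_def n_def .
qed

lemma f_vv_eq:
  assumes p: "0 \<le> p" "p < v" and \<sigma>: "\<sigma> = v\<^sup>2 - p\<^sup>2" and N: "N = 1 + v\<^sup>2"
  shows "f_vv p v w = kin p v * ((v / \<sigma> - 4 * v / N)\<^sup>2
       + (1 / \<sigma> - 2 * v\<^sup>2 / \<sigma>\<^sup>2 - 4 / N + 8 * v\<^sup>2 / N\<^sup>2)) / 2 * w\<^sup>2 + 2 * lin_v p v
     - (p * w - v) * (lin p v * ((1 / v + 2 * v / N + v / \<sigma>)\<^sup>2
       - (- 1 / v\<^sup>2 + 2 / N - 4 * v\<^sup>2 / N\<^sup>2 + 1 / \<sigma> - 2 * v\<^sup>2 / \<sigma>\<^sup>2)))"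
proof -
  note k = DERIV_kin_v_along[of "\<lambda>y. y" 1 v UNIV "\<lambda>_. p" 0, OF _ _ p \<sigma> N, simplified]
  note l' = DERIV_lin_v_along[of "\<lambda>y. y" 1 v UNIV "\<lambda>_. p" 0, OF _ _ p \<sigma> N, simplified]
  have l: "((\<lambda>y. lin p y) has_real_derivative lin_v p v) (at v)"
    using DERIV_lin_along[of "\<lambda>y. y" 1 v UNIV "\<lambda>_. p" 0] p unfolding lin_v_def by simp
  have "((\<lambda>y. kin_v p y / 2 * w\<^sup>2 + lin p y - (p * w - y) * lin_v p y) has_real_derivative
     kin p v * ((v / \<sigma> - 4 * v / N)\<^sup>2
       + (1 / \<sigma> - 2 * v\<^sup>2 / \<sigma>\<^sup>2 - 4 / N + 8 * v\<^sup>2 / N\<^sup>2)) / 2 * w\<^sup>2 + 2 * lin_v p v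
     - (p * w - v) * (lin p v * ((1 / v + 2 * v / N + v / \<sigma>)\<^sup>2
       - (- 1 / v\<^sup>2 + 2 / N - 4 * v\<^sup>2 / N\<^sup>2 + 1 / \<sigma> - 2 * v\<^sup>2 / \<sigma>\<^sup>2)))) (at v)"
    by (auto intro!: derivative_eq_intros k l l' simp: power2_eq_square) (simp add: algebra_simps)?
  \<comment> \<open>\<open>f_v_eq\<close> requires p < y, so the formula may replace the inner
    derivative only in a neighbourhood of v.\<close>
  moreover have "\<forall>\<^sub>F y in nhds v. f_v p y w = kin_v p y / 2 * w\<^sup>2 + lin p y - (p * w - y) * lin_v p y"
    using eventually_nhds_in_open[of "{p<..}" v] p
    by (auto elim!: eventually_mono simp: f_v_eq)
  ultimately show ?thesis unfolding f_vv_def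
    by (intro DERIV_imp_deriv) (subst DERIV_cong_ev[OF refl _ refl], auto)
qed

text \<open>What matters is the difference of \<open>f_vv\<close> and the derivative of
  \<open>f_wv\<close>, which is \<open>jac_Q - kin_v * v''\<close>. The Jacobi equation thereby
  reads (kin xi')' = (jac_Q - kin_v v'') xi; on the singular part, where v'' is
  \<open>singular_rhs\<close>, the potential collapses to
  \<open>kin * singular_rhs_v\<close>.\<close>

lemma DERIV_f_wv_along:
  assumes v: "(v has_real_derivative w p) (at p within A)"
    and w: "(w has_real_derivative d) (at p within A)"
    and p: "0 \<le> p" "p < v p" "p \<in> A" and A: "A \<subseteq> {0..}"
  shows "((\<lambda>q. f_wv q (v q) (w q)) has_real_derivative
     f_vv p (v p) (w p) - jac_Q p (v p) (w p) + kin_v p (v p) * d) (at p within A)"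
proof -
  define V W k \<sigma> N where "V = v p" and "W = w p" and "k = kin p (v p)" and "\<sigma> = (v p)\<^sup>2 - p\<^sup>2" and "N = 1 + (v p)\<^sup>2"
  have pos: "\<sigma> > 0" "N > 0" "V > 0" using square_less_square[OF p(1,2)] one_plus_square_pos[of "v p"] p
    by (auto simp: \<sigma>_def N_def V_def)
  have pp: "p * p = V * V - \<sigma>" "N = 1 + V * V" by (auto simp: \<sigma>_def V_def N_def power2_eq_square)
  have id: "((\<lambda>q. q) has_real_derivative 1) (at p within A)" by simp
  note D = DERIV_kin_v_along[OF v id p(1,2) \<sigma>_def N_def, simplified] DERIV_lin_v_along[OF v id p(1,2) \<sigma>_def N_def, simplified]
  have "((\<lambda>q. kin_v q (v q) * w q - q * lin_v q (v q)) has_real_derivative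
     k * (((V * W - p) / \<sigma> - 4 * V * W / N) * (V / \<sigma> - 4 * V / N)
       + (W / \<sigma> - 2 * V * (V * W - p) / \<sigma>\<^sup>2 - 4 * W / N + 8 * V\<^sup>2 * W / N\<^sup>2)) * W + kin_v p V * d
      - (lin_v p V + p * (lin p V * ((W / V + 2 * V * W / N + (V * W - p) / \<sigma>) * (1 / V + 2 * V / N + V / \<sigma>)
       - (- W / V\<^sup>2 + 2 * W / N - 4 * V\<^sup>2 * W / N\<^sup>2 + W / \<sigma> - 2 * V * (V * W - p) / \<sigma>\<^sup>2)))))
     (at p within A)"
    unfolding V_def W_def k_def
    by (rule derivative_eq_intros D w refl)+ (simp add: algebra_simps)
  moreover have "k * (((V * W - p) / \<sigma> - 4 * V * W / N) * (V / \<sigma> - 4 * V / N)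
       + (W / \<sigma> - 2 * V * (V * W - p) / \<sigma>\<^sup>2 - 4 * W / N + 8 * V\<^sup>2 * W / N\<^sup>2)) * W + kin_v p V * d
      - (lin_v p V + p * (lin p V * ((W / V + 2 * V * W / N + (V * W - p) / \<sigma>) * (1 / V + 2 * V / N + V / \<sigma>)
       - (- W / V\<^sup>2 + 2 * W / N - 4 * V\<^sup>2 * W / N\<^sup>2 + W / \<sigma> - 2 * V * (V * W - p) / \<sigma>\<^sup>2))))
     = f_vv p (v p) (w p) - jac_Q p (v p) (w p) + kin_v p (v p) * d"
    unfolding f_vv_eq[OF p(1,2) \<sigma>_def N_def] jac_Q_def singular_rhs_eq[OF p(1,2)] singular_rhs_v_def lin_v_def kin_v_def lin_eq_kin[OF p(1,2)]
      lin_eq_kin[OF p(1,2)[folded V_def]]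
    unfolding V_def[symmetric] W_def[symmetric] 
    unfolding \<sigma>_def[folded V_def, symmetric] N_def[folded V_def, symmetric] k_def[folded V_def, symmetric]
    using pos pp
    apply (simp add: divide_simps power2_eq_square)
    apply algebra
    done
  ultimately have "((\<lambda>q. kin_v q (v q) * w q - q * lin_v q (v q)) has_real_derivative
      f_vv p (v p) (w p) - jac_Q p (v p) (w p) + kin_v p (v p) * d) (at p within A)" by simp
  moreover have "\<forall>\<^sub>F q in at p within A. f_wv q (v q) (w q) = kin_v q (v q) * w q - q * lin_v q (v q)"
  proof -
    have "((\<lambda>q. v q - q) \<longlongrightarrow> v p - p) (at p within A)"
      using DERIV_isCont v by (auto intro!: tendsto_intros simp: has_field_derivative_def dest: has_derivative_continuous simp: continuous_within)
    then have "\<forall>\<^sub>F q in at p within A. v q - q > 0" using order_tendstoD(1)[of "\<lambda>q. v q - q" "v p - p" "at p within A" 0] p(2) by simp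
    moreover have "\<forall>\<^sub>F q in at p within A. q \<in> A" by (simp add: eventually_at_topological) blast
    ultimately show ?thesis by eventually_elim (use A in \<open>auto simp: f_wv_eq\<close>)
  qed
  ultimately show ?thesis
    using has_field_derivative_cong_eventually[where f="\<lambda>q. f_wv q (v q) (w q)"] f_wv_eq[OF p(1,2)] by auto
qed

section \<open>Fixed points, integral equations and one-sided derivatives\<close>

text \<open>Banach's theorem by Picard iteration on an order interval of continuous functions. The
  contraction property is phrased with an arbitrary bound D on the difference instead of a sup norm,
  because T acts on bare functions and only their values on the interval matter.\<close>

lemma contraction_fixed_point:
  fixes T :: "(real \<Rightarrow> real) \<Rightarrow> real \<Rightarrow> real" and lo hi :: "real \<Rightarrow> real" and \<alpha> \<beta> :: real
  defines "X \<equiv> {g. continuous_on {\<alpha>..\<beta>} g \<and> (\<forall>x\<in>{\<alpha>..\<beta>}. lo x \<le> g x \<and> g x \<le> hi x)}"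
  assumes g0: "g0 \<in> X"
    and maps: "\<And>g. g \<in> X \<Longrightarrow> T g \<in> X"
    and K: "0 \<le> K" "K < 1"
    and lip: "\<And>g h D. g \<in> X \<Longrightarrow> h \<in> X \<Longrightarrow> 0 \<le> D \<Longrightarrow> (\<And>x. x \<in> {\<alpha>..\<beta>} \<Longrightarrow> \<bar>g x - h x\<bar> \<le> D)
       \<Longrightarrow> (\<And>x. x \<in> {\<alpha>..\<beta>} \<Longrightarrow> \<bar>T g x - T h x\<bar> \<le> K * D)"
  obtains g where "g \<in> X" "\<And>x. x \<in> {\<alpha>..\<beta>} \<Longrightarrow> T g x = g x"
proof -
  define s where "s n = (T ^^ n) g0" for n
  have sX: "s n \<in> X" for n
    by (induction n) (auto simp: s_def g0 intro: maps)
  have cont: "continuous_on {\<alpha>..\<beta>} (s n)" for n using sX[of n] unfolding X_def by auto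
  have "compact ((\<lambda>x. s 1 x - s 0 x) ` {\<alpha>..\<beta>})"
    by (intro compact_continuous_image continuous_intros cont) auto
  then obtain D where D: "\<And>x. x \<in> {\<alpha>..\<beta>} \<Longrightarrow> \<bar>s 1 x - s 0 x\<bar> \<le> D" "D > 0"
    by (force dest!: compact_imp_bounded simp: bounded_pos)
  have step: "\<bar>s (Suc n) x - s n x\<bar> \<le> K ^ n * D" if "x \<in> {\<alpha>..\<beta>}" for n x
    using that
  proof (induction n arbitrary: x)
    case 0 then show ?case using D by simp
  next
    case (Suc n)
    have "\<bar>T (s (Suc n)) x - T (s n) x\<bar> \<le> K * (K ^ n * D)"
      by (rule lip[OF sX sX]) (use Suc D K in auto)
    then show ?case by (simp add: s_def)
  qed
  \<comment> \<open>The increments are dominated by a geometric series, so the telescoping sum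
    converges uniformly and its limit is again continuous.\<close>
  have "uniform_limit {\<alpha>..\<beta>} (\<lambda>n x. \<Sum>i<n. s (Suc i) x - s i x) (\<lambda>x. \<Sum>i. s (Suc i) x - s i x) sequentially"
    by (rule Weierstrass_m_test[where M="\<lambda>n. K ^ n * D"]) (use step K in \<open>auto intro!: summable_mult2 summable_geometric\<close>)
  then have ul: "uniform_limit {\<alpha>..\<beta>} (\<lambda>n x. s n x - s 0 x) (\<lambda>x. \<Sum>i. s (Suc i) x - s i x) sequentially"
    by (simp only: sum_lessThan_telescope[of "\<lambda>i. s i _"])
  define g where "g x = s 0 x + (\<Sum>i. s (Suc i) x - s i x)" for x
  have ug: "uniform_limit {\<alpha>..\<beta>} s g sequentially"
  proof -
    have "uniform_limit {\<alpha>..\<beta>} (\<lambda>_ x. s 0 x) (\<lambda>x. s 0 x) sequentially"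
      by (simp add: uniform_limit_iff)
    from uniform_limit_add[OF this ul] show ?thesis unfolding g_def by simp
  qed
  have lim: "(\<lambda>n. s n x) \<longlonglongrightarrow> g x" if "x \<in> {\<alpha>..\<beta>}" for x
    using tendsto_uniform_limitI[OF ug that] .
  have "continuous_on {\<alpha>..\<beta>} g"
    by (rule uniform_limit_theorem[OF _ ug]) (use cont in auto)
  moreover have "lo x \<le> g x \<and> g x \<le> hi x" if "x \<in> {\<alpha>..\<beta>}" for x
    using sX that lim[OF that] by (auto simp: X_def intro: LIMSEQ_le_const LIMSEQ_le_const2)
  ultimately have gX: "g \<in> X" unfolding X_def by auto
  moreover have "T g x = g x" if x: "x \<in> {\<alpha>..\<beta>}" for x
  proof -
    have "(\<lambda>n. s (Suc n) x) \<longlonglongrightarrow> T g x"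
    proof (rule metric_LIMSEQ_I)
      fix e :: real assume e: "e > 0"
      have "\<forall>\<^sub>F n in sequentially. \<forall>x\<in>{\<alpha>..\<beta>}. dist (s n x) (g x) < e"
        using ug e unfolding uniform_limit_iff by blast
      then obtain N where N: "\<And>n x. n \<ge> N \<Longrightarrow> x \<in> {\<alpha>..\<beta>} \<Longrightarrow> dist (s n x) (g x) < e"
        unfolding eventually_sequentially by blast
      have "dist (s (Suc n) x) (T g x) < e" if "n \<ge> N" for n
      proof -
        have "\<bar>T (s n) x - T g x\<bar> \<le> K * e"
          by (rule lip[OF sX gX]) (use N[OF that] e x in \<open>auto simp: dist_real_def intro: less_imp_le\<close>)
        also have "K * e < e" using K e by auto
        finally show ?thesis by (simp add: s_def dist_real_def)
      qed
      then show "\<exists>no. \<forall>n\<ge>no. dist (s (Suc n) x) (T g x) < e" by blast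
    qed
    then show ?thesis using LIMSEQ_unique LIMSEQ_Suc[OF lim[OF x]] by blast
  qed
  ultimately show ?thesis using that by blast
qed

text \<open>The kernels below are continuous up to, but not at, the end point where
  \<open>kin\<close> vanishes. Boundedness makes up for this, a single point being a null
  set.\<close>

lemma continuous_bounded_integrable_half_open:
  fixes h :: "real \<Rightarrow> real"
  assumes h: "continuous_on {a..<b} h" and B: "\<And>x. x \<in> {a..<b} \<Longrightarrow> \<bar>h x\<bar> \<le> B"
  shows "h integrable_on {a..b}"
proof -
  have "h integrable_on {a<..<b}"
  proof (rule measurable_bounded_by_integrable_imp_integrable)
    show "h \<in> borel_measurable (lebesgue_on {a<..<b})"
      by (rule continuous_imp_measurable_on_sets_lebesgue[OF continuous_on_subset[OF h]]) auto
    show "(\<lambda>_. B) integrable_on {a<..<b}"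
      by (simp add: integrable_on_Icc_iff_Ioo[symmetric] integrable_const_ivl)
  qed (use B in auto)
  then show ?thesis by (simp add: integrable_on_Icc_iff_Ioo)
qed

lemma DERIV_integral_upper:
  fixes h :: "real \<Rightarrow> real"
  assumes h: "h integrable_on {a..b}" and p: "p \<in> {a..b}" and c: "continuous (at p within {a..b}) h"
  shows "((\<lambda>p. integral {p..b} h) has_real_derivative - h p) (at p within {a..b})"
proof -
  have "((\<lambda>u. integral {a..u} h) has_vector_derivative h p) (at p within {a..b})"
    using integral_has_vector_derivative_continuous_at[OF h, of p "{}"] p c by auto
  then have "((\<lambda>u. integral {a..b} h - integral {a..u} h) has_real_derivative - h p) (at p within {a..b})"
    unfolding has_real_derivative_iff_has_vector_derivative
    by (auto intro!: derivative_eq_intros)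
  moreover have "integral {a..b} h - integral {a..u} h = integral {u..b} h" if "u \<in> {a..b}" for u
    using Henstock_Kurzweil_Integration.integral_combine[OF _ _ h, of u] that by auto
  ultimately show ?thesis using p
    by (rule_tac has_field_derivative_transform_within[where d=1 and f="\<lambda>u. integral {a..b} h - integral {a..u} h"]) auto
qed

text \<open>Solves ((y - y0)' / k)' = m y with y = y0 and zero flux at \<beta>, as a fixed point of
  a double integral. The factor k may be unbounded near \<beta>; only its product with the tail
  integral of |m| is controlled. The constants fit exactly: the correction is at most 3/10 * 3/2 =
  9/20, and 21/20 + 9/20 = 3/2.\<close>

lemma volterra_solution:
  fixes k m y0 :: "real \<Rightarrow> real"
  assumes ab: "\<alpha> < \<beta>"
    and k: "continuous_on {\<alpha>..<\<beta>} k" and m: "continuous_on {\<alpha>..\<beta>} m" and y0: "continuous_on {\<alpha>..\<beta>} y0"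
    and B: "\<And>p. p \<in> {\<alpha>..<\<beta>} \<Longrightarrow> \<bar>k p\<bar> * integral {p..\<beta>} (\<lambda>s. \<bar>m s\<bar>) \<le> B" "B * (\<beta> - \<alpha>) \<le> 3/10"
    and y0_bounds: "\<And>p. p \<in> {\<alpha>..\<beta>} \<Longrightarrow> 1 \<le> y0 p \<and> y0 p \<le> 21/20"
  shows "\<exists>y. continuous_on {\<alpha>..\<beta>} y \<and> (\<forall>p\<in>{\<alpha>..\<beta>}. 1/2 \<le> y p \<and> y p \<le> 3/2) \<and> y \<beta> = y0 \<beta> \<and>
    (\<forall>p\<in>{\<alpha>..<\<beta>}. ((\<lambda>p. y p - y0 p) has_real_derivative - (k p * integral {p..\<beta>} (\<lambda>s. m s * y s))) (at p within {\<alpha>..\<beta>})) \<and>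
    (\<forall>p\<in>{\<alpha>..<\<beta>}. \<bar>k p * integral {p..\<beta>} (\<lambda>s. m s * y s)\<bar> \<le> 3/2 * B)"
proof -
  define h where "h y p = k p * integral {p..\<beta>} (\<lambda>s. m s * y s)" for y p
  define T where "T y p = y0 p + integral {p..\<beta>} (h y)" for y p
  define X where "X = {g. continuous_on {\<alpha>..\<beta>} g \<and> (\<forall>x\<in>{\<alpha>..\<beta>}. 1/2 \<le> g x \<and> g x \<le> (3/2::real))}"
  have "0 \<le> \<bar>k \<alpha>\<bar> * integral {\<alpha>..\<beta>} (\<lambda>s. \<bar>m s\<bar>)"
    by (intro mult_nonneg_nonneg integral_nonneg integrable_continuous_real continuous_intros m) auto
  then have B0: "B \<ge> 0" using B(1)[of \<alpha>] ab by simp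
  have hb: "\<bar>h y p\<bar> \<le> B * D" if y: "continuous_on {\<alpha>..\<beta>} y" and D: "\<And>x. x \<in> {\<alpha>..\<beta>} \<Longrightarrow> \<bar>y x\<bar> \<le> D"
    and p: "p \<in> {\<alpha>..<\<beta>}" for y p D
  proof -
    have sub: "{p..\<beta>} \<subseteq> {\<alpha>..\<beta>}" using p by auto
    have D0: "D \<ge> 0" using D[of \<alpha>] ab by auto
    have mc: "continuous_on {p..\<beta>} m" "continuous_on {p..\<beta>} y" using m y sub continuous_on_subset by blast+
    have "\<bar>integral {p..\<beta>} (\<lambda>s. m s * y s)\<bar> \<le> integral {p..\<beta>} (\<lambda>s. \<bar>m s\<bar> * D)"
      unfolding real_norm_def[symmetric]
      by (rule integral_norm_bound_integral)
         (use sub D in \<open>auto intro!: integrable_continuous_real continuous_intros mc mult_left_mono simp: abs_mult\<close>)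
    also have "\<dots> = integral {p..\<beta>} (\<lambda>s. \<bar>m s\<bar>) * D" by simp
    finally have "\<bar>h y p\<bar> \<le> \<bar>k p\<bar> * (integral {p..\<beta>} (\<lambda>s. \<bar>m s\<bar>) * D)"
      unfolding h_def abs_mult by (intro mult_left_mono) auto
    also have "\<dots> \<le> B * D" using mult_right_mono[OF B(1)[OF p] D0] by (simp add: mult_ac)
    finally show ?thesis .
  qed
  have hc: "continuous_on {\<alpha>..<\<beta>} (h y)" if y: "continuous_on {\<alpha>..\<beta>} y" for y
    unfolding h_def
    by (intro continuous_intros k continuous_on_subset[OF indefinite_integral_continuous_1'[of "\<lambda>s. m s * y s" \<alpha> \<beta>]]
        integrable_continuous_real m y) auto
  have hi: "h y integrable_on {\<alpha>..\<beta>}" if y: "continuous_on {\<alpha>..\<beta>} y" for y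
  proof -
    obtain D where "\<And>x. x \<in> {\<alpha>..\<beta>} \<Longrightarrow> \<bar>y x\<bar> \<le> D"
      using compact_imp_bounded[OF compact_continuous_image[OF y compact_Icc]] by (force simp: bounded_iff)
    then show ?thesis using continuous_bounded_integrable_half_open[OF hc[OF y]] hb[OF y] by blast
  qed
  have hib: "\<bar>integral {p..\<beta>} (h y)\<bar> \<le> 3/10 * D" if y: "continuous_on {\<alpha>..\<beta>} y" and D: "\<And>x. x \<in> {\<alpha>..\<beta>} \<Longrightarrow> \<bar>y x\<bar> \<le> D"
    and p: "p \<in> {\<alpha>..\<beta>}" for y p D
  proof -
    have D0: "D \<ge> 0" using D[of \<alpha>] ab by auto
    \<comment> \<open>Nothing is assumed about k at \<beta>, but the inner integral is empty
      there.\<close>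
    have hh: "h y \<beta> = 0" unfolding h_def by simp
    have "norm (integral {p..\<beta>} (h y)) \<le> integral {p..\<beta>} (\<lambda>_. B * D)"
    proof (rule integral_norm_bound_integral)
      show "h y integrable_on {p..\<beta>}" using integrable_subinterval_real[OF hi[OF y]] p by auto
      show "norm (h y x) \<le> B * D" if "x \<in> {p..\<beta>}" for x
        using hb[OF y D, of x] that p hh B0 D0 by (cases "x = \<beta>") auto
    qed auto
    also have "\<dots> = B * (\<beta> - p) * D" using p by simp
    also have "\<dots> \<le> B * (\<beta> - \<alpha>) * D" using p B0 D0 by (intro mult_right_mono mult_left_mono) auto
    also have "\<dots> \<le> 3/10 * D" using B(2) D0 by (intro mult_right_mono)
    finally show ?thesis by simp
  qed
  have Tc: "continuous_on {\<alpha>..\<beta>} (T y)" if y: "continuous_on {\<alpha>..\<beta>} y" for y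
    unfolding T_def by (intro continuous_intros y0 indefinite_integral_continuous_1' hi[OF y])
  have lip: "\<bar>T y x - T z x\<bar> \<le> 3/10 * D" if yz: "continuous_on {\<alpha>..\<beta>} y" "continuous_on {\<alpha>..\<beta>} z"
     and D: "\<And>x. x \<in> {\<alpha>..\<beta>} \<Longrightarrow> \<bar>y x - z x\<bar> \<le> D" and x: "x \<in> {\<alpha>..\<beta>}" for y z D x
  proof -
    have "h y p - h z p = h (\<lambda>s. y s - z s) p" if "p \<in> {\<alpha>..\<beta>}" for p
    proof -
      have "(\<lambda>s. m s * y s) integrable_on {p..\<beta>}" "(\<lambda>s. m s * z s) integrable_on {p..\<beta>}"
        using that by (auto intro!: integrable_continuous_real continuous_intros continuous_on_subset[OF m] 
            continuous_on_subset[OF yz(1)] continuous_on_subset[OF yz(2)])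
      then show ?thesis unfolding h_def by (simp add: algebra_simps integral_diff)
    qed
    then have "integral {x..\<beta>} (h (\<lambda>s. y s - z s)) = integral {x..\<beta>} (\<lambda>p. h y p - h z p)"
      using x by (intro integral_cong) auto
    also have "\<dots> = integral {x..\<beta>} (h y) - integral {x..\<beta>} (h z)"
      using x by (intro integral_diff integrable_subinterval_real[OF hi[OF yz(1)]] integrable_subinterval_real[OF hi[OF yz(2)]]) auto
    finally have "T y x - T z x = integral {x..\<beta>} (h (\<lambda>s. y s - z s))" unfolding T_def by simp
    then show ?thesis using hib[of "\<lambda>s. y s - z s" D x] yz D x by (auto intro: continuous_intros)
  qed
  have maps: "T y \<in> X" if "y \<in> X" for y
  proof -
    have y: "continuous_on {\<alpha>..\<beta>} y" "\<And>x. x \<in> {\<alpha>..\<beta>} \<Longrightarrow> \<bar>y x\<bar> \<le> 3/2" using that unfolding X_def by force+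
    have "1/2 \<le> T y x \<and> T y x \<le> 3/2" if "x \<in> {\<alpha>..\<beta>}" for x
      using hib[OF y that] y0_bounds[OF that] unfolding T_def by linarith
    then show ?thesis unfolding X_def using Tc[OF y(1)] by auto
  qed
  obtain y where yX: "y \<in> X" and Ty: "\<And>x. x \<in> {\<alpha>..\<beta>} \<Longrightarrow> T y x = y x"
    by (rule contraction_fixed_point[of "\<lambda>_. 1" \<alpha> \<beta> "\<lambda>_. 1/2" "\<lambda>_. 3/2" T "3/10"])
       (use maps lip in \<open>auto simp: X_def\<close>)
  have y: "continuous_on {\<alpha>..\<beta>} y" "\<And>x. x \<in> {\<alpha>..\<beta>} \<Longrightarrow> \<bar>y x\<bar> \<le> 3/2" using yX unfolding X_def by force+
  show ?thesis
  proof (intro exI[of _ y] conjI ballI)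
    show "continuous_on {\<alpha>..\<beta>} y" by (rule y)
    show "1/2 \<le> y p" "y p \<le> 3/2" if "p \<in> {\<alpha>..\<beta>}" for p using yX that unfolding X_def by auto
    show "y \<beta> = y0 \<beta>" using Ty[of \<beta>] ab unfolding T_def by simp
    show "\<bar>k p * integral {p..\<beta>} (\<lambda>s. m s * y s)\<bar> \<le> 3/2 * B" if "p \<in> {\<alpha>..<\<beta>}" for p
      using hb[OF y that] unfolding h_def by (simp add: mult.commute)
    show "((\<lambda>p. y p - y0 p) has_real_derivative - (k p * integral {p..\<beta>} (\<lambda>s. m s * y s))) (at p within {\<alpha>..\<beta>})"
      if p: "p \<in> {\<alpha>..<\<beta>}" for p
    proof -
      have "continuous (at p within {\<alpha>..<\<beta>}) (h y)" using hc[OF y(1)] p by (simp add: continuous_on_eq_continuous_within)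
      moreover have "at p within {\<alpha>..<\<beta>} = at p within {\<alpha>..\<beta>}"
        by (rule at_within_nhd[of _ "{..<\<beta>}"]) (use p in auto)
      ultimately have "continuous (at p within {\<alpha>..\<beta>}) (h y)" by (simp add: continuous_within)
      from DERIV_integral_upper[OF hi[OF y(1)] _ this] p
      have "((\<lambda>p. integral {p..\<beta>} (h y)) has_real_derivative - h y p) (at p within {\<alpha>..\<beta>})" by auto
      then show ?thesis unfolding h_def[symmetric]
        by (rule has_field_derivative_transform_within[where d=1]) (use p Ty in \<open>auto simp: T_def dist_real_def algebra_simps\<close>)
    qed
  qed
qed

section \<open>Pasting and one-sided derivatives\<close>

lemma has_real_derivative_paste:
  fixes g1 g2 :: "real \<Rightarrow> real"
  assumes c: "a \<le> c" "c \<le> b" and p: "p \<in> {a..b}"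
    and "p \<le> c \<Longrightarrow> (g1 has_real_derivative D) (at p within {a..c})"
    and "c \<le> p \<Longrightarrow> (g2 has_real_derivative D) (at p within {c..b})"
    and eq: "g1 c = g2 c"
  shows "((\<lambda>x. if x \<le> c then g1 x else g2 x) has_real_derivative D) (at p within {a..b})"
proof -
  have "((\<lambda>x. if x \<in> {a..c} then g1 x else g2 x) has_vector_derivative (if p \<in> {a..c} then D else D)) (at p within {a..b})"
  proof (rule has_vector_derivative_If_within_closures[where T="{c..b}"])
    have *: "{a..c} \<union> closure {a..c} \<inter> closure {c..b} = {a..c}" "{c..b} \<union> closure {a..c} \<inter> closure {c..b} = {c..b}"
      using c by auto
    show "(g1 has_vector_derivative D) (at p within {a..c} \<union> closure {a..c} \<inter> closure {c..b})"
      if "p \<in> {a..c} \<union> closure {a..c} \<inter> closure {c..b}"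
      using assms that unfolding * by (auto simp: has_real_derivative_iff_has_vector_derivative)
    show "(g2 has_vector_derivative D) (at p within {c..b} \<union> closure {a..c} \<inter> closure {c..b})"
      if "p \<in> {c..b} \<union> closure {a..c} \<inter> closure {c..b}"
      using assms that unfolding * by (auto simp: has_real_derivative_iff_has_vector_derivative)
  qed (use c p eq in auto)
  then have "((\<lambda>x. if x \<in> {a..c} then g1 x else g2 x) has_real_derivative D) (at p within {a..b})"
    by (simp add: has_real_derivative_iff_has_vector_derivative)
  then show ?thesis
    by (rule has_field_derivative_transform_within[where d=1]) (use p in auto)
qed

text \<open>By the mean value theorem the difference quotients at b are values of g' at points
  nearer to b. This supplies the derivative at an end point to the left of which alone the
  differential equation is available.\<close>

lemma DERIV_at_right_endpoint:
  fixes g g' :: "real \<Rightarrow> real"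
  assumes ab: "a < b" and c: "continuous_on {a..b} g"
    and g': "\<And>p. p \<in> {a<..<b} \<Longrightarrow> (g has_real_derivative g' p) (at p)"
    and l: "(g' \<longlongrightarrow> l) (at_left b)"
  shows "(g has_real_derivative l) (at b within {a..b})"
  unfolding has_field_derivative_iff
proof (rule tendstoI)
  fix e :: real assume e: "e > 0"
  then have "\<forall>\<^sub>F x in at_left b. dist (g' x) l < e" using l tendstoD by blast
  then obtain a' where a': "a' < b" "\<And>x. a' < x \<Longrightarrow> x < b \<Longrightarrow> dist (g' x) l < e"
    unfolding eventually_at_left_field by blast
  have "dist ((g y - g b) / (y - b)) l < e" if y: "y \<in> {a..b}" "y > a'" "y \<noteq> b" for y
  proof -
    have yb: "y < b" using y by auto
    obtain z d where z: "y < z" "z < b" "(g has_real_derivative d) (at z)" "g b - g y = (b - y) * d"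
    proof (rule exE[OF MVT[OF yb]])
      show "continuous_on {y..b} g" using c y by (auto intro: continuous_on_subset)
      show "g differentiable (at x)" if "y < x" "x < b" for x
        using g'[of x] that y by (auto simp: real_differentiable_def)
    qed (use that in blast)
    have d: "d = g' z" using DERIV_unique[OF z(3) g'[of z]] z y by auto
    have "(g y - g b) / (y - b) = g' z" using z(4) yb d by (simp add: field_simps)
    then show ?thesis using a'(2)[of z] z y by simp
  qed
  then show "\<forall>\<^sub>F y in at b within {a..b}. dist ((g y - g b) / (y - b)) l < e"
    unfolding eventually_at using a'(1)
    by (intro exI[of _ "b - a'"]) (auto simp: dist_real_def)
qed

lemma D1_eq:
  assumes "0 < b" "p \<in> {0..b}" "(v has_real_derivative d) (at p within {0..b})"
  shows "D1 b v p = d"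
  unfolding D1_def using assms
  by (intro vector_derivative_within_closed_interval) (auto simp: has_real_derivative_iff_has_vector_derivative)

section \<open>The Jacobi equation along an affine part followed by a singular arc\<close>

text \<open>The abstract trajectory, with w standing for v': affine up to r, singular from r to b.
  \<open>rhs_lim\<close> supplies v'' at b, where \<open>singular_rhs\<close> would divide by v - p
  = 0. The positive bound \<kappa> gives convexity and keeps the end value l away from zero.\<close>

locale bent_arc =
  fixes b r \<kappa> l :: real and v w :: "real \<Rightarrow> real"
  assumes r: "0 < r" "r < b" and \<kappa>: "0 < \<kappa>"
    and v_deriv: "p \<in> {0..b} \<Longrightarrow> (v has_real_derivative w p) (at p within {0..b})"
    and w_cont: "continuous_on {0..b} w"
    and v_gt: "p \<in> {0..<b} \<Longrightarrow> p < v p"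
    and v_end: "v b = b" and w_end: "w b = 1"
    and w_affine: "p \<in> {0..r} \<Longrightarrow> w p = w r"
    and w_sing: "p \<in> {r..<b} \<Longrightarrow> (w has_real_derivative singular_rhs p (v p) (w p)) (at p within {r..b})"
    and rhs_lim: "((\<lambda>p. singular_rhs p (v p) (w p)) \<longlongrightarrow> l) (at_left b)"
    and rhs_ge: "p \<in> {r..<b} \<Longrightarrow> \<kappa> \<le> singular_rhs p (v p) (w p)"
begin

abbreviation "rhs p \<equiv> singular_rhs p (v p) (w p)"

lemma b_pos: "0 < b" using r by simp

lemma v_cont: "continuous_on {0..b} v"
  by (rule DERIV_continuous_on[OF v_deriv])

lemma w_deriv_affine:
  assumes p: "p \<in> {0..r}"
  shows "(w has_real_derivative 0) (at p within {0..r})"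
proof (rule has_field_derivative_transform_within[where d=1 and f="\<lambda>_. w r"])
  show "w r = w x" if "x \<in> {0..r}" for x using w_affine[OF that] by simp
qed (use p in auto)

lemma w_deriv_at: "p \<in> {r<..<b} \<Longrightarrow> (w has_real_derivative rhs p) (at p)"
  using w_sing[of p] at_within_interior[of p "{r..b}"] by auto

lemma v_deriv_sub: "p \<in> A \<Longrightarrow> A \<subseteq> {0..b} \<Longrightarrow> (v has_real_derivative w p) (at p within A)"
  by (rule has_field_derivative_subset[OF v_deriv]) auto

lemma w_deriv_end: "(w has_real_derivative l) (at b within {r..b})"
proof (rule DERIV_at_right_endpoint[OF r(2) _ _ rhs_lim])
  show "continuous_on {r..b} w" using r by (intro continuous_on_subset[OF w_cont]) auto
qed (rule w_deriv_at)

lemma l_ge: "\<kappa> \<le> l"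
proof (rule tendsto_lowerbound[OF rhs_lim])
  show "\<forall>\<^sub>F p in at_left b. \<kappa> \<le> rhs p"
    unfolding eventually_at_left_field using r rhs_ge by (intro exI[of _ r]) auto
qed auto

lemma w_mono:
  assumes "0 \<le> p" "p \<le> q" "q \<le> b"
  shows "w p \<le> w q"
proof -
  have *: "w p \<le> w q" if "r \<le> p" "p \<le> q" "q \<le> b" for p q
  proof (rule DERIV_nonneg_imp_increasing_open[OF that(2)])
    show "\<exists>y. (w has_real_derivative y) (at x) \<and> 0 \<le> y" if "p < x" "x < q" for x
      using w_deriv_at[of x] rhs_ge[of x] \<kappa> that \<open>r \<le> p\<close> \<open>q \<le> b\<close> by (intro exI[of _ "rhs x"]) auto
    show "continuous_on {p..q} w" using that r by (intro continuous_on_subset[OF w_cont]) auto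
  qed
  show ?thesis
  proof (cases "q \<le> r")
    case True then show ?thesis using w_affine[of p] w_affine[of q] assms by auto
  next
    case False
    have "w p \<le> w (max p r)" using w_affine[of p] assms by (cases "p \<le> r") auto
    also have "\<dots> \<le> w q" using * False assms by auto
    finally show ?thesis .
  qed
qed

lemma D1_v: "p \<in> {0..b} \<Longrightarrow> D1 b v p = w p"
  using D1_eq[OF b_pos _ v_deriv] by simp

lemma kin_cont: "continuous_on {0..b} (\<lambda>p. kin p (v p))"
  unfolding kin_def using one_plus_square_pos(2) by (intro continuous_intros v_cont) auto

lemma kin_end: "kin b (v b) = 0" unfolding kin_def v_end by simp

lemma singular_rhs_cont:
  assumes "A \<subseteq> {0..<b}"
  shows "continuous_on A (\<lambda>p. rhs p)"
proof -
  have "v p - p \<noteq> 0" "v p + p \<noteq> 0" if "p \<in> A" for p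
  proof -
    have "p \<in> {0..<b}" using that assms by blast
    then show "v p - p \<noteq> 0" "v p + p \<noteq> 0" using v_gt[of p] by auto
  qed
  moreover have "A \<subseteq> {0..b}" using assms by (meson atLeastLessThan_subseteq_atLeastAtMost_iff order_refl subset_trans)
  ultimately show ?thesis
    unfolding singular_rhs_def using one_plus_square_pos(2)
    by (intro continuous_intros continuous_on_subset[OF v_cont] continuous_on_subset[OF w_cont]) auto
qed

end

text \<open>\<open>kin_dec\<close> says that \<open>kin\<close> decreases along the trajectory.
  \<open>small\<close> bounds the inhomogeneity \<open>kk\<close> against the rate at which u falls.
  \<open>r_le\<close> and \<open>slope\<close> serve to keep r |xi'| below xi/20 at the switch, and
  \<open>jac_small\<close> makes the potential on the affine part at most 3/(10 r^2) relative to
  \<open>kin\<close>.\<close>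

locale jacobi_arc = bent_arc +
  assumes w_pos: "0 < w 0"
    and kin_dec: "p \<in> {0..<b} \<Longrightarrow> (v p * w p - p) * (1 + (v p)\<^sup>2) \<le> 4 * v p * w p * ((v p)\<^sup>2 - p\<^sup>2)"
    and small: "p \<in> {r..<b} \<Longrightarrow> 40 * b * (4 * (w p)\<^sup>2 * v p / (1 + (v p)\<^sup>2)\<^sup>2) \<le> 2 * r * \<kappa>"
    and r_le: "r \<le> b / 4"
    and slope: "r * (r * singular_rhs r (v r) (w r)) \<le> (v r - r * w r) / 50"
    and jac_small: "p \<in> {0..r} \<Longrightarrow> r\<^sup>2 * \<bar>jac_Q p (v p) (w p)\<bar> \<le> 3 / 10 * kin p (v p)"
begin

definition "u p = v p - p * w p"

lemma v_deriv_right: "p \<in> {r..b} \<Longrightarrow> (v has_real_derivative w p) (at p within {r..b})"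
  using r by (intro v_deriv_sub) auto

lemma u_deriv: assumes p: "p \<in> {r..<b}" shows "(u has_real_derivative - p * rhs p) (at p within {r..b})"
proof -
  have "p \<in> {r..b}" using p by simp
  from v_deriv_right[OF this] w_sing[OF p] show ?thesis
    unfolding u_def by (auto intro!: derivative_eq_intros)
qed

lemma u_deriv_end: "(u has_real_derivative - b * l) (at b within {r..b})"
proof -
  have "b \<in> {r..b}" using r by simp
  from v_deriv_right[OF this] w_deriv_end show ?thesis
    unfolding u_def by (auto intro!: derivative_eq_intros simp: w_end)
qed

lemma u_cont: "continuous_on {0..b} u"
  unfolding u_def by (intro continuous_intros v_cont w_cont)

lemma u_end: "u b = 0" unfolding u_def by (simp add: v_end w_end)

lemma u_pos: assumes p: "p \<in> {r..<b}" shows "u p > 0"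
proof -
  have "u p > u b"
  proof (rule DERIV_neg_imp_decreasing_open[of p b u])
    show "p < b" using p by auto
    show "\<exists>y. (u has_real_derivative y) (at x) \<and> y < 0" if "p < x" "x < b" for x
    proof -
      have "(u has_real_derivative - x * rhs x) (at x)"
        using u_deriv[of x] that p at_within_interior[of x "{r..b}"] by auto
      moreover have "- x * rhs x < 0" using rhs_ge[of x] \<kappa> that p r by (auto simp: mult_less_0_iff)
      ultimately show ?thesis by blast
    qed
    show "continuous_on {p..b} u" using p r by (intro continuous_on_subset[OF u_cont]) auto
  qed
  then show ?thesis using u_end by simp
qed

lemma DERIV_kin:
  assumes "p \<in> {0..<b}" "p \<in> A" "A \<subseteq> {0..b}"
  shows "((\<lambda>p. kin p (v p)) has_real_derivative
    kin p (v p) * ((v p * w p - p) / ((v p)\<^sup>2 - p\<^sup>2) - 4 * v p * w p / (1 + (v p)\<^sup>2))) (at p within A)"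
  using DERIV_kin_along[OF v_deriv_sub[OF assms(2,3)], of "\<lambda>p. p" 1] assms v_gt[of p] by simp

lemma kin_gt_0: "p \<in> {0..<b} \<Longrightarrow> 0 < kin p (v p)"
  using v_gt[of p] kin_pos[of p "v p"] by simp

lemma kin_slope: assumes "p \<in> {0..<b}"
  shows "(v p * w p - p) / ((v p)\<^sup>2 - p\<^sup>2) - 4 * v p * w p / (1 + (v p)\<^sup>2) \<le> 0"
proof -
  have "(v p)\<^sup>2 - p\<^sup>2 > 0" using square_less_square v_gt[OF assms] assms by simp
  then have "(v p * w p - p) / ((v p)\<^sup>2 - p\<^sup>2) \<le> 4 * v p * w p / (1 + (v p)\<^sup>2)"
    using kin_dec[OF assms] one_plus_square_pos(1)[of "v p"]
    by (simp only: pos_divide_le_eq times_divide_eq_left pos_le_divide_eq)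
  then show ?thesis by simp
qed

lemma kin_antimono:
  assumes "0 \<le> p" "p \<le> q" "q \<le> b"
  shows "kin q (v q) \<le> kin p (v p)"
proof (rule DERIV_nonpos_imp_decreasing_open[OF assms(2)])
  show "\<exists>y. ((\<lambda>p. kin p (v p)) has_real_derivative y) (at x) \<and> y \<le> 0" if "p < x" "x < q" for x
  proof -
    have x: "x \<in> {0..<b}" using that assms by auto
    then have "((\<lambda>p. kin p (v p)) has_real_derivative
      kin x (v x) * ((v x * w x - x) / ((v x)\<^sup>2 - x\<^sup>2) - 4 * v x * w x / (1 + (v x)\<^sup>2))) (at x)"
    proof -
      have "x \<in> {0<..<b}" "{0<..<b} \<subseteq> {0..b}" using that assms by auto
      then show ?thesis using DERIV_kin[of x "{0<..<b}", OF x] at_within_open[of x "{0<..<b}"] by simp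
    qed
    then show ?thesis using kin_slope[OF x] kin_gt_0[OF x] by (intro exI conjI) (auto intro: mult_nonneg_nonpos)
  qed
  show "continuous_on {p..q} (\<lambda>p. kin p (v p))" using assms by (intro continuous_on_subset[OF kin_cont]) auto
qed

text \<open>The defect in Euler's relation: p R_p + v R_v + R = kk for R =
  \<open>singular_rhs\<close>. Only the term 2 v w^2 / (1 + v^2) contributes, everything else being
  homogeneous of degree -1 in (p, v).\<close>

definition "kk p = 4 * (w p)\<^sup>2 * v p / (1 + (v p)\<^sup>2)\<^sup>2"

lemma kk_cont: "continuous_on {0..b} kk"
  unfolding kk_def using one_plus_square_pos(2) by (intro continuous_intros v_cont w_cont) auto

lemma kk_nonneg: "p \<in> {0..b} \<Longrightarrow> 0 \<le> kk p"
  unfolding kk_def using v_gt[of p] v_end by (cases "p = b") auto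

lemma kk_le: assumes "p \<in> {r..<b}" shows "kk p \<le> 2 * r * \<kappa> / (40 * b)"
  using small[OF assms] b_pos unfolding kk_def[symmetric] by (subst pos_le_divide_eq) (auto simp: mult_ac)

text \<open>The scaling field \<open>v - p v'\<close> solves the linearized equation up to the term of \<open>singular_rhs\<close> that is
  not homogeneous of degree -1.\<close>

lemma DERIV_rhs:
  assumes p: "p \<in> {r..<b}"
  shows "(rhs has_real_derivative singular_rhs_v p (v p) (w p) * w p
     + ((v p * w p - p) / ((v p)\<^sup>2 - p\<^sup>2) - 4 * v p * w p / (1 + (v p)\<^sup>2)) * (- rhs p)
     + (4 * (w p)\<^sup>2 * v p / (1 + (v p)\<^sup>2)\<^sup>2 - rhs p - v p * singular_rhs_v p (v p) (w p)) / p) (at p within {r..b})"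
    (is "(_ has_real_derivative ?D) _")
proof -
  have p0: "0 < p" "p < v p" "p \<in> {r..b}" using p r v_gt[of p] by auto
  define V W \<sigma> N R where "V = v p" and "W = w p" and "\<sigma> = V\<^sup>2 - p\<^sup>2" and "N = 1 + V\<^sup>2" and "R = rhs p"
  have pos: "\<sigma> > 0" "N > 0" "V > 0" using square_less_square[of p "v p"] one_plus_square_pos[of "v p"] p0
    by (auto simp: \<sigma>_def N_def V_def)
  have v': "(v has_real_derivative W) (at p within {r..b})" using v_deriv_right[OF p0(3)] unfolding W_def .
  have w': "(w has_real_derivative R) (at p within {r..b})" using w_sing[OF p] unfolding R_def .
  have S: "((\<lambda>p. (v p)\<^sup>2 - p\<^sup>2) has_real_derivative 2 * (V * W - p)) (at p within {r..b})"
    using v' by (auto intro!: derivative_eq_intros simp: V_def)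
  have n: "((\<lambda>p. 1 + (v p)\<^sup>2) has_real_derivative 2 * V * W) (at p within {r..b})"
    using v' by (auto intro!: derivative_eq_intros simp: V_def)
  have A: "((\<lambda>p. v p * ((w p)\<^sup>2 + 1) - 2 * p * w p) has_real_derivative
     W * (W\<^sup>2 + 1) + V * (2 * W * R) - 2 * W - 2 * p * R) (at p within {r..b})"
    using v' w' by (auto intro!: derivative_eq_intros simp: V_def W_def)
  have B: "((\<lambda>p. 2 * v p * (w p)\<^sup>2) has_real_derivative 2 * W * W\<^sup>2 + 4 * V * W * R) (at p within {r..b})"
    using v' w' by (auto intro!: derivative_eq_intros simp: V_def W_def)
  define X where "X = V * (W\<^sup>2 + 1) - 2 * p * W"
  have Req: "R = - X / (2 * \<sigma>) + 2 * V * W\<^sup>2 / N"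
    unfolding R_def X_def \<sigma>_def N_def V_def W_def using singular_rhs_eq[of p "v p" "w p"] p0 by simp
  have D: "((\<lambda>p. - (v p * ((w p)\<^sup>2 + 1) - 2 * p * w p) / (2 * ((v p)\<^sup>2 - p\<^sup>2)) + 2 * v p * (w p)\<^sup>2 / (1 + (v p)\<^sup>2)) has_real_derivative
     (- (W * (W\<^sup>2 + 1) + V * (2 * W * R) - 2 * W - 2 * p * R) * (2 * \<sigma>) + X * (4 * (V * W - p))) / ((2 * \<sigma>) * (2 * \<sigma>))
     + ((2 * W * W\<^sup>2 + 4 * V * W * R) * N - 2 * V * W\<^sup>2 * (2 * V * W)) / (N * N)) (at p within {r..b})"
    by (rule DERIV_cong[OF DERIV_add[OF DERIV_divide[OF DERIV_minus[OF A] DERIV_cmult[OF S]] DERIV_divide[OF B n]]])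
      (use pos in \<open>simp_all add: V_def[symmetric] W_def[symmetric] \<sigma>_def[symmetric] N_def[symmetric] X_def[symmetric]\<close>)
  moreover have "(- (W * (W\<^sup>2 + 1) + V * (2 * W * R) - 2 * W - 2 * p * R) * (2 * \<sigma>) + X * (4 * (V * W - p))) / ((2 * \<sigma>) * (2 * \<sigma>))
     + ((2 * W * W\<^sup>2 + 4 * V * W * R) * N - 2 * V * W\<^sup>2 * (2 * V * W)) / (N * N) = ?D"
  proof -
    define sv e i n where "sv = singular_rhs_v p V W" and "e = (V * W - p) / \<sigma> - 4 * V * W / N" and "i = 1 / \<sigma>" and "n = 1 / N"
    have i: "\<sigma> * i = 1" and n: "N * n = 1" using pos(1,2) unfolding i_def n_def by simp_all
    have sv: "sv = - (W\<^sup>2 + 1) * i / 2 + V * X * i\<^sup>2 + 2 * W\<^sup>2 * (1 - V\<^sup>2) * n\<^sup>2"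
      unfolding sv_def singular_rhs_v_def X_def[symmetric] \<sigma>_def[symmetric] N_def[symmetric] i_def n_def
      by (simp add: power_divide)
    have Ri: "R = - X * i / 2 + 2 * V * W\<^sup>2 * n" unfolding Req i_def n_def by simp
    have g1: "(- c * (2 * \<sigma>) + X * (4 * d)) / ((2 * \<sigma>) * (2 * \<sigma>)) = - c * i / 2 + X * d * i\<^sup>2" for c d
      unfolding i_def using pos(1) by (simp add: field_simps power2_eq_square)
    have g2: "((c + d) * N - g) / (N * N) = (c * N - g) * n\<^sup>2 + d * n" for c d g
      unfolding n_def using pos(2) by (simp add: field_simps power2_eq_square)
    have t1: "(- (W * (W\<^sup>2 + 1) + V * (2 * W * R) - 2 * W - 2 * p * R) * (2 * \<sigma>) + X * (4 * (V * W - p))) / ((2 * \<sigma>) * (2 * \<sigma>))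
      = - (W * (W\<^sup>2 + 1) - 2 * W) * i / 2 - R * ((V * W - p) * i) + X * (V * W - p) * i\<^sup>2"
      unfolding g1[of "W * (W\<^sup>2 + 1) + V * (2 * W * R) - 2 * W - 2 * p * R" "V * W - p"] by algebra
    have t2: "((2 * W * W\<^sup>2 + 4 * V * W * R) * N - 2 * V * W\<^sup>2 * (2 * V * W)) / (N * N)
      = (2 * W * W\<^sup>2 * N - 4 * V\<^sup>2 * W * W\<^sup>2) * n\<^sup>2 + 4 * V * W * R * n"
      unfolding g2[of "2 * W * W\<^sup>2" "4 * V * W * R" "2 * V * W\<^sup>2 * (2 * V * W)"] by algebra
    have t3: "2 * W * W\<^sup>2 * N - 4 * V\<^sup>2 * W * W\<^sup>2 = W * (2 * W\<^sup>2 * (1 - V\<^sup>2))" unfolding N_def by algebra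
    have ei: "e = (V * W - p) * i - 4 * V * W * n" unfolding e_def i_def n_def by simp
    \<comment> \<open>Euler's relation with its defect. The factor
      \<open>W * i - X * p * i\<^sup>2\<close> is the partial derivative of
      \<open>singular_rhs\<close> in p, which the statement expresses as a quotient by p in order to
      avoid a further definition.\<close>
    have euler: "p * (W * i - X * p * i\<^sup>2) + V * sv + R = 4 * W\<^sup>2 * V * n\<^sup>2"
    proof -
      have "p * (W * i - X * p * i\<^sup>2) + V * sv + R
        = X * i * (\<sigma> * i) - X * i / 2 - (V * (W\<^sup>2 + 1) - 2 * p * W) * i / 2 + 2 * V * W\<^sup>2 * n * ((1 - V\<^sup>2) * n + 1)"
        unfolding sv Ri \<sigma>_def by algebra
      also have "\<dots> = 2 * V * W\<^sup>2 * n * ((1 - V\<^sup>2) * n + N * n)" unfolding X_def[symmetric] i n by simp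
      also have "\<dots> = 4 * W\<^sup>2 * V * n\<^sup>2" unfolding N_def by algebra
      finally show ?thesis .
    qed
    have "(4 * W\<^sup>2 * V * n\<^sup>2 - R - V * sv) / p = W * i - X * p * i\<^sup>2"
      unfolding euler[symmetric] using p0(1) by simp
    moreover have "4 * W\<^sup>2 * V * n\<^sup>2 = 4 * W\<^sup>2 * V / N\<^sup>2" unfolding n_def by (simp add: power_one_over)
    ultimately have eu: "(4 * W\<^sup>2 * V / N\<^sup>2 - R - V * sv) / p = W * i - X * p * i\<^sup>2" by simp
    have D: "?D = sv * W + e * (- R) + (4 * W\<^sup>2 * V / N\<^sup>2 - R - V * sv) / p"
      by (simp only: V_def W_def \<sigma>_def N_def R_def sv_def e_def)
    have main: "- (W * (W\<^sup>2 + 1) - 2 * W) * i / 2 - R * ((V * W - p) * i) + X * (V * W - p) * i\<^sup>2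
       + (W * (2 * W\<^sup>2 * (1 - V\<^sup>2)) * n\<^sup>2 + 4 * V * W * R * n) = sv * W + e * (- R) + (W * i - X * p * i\<^sup>2)"
      unfolding sv ei by (simp add: field_simps power2_eq_square)
    show ?thesis by (simp only: t1 t2 t3 D eu main)
  qed
  ultimately have D: "((\<lambda>p. - (v p * ((w p)\<^sup>2 + 1) - 2 * p * w p) / (2 * ((v p)\<^sup>2 - p\<^sup>2)) + 2 * v p * (w p)\<^sup>2 / (1 + (v p)\<^sup>2)) has_real_derivative
     ?D) (at p within {r..b})" by simp
  show ?thesis
  proof (rule has_field_derivative_transform_within[OF D, of "b - p"])
    show "- (v x * ((w x)\<^sup>2 + 1) - 2 * x * w x) / (2 * ((v x)\<^sup>2 - x\<^sup>2)) + 2 * v x * (w x)\<^sup>2 / (1 + (v x)\<^sup>2) = rhs x"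
      if "x \<in> {r..b}" "dist x p < b - p" for x
    proof -
      have "x \<in> {0..<b}" using that p r by (auto simp: dist_real_def)
      then show ?thesis using singular_rhs_eq[of x "v x" "w x"] v_gt[of x] by simp
    qed
  qed (use p p0 in auto)
qed

end

section \<open>The Jacobi equation on the singular part\<close>

context jacobi_arc begin

abbreviation "H p \<equiv> f_wv p (v p) (w p)"
abbreviation "K p \<equiv> f_vv p (v p) (w p)"
abbreviation "sv p \<equiv> singular_rhs_v p (v p) (w p)"
abbreviation "G p \<equiv> kin p (v p)"

lemma H_deriv_right:
  assumes p: "p \<in> {r..<b}"
  shows "(H has_real_derivative K p - G p * sv p) (at p within {r..b})"
proof -
  have *: "p \<in> {r..b}" "{r..b} \<subseteq> {0..}" "0 \<le> p" "p < v p" using p r v_gt[of p] by auto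
  have "(H has_real_derivative K p - jac_Q p (v p) (w p) + kin_v p (v p) * rhs p) (at p within {r..b})"
    by (rule DERIV_f_wv_along[OF v_deriv_right w_sing]) (use p * in auto)
  then show ?thesis unfolding jac_Q_def by simp
qed

lemma H_deriv_left:
  assumes p: "p \<in> {0..r}"
  shows "(H has_real_derivative K p - jac_Q p (v p) (w p)) (at p within {0..r})"
proof -
  have *: "p < v p" "(v has_real_derivative w p) (at p within {0..r})" using p r v_gt[of p] by (auto intro: v_deriv_sub)
  have "(H has_real_derivative K p - jac_Q p (v p) (w p) + kin_v p (v p) * 0) (at p within {0..r})"
    by (rule DERIV_f_wv_along[OF *(2) w_deriv_affine]) (use p * in auto)
  then show ?thesis by simp
qed

text \<open>The partial derivative of \<open>singular_rhs\<close> in w is minus the logarithmic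
  derivative e of \<open>kin\<close>, so all terms with e cancel. What is left says that u satisfies
  (kin xi')' = kin sv xi up to the error - kin kk, since u' = - p * rhs p.\<close>

lemma DERIV_kin_u':
  assumes p: "p \<in> {r..<b}"
  shows "((\<lambda>p. G p * (- p * rhs p)) has_real_derivative G p * (sv p * u p - kk p)) (at p within {r..b})"
proof -
  define e where "e = (v p * w p - p) / ((v p)\<^sup>2 - p\<^sup>2) - 4 * v p * w p / (1 + (v p)\<^sup>2)"
  have p0: "p > 0" "p \<in> {0..<b}" "p \<in> {r..b}" "{r..b} \<subseteq> {0..b}" using p r by auto
  have G: "(G has_real_derivative G p * e) (at p within {r..b})"
    unfolding e_def by (rule DERIV_kin[OF p0(2-4)])
  have R: "(rhs has_real_derivative sv p * w p + e * (- rhs p) + (kk p - rhs p - v p * sv p) / p) (at p within {r..b})"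
    using DERIV_rhs[OF p] unfolding e_def kk_def .
  have "((\<lambda>p. - p * rhs p) has_real_derivative - rhs p - p * (sv p * w p + e * (- rhs p) + (kk p - rhs p - v p * sv p) / p)) (at p within {r..b})"
    using R by (auto intro!: derivative_eq_intros)
  from DERIV_mult_log[OF G this]
  show ?thesis
  proof (rule DERIV_cong)
    show "G p * (e * (- p * rhs p) + (- rhs p - p * (sv p * w p + e * (- rhs p) + (kk p - rhs p - v p * sv p) / p)))
      = G p * (sv p * u p - kk p)"
      using p0(1) unfolding u_def by (simp add: field_simps)
  qed
qed

text \<open>The weight in (kin u^2 y')' = mm y, the equation left for the ratio y = xi/u.\<close>

definition "mm p = G p * u p * kk p"

lemma mm_cont: "continuous_on {0..b} mm"
  unfolding mm_def by (intro continuous_intros kin_cont u_cont kk_cont)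

lemma mm_nonneg: "p \<in> {r..b} \<Longrightarrow> 0 \<le> mm p"
  using kin_gt_0[of p] u_pos[of p] kk_nonneg[of p] r kin_end unfolding mm_def by (cases "p = b") auto

text \<open>Both sides vanish at b, so derivatives are compared. As \<open>kin\<close> decreases and
  u' = - p R with p R >= r \<kappa>, one has - (kin u^2)' >= 2 r \<kappa> kin u, and by
  \<open>small\<close> this is at least 40 b mm.\<close>

lemma mm_integral_le:
  assumes q: "q \<in> {r..<b}"
  shows "integral {q..b} mm \<le> G q * (u q)\<^sup>2 / (40 * b)"
proof -
  define \<Psi> where "\<Psi> q = G q * (u q)\<^sup>2 / (40 * b) - integral {q..b} mm" for q
  have mc: "continuous_on {r..b} mm" by (rule continuous_on_subset[OF mm_cont]) (use r in auto)
  have "\<Psi> b \<le> \<Psi> q"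
  proof (rule DERIV_nonpos_imp_decreasing_open[of q b \<Psi>])
    show "q \<le> b" using q by auto
    show "\<exists>y. (\<Psi> has_real_derivative y) (at x) \<and> y \<le> 0" if x: "q < x" "x < b" for x
    proof -
      have x': "x \<in> {r..<b}" "x \<in> {0..<b}" "x \<in> {r..b}" "{r..b} \<subseteq> {0..b}" "x \<in> interior {r..b}" using x q r by auto
      define e where "e = (v x * w x - x) / ((v x)\<^sup>2 - x\<^sup>2) - 4 * v x * w x / (1 + (v x)\<^sup>2)"
      have G: "(G has_real_derivative G x * e) (at x within {r..b})"
        unfolding e_def by (rule DERIV_kin[OF x'(2-4)])
      have I: "((\<lambda>q. integral {q..b} mm) has_real_derivative - mm x) (at x within {r..b})"
        by (rule integral_has_real_derivative'[OF mc x'(3)])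
      have "((\<lambda>q. G q * (u q)\<^sup>2) has_real_derivative G x * e * (u x)\<^sup>2 + G x * (2 * u x * (- x * rhs x))) (at x within {r..b})"
        using G u_deriv[OF x'(1)] by (auto intro!: derivative_eq_intros)
      from DERIV_diff[OF DERIV_cdivide[OF this, of "40 * b"] I]
      have "(\<Psi> has_real_derivative (G x * e * (u x)\<^sup>2 + G x * (2 * u x * (- x * rhs x))) / (40 * b) + mm x) (at x within {r..b})"
        unfolding \<Psi>_def by simp
      then have "(\<Psi> has_real_derivative (G x * e * (u x)\<^sup>2 + G x * (2 * u x * (- x * rhs x))) / (40 * b) + mm x) (at x)"
        using at_within_interior[OF x'(5)] by simp
      moreover have "(G x * e * (u x)\<^sup>2 + G x * (2 * u x * (- x * rhs x))) / (40 * b) + mm x \<le> 0"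
      proof -
        have Gx: "G x > 0" "u x > 0" using kin_gt_0[OF x'(2)] u_pos[OF x'(1)] by auto
        have "e \<le> 0" unfolding e_def by (rule kin_slope[OF x'(2)])
        then have 1: "G x * e * (u x)\<^sup>2 \<le> 0" using Gx by (simp add: mult_nonneg_nonpos mult_nonpos_nonneg)
        have "r * \<kappa> \<le> x * rhs x" using rhs_ge[OF x'(1)] \<kappa> r x' by (intro mult_mono) auto
        then have "G x * u x * (r * \<kappa>) \<le> G x * u x * (x * rhs x)" using Gx by (intro mult_left_mono) auto
        then have 2: "G x * (2 * u x * (- x * rhs x)) \<le> - (G x * u x * (2 * r * \<kappa>))" by (simp add: algebra_simps)
        have "mm x \<le> G x * u x * (2 * r * \<kappa> / (40 * b))"
          unfolding mm_def using kk_le[OF x'(1)] Gx by (intro mult_left_mono) auto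
        also have "\<dots> = G x * u x * (2 * r * \<kappa>) / (40 * b)" by simp
        finally have 3: "mm x \<le> G x * u x * (2 * r * \<kappa>) / (40 * b)" .
        have "(G x * e * (u x)\<^sup>2 + G x * (2 * u x * (- x * rhs x))) / (40 * b) \<le> - (G x * u x * (2 * r * \<kappa>)) / (40 * b)"
          using 1 2 b_pos by (intro divide_right_mono) linarith+
        then show ?thesis using 3 by simp
      qed
      ultimately show ?thesis by blast
    qed
    show "continuous_on {q..b} \<Psi>"
      unfolding \<Psi>_def
      by (intro continuous_intros indefinite_integral_continuous_1' integrable_continuous_real
          continuous_on_subset[OF kin_cont] continuous_on_subset[OF u_cont] continuous_on_subset[OF mm_cont])
        (use q r in auto)
  qed
  moreover have "\<Psi> b = 0" unfolding \<Psi>_def by (simp add: u_end)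
  ultimately have "0 \<le> \<Psi> q" by simp
  then show ?thesis unfolding \<Psi>_def by simp
qed

text \<open>Reduction of order with xi = u y: the flux is kin u^2 y' = - J, where J is the tail
  integral of mm y, and y stays in [1/2, 3/2], so xi inherits the sign of u. The normalization at b
  is still that of u. The last two bounds at r are the initial data handed to the affine
  part.\<close>

lemma jacobi_right:
  obtains \<xi> \<xi>1 where "\<And>p. p \<in> {r..b} \<Longrightarrow> (\<xi> has_real_derivative \<xi>1 p) (at p within {r..b})"
    "continuous_on {r..b} \<xi>1"
    "\<And>p. p \<in> {r..<b} \<Longrightarrow> ((\<lambda>q. G q * \<xi>1 q) has_real_derivative G p * sv p * \<xi> p) (at p within {r..b})"
    "\<And>p. p \<in> {r..<b} \<Longrightarrow> 0 < \<xi> p" "\<xi> b = 0" "\<xi>1 b = - b * l"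
    "\<xi>1 r \<le> 0" "r * \<bar>\<xi>1 r\<bar> \<le> \<xi> r / 20"
proof -
  define k where "k q = 1 / (G q * (u q)\<^sup>2)" for q
  have Gu: "G q > 0" "u q > 0" if "q \<in> {r..<b}" for q using kin_gt_0[of q] u_pos[of q] that r by auto
  have sub: "{r..b} \<subseteq> {0..b}" "{r..<b} \<subseteq> {0..b}" using r by auto
  have kc: "continuous_on {r..<b} k" unfolding k_def
    using Gu by (intro continuous_intros continuous_on_subset[OF kin_cont sub(2)] continuous_on_subset[OF u_cont sub(2)])
       (auto simp: less_imp_neq[symmetric])
  have mc: "continuous_on {r..b} mm" by (rule continuous_on_subset[OF mm_cont sub(1)])
  have Bd: "\<bar>k q\<bar> * integral {q..b} (\<lambda>s. \<bar>mm s\<bar>) \<le> 1 / (40 * b)" if q: "q \<in> {r..<b}" for q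
  proof -
    have "integral {q..b} (\<lambda>s. \<bar>mm s\<bar>) = integral {q..b} mm"
      by (rule integral_cong) (use mm_nonneg q in auto)
    also have "\<dots> \<le> G q * (u q)\<^sup>2 / (40 * b)" by (rule mm_integral_le[OF q])
    finally have "\<bar>k q\<bar> * integral {q..b} (\<lambda>s. \<bar>mm s\<bar>) \<le> \<bar>k q\<bar> * (G q * (u q)\<^sup>2 / (40 * b))"
      by (intro mult_left_mono) auto
    also have "\<dots> = 1 / (40 * b)" unfolding k_def using Gu[OF q] by simp
    finally show ?thesis .
  qed
  have Bd2: "1 / (40 * b) * (b - r) \<le> 3 / 10" using b_pos r by (simp add: field_simps)
  have y0b: "1 \<le> (1::real) \<and> 1 \<le> (21/20 :: real)" for p :: real by simp
  obtain y where y: "continuous_on {r..b} y" "\<forall>p\<in>{r..b}. 1/2 \<le> y p \<and> y p \<le> 3/2" "y b = 1"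
    "\<forall>p\<in>{r..<b}. ((\<lambda>p. y p - 1) has_real_derivative - (k p * integral {p..b} (\<lambda>s. mm s * y s))) (at p within {r..b})"
    "\<forall>p\<in>{r..<b}. \<bar>k p * integral {p..b} (\<lambda>s. mm s * y s)\<bar> \<le> 3/2 * (1 / (40 * b))"
    using volterra_solution[OF r(2) kc mc continuous_on_const[of "{r..b}" "1::real"] Bd Bd2 y0b] by blast
  note y = y(1) y(2)[rule_format] y(3) y(4)[rule_format] y(5)[rule_format]
  define J where "J p = integral {p..b} (\<lambda>s. mm s * y s)" for p
  have my: "continuous_on {r..b} (\<lambda>s. mm s * y s)" by (intro continuous_intros mc y(1))
  have J': "(J has_real_derivative - (mm p * y p)) (at p within {r..b})" if "p \<in> {r..b}" for p
    unfolding J_def by (rule integral_has_real_derivative'[OF my that])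
  have Jc: "continuous_on {r..b} J" by (rule DERIV_continuous_on[OF J'])
  have J0: "J p \<ge> 0" if "p \<in> {r..b}" for p
  proof -
    have "0 \<le> mm s * y s" if "s \<in> {r..b}" for s using mm_nonneg[OF that] y(2)[OF that] by simp
    moreover have "(\<lambda>s. mm s * y s) integrable_on {p..b}"
      by (rule integrable_continuous_real[OF continuous_on_subset[OF my]]) (use that in auto)
    ultimately show ?thesis unfolding J_def using that by (intro integral_nonneg) auto
  qed
  have y': "(y has_real_derivative - (k p * J p)) (at p within {r..b})" if "p \<in> {r..<b}" for p
    using DERIV_add[OF y(4)[OF that] DERIV_const[of 1]] unfolding J_def by simp
  have kJ: "\<bar>k p * J p\<bar> \<le> 3 / (80 * b)" if "p \<in> {r..<b}" for p using y(5)[OF that] unfolding J_def by simp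
  define \<xi> where "\<xi> p = u p * y p" for p
  define \<xi>1 where "\<xi>1 p = (if p = b then - b * l else - p * rhs p * y p - u p * (k p * J p))" for p
  have x1: "(\<xi> has_real_derivative \<xi>1 p) (at p within {r..b})" if p: "p \<in> {r..b}" for p
  proof (cases "p = b")
    case False
    then have p': "p \<in> {r..<b}" using p by auto
    show ?thesis unfolding \<xi>_def \<xi>1_def using False u_deriv[OF p'] y'[OF p']
      by (auto intro!: derivative_eq_intros)
  next
    case True
    \<comment> \<open>No derivative of y is available at b. Since u b = 0, the difference quotient
      of u y is that of u times y, and continuity of y suffices.\<close>
    have "((\<lambda>q. (u q - u b) / (q - b)) \<longlongrightarrow> - b * l) (at b within {r..b})"
      using u_deriv_end unfolding has_field_derivative_iff .
    moreover have "(y \<longlongrightarrow> y b) (at b within {r..b})" using y(1) r by (auto simp: continuous_on_def)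
    ultimately have "((\<lambda>q. (u q - u b) / (q - b) * y q) \<longlongrightarrow> - b * l * y b) (at b within {r..b})"
      by (rule tendsto_mult)
    then show ?thesis unfolding True has_field_derivative_iff \<xi>_def \<xi>1_def by (simp add: u_end y(3))
  qed
  have x1c: "continuous_on {r..b} \<xi>1"
    unfolding continuous_on_def
  proof
    fix p assume p: "p \<in> {r..b}"
    show "(\<xi>1 \<longlongrightarrow> \<xi>1 p) (at p within {r..b})"
    proof (cases "p = b")
      case False
      then have p': "p \<in> {r..<b}" using p by auto
      have rc: "continuous_on {r..<b} rhs" by (rule singular_rhs_cont) (use r in auto)
      have "continuous_on {r..<b} (\<lambda>p. - p * rhs p * y p - u p * (k p * J p))"
        by (intro continuous_intros rc kc continuous_on_subset[OF u_cont sub(2)] continuous_on_subset[OF y(1)]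
            continuous_on_subset[OF Jc]) auto
      then have "continuous_on {r..<b} \<xi>1"
        by (rule continuous_on_eq) (auto simp: \<xi>1_def)
      then have "(\<xi>1 \<longlongrightarrow> \<xi>1 p) (at p within {r..<b})" using p' by (auto simp: continuous_on_def)
      moreover have "at p within {r..<b} = at p within {r..b}"
        by (rule at_within_nhd[of _ "{..<b}"]) (use p' in auto)
      ultimately show ?thesis by simp
    next
      case True
      have fb: "at b within {r..b} = at_left b"
        by (rule at_within_Icc_at_left[OF r(2)])
      have ev: "\<forall>\<^sub>F q in at_left b. q \<in> {r..<b}"
        unfolding eventually_at_left_field using r by (intro exI[of _ r]) auto
      have bb: "b \<in> {r..b}" using r by simp
      have yl: "(y \<longlongrightarrow> 1) (at_left b)"
        using bspec[OF y(1)[unfolded continuous_on_def] bb] unfolding fb y(3) .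
      have ul: "(u \<longlongrightarrow> 0) (at_left b)"
        using bspec[OF continuous_on_subset[OF u_cont sub(1), unfolded continuous_on_def] bb] unfolding fb u_end .
      have s: "((\<lambda>q. u q * (k q * J q)) \<longlongrightarrow> 0) (at_left b)"
      proof (rule Lim_null_comparison)
        show "\<forall>\<^sub>F q in at_left b. norm (u q * (k q * J q)) \<le> \<bar>u q\<bar> * (3 / (80 * b))"
          using ev
        proof eventually_elim
          case (elim q)
          then show ?case using mult_left_mono[OF kJ[OF elim] abs_ge_zero[of "u q"]] by (simp add: abs_mult)
        qed
        show "((\<lambda>q. \<bar>u q\<bar> * (3 / (80 * b))) \<longlongrightarrow> 0) (at_left b)"
          by (rule tendsto_mult_left_zero[OF tendsto_rabs_zero[OF ul]])
      qed
      have "((\<lambda>q. - q * rhs q * y q - u q * (k q * J q)) \<longlongrightarrow> - b * l * 1 - 0) (at_left b)"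
        by (intro tendsto_intros rhs_lim yl s)
      moreover have "\<forall>\<^sub>F q in at_left b. - q * rhs q * y q - u q * (k q * J q) = \<xi>1 q"
        using ev by eventually_elim (auto simp: \<xi>1_def)
      ultimately have "(\<xi>1 \<longlongrightarrow> - b * l * 1 - 0) (at_left b)" by (rule Lim_transform_eventually)
      then show ?thesis unfolding True fb \<xi>1_def by simp
    qed
  qed
  have x2: "((\<lambda>q. G q * \<xi>1 q) has_real_derivative G p * sv p * \<xi> p) (at p within {r..b})" if p: "p \<in> {r..<b}" for p
  proof -
    have "((\<lambda>q. G q * (- q * rhs q) * y q - J q / u q) has_real_derivative
       G p * (sv p * u p - kk p) * y p + - (k p * J p) * (G p * (- p * rhs p))
       - (- (mm p * y p) * u p - J p * (- p * rhs p)) / (u p * u p)) (at p within {r..b})"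
      using Gu[OF p] p
      by (intro DERIV_diff DERIV_mult DERIV_divide DERIV_kin_u' y' J' u_deriv) auto
    moreover have "G p * (sv p * u p - kk p) * y p + - (k p * J p) * (G p * (- p * rhs p))
       - (- (mm p * y p) * u p - J p * (- p * rhs p)) / (u p * u p) = G p * sv p * \<xi> p"
      using Gu[OF p] unfolding k_def mm_def \<xi>_def
      by (simp add: field_simps power2_eq_square)
    ultimately have D: "((\<lambda>q. G q * (- q * rhs q) * y q - J q / u q) has_real_derivative G p * sv p * \<xi> p) (at p within {r..b})"
      by simp
    show ?thesis
    proof (rule has_field_derivative_transform_within[OF D, of "b - p"])
      show "G x * (- x * rhs x) * y x - J x / u x = G x * \<xi>1 x" if "x \<in> {r..b}" "dist x p < b - p" for x
      proof -
        have "x \<in> {r..<b}" using that p by (auto simp: dist_real_def)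
        then show ?thesis using Gu[of x] unfolding \<xi>1_def k_def by (auto simp: field_simps power2_eq_square)
      qed
    qed (use p in auto)
  qed
  have rr: "r \<in> {r..<b}" using r by auto
  have e: "\<xi>1 r = - (r * rhs r * y r) - u r * (k r * J r)" unfolding \<xi>1_def using r by auto
  have yr: "1/2 \<le> y r" "y r \<le> 3/2" using y(2)[of r] r by auto
  have kJ0: "k r * J r \<ge> 0" using J0[of r] Gu[OF rr] r unfolding k_def by auto
  have rhs0: "rhs r > 0" using rhs_ge[OF rr] \<kappa> by simp
  have n1: "r * rhs r * y r \<ge> 0" "u r * (k r * J r) \<ge> 0" using yr rhs0 r Gu[OF rr] kJ0 by auto
  show ?thesis
  proof (rule that[OF x1 x1c x2])
    show "0 < \<xi> p" if "p \<in> {r..<b}" for p using Gu[OF that] y(2)[of p] that unfolding \<xi>_def by auto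
    show "\<xi> b = 0" unfolding \<xi>_def by (simp add: u_end)
    show "\<xi>1 b = - b * l" unfolding \<xi>1_def by simp
    show "\<xi>1 r \<le> 0" using e n1 by simp
    \<comment> \<open>Two contributions to r |xi'| relative to xi: 1/50 from \<open>slope\<close>
      and 3/160 from the correction y; together they stay below 1/20.\<close>
    have "r * (r * rhs r) \<le> u r / 50" using slope unfolding u_def .
    then have "r * (r * rhs r) * y r \<le> u r / 50 * y r" using yr by (intro mult_right_mono) auto
    moreover have "r * (u r * (k r * J r)) \<le> u r * y r * (3 / 160)"
    proof -
      have "k r * J r \<le> 3 / (80 * b)" using kJ[OF rr] by linarith
      then have "r * (k r * J r) \<le> (b / 4) * (3 / (80 * b))" using r_le r kJ0 by (intro mult_mono) auto
      also have "\<dots> = 3 / 320" using b_pos by simp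
      also have "\<dots> \<le> y r * (3 / 160)" using yr by simp
      finally show ?thesis using mult_left_mono[of "r * (k r * J r)" "y r * (3/160)" "u r"] Gu[OF rr] by (simp add: mult_ac)
    qed
    moreover have "\<bar>\<xi>1 r\<bar> = r * rhs r * y r + u r * (k r * J r)" using e n1 by simp
    moreover have "u r * y r \<ge> 0" using Gu[OF rr] yr by simp
    ultimately show "r * \<bar>\<xi>1 r\<bar> \<le> \<xi> r / 20" unfolding \<xi>_def by (simp add: algebra_simps)
  qed auto
qed

end

section \<open>The Jacobi equation on the affine part\<close>

context jacobi_arc begin

lemma jac_Q_cont: "continuous_on {0..r} (\<lambda>p. jac_Q p (v p) (w p))"
proof -
  have "(v p)\<^sup>2 - p\<^sup>2 \<noteq> 0" if "p \<in> {0..r}" for p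
  proof -
    have "p \<in> {0..<b}" using that r by auto
    then show ?thesis using square_less_square[of p "v p"] v_gt[of p] by auto
  qed
  moreover have "{0..r} \<subseteq> {0..b}" "{0..r} \<subseteq> {0..<b}" using r by auto
  ultimately show ?thesis
    unfolding jac_Q_def kin_v_def singular_rhs_v_def using one_plus_square_pos(2)
    by (intro continuous_intros continuous_on_subset[OF v_cont] continuous_on_subset[OF w_cont]
       continuous_on_subset[OF kin_cont] singular_rhs_cont) auto
qed

text \<open>The equation (kin xi')' = jac_Q xi is integrated from r down to 0 for z = xi / x0. The
  starting function \<open>y0\<close> is the solution without potential; because \<open>kin\<close>
  decreases, kin r times the integral of 1/kin is at most r, and so \<open>y0\<close> lies in
  [1, 21/20].\<close>

lemma jacobi_left:
  assumes x0: "0 < x0" and x1: "x1 \<le> 0" "r * \<bar>x1\<bar> \<le> x0 / 20"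
  obtains \<xi> \<xi>1 where "\<And>p. p \<in> {0..r} \<Longrightarrow> (\<xi> has_real_derivative \<xi>1 p) (at p within {0..r})"
    "continuous_on {0..r} \<xi>1"
    "\<And>p. p \<in> {0..r} \<Longrightarrow> ((\<lambda>q. G q * \<xi>1 q) has_real_derivative jac_Q p (v p) (w p) * \<xi> p) (at p within {0..r})"
    "\<And>p. p \<in> {0..r} \<Longrightarrow> 0 < \<xi> p" "\<xi> r = x0" "\<xi>1 r = x1"
proof -
  define Q where "Q p = jac_Q p (v p) (w p)" for p
  define \<rho> where "\<rho> = x1 / x0"
  have \<rho>: "\<rho> \<le> 0" "r * \<bar>\<rho>\<bar> \<le> 1 / 20" using x0 x1 unfolding \<rho>_def by (auto simp: field_simps)
  have Gp: "G q > 0" if "q \<in> {0..r}" for q using kin_gt_0[of q] that r by auto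
  have sub: "{0..r} \<subseteq> {0..b}" using r by auto
  have Qc: "continuous_on {0..r} Q" unfolding Q_def by (rule jac_Q_cont)
  have Gc: "continuous_on {0..r} (\<lambda>p. G p)" by (rule continuous_on_subset[OF kin_cont sub])
  have ic: "continuous_on {0..r} (\<lambda>p. 1 / G p)" using Gp by (intro continuous_intros Gc) (auto simp: less_imp_neq[symmetric])
  define y0 where "y0 p = 1 - \<rho> * G r * integral {p..r} (\<lambda>q. 1 / G q)" for p
  have y0': "(y0 has_real_derivative \<rho> * G r * (1 / G p)) (at p within {0..r})" if "p \<in> {0..r}" for p
    unfolding y0_def using integral_has_real_derivative'[OF ic that] by (auto intro!: derivative_eq_intros)
  have y0c: "continuous_on {0..r} y0" by (rule DERIV_continuous_on[OF y0'])
  have y0b: "1 \<le> y0 p \<and> y0 p \<le> 21/20" if p: "p \<in> {0..r}" for p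
  proof -
    have i: "(\<lambda>q. 1 / G q) integrable_on {p..r}" by (rule integrable_continuous_real[OF continuous_on_subset[OF ic]]) (use p in auto)
    have 0: "0 \<le> integral {p..r} (\<lambda>q. 1 / G q)"
      using p Gp by (intro integral_nonneg[OF i]) (auto intro: less_imp_le)
    have "integral {p..r} (\<lambda>q. 1 / G q) \<le> integral {p..r} (\<lambda>q. 1 / G r)"
    proof (rule integral_le[OF i])
      show "1 / G q \<le> 1 / G r" if "q \<in> {p..r}" for q
        using kin_antimono[of q r] Gp[of r] that p r by (intro divide_left_mono mult_pos_pos) (auto intro!: Gp)
    qed auto
    also have "\<dots> = (r - p) / G r" using p by simp
    finally have "G r * integral {p..r} (\<lambda>q. 1 / G q) \<le> r - p" using Gp[of r] r by (simp add: field_simps)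
    then have 1: "G r * integral {p..r} (\<lambda>q. 1 / G q) \<le> r" using p by simp
    have 2: "0 \<le> G r * integral {p..r} (\<lambda>q. 1 / G q)" using 0 Gp[of r] r by simp
    have "(- \<rho>) * (G r * integral {p..r} (\<lambda>q. 1 / G q)) \<le> (- \<rho>) * r" using 1 \<rho> by (intro mult_left_mono) auto
    moreover have "(- \<rho>) * r \<le> 1 / 20" using \<rho> by (simp add: mult.commute)
    moreover have "0 \<le> (- \<rho>) * (G r * integral {p..r} (\<lambda>q. 1 / G q))" using mult_nonneg_nonneg[of "- \<rho>", OF _ 2] \<rho> by simp
    ultimately show ?thesis unfolding y0_def by (simp add: mult.assoc)
  qed
  \<comment> \<open>The bound 3/(10 r) on an interval of length r is exactly the 3/10 that
    \<open>volterra_solution\<close> allows.\<close>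
  have kb: "\<bar>1 / G p\<bar> * integral {p..r} (\<lambda>s. \<bar>Q s\<bar>) \<le> 3 / (10 * r)" if p: "p \<in> {0..<r}" for p
  proof -
    have Gpp: "G p > 0" using Gp[of p] p by auto
    have "integral {p..r} (\<lambda>s. \<bar>Q s\<bar>) \<le> integral {p..r} (\<lambda>_. 3 / (10 * r\<^sup>2) * G p)"
    proof (rule integral_le)
      show "(\<lambda>s. \<bar>Q s\<bar>) integrable_on {p..r}"
        by (rule integrable_continuous_real[OF continuous_on_rabs[OF continuous_on_subset[OF Qc]]]) (use p in auto)
      show "\<bar>Q s\<bar> \<le> 3 / (10 * r\<^sup>2) * G p" if s: "s \<in> {p..r}" for s
      proof -
        have "r\<^sup>2 * \<bar>Q s\<bar> \<le> 3 / 10 * G s" using jac_small[of s] s p unfolding Q_def by auto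
        also have "\<dots> \<le> 3 / 10 * G p" using kin_antimono[of p s] s p r by auto
        finally show ?thesis using r by (simp add: field_simps)
      qed
    qed auto
    also have "\<dots> = 3 / (10 * r\<^sup>2) * G p * (r - p)" using p by simp
    also have "\<dots> \<le> 3 / (10 * r\<^sup>2) * G p * r" using p Gpp by (intro mult_left_mono) auto
    finally have "\<bar>1 / G p\<bar> * integral {p..r} (\<lambda>s. \<bar>Q s\<bar>) \<le> \<bar>1 / G p\<bar> * (3 / (10 * r\<^sup>2) * G p * r)"
      by (intro mult_left_mono) auto
    also have "\<dots> = 3 / (10 * r)" using Gpp r by (simp add: field_simps power2_eq_square)
    finally show ?thesis .
  qed
  have kb2: "3 / (10 * r) * (r - 0) \<le> 3 / 10" using r by simp
  have k': "continuous_on {0..<r} (\<lambda>p. 1 / G p)" by (rule continuous_on_subset[OF ic]) auto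
  obtain z where z: "continuous_on {0..r} z" "\<forall>p\<in>{0..r}. 1/2 \<le> z p \<and> z p \<le> 3/2" "z r = y0 r"
    "\<forall>p\<in>{0..<r}. ((\<lambda>p. z p - y0 p) has_real_derivative - (1 / G p * integral {p..r} (\<lambda>s. Q s * z s))) (at p within {0..r})"
    using volterra_solution[OF r(1) k' Qc y0c kb kb2 y0b] by blast
  define J where "J p = integral {p..r} (\<lambda>s. Q s * z s)" for p
  have Qz: "continuous_on {0..r} (\<lambda>s. Q s * z s)" by (intro continuous_intros Qc z(1))
  have J': "(J has_real_derivative - (Q p * z p)) (at p within {0..r})" if "p \<in> {0..r}" for p
    unfolding J_def by (rule integral_has_real_derivative'[OF Qz that])
  have Jc: "continuous_on {0..r} J" by (rule DERIV_continuous_on[OF J'])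
  define z1 where "z1 p = (\<rho> * G r - J p) / G p" for p
  have z1c: "continuous_on {0..r} z1" unfolding z1_def using Gp by (intro continuous_intros Jc Gc) (auto simp: less_imp_neq[symmetric])
  have z': "(z has_real_derivative z1 p) (at p within {0..r})" if p: "p \<in> {0..<r}" for p
  proof -
    have "p \<in> {0..r}" using p by simp
    from DERIV_add[OF bspec[OF z(4) p] y0'[OF this]] show ?thesis unfolding z1_def J_def by (simp add: diff_divide_distrib)
  qed
  have zr: "(z has_real_derivative z1 r) (at r within {0..r})"
  proof (rule DERIV_at_right_endpoint[OF r(1) z(1)])
    show "(z has_real_derivative z1 p) (at p)" if "p \<in> {0<..<r}" for p
      using z'[of p] at_within_interior[of p "{0..r}"] that by auto
    have "r \<in> {0..r}" using r by simp
    from bspec[OF z1c[unfolded continuous_on_def] this] show "(z1 \<longlongrightarrow> z1 r) (at_left r)"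
      unfolding at_within_Icc_at_left[OF r(1)] .
  qed
  have z1r: "z1 r = \<rho>" unfolding z1_def J_def using Gp[of r] r by simp
  have zz: "z r = 1" using z(3) unfolding y0_def by simp
  show ?thesis
  proof (rule that[of "\<lambda>p. x0 * z p" "\<lambda>p. x0 * z1 p"])
    show "((\<lambda>p. x0 * z p) has_real_derivative x0 * z1 p) (at p within {0..r})" if "p \<in> {0..r}" for p
      using that zr z'[of p] by (cases "p = r") (auto intro!: DERIV_cmult)
    show "continuous_on {0..r} (\<lambda>p. x0 * z1 p)" by (intro continuous_intros z1c)
    show "((\<lambda>q. G q * (x0 * z1 q)) has_real_derivative jac_Q p (v p) (w p) * (x0 * z p)) (at p within {0..r})"
      if p: "p \<in> {0..r}" for p
    proof -
      have D: "((\<lambda>q. x0 * (\<rho> * G r - J q)) has_real_derivative jac_Q p (v p) (w p) * (x0 * z p)) (at p within {0..r})"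
        using J'[OF p] unfolding Q_def by (auto intro!: derivative_eq_intros)
      show ?thesis
      proof (rule has_field_derivative_transform_within[OF D, of 1])
        show "x0 * (\<rho> * G r - J x) = G x * (x0 * z1 x)" if "x \<in> {0..r}" for x
          using Gp[OF that] unfolding z1_def by simp
      qed (use p in auto)
    qed
    show "0 < x0 * z p" if "p \<in> {0..r}" for p using bspec[OF z(2) that] x0 by simp
    show "x0 * z r = x0" "x0 * z1 r = x1" using zz z1r x0 unfolding \<rho>_def by auto
  qed
qed

lemma jacobi_exists:
  obtains \<xi> \<xi>1 where "\<And>p. p \<in> {0..b} \<Longrightarrow> (\<xi> has_real_derivative \<xi>1 p) (at p within {0..b})"
    "continuous_on {0..b} \<xi>1"
    "\<And>p. p \<in> {0..<b} \<Longrightarrow> ((\<lambda>q. G q * \<xi>1 q + H q * \<xi> q) has_real_derivative H p * \<xi>1 p + K p * \<xi> p) (at p within {0..b})"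
    "\<And>p. p \<in> {0..<b} \<Longrightarrow> \<xi> p \<noteq> 0" "\<xi> b = 0" "\<xi>1 b = 1"
proof -
  obtain R R1 where R: "\<And>p. p \<in> {r..b} \<Longrightarrow> (R has_real_derivative R1 p) (at p within {r..b})"
    "continuous_on {r..b} R1"
    "\<And>p. p \<in> {r..<b} \<Longrightarrow> ((\<lambda>q. G q * R1 q) has_real_derivative G p * sv p * R p) (at p within {r..b})"
    "\<And>p. p \<in> {r..<b} \<Longrightarrow> 0 < R p" "R b = 0" "R1 b = - b * l"
    "R1 r \<le> 0" "r * \<bar>R1 r\<bar> \<le> R r / 20"
    using jacobi_right by blast
  have Rr: "0 < R r" using R(4)[of r] r by simp
  obtain L L1 where L: "\<And>p. p \<in> {0..r} \<Longrightarrow> (L has_real_derivative L1 p) (at p within {0..r})"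
    "continuous_on {0..r} L1"
    "\<And>p. p \<in> {0..r} \<Longrightarrow> ((\<lambda>q. G q * L1 q) has_real_derivative jac_Q p (v p) (w p) * L p) (at p within {0..r})"
    "\<And>p. p \<in> {0..r} \<Longrightarrow> 0 < L p" "L r = R r" "L1 r = R1 r"
    using jacobi_left[OF Rr R(7,8)] by blast
  \<comment> \<open>The value of xi' at b before normalization; it is nonzero because l >= \<kappa>
    > 0.\<close>
  define c where "c = - b * l"
  have c: "c \<noteq> 0" using l_ge \<kappa> b_pos unfolding c_def by auto
  define X where "X p = (if p \<le> r then L p else R p)" for p
  define X1 where "X1 p = (if p \<le> r then L1 p else R1 p)" for p
  have rb: "0 \<le> r" "r \<le> b" using r by auto
  have Xr: "X p = R p" "X1 p = R1 p" if "r \<le> p" for p using that L(5,6) unfolding X_def X1_def by (cases "p = r"; simp)+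
  have X': "(X has_real_derivative X1 p) (at p within {0..b})" if p: "p \<in> {0..b}" for p
    unfolding X_def
  proof (rule has_real_derivative_paste[OF rb p])
    show "(L has_real_derivative X1 p) (at p within {0..r})" if "p \<le> r"
      using L(1)[of p] that p unfolding X1_def by simp
    show "(R has_real_derivative X1 p) (at p within {r..b})" if "r \<le> p"
      using R(1)[of p] that p Xr(2)[OF that] by simp
  qed (simp add: L(5))
  have X1c: "continuous_on {0..b} X1"
  proof -
    have "{0..b} = {0..r} \<union> {r..b}" using r by auto
    then show ?thesis unfolding X1_def
      using L(2) R(2) L(6) by (auto intro!: continuous_on_cases)
  qed
  \<comment> \<open>At r the derivative of \<open>f_wv\<close> jumps along with v'', and so does
    that of kin xi'. The two jumps cancel in the sum, so the pasting has to be done for the sum and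
    not for its terms.\<close>
  have X2: "((\<lambda>q. G q * X1 q + H q * X q) has_real_derivative H p * X1 p + K p * X p) (at p within {0..b})"
    if p: "p \<in> {0..<b}" for p
  proof -
    have p': "p \<in> {0..b}" using p by simp
    have "((\<lambda>q. if q \<le> r then G q * L1 q + H q * L q else G q * R1 q + H q * R q) has_real_derivative H p * X1 p + K p * X p) (at p within {0..b})"
    proof (rule has_real_derivative_paste[OF rb p'])
      assume "p \<le> r"
      then have q: "p \<in> {0..r}" using p by simp
      have "((\<lambda>q. G q * L1 q + H q * L q) has_real_derivative
          jac_Q p (v p) (w p) * L p + ((K p - jac_Q p (v p) (w p)) * L p + L1 p * H p)) (at p within {0..r})"
        by (intro DERIV_add DERIV_mult L(3) H_deriv_left L(1) q)
      then show "((\<lambda>q. G q * L1 q + H q * L q) has_real_derivative H p * X1 p + K p * X p) (at p within {0..r})"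
        by (rule DERIV_cong) (use \<open>p \<le> r\<close> in \<open>simp add: X_def X1_def algebra_simps\<close>)
    next
      assume "r \<le> p"
      then have q: "p \<in> {r..<b}" "p \<in> {r..b}" using p by auto
      have "((\<lambda>q. G q * R1 q + H q * R q) has_real_derivative
          G p * sv p * R p + ((K p - G p * sv p) * R p + R1 p * H p)) (at p within {r..b})"
        by (intro DERIV_add DERIV_mult R(3) H_deriv_right R(1) q)
      then show "((\<lambda>q. G q * R1 q + H q * R q) has_real_derivative H p * X1 p + K p * X p) (at p within {r..b})"
        by (rule DERIV_cong) (simp add: Xr[OF \<open>r \<le> p\<close>] algebra_simps)
    qed (simp add: L(5,6))
    moreover have "(\<lambda>q. if q \<le> r then G q * L1 q + H q * L q else G q * R1 q + H q * R q) = (\<lambda>q. G q * X1 q + H q * X q)"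
      unfolding X_def X1_def by auto
    ultimately show ?thesis by simp
  qed
  show ?thesis
  proof (rule that[of "\<lambda>p. X p / c" "\<lambda>p. X1 p / c"])
    show "((\<lambda>p. X p / c) has_real_derivative X1 p / c) (at p within {0..b})" if "p \<in> {0..b}" for p
      by (rule DERIV_cdivide[OF X'[OF that]])
    show "continuous_on {0..b} (\<lambda>p. X1 p / c)" using c by (auto intro!: continuous_intros X1c)
    show "((\<lambda>q. G q * (X1 q / c) + H q * (X q / c)) has_real_derivative H p * (X1 p / c) + K p * (X p / c)) (at p within {0..b})"
      if "p \<in> {0..<b}" for p
      using DERIV_cdivide[OF X2[OF that], of c] by (simp add: add_divide_distrib)
    show "X p / c \<noteq> 0" if "p \<in> {0..<b}" for p
      using L(4)[of p] R(4)[of p] that c unfolding X_def by auto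
    show "X b / c = 0" "X1 b / c = 1" using Xr[of b] r R(5,6) c unfolding c_def by auto
  qed
qed

section \<open>Uniqueness, and the conclusion on the Jacobi equation\<close>

lemma f_coeffs: "q \<in> {0..b} \<Longrightarrow> f_ww q (v q) (D1 b v q) = G q \<and> f_wv q (v q) (D1 b v q) = H q \<and> f_vv q (v q) (D1 b v q) = K q"
  by (simp add: D1_v f_ww_eq)

text \<open>Trades \<open>D1\<close> for an explicit derivative function, so that quotients,
  multiples and pasted functions can be treated with the ordinary derivative rules.\<close>

lemma jacobi_solution_iff:
  "jacobi_solution b v \<xi> \<longleftrightarrow> (\<exists>\<xi>1. (\<forall>p\<in>{0..b}. (\<xi> has_real_derivative \<xi>1 p) (at p within {0..b})) \<and> continuous_on {0..b} \<xi>1 \<and>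
     (\<forall>p\<in>{0..<b}. ((\<lambda>q. G q * \<xi>1 q + H q * \<xi> q) has_real_derivative H p * \<xi>1 p + K p * \<xi> p) (at p within {0..b})) \<and>
     \<xi> b = 0 \<and> \<xi>1 b = 1)" (is "_ \<longleftrightarrow> ?R")
proof
  assume J: "jacobi_solution b v \<xi>"
  show ?R
  proof (intro exI[of _ "D1 b \<xi>"] conjI ballI)
    show "(\<xi> has_real_derivative D1 b \<xi> p) (at p within {0..b})" if "p \<in> {0..b}" for p
      using J that unfolding jacobi_solution_def differentiable_on_def D1_def
      by (simp add: has_real_derivative_iff_has_vector_derivative vector_derivative_works[symmetric])
    show "((\<lambda>q. G q * D1 b \<xi> q + H q * \<xi> q) has_real_derivative H p * D1 b \<xi> p + K p * \<xi> p) (at p within {0..b})"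
      if p: "p \<in> {0..<b}" for p
    proof -
      have p': "p \<in> {0..b}" using p by simp
      have "((\<lambda>q. f_ww q (v q) (D1 b v q) * D1 b \<xi> q + f_wv q (v q) (D1 b v q) * \<xi> q)
           has_real_derivative f_wv p (v p) (D1 b v p) * D1 b \<xi> p + f_vv p (v p) (D1 b v p) * \<xi> p) (at p within {0..b})"
        using J p unfolding jacobi_solution_def by blast
      then have "((\<lambda>q. f_ww q (v q) (D1 b v q) * D1 b \<xi> q + f_wv q (v q) (D1 b v q) * \<xi> q)
           has_real_derivative H p * D1 b \<xi> p + K p * \<xi> p) (at p within {0..b})"
        using f_coeffs[OF p'] by simp
      then show ?thesis
        by (rule has_field_derivative_transform_within[where d=1]) (use p' f_coeffs in auto)
    qed
  qed (use J in \<open>auto simp: jacobi_solution_def\<close>)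
next
  assume ?R
  then obtain \<xi>1 where x: "\<forall>p\<in>{0..b}. (\<xi> has_real_derivative \<xi>1 p) (at p within {0..b})" "continuous_on {0..b} \<xi>1"
    "\<forall>p\<in>{0..<b}. ((\<lambda>q. G q * \<xi>1 q + H q * \<xi> q) has_real_derivative H p * \<xi>1 p + K p * \<xi> p) (at p within {0..b})"
    "\<xi> b = 0" "\<xi>1 b = 1" by blast
  have d: "D1 b \<xi> p = \<xi>1 p" if "p \<in> {0..b}" for p using D1_eq[OF b_pos that] x(1) that by blast
  show "jacobi_solution b v \<xi>" unfolding jacobi_solution_def
  proof (intro conjI ballI)
    show "\<xi> differentiable_on {0..b}" unfolding differentiable_on_def
      using x(1) real_differentiable_def by blast
    show "continuous_on {0..b} (D1 b \<xi>)" by (rule continuous_on_eq[OF x(2)]) (simp add: d)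
    show "((\<lambda>q. f_ww q (v q) (D1 b v q) * D1 b \<xi> q + f_wv q (v q) (D1 b v q) * \<xi> q)
           has_real_derivative f_wv p (v p) (D1 b v p) * D1 b \<xi> p + f_vv p (v p) (D1 b v p) * \<xi> p) (at p within {0..b})"
      if p: "p \<in> {0..<b}" for p
    proof -
      have p': "p \<in> {0..b}" using p by simp
      have "((\<lambda>q. f_ww q (v q) (D1 b v q) * D1 b \<xi> q + f_wv q (v q) (D1 b v q) * \<xi> q)
           has_real_derivative H p * \<xi>1 p + K p * \<xi> p) (at p within {0..b})"
        by (rule has_field_derivative_transform_within[where d=1, OF bspec[OF x(3) p]]) (use p' f_coeffs d in auto)
      then show ?thesis using f_coeffs[OF p'] d[OF p'] by simp
    qed
    show "D1 b \<xi> b = 1" using d[of b] b_pos x(5) by simp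
  qed (rule x(4))
qed

text \<open>The usual uniqueness theorem fails at b, where \<open>kin\<close> vanishes. For the same
  reason, however, the Wronskian times \<open>kin\<close>, which is constant and continuous up to b,
  must be zero. Hence eta/xi is constant wherever xi does not vanish, and the derivatives at b make
  the constant 1.\<close>

lemma jacobi_unique:
  assumes x: "\<And>p. p \<in> {0..b} \<Longrightarrow> (\<xi> has_real_derivative \<xi>1 p) (at p within {0..b})" "continuous_on {0..b} \<xi>1"
    "\<And>p. p \<in> {0..<b} \<Longrightarrow> ((\<lambda>q. G q * \<xi>1 q + H q * \<xi> q) has_real_derivative H p * \<xi>1 p + K p * \<xi> p) (at p within {0..b})"
    "\<xi> b = 0" "\<xi>1 b = 1" and nz: "\<And>p. p \<in> {0..<b} \<Longrightarrow> \<xi> p \<noteq> 0"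
  and y: "\<And>p. p \<in> {0..b} \<Longrightarrow> (\<eta> has_real_derivative \<eta>1 p) (at p within {0..b})" "continuous_on {0..b} \<eta>1"
    "\<And>p. p \<in> {0..<b} \<Longrightarrow> ((\<lambda>q. G q * \<eta>1 q + H q * \<eta> q) has_real_derivative H p * \<eta>1 p + K p * \<eta> p) (at p within {0..b})"
    "\<eta> b = 0" "\<eta>1 b = 1"
  and p: "p \<in> {0..b}"
  shows "\<eta> p = \<xi> p"
proof -
  define W where "W q = G q * (\<xi>1 q * \<eta> q - \<eta>1 q * \<xi> q)" for q
  have W': "(W has_real_derivative 0) (at q)" if q: "0 < q" "q < b" for q
  proof -
    have q': "q \<in> {0..<b}" "q \<in> {0..b}" "q \<in> interior {0..b}" using q by auto
    have "((\<lambda>q. (G q * \<xi>1 q + H q * \<xi> q) * \<eta> q - (G q * \<eta>1 q + H q * \<eta> q) * \<xi> q) has_real_derivative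
       ((H q * \<xi>1 q + K q * \<xi> q) * \<eta> q + \<eta>1 q * (G q * \<xi>1 q + H q * \<xi> q))
       - ((H q * \<eta>1 q + K q * \<eta> q) * \<xi> q + \<xi>1 q * (G q * \<eta>1 q + H q * \<eta> q))) (at q within {0..b})"
      by (intro DERIV_diff DERIV_mult x(3) y(3) x(1) y(1) q')
    moreover have "(\<lambda>q. (G q * \<xi>1 q + H q * \<xi> q) * \<eta> q - (G q * \<eta>1 q + H q * \<eta> q) * \<xi> q) = W"
      unfolding W_def by (auto simp: algebra_simps)
    ultimately have "(W has_real_derivative 0) (at q within {0..b})" by (simp add: algebra_simps)
    then show ?thesis using at_within_interior[OF q'(3)] by simp
  qed
  have xc: "continuous_on {0..b} \<xi>" "continuous_on {0..b} \<eta>" using DERIV_continuous_on x(1) y(1) by blast+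
  have Wc: "continuous_on {0..b} W" unfolding W_def by (intro continuous_intros kin_cont xc x(2) y(2))
  have W0: "W q = 0" if q: "0 \<le> q" "q < b" for q
  proof -
    have "W b = W q"
      by (rule DERIV_isconst_end[OF q(2) continuous_on_subset[OF Wc]]) (use q W' in auto)
    then show ?thesis unfolding W_def using kin_end by simp
  qed
  have eq: "\<xi>1 q * \<eta> q = \<eta>1 q * \<xi> q" if q: "0 \<le> q" "q < b" for q
    using W0[OF q] kin_gt_0[of q] q unfolding W_def by auto
  define c where "c = \<eta> 0 / \<xi> 0"
  have cq: "\<eta> q / \<xi> q = c" if q: "0 < q" "q < b" for q
  proof -
    have nzq: "\<xi> t \<noteq> 0" if "t \<in> {0..q}" for t using nz[of t] that q by auto
    have "\<eta> q / \<xi> q = \<eta> 0 / \<xi> 0"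
    proof (rule DERIV_isconst_end[OF q(1)])
      show "continuous_on {0..q} (\<lambda>q. \<eta> q / \<xi> q)"
        using nzq q by (intro continuous_intros continuous_on_subset[OF xc(1)] continuous_on_subset[OF xc(2)]) auto
      show "((\<lambda>q. \<eta> q / \<xi> q) has_real_derivative 0) (at t)" if t: "0 < t" "t < q" for t
      proof -
        have t': "t \<in> {0..b}" "t \<in> interior {0..b}" using t q by auto
        have "((\<lambda>q. \<eta> q / \<xi> q) has_real_derivative (\<eta>1 t * \<xi> t - \<eta> t * \<xi>1 t) / (\<xi> t * \<xi> t)) (at t within {0..b})"
          by (intro DERIV_divide x(1) y(1) t' nzq) (use t in auto)
        moreover have "\<eta>1 t * \<xi> t - \<eta> t * \<xi>1 t = 0" using eq[of t] t q by (simp add: mult.commute)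
        ultimately show ?thesis using at_within_interior[OF t'(2)] by simp
      qed
    qed
    then show ?thesis unfolding c_def .
  qed
  have e: "\<eta> q = c * \<xi> q" if q: "q \<in> {0..b}" for q
  proof (cases "q = b")
    case True then show ?thesis using x(4) y(4) by simp
  next
    case False
    then have "\<xi> q \<noteq> 0" using nz[of q] q by simp
    moreover have "\<eta> q / \<xi> q = c" using cq[of q] q False unfolding c_def by (cases "q = 0") auto
    ultimately show ?thesis by (metis nonzero_divide_eq_eq)
  qed
  have bb: "b \<in> {0..b}" using b_pos by simp
  have "(\<eta> has_real_derivative c * \<xi>1 b) (at b within {0..b})"
    by (rule has_field_derivative_transform_within[where d=1, OF DERIV_cmult[OF x(1)[OF bb], of c]]) (use bb e in auto)
  from D1_eq[OF b_pos bb this] D1_eq[OF b_pos bb y(1)[OF bb]] have "c = 1" using x(5) y(5) by simp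
  then show ?thesis using e[OF p] by simp
qed

theorem jacobi_conclusion:
  "\<exists>\<xi>. jacobi_solution b v \<xi> \<and> (\<forall>\<eta>. jacobi_solution b v \<eta> \<longrightarrow> (\<forall>p\<in>{0..b}. \<eta> p = \<xi> p)) \<and> (\<forall>p\<in>{0..<b}. \<xi> p \<noteq> 0)"
proof -
  obtain \<xi> \<xi>1 where x: "\<And>p. p \<in> {0..b} \<Longrightarrow> (\<xi> has_real_derivative \<xi>1 p) (at p within {0..b})"
    "continuous_on {0..b} \<xi>1"
    "\<And>p. p \<in> {0..<b} \<Longrightarrow> ((\<lambda>q. G q * \<xi>1 q + H q * \<xi> q) has_real_derivative H p * \<xi>1 p + K p * \<xi> p) (at p within {0..b})"
    "\<And>p. p \<in> {0..<b} \<Longrightarrow> \<xi> p \<noteq> 0" "\<xi> b = 0" "\<xi>1 b = 1"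
    using jacobi_exists by blast
  have "jacobi_solution b v \<xi>" unfolding jacobi_solution_iff using x by blast
  moreover have "\<eta> p = \<xi> p" if J: "jacobi_solution b v \<eta>" and p: "p \<in> {0..b}" for \<eta> p
  proof -
    obtain \<eta>1 where y: "\<forall>p\<in>{0..b}. (\<eta> has_real_derivative \<eta>1 p) (at p within {0..b})" "continuous_on {0..b} \<eta>1"
    "\<forall>p\<in>{0..<b}. ((\<lambda>q. G q * \<eta>1 q + H q * \<eta> q) has_real_derivative H p * \<eta>1 p + K p * \<eta> p) (at p within {0..b})"
    "\<eta> b = 0" "\<eta>1 b = 1" using J unfolding jacobi_solution_iff by blast
    show ?thesis
      by (rule jacobi_unique[OF x(1-3,5,6,4) y(1)[rule_format] y(2) y(3)[rule_format] y(4,5) p])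
  qed
  ultimately show ?thesis using x(4) by blast
qed

end

section \<open>Pontryagin's Maximum Principle along such a trajectory\<close>

lemma convex_on_Icc_mono_deriv:
  fixes g g' :: "real \<Rightarrow> real"
  assumes c: "continuous_on {a..b} g" and d: "\<And>x. x \<in> {a<..<b} \<Longrightarrow> (g has_real_derivative g' x) (at x)"
    and m: "\<And>x y. a \<le> x \<Longrightarrow> x \<le> y \<Longrightarrow> y \<le> b \<Longrightarrow> g' x \<le> g' y"
  shows "convex_on {a..b} g"
proof (rule convex_on_linorderI)
  fix t x y :: real assume t: "0 < t" "t < 1" and xy: "x \<in> {a..b}" "y \<in> {a..b}" "x < y"
  define z where "z = (1 - t) * x + t * y"
  have zx: "z - x = t * (y - x)" and yz: "y - z = (1 - t) * (y - x)" unfolding z_def by (auto simp: algebra_simps)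
  have z: "x < z" "z < y" using zx yz t xy mult_pos_pos[of t "y - x"] mult_pos_pos[of "1 - t" "y - x"] by linarith+
  have mvt: "\<exists>k. p < k \<and> k < q \<and> g q - g p = (q - p) * g' k" if pq: "a \<le> p" "p < q" "q \<le> b" for p q
  proof -
    have "\<exists>l k. p < k \<and> k < q \<and> (g has_real_derivative l) (at k) \<and> g q - g p = (q - p) * l"
    proof (rule MVT[OF pq(2)])
      show "continuous_on {p..q} g" using pq by (intro continuous_on_subset[OF c]) auto
      show "g differentiable at x" if "p < x" "x < q" for x
        using d[of x] that pq by (auto simp: real_differentiable_def)
    qed
    then obtain l k where k: "p < k" "k < q" "(g has_real_derivative l) (at k)" "g q - g p = (q - p) * l" by blast
    then have "l = g' k" using DERIV_unique d[of k] pq by auto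
    then show ?thesis using k by blast
  qed
  obtain k1 k2 where k1: "x < k1" "k1 < z" "g z - g x = (z - x) * g' k1"
    and k2: "z < k2" "k2 < y" "g y - g z = (y - z) * g' k2"
    using mvt[of x z] mvt[of z y] z xy by auto
  have "g' k1 \<le> g' k2" using m[of k1 k2] k1 k2 xy by auto
  then have "0 \<le> t * (1 - t) * (y - x) * (g' k2 - g' k1)" using t xy by simp
  also have "\<dots> = t * ((y - z) * g' k2) - (1 - t) * ((z - x) * g' k1)" unfolding zx yz by (simp add: algebra_simps)
  also have "\<dots> = (1 - t) * g x + t * g y - g z" unfolding k1(3)[symmetric] k2(3)[symmetric] by (simp add: algebra_simps)
  finally show "g ((1 - t) *\<^sub>R x + t *\<^sub>R y) \<le> (1 - t) * g x + t * g y" unfolding z_def by simp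
qed simp

section \<open>Smoothness, convexity and admissibility of the trajectory\<close>

context bent_arc begin

lemma v_convex: "convex_on {0..b} v"
proof (rule convex_on_Icc_mono_deriv[OF v_cont _ w_mono])
  show "(v has_real_derivative w x) (at x)" if "x \<in> {0<..<b}" for x
    using v_deriv[of x] at_within_interior[of x "{0..b}"] that by auto
qed auto

lemma D1_deriv:
  assumes "p \<in> {0..b}" "(w has_real_derivative d) (at p within {0..b})"
  shows "(D1 b v has_real_derivative d) (at p within {0..b})"
  by (rule has_field_derivative_transform_within[where d=1, OF assms(2)]) (use assms(1) D1_v in auto)

lemma D2_lt: assumes p: "0 \<le> p" "p < r"
  shows "(D1 b v has_real_derivative 0) (at p within {0..b})" "D2 b v p = 0"
proof -
  have "at p within {0..r} = at p within {0..b}"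
    by (rule at_within_nhd[of _ "{..<r}"]) (use p r in auto)
  moreover have "(w has_real_derivative 0) (at p within {0..r})" using w_deriv_affine[of p] p by simp
  ultimately show "(D1 b v has_real_derivative 0) (at p within {0..b})" using D1_deriv[of p] p r by simp
  then show "D2 b v p = 0" unfolding D2_def using D1_eq[OF b_pos] p r by simp
qed

lemma D2_gt: assumes p: "r < p" "p < b"
  shows "(D1 b v has_real_derivative rhs p) (at p within {0..b})" "D2 b v p = rhs p"
proof -
  have "(w has_real_derivative rhs p) (at p within {0..b})"
    using w_deriv_at[of p] p by (auto intro: has_field_derivative_at_within)
  then show "(D1 b v has_real_derivative rhs p) (at p within {0..b})" using D1_deriv[of p] p r by simp
  then show "D2 b v p = rhs p" unfolding D2_def using D1_eq[OF b_pos] p r by simp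
qed

lemma D2_end: "D2 b v b = l"
proof -
  have "at b within {r..b} = at b within {0..b}"
    by (rule at_within_nhd[of _ "{r<..}"]) (use r in auto)
  then have "(D1 b v has_real_derivative l) (at b within {0..b})" using w_deriv_end D1_deriv[of b] r by simp
  then show ?thesis unfolding D2_def using D1_eq[OF b_pos] b_pos by simp
qed

lemma rhs_tendsto_right: assumes "r \<le> s" "s < b" shows "((\<lambda>p. rhs p) \<longlongrightarrow> rhs s) (at_right s)"
proof -
  have s: "s < (s + b) / 2" using assms by simp
  have "continuous_on {s..(s+b)/2} (\<lambda>p. rhs p)" by (rule singular_rhs_cont) (use assms r in auto)
  then have "((\<lambda>p. rhs p) \<longlongrightarrow> rhs s) (at s within {s..(s+b)/2})"
    using s unfolding continuous_on_def by (meson atLeastAtMost_iff less_imp_le order_refl)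
  then show ?thesis unfolding at_within_Icc_at_right[OF s] .
qed

lemma rhs_tendsto_left: assumes "r < s" "s < b" shows "((\<lambda>p. rhs p) \<longlongrightarrow> rhs s) (at_left s)"
proof -
  have "continuous_on {r..s} (\<lambda>p. rhs p)" by (rule singular_rhs_cont) (use assms r in auto)
  then have "((\<lambda>p. rhs p) \<longlongrightarrow> rhs s) (at s within {r..s})"
    using assms unfolding continuous_on_def by (meson atLeastAtMost_iff less_imp_le order_refl)
  then show ?thesis unfolding at_within_Icc_at_left[OF assms(1)] .
qed

lemma D2_piecewise: "piecewise_continuous 0 b (D2 b v)"
  unfolding piecewise_continuous_def
proof (intro conjI ballI)
  show "\<exists>S. finite S \<and> continuous_on ({0..b} - S) (D2 b v)"
  proof (intro exI[of _ "{r, b}"] conjI)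
    show "continuous_on ({0..b} - {r, b}) (D2 b v)" unfolding continuous_on_def
    proof
      fix x assume x: "x \<in> {0..b} - {r, b}"
      show "(D2 b v \<longlongrightarrow> D2 b v x) (at x within {0..b} - {r, b})"
      proof (cases "x < r")
        case True
        have "\<forall>\<^sub>F y in at x within {0..b} - {r, b}. D2 b v y = D2 b v x"
          unfolding eventually_at using True x
          by (intro exI[of _ "r - x"]) (auto simp: dist_real_def D2_lt)
        then show ?thesis by (rule tendsto_eventually)
      next
        case False
        then have xr: "r < x" "x < b" using x by auto
        have l: "((\<lambda>p. rhs p) \<longlongrightarrow> rhs x) (at x within {0..b} - {r, b})"
          using rhs_tendsto_left[OF xr] rhs_tendsto_right[of x] xr
          by (meson filterlim_at_split filterlim_mono at_within_le_at order_refl tendsto_within_subset subset_UNIV less_imp_le)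
        have "\<forall>\<^sub>F y in at x within {0..b} - {r, b}. rhs y = D2 b v y"
          unfolding eventually_at using xr x
          by (intro exI[of _ "min (x - r) (b - x)"]) (auto simp: dist_real_def D2_gt)
        from Lim_transform_eventually[OF l this] show ?thesis using D2_gt[OF xr] by simp
      qed
    qed
  qed simp
next
  fix s assume s: "s \<in> {0..<b}"
  show "\<exists>l. (D2 b v \<longlongrightarrow> l) (at_right s)"
  proof (cases "s < r")
    case True
    have "\<forall>\<^sub>F y in at_right s. D2 b v y = 0"
      unfolding eventually_at_right_field using True s D2_lt by (intro exI[of _ r]) auto
    then show ?thesis using tendsto_eventually by blast
  next
    case False
    have "\<forall>\<^sub>F y in at_right s. rhs y = D2 b v y"
      unfolding eventually_at_right_field using False s D2_gt by (intro exI[of _ b]) auto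
    from Lim_transform_eventually[OF rhs_tendsto_right[of s] this] show ?thesis using False s by auto
  qed
next
  fix s assume s: "s \<in> {0<..b}"
  show "\<exists>l. (D2 b v \<longlongrightarrow> l) (at_left s)"
  proof (cases "s \<le> r")
    case True
    have "\<forall>\<^sub>F y in at_left s. D2 b v y = 0"
      unfolding eventually_at_left_field using True s D2_lt by (intro exI[of _ 0]) auto
    then show ?thesis using tendsto_eventually by blast
  next
    case False
    have ev: "\<forall>\<^sub>F y in at_left s. rhs y = D2 b v y"
      unfolding eventually_at_left_field using False s D2_gt by (intro exI[of _ r]) auto
    show ?thesis
    proof (cases "s = b")
      case True
      from Lim_transform_eventually[OF rhs_lim ev[unfolded True]] show ?thesis using True by blast
    next
      case 2: False
      from Lim_transform_eventually[OF rhs_tendsto_left[of s] ev] show ?thesis using 2 False s by auto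
    qed
  qed
qed

lemma v_PC2: "v \<in> PC2 b"
  unfolding PC2_def
proof (intro CollectI conjI)
  show "v differentiable_on {0..b}" unfolding differentiable_on_def
    using v_deriv real_differentiable_def by blast
  show "continuous_on {0..b} (D1 b v)" by (rule continuous_on_eq[OF w_cont]) (simp add: D1_v)
  show "\<exists>S. finite S \<and> D1 b v differentiable_on {0..b} - S"
  proof (intro exI[of _ "{r, b}"] conjI)
    show "D1 b v differentiable_on {0..b} - {r, b}" unfolding differentiable_on_def
    proof
      fix x assume x: "x \<in> {0..b} - {r, b}"
      have "\<exists>d. (D1 b v has_real_derivative d) (at x within {0..b})"
        using D2_lt(1)[of x] D2_gt(1)[of x] x by (cases "x < r") auto
      then have "\<exists>d. (D1 b v has_real_derivative d) (at x within {0..b} - {r, b})"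
        by (meson Diff_subset has_field_derivative_subset)
      then show "D1 b v differentiable at x within {0..b} - {r, b}" by (simp add: real_differentiable_def)
    qed
  qed simp
qed (rule D2_piecewise)

lemma v_admissible: "admissible b v"
  unfolding admissible_def
proof (intro conjI ballI impI)
  fix p assume p: "p \<in> {0..b}" and d: "D1 b v differentiable (at p within {0..b})"
  consider "p < r" | "p = r" | "r < p" "p < b" | "p = b" using p by fastforce
  then show "0 \<le> D2 b v p"
  proof cases
    case 1 then show ?thesis using D2_lt[of p] p by simp
  next
    \<comment> \<open>At r the one-sided values of v'' are 0 and something positive. If a two-sided
      derivative is assumed, comparison with the left one gives 0, which is all that the goal asks
      for.\<close>
    case 2
    obtain e where e: "(D1 b v has_real_derivative e) (at p within {0..b})" using d by (auto simp: real_differentiable_def)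
    have rr: "r \<in> {0..r}" using r by simp
    have "(D1 b v has_real_derivative e) (at r within {0..r})" using e 2 r by (auto intro: has_field_derivative_subset)
    moreover have "(D1 b v has_real_derivative 0) (at r within {0..r})"
      by (rule has_field_derivative_transform_within[where d=1, OF w_deriv_affine[OF rr]]) (use r D1_v in auto)
    ultimately have "e = 0" using D1_eq[OF r(1) rr] by metis
    then show ?thesis unfolding D2_def using D1_eq[OF b_pos p e] by simp
  next
    case 3 then show ?thesis using D2_gt[of p] rhs_ge[of p] \<kappa> by simp
  next
    case 4 then show ?thesis using D2_end l_ge \<kappa> by simp
  qed
qed (use v_PC2 v_end v_gt in auto)

end

text \<open>\<open>I1\<close> is the first moment of \<open>kin * singular_rhs\<close> on the affine
  part; its vanishing at r is the condition psi 0 = 0. \<open>rhs_sign\<close> says that along the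
  line \<open>singular_rhs\<close> can change sign only once, from negative to nonnegative.\<close>

locale pmp_arc = bent_arc +
  fixes I1 :: "real \<Rightarrow> real"
  assumes I1_0: "I1 0 = 0" and I1_r: "I1 r = 0"
    and I1_deriv: "p \<in> {0..r} \<Longrightarrow> (I1 has_real_derivative p * (kin p (v p) * singular_rhs p (v p) (w p))) (at p within {0..r})"
    and rhs_sign: "0 \<le> p \<Longrightarrow> p \<le> q \<Longrightarrow> q \<le> r \<Longrightarrow> 0 \<le> singular_rhs p (v p) (w p) \<Longrightarrow> 0 \<le> singular_rhs q (v q) (w q)"
begin

section \<open>The multipliers of the maximum principle\<close>

definition "Y p = kin p (v p) * rhs p"

definition "I0 p = integral {0..p} Y"

definition "\<psi>1 p = (if p \<le> r then I0 r - I0 p else 0)"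

text \<open>The solution of psi'' = - Y with psi r = psi' r = 0, that is, minus the integral of (s -
  p) Y s over [p, r], expanded by means of \<open>I1 r = 0\<close>. The function
  \<open>\<phi>\<close> is then read off from psi' = f_w - phi.\<close>

definition "\<psi> p = (if p \<le> r then I1 p + p * (I0 r - I0 p) else 0)"

definition "\<phi> p = f_w p (v p) (w p) - \<psi>1 p"

lemma rs: "{0..r} \<subseteq> {0..b}" "{0..r} \<subseteq> {0..<b}" using r by auto

lemma kin_gt: "p \<in> {0..r} \<Longrightarrow> 0 < kin p (v p)"
  using kin_pos[of p "v p"] v_gt[of p] r by auto

lemma Y_cont: "continuous_on {0..r} Y"
  unfolding Y_def by (intro continuous_intros continuous_on_subset[OF kin_cont] singular_rhs_cont rs)

lemma I0_deriv: "p \<in> {0..r} \<Longrightarrow> (I0 has_real_derivative Y p) (at p within {0..r})"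
  unfolding I0_def by (rule integral_has_real_derivative[OF Y_cont])

lemma I1_deriv': "p \<in> {0..r} \<Longrightarrow> (I1 has_real_derivative p * Y p) (at p within {0..r})"
  using I1_deriv unfolding Y_def .

lemma I1_cont: "continuous_on {0..r} I1" by (rule DERIV_continuous_on[OF I1_deriv'])

lemma I0_cont: "continuous_on {0..r} I0" by (rule DERIV_continuous_on[OF I0_deriv])

lemma \<psi>_deriv: assumes p: "p \<in> {0..b}" shows "(\<psi> has_real_derivative \<psi>1 p) (at p within {0..b})"
proof -
  have rb: "0 \<le> r" "r \<le> b" using r by auto
  show ?thesis unfolding \<psi>_def
  proof (rule has_real_derivative_paste[OF rb p])
    assume "p \<le> r"
    then have q: "p \<in> {0..r}" using p by simp
    show "((\<lambda>p. I1 p + p * (I0 r - I0 p)) has_real_derivative \<psi>1 p) (at p within {0..r})"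
      using I0_deriv[OF q] I1_deriv'[OF q] \<open>p \<le> r\<close> unfolding \<psi>1_def
      by (auto intro!: derivative_eq_intros simp: algebra_simps)
  next
    assume "r \<le> p"
    then show "((\<lambda>p. 0) has_real_derivative \<psi>1 p) (at p within {r..b})" unfolding \<psi>1_def by auto
  qed (simp add: I1_r)
qed

text \<open>On the affine part f_w has the Euler-Lagrange defect - Y, and subtracting
  \<open>\<psi>1\<close>, whose derivative is - Y as well, removes it. On the singular part there is
  no defect.\<close>

lemma \<phi>_deriv: assumes p: "p \<in> {0..<b}" shows "(\<phi> has_real_derivative f_v p (v p) (w p)) (at p within {0..b})"
proof -
  have rb: "0 \<le> r" "r \<le> b" "p \<in> {0..b}" using r p by auto
  have vp: "p < v p" "0 \<le> p" using v_gt[OF p] p by auto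
  have "((\<lambda>p. if p \<le> r then f_w p (v p) (w p) - (I0 r - I0 p) else f_w p (v p) (w p) - 0) has_real_derivative f_v p (v p) (w p)) (at p within {0..b})"
  proof (rule has_real_derivative_paste[OF rb])
    assume "p \<le> r"
    then have q: "p \<in> {0..r}" using p by simp
    have "((\<lambda>q. f_w q (v q) (w q)) has_real_derivative f_v p (v p) (w p) + kin p (v p) * (0 - rhs p)) (at p within {0..r})"
      by (rule DERIV_f_w_along[OF v_deriv_sub[OF q rs(1)] w_deriv_affine[OF q] vp(2,1)])
    from DERIV_diff[OF this DERIV_diff[OF DERIV_const[of "I0 r"] I0_deriv[OF q]]]
    show "((\<lambda>p. f_w p (v p) (w p) - (I0 r - I0 p)) has_real_derivative f_v p (v p) (w p)) (at p within {0..r})"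
      unfolding Y_def by simp
  next
    assume "r \<le> p"
    then have q: "p \<in> {r..<b}" "p \<in> {r..b}" "{r..b} \<subseteq> {0..b}" using p r by auto
    have "((\<lambda>q. f_w q (v q) (w q)) has_real_derivative f_v p (v p) (w p) + kin p (v p) * (rhs p - rhs p)) (at p within {r..b})"
      by (rule DERIV_f_w_along[OF v_deriv_sub[OF q(2,3)] w_sing[OF q(1)] vp(2,1)])
    then show "((\<lambda>p. f_w p (v p) (w p) - 0) has_real_derivative f_v p (v p) (w p)) (at p within {r..b})" by simp
  qed simp
  moreover have "(\<lambda>p. if p \<le> r then f_w p (v p) (w p) - (I0 r - I0 p) else f_w p (v p) (w p) - 0) = \<phi>"
    unfolding \<phi>_def \<psi>1_def by auto
  ultimately show ?thesis by simp
qed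

lemma Y_sign: "p \<in> {0..r} \<Longrightarrow> 0 \<le> Y p \<longleftrightarrow> 0 \<le> rhs p"
  unfolding Y_def using kin_gt[of p] by (simp add: zero_le_mult_iff)

text \<open>The derivative p Y is first negative and then nonnegative, so \<open>I1\<close> falls
  and then rises between its two zeros 0 and r.\<close>

lemma I1_nonpos: assumes p: "p \<in> {0..r}" shows "I1 p \<le> 0"
proof (cases "0 \<le> rhs p")
  case True
  have "I1 p \<le> I1 r"
  proof (rule DERIV_nonneg_imp_increasing_open[of p r])
    show "\<exists>y. (I1 has_real_derivative y) (at x) \<and> 0 \<le> y" if x: "p < x" "x < r" for x
    proof -
      have x': "x \<in> {0..r}" "x \<in> interior {0..r}" using x p by auto
      have "0 \<le> Y x" using Y_sign[OF x'(1)] rhs_sign[of p x] True x p by auto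
      then show ?thesis using I1_deriv'[OF x'(1)] at_within_interior[OF x'(2)] x' by (intro exI[of _ "x * Y x"]) auto
    qed
  qed (use p continuous_on_subset[OF I1_cont] in auto)
  then show ?thesis using I1_r by simp
next
  case False
  have "I1 p \<le> I1 0"
  proof (rule DERIV_nonpos_imp_decreasing_open[of 0 p])
    show "\<exists>y. (I1 has_real_derivative y) (at x) \<and> y \<le> 0" if x: "0 < x" "x < p" for x
    proof -
      have x': "x \<in> {0..r}" "x \<in> interior {0..r}" using x p by auto
      have "\<not> 0 \<le> Y x" using Y_sign[OF x'(1)] rhs_sign[of x p] False x p by auto
      then show ?thesis using I1_deriv'[OF x'(1)] at_within_interior[OF x'(2)] x'
        by (intro exI[of _ "x * Y x"]) (auto intro: mult_nonneg_nonpos)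
    qed
  qed (use p continuous_on_subset[OF I1_cont] in auto)
  then show ?thesis using I1_0 by simp
qed

text \<open>On the affine part \<open>(\<psi> p / p)' = - I1 p / p\<^sup>2 \<ge> 0\<close>, and \<open>\<psi> r = 0\<close>.\<close>

lemma \<psi>_nonpos: "\<psi> p \<le> 0" if p: "p \<in> {0..b}"
proof -
  consider "r < p" | "p = 0" | "0 < p" "p \<le> r" using p by fastforce
  then show ?thesis
  proof cases
    case 1 then show ?thesis unfolding \<psi>_def by simp
  next
    case 2 then show ?thesis unfolding \<psi>_def by (simp add: I1_0)
  next
    case 3
    define q where "q x = I1 x / x + (I0 r - I0 x)" for x
    have sub: "{p..r} \<subseteq> {0..r}" using 3 by auto
    have "q p \<le> q r"
    proof (rule DERIV_nonneg_imp_increasing_open[OF 3(2)])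
      show "\<exists>y. (q has_real_derivative y) (at x) \<and> 0 \<le> y" if x: "p < x" "x < r" for x
      proof -
        have x': "x \<in> {0..r}" "x \<in> interior {0..r}" "x > 0" using x 3 by auto
        have "(q has_real_derivative (x * Y x * x - I1 x * 1) / (x * x) + (0 - Y x)) (at x within {0..r})"
          unfolding q_def
          by (intro DERIV_add DERIV_diff DERIV_divide I1_deriv' I0_deriv DERIV_ident DERIV_const) (use x' in auto)
        moreover have "(x * Y x * x - I1 x * 1) / (x * x) + (0 - Y x) = - I1 x / (x * x)"
          using x' by (simp add: field_simps)
        moreover have "0 \<le> - I1 x / (x * x)" using I1_nonpos[OF x'(1)] x' by (simp add: divide_nonpos_pos)
        ultimately show ?thesis using at_within_interior[OF x'(2)] by auto
      qed
      show "continuous_on {p..r} q" unfolding q_def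
        by (intro continuous_intros continuous_on_subset[OF I1_cont sub] continuous_on_subset[OF I0_cont sub]) (use 3 in auto)
    qed
    moreover have "q r = 0" unfolding q_def by (simp add: I1_r)
    moreover have "\<psi> p = p * q p" using 3 unfolding \<psi>_def q_def by (simp add: field_simps)
    ultimately show ?thesis using 3 by (simp add: mult_nonneg_nonpos)
  qed
qed

lemma control_support_sub: "control_support b v \<subseteq> {r..b}"
  unfolding control_support_def
proof (rule closure_minimal)
  show "{p \<in> {0..b}. D1 b v differentiable at p within {0..b} \<and> D2 b v p \<noteq> 0} \<subseteq> {r..b}"
    using D2_lt(2) by force
qed simp

lemma \<psi>_right: "p \<in> {r..b} \<Longrightarrow> \<psi> p = 0"
  unfolding \<psi>_def using I1_r by (cases "p = r") auto

text \<open>If psi vanished on the affine part, differentiating twice would give Y = 0 inside it,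
  and by continuity at r; but Y r > 0 by \<open>rhs_ge\<close>.\<close>

lemma not_singular: "\<not> singular_on {0..r} \<psi>"
proof
  assume s: "singular_on {0..r} \<psi>"
  have z: "I0 r - I0 p = 0" if p: "p \<in> {0<..<r}" for p
  proof -
    have p': "p \<in> {0..b}" "p \<in> interior {0..r}" "{0..r} \<subseteq> {0..b}" using p r by auto
    have "(\<psi> has_real_derivative \<psi>1 p) (at p)"
      using has_field_derivative_subset[OF \<psi>_deriv[OF p'(1)] p'(3)] at_within_interior[OF p'(2)] by simp
    moreover have "(\<psi> has_real_derivative 0) (at p)"
      by (rule has_field_derivative_transform_within_open[of "\<lambda>_. 0" _ _ "{0<..<r}"])
         (use s p in \<open>auto simp: singular_on_def\<close>)
    ultimately have "\<psi>1 p = 0" by (rule DERIV_unique)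
    then show ?thesis using p unfolding \<psi>1_def by simp
  qed
  have "Y p = 0" if p: "p \<in> {0<..<r}" for p
  proof -
    have p': "p \<in> {0..r}" "p \<in> interior {0..r}" using p by auto
    have "(I0 has_real_derivative Y p) (at p)" using I0_deriv[OF p'(1)] at_within_interior[OF p'(2)] by simp
    moreover have "(I0 has_real_derivative 0) (at p)"
      by (rule has_field_derivative_transform_within_open[of "\<lambda>_. I0 r" _ _ "{0<..<r}"])
         (use z p in auto)
    ultimately show ?thesis by (rule DERIV_unique)
  qed
  then have ev: "\<forall>\<^sub>F p in at_left r. Y p = 0"
    unfolding eventually_at_left_field using r by (intro exI[of _ 0]) auto
  have "r \<in> {0..r}" using r by simp
  from bspec[OF Y_cont[unfolded continuous_on_def] this] have "(Y \<longlongrightarrow> Y r) (at_left r)"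
    unfolding at_within_Icc_at_left[OF r(1)] .
  moreover have "(Y \<longlongrightarrow> 0) (at_left r)" by (rule tendsto_eventually[OF ev])
  ultimately have "Y r = 0" using tendsto_unique[of "at_left r"] by (simp add: trivial_limit_at_left_real)
  moreover have "Y r > 0" unfolding Y_def using kin_gt[of r] rhs_ge[of r] \<kappa> r by simp
  ultimately show False by simp
qed

text \<open>Near b, where psi = 0, the expression is f + f_w (1 - v'). The unbounded
  \<open>lin\<close> survives in it only with the factor v - p, and the product is of order sqrt (v
  - p).\<close>

lemma transversality: "((\<lambda>p. \<phi> p - Ham b v \<phi> \<psi> p) \<longlongrightarrow> 0) (at_left b)"
proof -
  have ev: "\<forall>\<^sub>F p in at_left b. kin p (v p) / 2 * (w p)\<^sup>2 + kin p (v p) * w p * (1 - w p)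
      + sqrt (v p - p) / (v p * (1 + (v p)\<^sup>2) * sqrt (v p + p)) = \<phi> p - Ham b v \<phi> \<psi> p"
    unfolding eventually_at_left_field
  proof (intro exI[of _ r] conjI allI impI)
    fix p assume p: "r < p" "p < b"
    then have p': "p \<in> {0..b}" "p \<in> {0..<b}" using r by auto
    have vp: "v p - p > 0" "v p + p > 0" using v_gt[OF p'(2)] p r by auto
    have "(v p)\<^sup>2 - p\<^sup>2 = (v p - p) * (v p + p)" by (simp add: power2_eq_square algebra_simps)
    then have "(v p - p) * lin p (v p) = sqrt (v p - p) * sqrt (v p - p) / (v p * (1 + (v p)\<^sup>2) * (sqrt (v p - p) * sqrt (v p + p)))"
      unfolding lin_def using vp by (simp add: real_sqrt_mult)
    also have "\<dots> = sqrt (v p - p) / (v p * (1 + (v p)\<^sup>2) * sqrt (v p + p))"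
    proof -
      have cancel: "x * x / (X * (x * y)) = x / (X * y)" if "x \<noteq> 0" for x X y :: real
        using that by (simp add: mult.left_commute[of X])
      show ?thesis by (rule cancel) (use vp in simp)
    qed
    finally have l: "(v p - p) * lin p (v p) = sqrt (v p - p) / (v p * (1 + (v p)\<^sup>2) * sqrt (v p + p))" .
    have "\<phi> p - Ham b v \<phi> \<psi> p = f p (v p) (w p) + f_w p (v p) (w p) * (1 - w p)"
      unfolding Ham_def \<phi>_def \<psi>1_def \<psi>_def using p D1_v[OF p'(1)] by (simp add: algebra_simps)
    also have "\<dots> = kin p (v p) / 2 * (w p)\<^sup>2 + kin p (v p) * w p * (1 - w p) + (v p - p) * lin p (v p)"
      unfolding f_eq f_w_eq by (simp add: algebra_simps)
    finally show "kin p (v p) / 2 * (w p)\<^sup>2 + kin p (v p) * w p * (1 - w p)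
      + sqrt (v p - p) / (v p * (1 + (v p)\<^sup>2) * sqrt (v p + p)) = \<phi> p - Ham b v \<phi> \<psi> p" unfolding l by simp
  qed (use r in auto)
  have bb: "b \<in> {0..b}" using b_pos by simp
  have t: "(g \<longlongrightarrow> g b) (at_left b)" if "continuous_on {0..b} g" for g :: "real \<Rightarrow> real"
    using bspec[OF that[unfolded continuous_on_def] bb] unfolding at_within_Icc_at_left[OF b_pos] .
  have "((\<lambda>p. kin p (v p) / 2 * (w p)\<^sup>2 + kin p (v p) * w p * (1 - w p)
      + sqrt (v p - p) / (v p * (1 + (v p)\<^sup>2) * sqrt (v p + p))) \<longlongrightarrow>
       0 / 2 * (w b)\<^sup>2 + 0 * w b * (1 - w b) + sqrt (b - b) / (b * (1 + b\<^sup>2) * sqrt (b + b))) (at_left b)"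
    using t[OF kin_cont, unfolded kin_end] t[OF w_cont] t[OF v_cont, unfolded v_end] one_plus_square_pos(2)[of b] b_pos
    by (intro tendsto_intros) auto
  from Lim_transform_eventually[OF this ev] show ?thesis by simp
qed

theorem pmp: "PMP b v \<phi> \<psi>"
  unfolding PMP_def
proof (intro conjI ballI)
  show "(\<phi> has_real_derivative f_v p (v p) (D1 b v p)) (at p within {0..b})" if "p \<in> {0..<b}" for p
    using \<phi>_deriv[OF that] D1_v[of p] that by simp
  show "(\<psi> has_real_derivative f_w p (v p) (D1 b v p) - \<phi> p) (at p within {0..b})" if "p \<in> {0..<b}" for p
    using \<psi>_deriv[of p] D1_v[of p] that unfolding \<phi>_def by simp
  show "continuous_on {0..b} \<psi>" by (rule DERIV_continuous_on[OF \<psi>_deriv])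
  show "\<psi> p \<le> 0" if "p \<in> {0..b}" for p using \<psi>_nonpos[OF that] .
  show "\<psi> p = 0" if "p \<in> control_support b v" for p using control_support_sub \<psi>_right that by blast
  show "\<psi> 0 = 0" unfolding \<psi>_def using I1_0 r by simp
  show "\<psi> b = 0" using \<psi>_right[of b] r by simp
qed (rule transversality)

theorem pmp_conclusion:
  "admissible b v \<and> convex_on {0..b} v \<and>
     (\<exists>\<phi> \<psi>. PMP b v \<phi> \<psi> \<and>
        (\<exists>r. 0 < r \<and> r < b \<and>
           (\<forall>p\<in>{0..r}. (D1 b v has_real_derivative 0) (at p within {0..r})) \<and>
           \<not> singular_on {0..r} \<psi> \<and> singular_on {r..b} \<psi> \<and>
           (\<forall>p\<in>{r..<b}. (D1 b v has_real_derivative singular_rhs p (v p) (D1 b v p)) (at p within {r..b}))))"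
proof -
  have "(D1 b v has_real_derivative 0) (at p within {0..r})" if "p \<in> {0..r}" for p
    by (rule has_field_derivative_transform_within[where d=1, OF w_deriv_affine[OF that]]) (use that r D1_v in auto)
  moreover have "singular_on {r..b} \<psi>" unfolding singular_on_def using \<psi>_right by blast
  moreover have "(D1 b v has_real_derivative singular_rhs p (v p) (D1 b v p)) (at p within {r..b})" if p: "p \<in> {r..<b}" for p
  proof -
    have "(D1 b v has_real_derivative rhs p) (at p within {r..b})"
      by (rule has_field_derivative_transform_within[where d=1, OF w_sing[OF p]]) (use p r D1_v in auto)
    then show ?thesis using D1_v[of p] p r by simp
  qed
  ultimately show ?thesis using r v_admissible v_convex pmp not_singular by blast
qed

end

section \<open>Singular arcs\<close>

text \<open>The cube of half of \<open>ss x\<close> below. It is the integrating factor with Wt'/Wt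
  = 3 (1 - x^2) / (x (1 + x^2)), the coefficient that is singular at x = 0 in the equation for b^2 -
  1; \<open>wt\<close> is its derivative.\<close>

definition Wt :: "real \<Rightarrow> real" where "Wt x = x ^ 3 / (1 + x\<^sup>2) ^ 3"
definition wt :: "real \<Rightarrow> real" where "wt x = 3 * x\<^sup>2 * (1 - x\<^sup>2) / (1 + x\<^sup>2) ^ 4"

lemma DERIV_Wt: "(Wt has_real_derivative wt x) (at x within A)"
proof -
  define N where "N = 1 + x\<^sup>2"
  have N: "N > 0" unfolding N_def by (rule one_plus_square_pos)
  have "(Wt has_real_derivative (3 * x\<^sup>2 * N ^ 3 - x ^ 3 * (3 * N\<^sup>2 * (2 * x))) / (N ^ 3 * N ^ 3)) (at x within A)"
    unfolding Wt_def using N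
    by (auto intro!: derivative_eq_intros simp: N_def) (simp add: mult_ac power2_eq_square)?
  moreover have "(3 * x\<^sup>2 * N ^ 3 - x ^ 3 * (3 * N\<^sup>2 * (2 * x))) / (N ^ 3 * N ^ 3) = 3 * x\<^sup>2 * (N - 2 * x\<^sup>2) / N ^ 4"
    using N by (simp add: field_simps power2_eq_square power3_eq_cube power4_eq_xxxx)
  moreover have "N - 2 * x\<^sup>2 = 1 - x\<^sup>2" unfolding N_def by simp
  ultimately show ?thesis unfolding wt_def N_def by simp
qed

lemma Wt_pos: "x > 0 \<Longrightarrow> Wt x > 0" unfolding Wt_def using one_plus_square_pos(1)[of x] by simp

lemma Wt_0: "Wt 0 = 0" unfolding Wt_def by simp

lemma wt_nonneg: "0 \<le> x \<Longrightarrow> x \<le> 1 \<Longrightarrow> 0 \<le> wt x"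
  unfolding wt_def using one_plus_square_pos(1)[of x] by (auto simp: power_le_one intro!: divide_nonneg_pos mult_nonneg_nonneg)

lemma wt_cont: "continuous_on A wt"
  unfolding wt_def using one_plus_square_pos(2) by (intro continuous_intros) auto

lemma wt_has_integral: assumes "0 \<le> x" shows "(wt has_integral Wt x) {0..x}"
proof -
  have "(wt has_integral (Wt x - Wt 0)) {0..x}"
    by (rule fundamental_theorem_of_calculus[OF assms])
       (simp add: has_real_derivative_iff_has_vector_derivative[symmetric] DERIV_Wt)
  then show ?thesis by (simp add: Wt_0)
qed

text \<open>A weighted mean of h over [0, x], continued to x = 0 by h 0. For b^2 - 1 = avg h one has
  (Wt (b^2 - 1))' = wt h, with no multiple of 1/Wt added: this selects the solution that is bounded
  at 0.\<close>

definition avg :: "(real \<Rightarrow> real) \<Rightarrow> real \<Rightarrow> real" where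
  "avg h x = (if x = 0 then h 0 else integral {0..x} (\<lambda>s. wt s * h s) / Wt x)"

lemma avg_integrable: "continuous_on {0..c} h \<Longrightarrow> x \<le> c \<Longrightarrow> (\<lambda>s. wt s * h s) integrable_on {0..x}"
  by (rule integrable_continuous_real, rule continuous_on_mult[OF wt_cont], erule continuous_on_subset) auto

lemma avg_mono:
  assumes h: "continuous_on {0..c} h" "continuous_on {0..c} k" and c: "c \<le> 1" and x: "0 \<le> x" "x \<le> c"
    and le: "\<And>s. 0 \<le> s \<Longrightarrow> s \<le> x \<Longrightarrow> h s \<le> k s"
  shows "avg h x \<le> avg k x"
proof (cases "x = 0")
  case True then show ?thesis using le unfolding avg_def by simp
next
  case False
  have "integral {0..x} (\<lambda>s. wt s * h s) \<le> integral {0..x} (\<lambda>s. wt s * k s)"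
    by (rule integral_le[OF avg_integrable[OF h(1) x(2)] avg_integrable[OF h(2) x(2)]])
       (use x c le wt_nonneg in \<open>auto intro!: mult_left_mono\<close>)
  then show ?thesis unfolding avg_def using False Wt_pos[of x] x by (simp add: divide_right_mono)
qed

lemma avg_diff:
  assumes h: "continuous_on {0..c} h" "continuous_on {0..c} k" and x: "0 \<le> x" "x \<le> c"
  shows "avg (\<lambda>s. h s - k s) x = avg h x - avg k x"
  unfolding avg_def using integral_diff[OF avg_integrable[OF h(1) x(2)] avg_integrable[OF h(2) x(2)]]
  by (simp add: right_diff_distrib diff_divide_distrib)

lemma avg_minus: "avg (\<lambda>s. - h s) x = - avg h x"
  unfolding avg_def by simp

text \<open>The function \<open>x (3 + x\<^sup>2) / 6\<close> is the average of \<open>2 x / (3 (1 - x\<^sup>2))\<close>.\<close>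

definition rho :: "real \<Rightarrow> real" where "rho x = x * (3 + x\<^sup>2) / 6"

text \<open>Obtained by differentiating Wt (\<alpha> rho + \<beta>). The identity behind it is (1 -
  s^2) (3 + s^2) + (1 + s^2)^2 = 4.\<close>

lemma avg_affine:
  assumes x: "0 \<le> x" "x < 1"
  shows "avg (\<lambda>s. 2 * s / (3 * (1 - s\<^sup>2)) * \<alpha> + \<beta>) x = \<alpha> * rho x + \<beta>"
proof (cases "x = 0")
  case True then show ?thesis unfolding avg_def rho_def by simp
next
  case False
  have "((\<lambda>s. wt s * (2 * s / (3 * (1 - s\<^sup>2)) * \<alpha> + \<beta>)) has_integral (Wt x * (\<alpha> * rho x + \<beta>) - Wt 0 * (\<alpha> * rho 0 + \<beta>))) {0..x}"
  proof (rule fundamental_theorem_of_calculus[OF x(1)])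
    fix s assume s: "s \<in> {0..x}"
    define N where "N = 1 + s\<^sup>2"
    have N: "N > 0" unfolding N_def by (rule one_plus_square_pos)
    have s1: "1 - s\<^sup>2 > 0" using s x abs_square_less_1[of s] by auto
    have "(rho has_real_derivative N / 2) (at s within {0..x})"
      unfolding rho_def N_def by (auto intro!: derivative_eq_intros simp: field_simps power2_eq_square)
    then have "((\<lambda>s. Wt s * (\<alpha> * rho s + \<beta>)) has_real_derivative wt s * (\<alpha> * rho s + \<beta>) + \<alpha> * (N / 2) * Wt s) (at s within {0..x})"
      using DERIV_Wt[of s "{0..x}"] by (auto intro!: derivative_eq_intros)
    moreover have "wt s * (\<alpha> * rho s + \<beta>) + \<alpha> * (N / 2) * Wt s = wt s * (2 * s / (3 * (1 - s\<^sup>2)) * \<alpha> + \<beta>)"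
    proof -
      have "3 * s\<^sup>2 * (1 - s\<^sup>2) / N ^ 4 * (s * (3 + s\<^sup>2) / 6) + N / 2 * (s ^ 3 / N ^ 3)
        = (s ^ 3 / (2 * N ^ 4)) * ((1 - s\<^sup>2) * (3 + s\<^sup>2) + N\<^sup>2)"
        using N by (simp add: field_simps power2_eq_square power3_eq_cube power4_eq_xxxx)
      also have "(1 - s\<^sup>2) * (3 + s\<^sup>2) + N\<^sup>2 = 4" unfolding N_def by (simp add: algebra_simps power2_eq_square)
      also have "(s ^ 3 / (2 * N ^ 4)) * 4 = 3 * s\<^sup>2 * (1 - s\<^sup>2) / N ^ 4 * (2 * s / (3 * (1 - s\<^sup>2)))"
        using N s1 by (simp add: divide_simps power2_eq_square power3_eq_cube)
      finally have "wt s * rho s + N / 2 * Wt s = wt s * (2 * s / (3 * (1 - s\<^sup>2)))"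
        unfolding wt_def rho_def Wt_def N_def .
      then have "\<alpha> * (wt s * rho s + N / 2 * Wt s) = \<alpha> * (wt s * (2 * s / (3 * (1 - s\<^sup>2))))" by simp
      then show ?thesis by (simp add: algebra_simps)
    qed
    ultimately show "((\<lambda>s. Wt s * (\<alpha> * rho s + \<beta>)) has_vector_derivative wt s * (2 * s / (3 * (1 - s\<^sup>2)) * \<alpha> + \<beta>)) (at s within {0..x})"
      by (simp add: has_real_derivative_iff_has_vector_derivative)
  qed
  then have "integral {0..x} (\<lambda>s. wt s * (2 * s / (3 * (1 - s\<^sup>2)) * \<alpha> + \<beta>)) = Wt x * (\<alpha> * rho x + \<beta>)"
    by (simp add: Wt_0 integral_unique)
  then show ?thesis unfolding avg_def using False Wt_pos[of x] x by simp
qed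

lemma avg_affine_cont:
  fixes c :: real
  assumes "c < 1"
  shows "continuous_on {0..c} (\<lambda>s. 2 * s / (3 * (1 - s\<^sup>2)) * \<alpha> + \<beta>)"
proof -
  have "3 * (1 - s\<^sup>2) \<noteq> 0" if "s \<in> {0..c}" for s :: real
    using that assms abs_square_less_1[of s] by auto
  then show ?thesis by (intro continuous_intros) auto
qed

text \<open>The shape of the bound is that of \<open>arc_h\<close>: the dependence on b carries the
  factor 2 s / (3 (1 - s^2)), and the remaining \<open>mfun\<close> term a constant. Such bounds are
  averaged exactly by \<open>avg_affine\<close>.\<close>

lemma avg_abs_le:
  assumes h: "continuous_on {0..c} h" "continuous_on {0..c} k" and c: "c < 1" and x: "0 \<le> x" "x \<le> c"
    and le: "\<And>s. 0 \<le> s \<Longrightarrow> s \<le> x \<Longrightarrow> \<bar>h s - k s\<bar> \<le> 2 * s / (3 * (1 - s\<^sup>2)) * \<alpha> + \<beta>"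
  shows "\<bar>avg h x - avg k x\<bar> \<le> \<alpha> * rho x + \<beta>"
proof -
  have hk: "continuous_on {0..c} (\<lambda>s. h s - k s)" "continuous_on {0..c} (\<lambda>s. - (h s - k s))" using h by (auto intro!: continuous_intros)
  have c1: "c \<le> 1" "x < 1" using c x by auto
  have "avg (\<lambda>s. h s - k s) x \<le> avg (\<lambda>s. 2 * s / (3 * (1 - s\<^sup>2)) * \<alpha> + \<beta>) x"
  proof (rule avg_mono[OF hk(1) avg_affine_cont[OF c] c1(1) x])
    show "h s - k s \<le> 2 * s / (3 * (1 - s\<^sup>2)) * \<alpha> + \<beta>" if "0 \<le> s" "s \<le> x" for s using le[OF that] by linarith
  qed
  moreover have "avg (\<lambda>s. - (h s - k s)) x \<le> avg (\<lambda>s. 2 * s / (3 * (1 - s\<^sup>2)) * \<alpha> + \<beta>) x"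
  proof (rule avg_mono[OF hk(2) avg_affine_cont[OF c] c1(1) x])
    show "- (h s - k s) \<le> 2 * s / (3 * (1 - s\<^sup>2)) * \<alpha> + \<beta>" if "0 \<le> s" "s \<le> x" for s using le[OF that] by linarith
  qed
  ultimately have "avg (\<lambda>s. h s - k s) x \<le> \<alpha> * rho x + \<beta>" "avg (\<lambda>s. - (h s - k s)) x \<le> \<alpha> * rho x + \<beta>"
    unfolding avg_affine[OF x(1) c1(2)] by auto
  then show ?thesis unfolding avg_minus avg_diff[OF h x] by (simp add: abs_le_iff)
qed

lemma avg_cont:
  assumes h: "continuous_on {0..c} h" and c: "c \<le> 1"
  shows "continuous_on {0..c} (avg h)"
proof (cases "0 \<le> c")
  case True
  show ?thesis unfolding continuous_on_def
  proof
    fix x assume x: "x \<in> {0..c}"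
    show "(avg h \<longlongrightarrow> avg h x) (at x within {0..c})"
    proof (cases "x = 0")
      case False
      have I: "continuous_on {0..c} (\<lambda>x. integral {0..x} (\<lambda>s. wt s * h s))"
        by (rule indefinite_integral_continuous_1[OF avg_integrable[OF h order_refl]])
      have W: "continuous_on {0..c} Wt" by (rule DERIV_continuous_on[OF DERIV_Wt])
      have "((\<lambda>x. integral {0..x} (\<lambda>s. wt s * h s) / Wt x) \<longlongrightarrow> integral {0..x} (\<lambda>s. wt s * h s) / Wt x) (at x within {0..c})"
        using bspec[OF I[unfolded continuous_on_def] x] bspec[OF W[unfolded continuous_on_def] x] Wt_pos[of x] x False
        by (intro tendsto_divide) auto
      moreover have "\<forall>\<^sub>F y in at x within {0..c}. integral {0..y} (\<lambda>s. wt s * h s) / Wt y = avg h y"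
        unfolding eventually_at using x False by (intro exI[of _ x]) (auto simp: avg_def dist_real_def)
      ultimately show ?thesis using Lim_transform_eventually False unfolding avg_def by fastforce
    next
      case x0: True
      show ?thesis
      proof (rule tendstoI)
        fix e :: real assume e: "e > 0"
        have "\<forall>\<^sub>F s in at 0 within {0..c}. dist (h s) (h 0) < e / 2"
          using bspec[OF h[unfolded continuous_on_def], of 0] True e by (intro tendstoD) auto
        then obtain d where d: "d > 0" "\<And>s. s \<in> {0..c} \<Longrightarrow> s \<noteq> 0 \<Longrightarrow> dist s 0 < d \<Longrightarrow> dist (h s) (h 0) < e / 2"
          unfolding eventually_at by blast
        have "dist (avg h y) (avg h x) < e" if y: "y \<in> {0..c}" "y < d" for y
        proof -
          have b: "\<bar>h s - h 0\<bar> \<le> e / 2" if "0 \<le> s" "s \<le> y" for s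
            using d(2)[of s] that y e by (cases "s = 0") (auto simp: dist_real_def intro: less_imp_le)
          have k: "avg (\<lambda>_. a) y = a" for a
            using wt_has_integral[of y] y has_integral_mult_left[OF wt_has_integral[of y], of a] Wt_pos[of y]
            unfolding avg_def by (auto simp: integral_unique)
          have "avg h y \<le> avg (\<lambda>_. h 0 + e / 2) y"
          proof (rule avg_mono[OF h _ c])
            show "h s \<le> h 0 + e / 2" if "0 \<le> s" "s \<le> y" for s using b[OF that] by linarith
          qed (use y in auto)
          moreover have "avg (\<lambda>_. h 0 - e / 2) y \<le> avg h y"
          proof (rule avg_mono[OF _ h c])
            show "h 0 - e / 2 \<le> h s" if "0 \<le> s" "s \<le> y" for s using b[OF that] by linarith
          qed (use y in auto)
          ultimately have "\<bar>avg h y - h 0\<bar> \<le> e / 2" unfolding k by linarith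
          then show ?thesis using e x0 unfolding avg_def by (simp add: dist_real_def)
        qed
        then show "\<forall>\<^sub>F y in at x within {0..c}. dist (avg h y) (avg h x) < e"
          unfolding eventually_at using d(1) x0 by (intro exI[of _ d]) (auto simp: dist_real_def)
      qed
    qed
  qed
qed auto

text \<open>The quotient rule, with wt / Wt as above. Through it the fixed point equation for b
  becomes a differential equation again for x > 0.\<close>

lemma DERIV_avg:
  assumes h: "continuous_on {0..c} h" and x: "0 < x" "x \<le> c"
  shows "(avg h has_real_derivative 3 * (1 - x\<^sup>2) / (x * (1 + x\<^sup>2)) * (h x - avg h x)) (at x within {0..c})"
proof -
  have x': "x \<in> {0..c}" using x by simp
  have hc: "continuous_on {0..c} (\<lambda>s. wt s * h s)" by (intro continuous_intros wt_cont h)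
  define I where "I x = integral {0..x} (\<lambda>s. wt s * h s)" for x
  have W: "Wt x > 0" using Wt_pos x by simp
  have "((\<lambda>x. I x / Wt x) has_real_derivative (wt x * h x * Wt x - I x * wt x) / (Wt x * Wt x)) (at x within {0..c})"
    unfolding I_def by (intro DERIV_divide integral_has_real_derivative[OF hc x'] DERIV_Wt) (use W in auto)
  moreover have "(wt x * h x * Wt x - I x * wt x) / (Wt x * Wt x) = 3 * (1 - x\<^sup>2) / (x * (1 + x\<^sup>2)) * (h x - avg h x)"
  proof -
    have r: "wt x / Wt x = 3 * (1 - x\<^sup>2) / (x * (1 + x\<^sup>2))"
      unfolding wt_def Wt_def using x one_plus_square_pos(1)[of x]
      by (simp add: divide_simps power2_eq_square power3_eq_cube power4_eq_xxxx)
    have "(wt x * h x * Wt x - I x * wt x) / (Wt x * Wt x) = wt x / Wt x * (h x - I x / Wt x)"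
      using W by (simp add: field_simps)
    also have "I x / Wt x = avg h x" unfolding avg_def I_def using x by simp
    finally show ?thesis unfolding r .
  qed
  ultimately have D: "((\<lambda>x. I x / Wt x) has_real_derivative 3 * (1 - x\<^sup>2) / (x * (1 + x\<^sup>2)) * (h x - avg h x)) (at x within {0..c})"
    by simp
  show ?thesis
    by (rule has_field_derivative_transform_within[OF D x(1) x']) (use x in \<open>auto simp: avg_def I_def dist_real_def\<close>)
qed

text \<open>At its first zero D would have a positive derivative although it comes down from
  positive values. The derivative is asked for only at zeros of D; there the two compared functions
  agree, which is what makes its sign computable.\<close>

lemma barrier_positive:
  fixes D :: "real \<Rightarrow> real"
  assumes cont: "continuous_on {0..c} D" and D0: "D 0 > 0"
    and zero: "\<And>x. 0 < x \<Longrightarrow> x \<le> c \<Longrightarrow> D x = 0 \<Longrightarrow> \<exists>d>0. (D has_real_derivative d) (at x within {0..c})"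
    and x: "x \<in> {0..c}"
  shows "D x > 0"
proof (rule ccontr)
  assume n: "\<not> D x > 0"
  define Z where "Z = {0..c} \<inter> D -` {..0}"
  have "closed Z" unfolding Z_def by (rule continuous_closed_preimage[OF cont]) auto
  then have Z: "compact Z" unfolding Z_def
    by (metis Int_lower1 bounded_closed_interval bounded_subset compact_eq_bounded_closed)
  have "x \<in> Z" using n x unfolding Z_def by auto
  then obtain t where t: "t \<in> Z" "\<And>s. s \<in> Z \<Longrightarrow> t \<le> s" using compact_attains_inf[OF Z] by blast
  have tc: "0 < t" "t \<le> c" "D t \<le> 0" using t(1) D0 unfolding Z_def by (auto simp: order_le_less)
  have before: "D s > 0" if "0 \<le> s" "s < t" for s using t(2)[of s] that tc unfolding Z_def by (cases "D s > 0") auto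
  have "D t = 0"
  proof (rule ccontr)
    assume "D t \<noteq> 0"
    then have "D t < 0" using tc by simp
    then have "\<forall>\<^sub>F s in at t within {0..t}. D s < 0"
      using continuous_on_subset[OF cont, of "{0..t}"] tc order_tendstoD(2)[of D "D t" "at t within {0..t}" 0]
      by (auto simp: continuous_on_def)
    then have "\<forall>\<^sub>F s in at_left t. D s < 0" unfolding at_within_Icc_at_left[OF tc(1)] .
    moreover have "\<forall>\<^sub>F s in at_left t. D s > 0"
      unfolding eventually_at_left_field using tc(1) before by (intro exI[of _ 0]) auto
    ultimately have "\<forall>\<^sub>F s in at_left t. False" by eventually_elim simp
    then show False by (simp add: trivial_limit_at_left_real eventually_False)
  qed
  then obtain d where d: "d > 0" "(D has_real_derivative d) (at t within {0..c})" using zero tc by blast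
  then obtain e where e: "e > 0" "\<And>h. h > 0 \<Longrightarrow> t - h \<in> {0..c} \<Longrightarrow> h < e \<Longrightarrow> D (t - h) < D t"
    using has_real_derivative_pos_inc_left[OF d(2,1)] by blast
  define h where "h = min (e / 2) (t / 2)"
  have h: "0 < h" "h < e" "h < t" using e(1) tc(1) unfolding h_def by auto
  have "D (t - h) < D t" using h tc(2) by (intro e(2)) auto
  moreover have "D (t - h) > 0" using h by (intro before) auto
  ultimately show False using tc by simp
qed

text \<open>On an arc with \<open>v' = 1 / (cc x + ss x * b x)\<close> one has \<open>ln v = \<tau> - zet b x\<close>, where \<open>\<tau> = ln p\<^sub>0\<close>, and
  \<open>mfun (ln v) = 1 / (1 + v\<^sup>2)\<close>. The singular equation is then \<open>(Wt * (b\<^sup>2 - 1))' = wt * arc_h \<tau> b\<close>, that is,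
  \<open>b = arc_T \<tau> b\<close>.\<close>

definition mfun :: "real \<Rightarrow> real" where "mfun t = 1 / (1 + exp (2 * t))"

definition zet :: "(real \<Rightarrow> real) \<Rightarrow> real \<Rightarrow> real" where
  "zet b x = integral {0..x} (\<lambda>s. 2 / ((1 + s\<^sup>2) * b s))"

definition arc_h :: "real \<Rightarrow> (real \<Rightarrow> real) \<Rightarrow> real \<Rightarrow> real" where
  "arc_h \<tau> b x = 2 * x / (3 * (1 - x\<^sup>2)) * ((5 - 4 * mfun (\<tau> - zet b x)) * b x - (b x) ^ 3)
     - 4 / 3 * mfun (\<tau> - zet b x)"

definition arc_T :: "real \<Rightarrow> (real \<Rightarrow> real) \<Rightarrow> real \<Rightarrow> real" where
  "arc_T \<tau> b x = sqrt (1 + avg (arc_h \<tau> b) x)"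

text \<open>The envelope is what \<open>arc_T\<close> returns: 5 t - t^3 lies between 3.44 and 4.304
  for t in [99/100, 1737/1000], averaging multiplies these numbers by \<open>rho\<close>, and the
  resulting envelope stays within that range of t. Rounding to 3.4 and 4.31 and the 1/1000 leave
  room for the \<open>mfun\<close> terms.\<close>

definition arc_set :: "(real \<Rightarrow> real) set" where
  "arc_set = {b. continuous_on {0..7/9} b \<and>
     (\<forall>x\<in>{0..7/9}. sqrt (999/1000 + 34/10 * rho x) \<le> b x \<and> b x \<le> sqrt (1 + 431/100 * rho x))}"

lemma mfun_pos: "0 < mfun t"
  unfolding mfun_def by (simp add: add_pos_pos)

lemma exp_36: assumes "18 \<le> t" shows "10 ^ 9 \<le> exp (2 * t :: real)"
proof -
  have "(2::real) \<le> exp 1" using exp_ge_add_one_self[of 1] by simp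
  then have "(2::real) ^ 36 \<le> exp 1 ^ 36" by (intro power_mono) auto
  also have "\<dots> = exp 36" by (simp add: exp_of_nat_mult[symmetric])
  also have "\<dots> \<le> exp (2 * t)" using assms by simp
  finally show ?thesis by simp
qed

lemma mfun_le: assumes "18 \<le> t" shows "mfun t \<le> 1 / 10 ^ 9"
proof -
  have "(10::real) ^ 9 \<le> 1 + exp (2 * t)" using exp_36[OF assms] by simp
  then show ?thesis unfolding mfun_def by (intro divide_left_mono) (auto simp: add_pos_pos)
qed

lemma mfun_lipschitz:
  assumes "18 \<le> s" "18 \<le> t"
  shows "\<bar>mfun s - mfun t\<bar> \<le> 2 / 10 ^ 9 * \<bar>s - t\<bar>"
proof -
  have "norm (mfun s - mfun t) \<le> 2 / 10 ^ 9 * norm (s - t)"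
  proof (rule field_differentiable_bound[of "{18..}" mfun "\<lambda>t. - (2 * exp (2 * t)) / (1 + exp (2 * t))\<^sup>2"])
    show "(mfun has_field_derivative - (2 * exp (2 * z)) / (1 + exp (2 * z))\<^sup>2) (at z within {18..})" for z
    proof -
      have "1 + exp (2 * z) > 0" by (simp add: add_pos_pos)
      then show ?thesis unfolding mfun_def by (auto intro!: derivative_eq_intros simp: power2_eq_square)
    qed
    show "norm (- (2 * exp (2 * z)) / (1 + exp (2 * z))\<^sup>2) \<le> 2 / 10 ^ 9" if "z \<in> {18..}" for z :: real
    proof -
      define e where "e = exp (2 * z)"
      have e: "10 ^ 9 \<le> e" "e > 0" using exp_36[of z] that unfolding e_def by auto
      have "2 * e / (1 + e)\<^sup>2 \<le> 2 * e / e\<^sup>2" using e by (intro divide_left_mono power_mono mult_pos_pos) auto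
      also have "\<dots> = 2 / e" using e by (simp add: power2_eq_square)
      also have "\<dots> \<le> 2 / 10 ^ 9" using e by (intro divide_left_mono) auto
      finally show ?thesis using e unfolding e_def by simp
    qed
  qed (use assms in auto)
  then show ?thesis by simp
qed

lemma rho_bounds: assumes "x \<in> {0..7/9}" shows "0 \<le> rho x" "rho x \<le> 4674 / 10000"
proof -
  show "0 \<le> rho x" unfolding rho_def using assms by simp
  have "x\<^sup>2 \<le> (7/9)\<^sup>2" using assms by (intro power_mono) auto
  then have "x * (3 + x\<^sup>2) \<le> 7/9 * (3 + (7/9)\<^sup>2)" using assms by (intro mult_mono) auto
  then show "rho x \<le> 4674 / 10000" unfolding rho_def by (simp add: power2_eq_square)
qed

section \<open>The fixed point equation of the singular arc\<close>

lemma arc_set_cont: "b \<in> arc_set \<Longrightarrow> continuous_on {0..7/9} b"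
  unfolding arc_set_def by simp

lemma arc_set_bounds:
  assumes b: "b \<in> arc_set" and x: "x \<in> {0..7/9}"
  shows "99/100 \<le> b x" "b x \<le> 1737/1000" "999/1000 + 34/10 * rho x \<le> (b x)\<^sup>2" 
proof -
  have 1: "sqrt (999/1000 + 34/10 * rho x) \<le> b x" "b x \<le> sqrt (1 + 431/100 * rho x)" using b x unfolding arc_set_def by auto
  have "99/100 \<le> sqrt (999/1000 + 34/10 * rho x)" using rho_bounds[OF x] by (intro real_le_rsqrt) (simp add: power2_eq_square)
  then show l: "99/100 \<le> b x" using 1 by simp
  have "sqrt (1 + 431/100 * rho x) \<le> 1737/1000" using rho_bounds[OF x] by (intro real_le_lsqrt) (auto simp: power2_eq_square)
  then show "b x \<le> 1737/1000" using 1 by simp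
  have "(sqrt (999/1000 + 34/10 * rho x))\<^sup>2 \<le> (b x)\<^sup>2" using 1 rho_bounds[OF x] by (intro power_mono) auto
  then show "999/1000 + 34/10 * rho x \<le> (b x)\<^sup>2" using rho_bounds[OF x] by simp
qed

lemma zet_integrand_cont:
  fixes b :: "real \<Rightarrow> real"
  assumes b: "continuous_on {0..c} b" "\<And>x. x \<in> {0..c} \<Longrightarrow> b x > 0"
  shows "continuous_on {0..c} (\<lambda>s. 2 / ((1 + s\<^sup>2) * b s))"
proof -
  have "(1 + s\<^sup>2) * b s \<noteq> 0" if "s \<in> {0..c}" for s using b(2)[OF that] one_plus_square_pos(2)[of s] by simp
  then show ?thesis by (intro continuous_intros b(1)) auto
qed

lemma zet_cont:
  assumes b: "continuous_on {0..c} b" "\<And>x. x \<in> {0..c} \<Longrightarrow> b x > 0"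
  shows "continuous_on {0..c} (zet b)"
  unfolding zet_def
  by (intro indefinite_integral_continuous_1 integrable_continuous_real zet_integrand_cont b)

lemma DERIV_zet:
  assumes b: "continuous_on {0..c} b" "\<And>x. x \<in> {0..c} \<Longrightarrow> b x > 0" and x: "x \<in> {0..c}"
  shows "(zet b has_real_derivative 2 / ((1 + x\<^sup>2) * b x)) (at x within {0..c})"
  unfolding zet_def
  by (rule integral_has_real_derivative[OF zet_integrand_cont[OF b] x])

lemma zet_bounds:
  assumes b: "continuous_on {0..c} b" "\<And>x. x \<in> {0..c} \<Longrightarrow> b x \<ge> 99/100" and c: "c \<le> 1" and x: "x \<in> {0..c}"
  shows "0 \<le> zet b x" "zet b x \<le> 21/10 * x"
proof -
  have bp: "b s > 0" if "s \<in> {0..c}" for s using b(2)[OF that] by simp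
  have i: "(\<lambda>s. 2 / ((1 + s\<^sup>2) * b s)) integrable_on {0..x}"
    by (rule integrable_continuous_real[OF continuous_on_subset[OF zet_integrand_cont[OF b(1) bp]]]) (use x in auto)
  have B: "0 \<le> 2 / ((1 + s\<^sup>2) * b s)" "2 / ((1 + s\<^sup>2) * b s) \<le> 21/10" if "s \<in> {0..x}" for s
  proof -
    have bs: "b s \<ge> 99/100" using b(2) that x by auto
    have "99/100 * 1 \<le> b s * (1 + s\<^sup>2)" using bs by (intro mult_mono) auto
    then have p: "99/100 \<le> (1 + s\<^sup>2) * b s" by (simp add: mult.commute)
    then show "0 \<le> 2 / ((1 + s\<^sup>2) * b s)" by simp
    have "2 / ((1 + s\<^sup>2) * b s) \<le> 2 / (99/100)" using p by (intro divide_left_mono) auto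
    then show "2 / ((1 + s\<^sup>2) * b s) \<le> 21/10" by simp
  qed
  show "0 \<le> zet b x" unfolding zet_def by (intro integral_nonneg[OF i]) (use B in auto)
  have "zet b x \<le> integral {0..x} (\<lambda>_. 21/10)" unfolding zet_def by (rule integral_le[OF i]) (use B in auto)
  then show "zet b x \<le> 21/10 * x" using x by simp
qed

lemma zet_lipschitz:
  assumes b: "continuous_on {0..c} b1" "\<And>x. x \<in> {0..c} \<Longrightarrow> b1 x \<ge> 99/100"
     "continuous_on {0..c} b2" "\<And>x. x \<in> {0..c} \<Longrightarrow> b2 x \<ge> 99/100" and x: "x \<in> {0..c}"
    and D: "\<And>s. s \<in> {0..x} \<Longrightarrow> \<bar>b1 s - b2 s\<bar> \<le> D"
  shows "\<bar>zet b1 x - zet b2 x\<bar> \<le> 21/10 * D * x"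
proof -
  have bp: "b1 s > 0" "b2 s > 0" if "s \<in> {0..c}" for s using b(2,4)[OF that] by auto
  have i: "(\<lambda>s. 2 / ((1 + s\<^sup>2) * b1 s)) integrable_on {0..x}" "(\<lambda>s. 2 / ((1 + s\<^sup>2) * b2 s)) integrable_on {0..x}"
    using integrable_continuous_real[OF continuous_on_subset[OF zet_integrand_cont[OF b(1) bp(1)]]]
      integrable_continuous_real[OF continuous_on_subset[OF zet_integrand_cont[OF b(3) bp(2)]]] x by auto
  have D0: "D \<ge> 0" using D[of 0] x by auto
  have "norm (integral {0..x} (\<lambda>s. 2 / ((1 + s\<^sup>2) * b1 s) - 2 / ((1 + s\<^sup>2) * b2 s))) \<le> integral {0..x} (\<lambda>_. 21/10 * D)"
  proof (rule integral_norm_bound_integral)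
    show "norm (2 / ((1 + s\<^sup>2) * b1 s) - 2 / ((1 + s\<^sup>2) * b2 s)) \<le> 21/10 * D" if s: "s \<in> {0..x}" for s
    proof -
      have bs: "b1 s \<ge> 99/100" "b2 s \<ge> 99/100" using b(2,4) s x by auto
      define N where "N = 1 + s\<^sup>2"
      have N: "N \<ge> 1" unfolding N_def by simp
      define d where "d = b2 s - b1 s"
      have "2 / (N * b1 s) - 2 / (N * b2 s) = 2 * d / (N * (b1 s * b2 s))"
        unfolding d_def using bs N by (simp add: field_simps)
      then have "\<bar>2 / (N * b1 s) - 2 / (N * b2 s)\<bar> = 2 * \<bar>d\<bar> / (N * (b1 s * b2 s))"
        using bs N by (simp add: abs_mult)
      also have "\<dots> \<le> 2 * D / (1 * (99/100 * (99/100)))"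
        using bs N D[OF s] D0 unfolding d_def by (intro frac_le mult_mono) auto
      also have "\<dots> \<le> 21/10 * D" using D0 by simp
      finally show ?thesis unfolding N_def by simp
    qed
  qed (auto intro!: integrable_diff i)
  then show ?thesis unfolding zet_def using integral_diff[OF i] x by (simp add: mult_ac)
qed

lemma arc_set_zet:
  assumes b: "b \<in> arc_set" and x: "x \<in> {0..7/9}"
  shows "0 \<le> zet b x" "zet b x \<le> 2"
  using zet_bounds[OF arc_set_cont[OF b] arc_set_bounds(1)[OF b] _ x] x by auto

lemma arc_set_pos: "b \<in> arc_set \<Longrightarrow> x \<in> {0..7/9} \<Longrightarrow> b x > 0"
  using arc_set_bounds(1)[of b x] by linarith

lemma arc_set_mfun:
  assumes b: "b \<in> arc_set" and x: "x \<in> {0..7/9}" and \<tau>: "20 \<le> \<tau>"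
  shows "mfun (\<tau> - zet b x) \<le> 1 / 10 ^ 9"
  using arc_set_zet[OF b x] \<tau> by (intro mfun_le) auto

lemma one_minus_square_pos: "x \<in> {0..7/9} \<Longrightarrow> 1 - (x::real)\<^sup>2 > 0"
  using abs_square_less_1[of x] by auto

lemma arc_h_cont:
  assumes b: "b \<in> arc_set"
  shows "continuous_on {0..7/9} (arc_h \<tau> b)"
proof -
  have z: "continuous_on {0..7/9} (zet b)" by (rule zet_cont[OF arc_set_cont[OF b] arc_set_pos[OF b]])
  have e: "1 + exp (t::real) \<noteq> 0" for t using exp_gt_zero[of t] by linarith
  have s: "3 * (1 - x\<^sup>2) \<noteq> 0" if "x \<in> {0..7/9}" for x :: real using one_minus_square_pos[OF that] by simp
  show ?thesis unfolding arc_h_def mfun_def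
    by (intro continuous_intros z arc_set_cont[OF b]) (use e s in auto)
qed

text \<open>The function 5 t - t^3 is concave here. The first factorization bounds t^3 by its chord
  over the interval, the second by its tangent at 1.291, close to the maximum of 5 t - t^3 at sqrt
  (5/3).\<close>

lemma cubic_bounds:
  fixes t :: real
  assumes "99/100 \<le> t" "t \<le> 1737/1000"
  shows "344/100 \<le> 5 * t - t ^ 3" "5 * t - t ^ 3 \<le> 4304/1000"
proof -
  have g: "(t - a) * (b - t) * (t + (a + b)) = (a * a + a * b + b * b) * t - a * b * (a + b) - t ^ 3" for a b
    by (simp add: algebra_simps power3_eq_cube)
  have "0 \<le> (t - 99/100) * (1737/1000 - t) * (t + (99/100 + 1737/1000))" using assms by (intro mult_nonneg_nonneg) auto
  then have "t ^ 3 \<le> 5716899/1000000 * t - 468943101/100000000" unfolding g by simp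
  then show "344/100 \<le> 5 * t - t ^ 3" using assms by simp
  have g2: "(t - a)\<^sup>2 * (t + 2 * a) = t ^ 3 - 3 * (a * a) * t + 2 * (a * a * a)" for a
    by (simp add: algebra_simps power3_eq_cube power2_eq_square)
  have "0 \<le> (t - 1291/1000)\<^sup>2 * (t + 2 * (1291/1000))" using assms by (intro mult_nonneg_nonneg) auto
  then show "5 * t - t ^ 3 \<le> 4304/1000" using assms unfolding g2 by simp
qed

lemma avg_arc_h_bounds:
  assumes b: "b \<in> arc_set" and x: "x \<in> {0..7/9}" and \<tau>: "20 \<le> \<tau>"
  shows "34/10 * rho x - 1/1000 \<le> avg (arc_h \<tau> b) x" "avg (arc_h \<tau> b) x \<le> 431/100 * rho x"
proof -
  define q where "q s = 2 * s / (3 * (1 - s\<^sup>2))" for s :: real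
  have bd: "q s * (343/100) + (- 1/1000) \<le> arc_h \<tau> b s \<and> arc_h \<tau> b s \<le> q s * (4304/1000) + 0" if s: "s \<in> {0..7/9}" for s
  proof -
    define m where "m = mfun (\<tau> - zet b s)"
    have m: "0 < m" "m \<le> 1 / 10 ^ 9" unfolding m_def using mfun_pos arc_set_mfun[OF b s \<tau>] by auto
    have bs: "99/100 \<le> b s" "b s \<le> 1737/1000" using arc_set_bounds[OF b s] by auto
    have q0: "q s \<ge> 0" unfolding q_def using one_minus_square_pos[OF s] s by simp
    have mb: "0 \<le> m * b s" "m * b s \<le> 1 / 10 ^ 9 * 2"
      using m bs mult_mono[of m "1 / 10 ^ 9" "b s" 2] by auto
    have k: "343/100 \<le> (5 - 4 * m) * b s - (b s) ^ 3" "(5 - 4 * m) * b s - (b s) ^ 3 \<le> 4304/1000"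
      using cubic_bounds[OF bs] mb by (auto simp: algebra_simps)
    show ?thesis unfolding arc_h_def q_def[symmetric] m_def[symmetric]
      using m mult_left_mono[OF k(1) q0] mult_left_mono[OF k(2) q0] by auto
  qed
  have x1: "0 \<le> x" "x < 1" "x \<le> 7/9" using x by auto
  have "avg (\<lambda>s. q s * (343/100) + (- 1/1000)) x \<le> avg (arc_h \<tau> b) x"
    unfolding q_def by (rule avg_mono[OF avg_affine_cont arc_h_cont[OF b]]) (use x bd in \<open>auto simp: q_def\<close>)
  then have "343/100 * rho x - 1/1000 \<le> avg (arc_h \<tau> b) x"
    unfolding q_def avg_affine[OF x1(1,2)] by simp
  then show "34/10 * rho x - 1/1000 \<le> avg (arc_h \<tau> b) x" using rho_bounds[OF x] by linarith
  have "avg (arc_h \<tau> b) x \<le> avg (\<lambda>s. q s * (4304/1000) + 0) x"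
    unfolding q_def by (rule avg_mono[OF arc_h_cont[OF b] avg_affine_cont]) (use x bd in \<open>auto simp: q_def\<close>)
  then have "avg (arc_h \<tau> b) x \<le> 4304/1000 * rho x"
    unfolding q_def avg_affine[OF x1(1,2)] by simp
  then show "avg (arc_h \<tau> b) x \<le> 431/100 * rho x" using rho_bounds[OF x] by linarith
qed

lemma arc_T_maps:
  assumes b: "b \<in> arc_set" and \<tau>: "20 \<le> \<tau>"
  shows "arc_T \<tau> b \<in> arc_set"
  unfolding arc_set_def
proof (intro CollectI conjI ballI)
  show "continuous_on {0..7/9} (arc_T \<tau> b)" unfolding arc_T_def
    by (intro continuous_intros avg_cont arc_h_cont b) auto
  fix x :: real assume x: "x \<in> {0..7/9}"
  show "sqrt (999/1000 + 34/10 * rho x) \<le> arc_T \<tau> b x" "arc_T \<tau> b x \<le> sqrt (1 + 431/100 * rho x)"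
    unfolding arc_T_def using avg_arc_h_bounds[OF b x \<tau>] by auto
qed

text \<open>The difference quotient of the cubic term is at most 4.06 in size, averaging turns this
  into 4.06 \<open>rho\<close>, and the square root divides by a sum of two values, each at least
  sqrt (0.999 + 3.4 rho). The parameter \<tau> enters only through \<open>mfun\<close>, whose
  Lipschitz constant is 2/10^9.\<close>

lemma arc_T_lipschitz:
  assumes b: "b1 \<in> arc_set" "b2 \<in> arc_set" and \<tau>: "20 \<le> \<tau>1" "20 \<le> \<tau>2"
    and D: "\<And>s. s \<in> {0..7/9} \<Longrightarrow> \<bar>b1 s - b2 s\<bar> \<le> D" and x: "x \<in> {0..7/9}"
  shows "\<bar>arc_T \<tau>1 b1 x - arc_T \<tau>2 b2 x\<bar> \<le> 65/100 * D + 1 / 10 ^ 7 * \<bar>\<tau>1 - \<tau>2\<bar>"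
proof -
  have D0: "D \<ge> 0" using D[of 0] by auto
  define \<Delta> where "\<Delta> = \<bar>\<tau>1 - \<tau>2\<bar>"
  define E where "E = 2 / 10 ^ 9 * (\<Delta> + 2 * D)"
  have E0: "E \<ge> 0" unfolding E_def \<Delta>_def using D0 by simp
  have bd: "\<bar>arc_h \<tau>1 b1 s - arc_h \<tau>2 b2 s\<bar> \<le> 2 * s / (3 * (1 - s\<^sup>2)) * (406/100 * D + 8 * E) + 4/3 * E" if s: "s \<in> {0..7/9}" for s
  proof -
    define m1 m2 where "m1 = mfun (\<tau>1 - zet b1 s)" and "m2 = mfun (\<tau>2 - zet b2 s)"
    have m1: "0 < m1" "m1 \<le> 1 / 10 ^ 9" unfolding m1_def using mfun_pos arc_set_mfun[OF b(1) s \<tau>(1)] by auto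
    have z: "\<bar>zet b1 s - zet b2 s\<bar> \<le> 21/10 * D * s"
      by (rule zet_lipschitz[of "7/9"]) (use b arc_set_cont arc_set_bounds(1) s D in auto)
    have "21/10 * D * s \<le> 21/10 * D * (7/9)" using s D0 by (intro mult_left_mono) auto
    then have z2: "\<bar>zet b1 s - zet b2 s\<bar> \<le> 2 * D" using z D0 by simp
    have "\<bar>m1 - m2\<bar> \<le> 2 / 10 ^ 9 * \<bar>(\<tau>1 - zet b1 s) - (\<tau>2 - zet b2 s)\<bar>"
      unfolding m1_def m2_def using arc_set_zet[OF b(1) s] arc_set_zet[OF b(2) s] \<tau> by (intro mfun_lipschitz) auto
    also have "\<dots> \<le> E" unfolding E_def \<Delta>_def using z2 by (intro mult_left_mono) auto
    finally have mm: "\<bar>m1 - m2\<bar> \<le> E" .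
    define t1 t2 where "t1 = b1 s" and "t2 = b2 s"
    have t: "99/100 \<le> t1" "t1 \<le> 1737/1000" "99/100 \<le> t2" "t2 \<le> 1737/1000" "\<bar>t1 - t2\<bar> \<le> D"
      using arc_set_bounds[OF b(1) s] arc_set_bounds[OF b(2) s] D[OF s] unfolding t1_def t2_def by auto
    define dm where "dm = m1 - m2"
    have e: "((5 - 4 * m1) * t1 - t1 ^ 3) - ((5 - 4 * m2) * t2 - t2 ^ 3)
      = (t1 - t2) * (5 - 4 * m1 - (t1\<^sup>2 + t1 * t2 + t2\<^sup>2)) - 4 * dm * t2"
      unfolding dm_def by (simp add: algebra_simps power2_eq_square power3_eq_cube)
    have *: "99/100 * (99/100) \<le> t1 * t1" "t1 * t1 \<le> 1737/1000 * (1737/1000)" "99/100 * (99/100) \<le> t1 * t2" "t1 * t2 \<le> 1737/1000 * (1737/1000)"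
      "99/100 * (99/100) \<le> t2 * t2" "t2 * t2 \<le> 1737/1000 * (1737/1000)"
      using t by (intro mult_mono; simp)+
    then have S: "\<bar>5 - 4 * m1 - (t1\<^sup>2 + t1 * t2 + t2\<^sup>2)\<bar> \<le> 406/100"
    proof -
      have "m1 \<le> 1 / 1000" using m1(2) by simp
      then show ?thesis using m1(1) * unfolding power2_eq_square abs_le_iff by linarith
    qed
    have "\<bar>((5 - 4 * m1) * t1 - t1 ^ 3) - ((5 - 4 * m2) * t2 - t2 ^ 3)\<bar>
      \<le> \<bar>t1 - t2\<bar> * \<bar>5 - 4 * m1 - (t1\<^sup>2 + t1 * t2 + t2\<^sup>2)\<bar> + 4 * \<bar>dm\<bar> * \<bar>t2\<bar>"
      unfolding e by (rule order_trans[OF abs_triangle_ineq4]) (simp add: abs_mult)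
    also have "\<dots> \<le> D * (406/100) + 4 * E * 2"
      using t S mm[folded dm_def] D0 E0 by (intro add_mono mult_mono) auto
    finally have k: "\<bar>((5 - 4 * m1) * t1 - t1 ^ 3) - ((5 - 4 * m2) * t2 - t2 ^ 3)\<bar> \<le> 406/100 * D + 8 * E" by simp
    define q where "q = 2 * s / (3 * (1 - s\<^sup>2))"
    have q0: "q \<ge> 0" unfolding q_def using one_minus_square_pos[OF s] s by simp
    define X where "X = ((5 - 4 * m1) * t1 - t1 ^ 3) - ((5 - 4 * m2) * t2 - t2 ^ 3)"
    have "arc_h \<tau>1 b1 s - arc_h \<tau>2 b2 s = q * X - 4/3 * dm"
      unfolding arc_h_def q_def X_def dm_def m1_def m2_def t1_def t2_def by (simp add: algebra_simps)
    then have "\<bar>arc_h \<tau>1 b1 s - arc_h \<tau>2 b2 s\<bar> \<le> q * \<bar>X\<bar> + 4/3 * \<bar>dm\<bar>"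
      using abs_triangle_ineq4[of "q * X" "4/3 * dm"] q0 by (simp add: abs_mult)
    also have "\<dots> \<le> q * (406/100 * D + 8 * E) + 4/3 * E"
      using k[folded X_def] mm[folded dm_def] q0 by (intro add_mono mult_left_mono) auto
    finally show ?thesis unfolding q_def .
  qed
  define A1 A2 where "A1 = avg (arc_h \<tau>1 b1) x" and "A2 = avg (arc_h \<tau>2 b2) x"
  define r where "r = rho x"
  have r: "0 \<le> r" "r \<le> 4674/10000" unfolding r_def using rho_bounds[OF x] by auto
  have "\<bar>A1 - A2\<bar> \<le> (406/100 * D + 8 * E) * rho x + 4/3 * E"
    unfolding A1_def A2_def by (rule avg_abs_le[OF arc_h_cont[OF b(1)] arc_h_cont[OF b(2)]]) (use x bd in auto)
  also have "\<dots> = 406/100 * r * D + 8 * r * E + 4/3 * E" unfolding r_def by (simp add: algebra_simps)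
  also have "8 * r * E \<le> 4 * E" using r E0 by (intro mult_right_mono) auto
  finally have A: "\<bar>A1 - A2\<bar> \<le> 406/100 * r * D + 6 * E" using E0 by simp
  define T1 T2 where "T1 = sqrt (1 + A1)" and "T2 = sqrt (1 + A2)"
  have lo: "1 + A1 \<ge> 999/1000 + 34/10 * r" "1 + A2 \<ge> 999/1000 + 34/10 * r"
    using avg_arc_h_bounds(1)[OF b(1) x \<tau>(1)] avg_arc_h_bounds(1)[OF b(2) x \<tau>(2)] unfolding A1_def A2_def r_def by auto
  define L where "L = sqrt (999/1000 + 34/10 * r)"
  have L3: "99/100 \<le> L" unfolding L_def using r by (intro real_le_rsqrt) (simp add: power2_eq_square)
  have L: "T1 \<ge> L" "T2 \<ge> L" "L \<ge> 99/100" using L3 unfolding T1_def T2_def L_def using lo by simp_all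
  \<comment> \<open>Here the contraction constant is decided: 13/10 is twice 65/100, and the growth
    of L with r compensates that of 4.06 r. The summand 1/10^6 absorbs the effect of b on
    \<open>mfun\<close> through \<open>zet\<close>.\<close>
  have Lr: "406/100 * r + 1 / 10 ^ 6 \<le> 13/10 * L"
  proof -
    have "(406/100 * r + 1 / 10 ^ 6) / (13/10) \<le> L" unfolding L_def
    proof (rule real_le_rsqrt)
      have "r * r \<le> 4674/10000 * r" using r by (intro mult_right_mono) auto
      then show "((406/100 * r + 1 / 10 ^ 6) / (13/10))\<^sup>2 \<le> 999/1000 + 34/10 * r"
        using r by (simp add: power2_eq_square algebra_simps)
    qed
    then show ?thesis by simp
  qed
  have T: "(T1 - T2) * (T1 + T2) = A1 - A2"
  proof -
    have "T1 * T1 = 1 + A1" "T2 * T2 = 1 + A2" unfolding T1_def T2_def using lo r by auto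
    then show ?thesis by (simp add: algebra_simps)
  qed
  have "\<bar>T1 - T2\<bar> * (2 * L) \<le> \<bar>T1 - T2\<bar> * (T1 + T2)" using L by (intro mult_left_mono) auto
  also have "\<dots> = \<bar>A1 - A2\<bar>" using T L by (metis abs_mult abs_of_nonneg add_nonneg_nonneg order_trans zero_le_divide_iff zero_le_numeral)
  also have "\<dots> \<le> 406/100 * r * D + 6 * E" by (rule A)
  also have "\<dots> = 406/100 * r * D + 24 / 10 ^ 9 * D + 12 / 10 ^ 9 * \<Delta>" unfolding E_def by simp
  also have "\<dots> \<le> 406/100 * r * D + 1 / 10 ^ 6 * D + 12 / 10 ^ 9 * \<Delta>" using D0 by simp
  also have "\<dots> = (406/100 * r + 1 / 10 ^ 6) * D + 12 / 10 ^ 9 * \<Delta>" by (simp add: distrib_right)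
  also have "\<dots> \<le> 13/10 * L * D + 2 * L * (1 / 10 ^ 7 * \<Delta>)"
  proof (rule add_mono)
    show "(406/100 * r + 1 / 10 ^ 6) * D \<le> 13/10 * L * D" using Lr D0 by (intro mult_right_mono) auto
    have "12 / 10 ^ 9 \<le> 2 * L * (1 / 10 ^ 7)" using L by simp
    then have "12 / 10 ^ 9 * \<Delta> \<le> 2 * L * (1 / 10 ^ 7) * \<Delta>" unfolding \<Delta>_def by (intro mult_right_mono) auto
    then show "12 / 10 ^ 9 * \<Delta> \<le> 2 * L * (1 / 10 ^ 7 * \<Delta>)" by simp
  qed
  also have "\<dots> = (65/100 * D + 1 / 10 ^ 7 * \<Delta>) * (2 * L)" by (simp add: algebra_simps)
  finally have "\<bar>T1 - T2\<bar> \<le> 65/100 * D + 1 / 10 ^ 7 * \<Delta>" using L by (simp add: mult_le_cancel_right)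
  then show ?thesis unfolding T1_def T2_def A1_def A2_def \<Delta>_def arc_T_def .
qed

lemma arc_exists:
  assumes \<tau>: "20 \<le> \<tau>"
  shows "\<exists>b. b \<in> arc_set \<and> (\<forall>x\<in>{0..7/9}. arc_T \<tau> b x = b x)"
proof -
  define lo hi where "lo x = sqrt (999/1000 + 34/10 * rho x)" and "hi x = sqrt (1 + 431/100 * rho x)" for x
  have S: "arc_set = {g. continuous_on {0..7/9} g \<and> (\<forall>x\<in>{0..7/9}. lo x \<le> g x \<and> g x \<le> hi x)}"
    unfolding arc_set_def lo_def hi_def ..
  have lo: "lo \<in> arc_set" unfolding arc_set_def
  proof (intro CollectI conjI ballI)
    show "continuous_on {0..7/9} lo" unfolding lo_def rho_def by (intro continuous_intros) auto
    show "sqrt (999/1000 + 34/10 * rho x) \<le> lo x" "lo x \<le> sqrt (1 + 431/100 * rho x)" if "x \<in> {0..7/9}" for x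
      unfolding lo_def using rho_bounds[OF that] by auto
  qed
  obtain b where "b \<in> arc_set" "\<And>x. x \<in> {0..7/9} \<Longrightarrow> arc_T \<tau> b x = b x"
  proof (rule contraction_fixed_point[of lo 0 "7/9" lo hi "arc_T \<tau>" "65/100", folded S])
    show "\<bar>arc_T \<tau> g x - arc_T \<tau> h x\<bar> \<le> 65/100 * D"
      if "g \<in> arc_set" "h \<in> arc_set" "\<And>x. x \<in> {0..7/9} \<Longrightarrow> \<bar>g x - h x\<bar> \<le> D" "x \<in> {0..7/9}" for g h D x
      using arc_T_lipschitz[OF that(1,2) \<tau> \<tau> that(3,4)] by simp
  qed (use lo arc_T_maps[OF _ \<tau>] in auto)
  then show ?thesis by blast
qed

definition sarc :: "real \<Rightarrow> real \<Rightarrow> real" where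
  "sarc \<tau> = (SOME b. b \<in> arc_set \<and> (\<forall>x\<in>{0..7/9}. arc_T \<tau> b x = b x))"

lemma arc_in_set: "20 \<le> \<tau> \<Longrightarrow> sarc \<tau> \<in> arc_set"
  and arc_fixed: "20 \<le> \<tau> \<Longrightarrow> x \<in> {0..7/9} \<Longrightarrow> arc_T \<tau> (sarc \<tau>) x = sarc \<tau> x"
  using someI_ex[OF arc_exists[of \<tau>]] unfolding sarc_def by auto

text \<open>Stability of the fixed point: the maximal difference D of two arcs satisfies D <= 0.65 D
  + 10^-7 times the difference of the parameters.\<close>

lemma arc_lipschitz:
  assumes \<tau>: "20 \<le> \<tau>1" "20 \<le> \<tau>2" and x: "x \<in> {0..7/9}"
  shows "\<bar>sarc \<tau>1 x - sarc \<tau>2 x\<bar> \<le> 1 / 10 ^ 6 * \<bar>\<tau>1 - \<tau>2\<bar>"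
proof -
  note b = arc_in_set[OF \<tau>(1)] arc_in_set[OF \<tau>(2)]
  have "\<exists>t\<in>{0..7/9}. \<forall>s\<in>{0..7/9}. \<bar>sarc \<tau>1 s - sarc \<tau>2 s\<bar> \<le> \<bar>sarc \<tau>1 t - sarc \<tau>2 t\<bar>"
    by (rule continuous_attains_sup) (auto intro!: continuous_intros arc_set_cont[OF b(1)] arc_set_cont[OF b(2)])
  then obtain t where t: "t \<in> {0..7/9}" "\<And>s. s \<in> {0..7/9} \<Longrightarrow> \<bar>sarc \<tau>1 s - sarc \<tau>2 s\<bar> \<le> \<bar>sarc \<tau>1 t - sarc \<tau>2 t\<bar>"
    by blast
  define D where "D = \<bar>sarc \<tau>1 t - sarc \<tau>2 t\<bar>"
  have "\<bar>arc_T \<tau>1 (sarc \<tau>1) t - arc_T \<tau>2 (sarc \<tau>2) t\<bar> \<le> 65/100 * D + 1 / 10 ^ 7 * \<bar>\<tau>1 - \<tau>2\<bar>"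
    by (rule arc_T_lipschitz[OF b \<tau> _ t(1)]) (use t(2) D_def in auto)
  then have "D \<le> 65/100 * D + 1 / 10 ^ 7 * \<bar>\<tau>1 - \<tau>2\<bar>" unfolding arc_fixed[OF \<tau>(1) t(1)] arc_fixed[OF \<tau>(2) t(1)] D_def .
  moreover have "D \<le> 1 / 10 ^ 6 * \<Delta>" if "0 \<le> \<Delta>" "D \<le> 65/100 * D + 1 / 10 ^ 7 * \<Delta>" for \<Delta>
    using that by simp
  ultimately have "D \<le> 1 / 10 ^ 6 * \<bar>\<tau>1 - \<tau>2\<bar>" using abs_ge_zero by blast
  then show ?thesis using t(2)[OF x] unfolding D_def by simp
qed

text \<open>The angular variable is \<open>x = sqrt ((v - p) / (v + p))\<close>; then \<open>cc x = p / v\<close> and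
  \<open>ss x = sqrt (v\<^sup>2 - p\<^sup>2) / v\<close>.\<close>

definition cc :: "real \<Rightarrow> real" where "cc x = (1 - x\<^sup>2) / (1 + x\<^sup>2)"
definition ss :: "real \<Rightarrow> real" where "ss x = 2 * x / (1 + x\<^sup>2)"

text \<open>Without the \<open>mfun\<close> terms the arc expands as b = 1 + x - x^2 / 10 + ... at x
  = 0. The barriers keep this shape, with the start e and the curvature k shifted.\<close>

definition barrier :: "real \<Rightarrow> real \<Rightarrow> real \<Rightarrow> real" where "barrier e k x = e + x - k * x\<^sup>2"

definition smu :: "real \<Rightarrow> real \<Rightarrow> real" where "smu \<tau> x = mfun (\<tau> - zet (sarc \<tau>) x)"

definition yy :: "real \<Rightarrow> real \<Rightarrow> real" where "yy \<tau> x = cc x + ss x * sarc \<tau> x"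

lemma cc_ss: "(cc x)\<^sup>2 + (ss x)\<^sup>2 = 1"
proof -
  have "(1 - x\<^sup>2)\<^sup>2 + (2 * x)\<^sup>2 = (1 + x\<^sup>2)\<^sup>2" by (simp add: power2_eq_square algebra_simps)
  then show ?thesis unfolding cc_def ss_def power_divide using one_plus_square_pos(1)[of x]
    by (simp add: add_divide_distrib[symmetric])
qed

lemma DERIV_cc: "(cc has_real_derivative - (2 / (1 + x\<^sup>2)) * ss x) (at x within A)"
proof -
  define N where "N = 1 + x\<^sup>2"
  have N: "N > 0" unfolding N_def by (rule one_plus_square_pos)
  have "(cc has_real_derivative (- (2 * x) * N - (1 - x\<^sup>2) * (2 * x)) / (N * N)) (at x within A)"
    unfolding cc_def using N by (auto intro!: derivative_eq_intros simp: N_def)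
  moreover have "- (2 * x) * N - (1 - x\<^sup>2) * (2 * x) = - 4 * x" unfolding N_def by (simp add: algebra_simps power2_eq_square)
  ultimately show ?thesis unfolding ss_def N_def by simp
qed

lemma DERIV_ss: "(ss has_real_derivative 2 / (1 + x\<^sup>2) * cc x) (at x within A)"
proof -
  define N where "N = 1 + x\<^sup>2"
  have N: "N > 0" unfolding N_def by (rule one_plus_square_pos)
  have "(ss has_real_derivative (2 * N - 2 * x * (2 * x)) / (N * N)) (at x within A)"
    unfolding ss_def using N by (auto intro!: derivative_eq_intros simp: N_def)
  moreover have "2 * N - 2 * x * (2 * x) = 2 * (1 - x\<^sup>2)" unfolding N_def by (simp add: algebra_simps power2_eq_square)
  ultimately show ?thesis unfolding cc_def N_def by simp
qed

lemma cc_cont: "continuous_on A cc" by (rule DERIV_continuous_on[OF DERIV_cc])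
lemma ss_cont: "continuous_on A ss" by (rule DERIV_continuous_on[OF DERIV_ss])

section \<open>The arc as solution of a differential equation, and its barriers\<close>

context
  fixes \<tau> :: real
  assumes \<tau>: "20 \<le> \<tau>"
begin

abbreviation "sb \<equiv> sarc \<tau>"

lemma sb_cont: "continuous_on {0..7/9} sb" by (rule arc_set_cont[OF arc_in_set[OF \<tau>]])

lemma sb_bounds: "x \<in> {0..7/9} \<Longrightarrow> 99/100 \<le> sb x" "x \<in> {0..7/9} \<Longrightarrow> sb x \<le> 1737/1000"
  using arc_set_bounds[OF arc_in_set[OF \<tau>]] by auto

lemma sb_pos: "x \<in> {0..7/9} \<Longrightarrow> 0 < sb x" by (rule arc_set_pos[OF arc_in_set[OF \<tau>]])

lemma smu_bounds: "0 < smu \<tau> x" "x \<in> {0..7/9} \<Longrightarrow> smu \<tau> x \<le> 1 / 10 ^ 9"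
  unfolding smu_def using mfun_pos arc_set_mfun[OF arc_in_set[OF \<tau>] _ \<tau>] by auto

lemma sb_square: assumes x: "x \<in> {0..7/9}" shows "(sb x)\<^sup>2 = 1 + avg (arc_h \<tau> sb) x"
proof -
  have "0 \<le> 1 + avg (arc_h \<tau> sb) x"
    using avg_arc_h_bounds(1)[OF arc_in_set[OF \<tau>] x \<tau>] rho_bounds[OF x] by simp
  then show ?thesis using arc_fixed[OF \<tau> x] unfolding arc_T_def by (metis real_sqrt_pow2)
qed

definition "sa' x = (2 * x * ((5 - 4 * smu \<tau> x) * sb x - sb x ^ 3) - 4 * smu \<tau> x * (1 - x\<^sup>2) - 3 * (1 - x\<^sup>2) * ((sb x)\<^sup>2 - 1))
   / (x * (1 + x\<^sup>2))"

lemma DERIV_sb_square: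
  assumes x: "0 < x" "x \<le> 7/9"
  shows "((\<lambda>x. (sb x)\<^sup>2) has_real_derivative sa' x) (at x within {0..7/9})"
proof -
  have x': "x \<in> {0..7/9}" using x by simp
  have "((\<lambda>x. 1 + avg (arc_h \<tau> sb) x) has_real_derivative 3 * (1 - x\<^sup>2) / (x * (1 + x\<^sup>2)) * (arc_h \<tau> sb x - avg (arc_h \<tau> sb) x)) (at x within {0..7/9})"
    using DERIV_avg[OF arc_h_cont[OF arc_in_set[OF \<tau>]] x] by (auto intro!: derivative_eq_intros)
  moreover have "3 * (1 - x\<^sup>2) / (x * (1 + x\<^sup>2)) * (arc_h \<tau> sb x - avg (arc_h \<tau> sb) x) = sa' x"
  proof -
    define q B where "q = 1 - x\<^sup>2" and "B = (5 - 4 * smu \<tau> x) * sb x - sb x ^ 3"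
    have q: "q > 0" unfolding q_def using one_minus_square_pos[OF x'] .
    have "3 * q * (2 * x / (3 * q) * B - 4/3 * smu \<tau> x - ((sb x)\<^sup>2 - 1)) = 2 * x * B - 4 * smu \<tau> x * q - 3 * q * ((sb x)\<^sup>2 - 1)"
      using q by (simp add: field_simps)
    moreover have "avg (arc_h \<tau> sb) x = (sb x)\<^sup>2 - 1" using sb_square[OF x'] by simp
    moreover have "arc_h \<tau> sb x = 2 * x / (3 * q) * B - 4/3 * smu \<tau> x" unfolding arc_h_def q_def B_def smu_def by simp
    ultimately show ?thesis unfolding sa'_def q_def[symmetric] B_def[symmetric] by simp
  qed
  ultimately have D: "((\<lambda>x. 1 + avg (arc_h \<tau> sb) x) has_real_derivative sa' x) (at x within {0..7/9})" by simp
  show ?thesis by (rule has_field_derivative_transform_within[where d=1, OF D]) (use x sb_square in auto)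
qed

lemma DERIV_sb:
  assumes x: "0 < x" "x \<le> 7/9"
  shows "(sb has_real_derivative sa' x / (2 * sb x)) (at x within {0..7/9})"
proof -
  have x': "x \<in> {0..7/9}" using x by simp
  have "((\<lambda>x. sqrt ((sb x)\<^sup>2)) has_real_derivative inverse (sqrt ((sb x)\<^sup>2)) / 2 * sa' x) (at x within {0..7/9})"
    by (rule DERIV_chain2[OF DERIV_real_sqrt DERIV_sb_square[OF x]]) (use sb_pos[OF x'] in auto)
  moreover have "inverse (sqrt ((sb x)\<^sup>2)) / 2 * sa' x = sa' x / (2 * sb x)"
    using sb_pos[OF x'] by (simp add: field_simps)
  ultimately have D: "((\<lambda>x. sqrt ((sb x)\<^sup>2)) has_real_derivative sa' x / (2 * sb x)) (at x within {0..7/9})"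
    by (rule DERIV_cong)
  show ?thesis
  proof (rule has_field_derivative_transform_within[where d=1, OF D])
    show "sqrt ((sb z)\<^sup>2) = sb z" if "z \<in> {0..7/9}" for z using sb_pos[OF that] by simp
  qed (use x in auto)
qed

lemma sb_zero: "(sb 0)\<^sup>2 = 1 - 4/3 * smu \<tau> 0"
  using sb_square[of 0] unfolding avg_def arc_h_def smu_def by simp

text \<open>This is x (1 + x^2) times the defect of the squared barrier in the equation for b^2,
  with \<open>smu\<close> set to 0. A positive residual makes a lower barrier, a negative one an
  upper barrier.\<close>

lemma barrier_residual:
  fixes e k x :: real
  defines "L \<equiv> barrier e k x"
  shows "2 * x * (5 * L - L ^ 3) - 3 * (1 - x\<^sup>2) * (L\<^sup>2 - 1) - x * (1 + x\<^sup>2) * (2 * L * (1 - 2 * k * x))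
   = 3 * (1 - e * e) + 2 * (e - e * e * e) * x + (2 - 3 * e * e + 10 * e * k) * x\<^sup>2 + (2 * k - 2 * e + 6 * e * e * k) * x ^ 3
     + (10 * e * k - 1 - 7 * k * k) * x ^ 4 + (6 * k - 6 * e * k * k) * x ^ 5 - 7 * k * k * x ^ 6 + 2 * k * k * k * x ^ 7"
  unfolding L_def barrier_def by (simp add: algebra_simps eval_nat_numeral)

text \<open>Where b meets the barrier, b^2 has the larger slope: the residual is at least 5/1000,
  far above the \<open>smu\<close> terms. The start 999/1000 supplies the constant 3 (1 - e^2) =
  0.005997, and k = 14/100 keeps the remaining terms nonnegative up to 7/9.\<close>

lemma barrier_low: assumes x: "x \<in> {0..7/9}" shows "barrier (999/1000) (14/100) x < sb x"
proof -
  define L where "L x = barrier (999/1000) (14/100) x" for x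
  have Lp: "L x > 0" "L x \<le> 2" if "x \<in> {0..7/9}" for x
  proof -
    have "x * x \<le> 1 * x" using that by (intro mult_right_mono) auto
    then show "L x > 0" using that unfolding L_def barrier_def by (simp add: power2_eq_square)
    have "0 \<le> x" "x \<le> 7/9" using that by auto
    then show "L x \<le> 2" using zero_le_square[of x] unfolding L_def barrier_def power2_eq_square by linarith
  qed
  have L': "((\<lambda>x. (L x)\<^sup>2) has_real_derivative 2 * L x * (1 - 2 * (14/100) * x)) (at x within {0..7/9})" for x
  proof -
    have "(L has_real_derivative 1 - 2 * (14/100) * x) (at x within {0..7/9})"
      unfolding L_def barrier_def by (auto intro!: derivative_eq_intros)
    from DERIV_power[OF this, of 2] show ?thesis by (simp add: mult_ac)
  qed
  have "(sb x)\<^sup>2 - (L x)\<^sup>2 > 0"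
  proof (rule barrier_positive[OF _ _ _ x])
    show "continuous_on {0..7/9} (\<lambda>x. (sb x)\<^sup>2 - (L x)\<^sup>2)"
      unfolding L_def barrier_def by (intro continuous_intros sb_cont)
    show "(sb 0)\<^sup>2 - (L 0)\<^sup>2 > 0" unfolding sb_zero L_def barrier_def using smu_bounds[of 0] by (simp add: power2_eq_square)
    fix x :: real assume xx: "0 < x" "x \<le> 7/9" and z: "(sb x)\<^sup>2 - (L x)\<^sup>2 = 0"
    have x': "x \<in> {0..7/9}" using xx by simp
    have e: "sb x = L x" using z sb_pos[OF x'] Lp(1)[OF x'] by (simp add: power2_eq_iff_nonneg)
    define m where "m = smu \<tau> x"
    have m: "0 < m" "m \<le> 1 / 10 ^ 9" using smu_bounds x' unfolding m_def by auto
    define res where "res = 2 * x * (5 * L x - L x ^ 3) - 3 * (1 - x\<^sup>2) * ((L x)\<^sup>2 - 1) - x * (1 + x\<^sup>2) * (2 * L x * (1 - 2 * (14/100) * x))"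
    have res: "res \<ge> 5 / 1000"
    proof -
      have g1: "(x - a)\<^sup>2 = x\<^sup>2 - (2 * a * x - a * a)"
        and g2: "(x - a)\<^sup>2 * (x + 2 * a) = x ^ 3 - (3 * (a * a) * x - 2 * (a * a * a))" for a
        by (simp_all add: algebra_simps power3_eq_cube power2_eq_square)
      \<comment> \<open>Tangents at 57/100, near the point where the polynomial that remains after
        splitting off \<open>x\<^sup>2\<close> is smallest.\<close>
      have "0 \<le> (x - 57/100)\<^sup>2" by simp
      then have t1: "x\<^sup>2 \<ge> 114/100 * x - 3249/10000" unfolding g1 by simp
      have "0 \<le> (x - 57/100)\<^sup>2 * (x + 2 * (57/100))" using xx by simp
      then have "x ^ 3 \<ge> 9747/10000 * x - 370386/1000000" unfolding g2 by simp
      note t = t1 this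
      have x4: "x ^ 4 \<le> 7/9 * x ^ 3" using xx mult_right_mono[of x "7/9" "x ^ 3"] by (simp add: eval_nat_numeral)
      have "0 \<le> 404597/1000000 - 87967916/100000000 * x + 2614/10000 * x\<^sup>2 + 7225176/10000000 * x ^ 3 - 1372/10000 * x ^ 4 + 5488/1000000 * x ^ 5"
        using t x4 xx zero_le_power[of x 5] by simp
      then have "0 \<le> x\<^sup>2 * (404597/1000000 - 87967916/100000000 * x + 2614/10000 * x\<^sup>2 + 7225176/10000000 * x ^ 3 - 1372/10000 * x ^ 4 + 5488/1000000 * x ^ 5)"
        by simp
      also have "\<dots> = res - 5997/1000000 - 3994002/1000000000 * x"
        unfolding res_def L_def barrier_residual by (simp add: algebra_simps eval_nat_numeral)
      finally show ?thesis using xx by simp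
    qed
    have N: "x * (1 + x\<^sup>2) > 0" using xx one_plus_square_pos(1)[of x] by simp
    have D: "((\<lambda>x. (sb x)\<^sup>2 - (L x)\<^sup>2) has_real_derivative sa' x - 2 * L x * (1 - 2 * (14/100) * x)) (at x within {0..7/9})"
      by (intro DERIV_diff DERIV_sb_square xx L')
    have E: "sa' x - 2 * L x * (1 - 2 * (14/100) * x) = (res - 8 * m * x * L x - 4 * m * (1 - x\<^sup>2)) / (x * (1 + x\<^sup>2))"
    proof -
      have "sa' x * (x * (1 + x\<^sup>2)) = 2 * x * ((5 - 4 * m) * L x - L x ^ 3) - 4 * m * (1 - x\<^sup>2) - 3 * (1 - x\<^sup>2) * ((L x)\<^sup>2 - 1)"
        unfolding sa'_def e m_def using xx one_plus_square_pos(2)[of x] by simp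
      then have "(sa' x - 2 * L x * (1 - 2 * (14/100) * x)) * (x * (1 + x\<^sup>2)) = res - 8 * m * x * L x - 4 * m * (1 - x\<^sup>2)"
        unfolding res_def by (simp only: left_diff_distrib) (simp add: algebra_simps)
      then show ?thesis using xx one_plus_square_pos(2)[of x] by (simp add: eq_divide_eq)
    qed
    have P: "res - 8 * m * x * L x - 4 * m * (1 - x\<^sup>2) > 0"
    proof -
      have 1: "m * (x * L x) \<le> 1 / 10 ^ 9 * (1 * 2)" using m xx Lp[OF x'] by (intro mult_mono) auto
      have 2: "m * (1 - x\<^sup>2) \<le> 1 / 10 ^ 9 * 1" using m one_minus_square_pos[OF x'] by (intro mult_mono) auto
      have "m * (x * L x) \<le> 1 / 10 ^ 6" "m * (1 - x\<^sup>2) \<le> 1 / 10 ^ 6"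
        by (rule order_trans[OF 1], simp) (rule order_trans[OF 2], simp)
      moreover have "8 * m * x * L x = 8 * (m * (x * L x))" "4 * m * (1 - x\<^sup>2) = 4 * (m * (1 - x\<^sup>2))" by simp_all
      ultimately show ?thesis using res by simp
    qed
    show "\<exists>d>0. ((\<lambda>x. (sb x)\<^sup>2 - (L x)\<^sup>2) has_real_derivative d) (at x within {0..7/9})"
      using DERIV_cong[OF D E] divide_pos_pos[OF P N] by blast
  qed
  then have "(L x)\<^sup>2 < (sb x)\<^sup>2" by simp
  then show ?thesis using sb_pos[OF x] unfolding L_def[symmetric] by (auto elim!: power2_less_imp_less)
qed

text \<open>For k = 11/100 the quadratic term of the residual still has the wrong sign, so the start
  must exceed 1: for small x the constant - 0.006003 prevails, for larger x the cubic term. The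
  \<open>smu\<close> terms have the favourable sign here.\<close>

lemma barrier_high: assumes x: "x \<in> {0..7/9}" shows "sb x < barrier (1001/1000) (11/100) x"
proof -
  define L where "L x = barrier (1001/1000) (11/100) x" for x
  have Lp: "L x > 0" "L x \<le> 2" if "x \<in> {0..7/9}" for x
  proof -
    have "x * x \<le> 1 * x" using that by (intro mult_right_mono) auto
    then show "L x > 0" using that unfolding L_def barrier_def by (simp add: power2_eq_square)
    have "0 \<le> x" "x \<le> 7/9" using that by auto
    then show "L x \<le> 2" using zero_le_square[of x] unfolding L_def barrier_def power2_eq_square by linarith
  qed
  have L': "((\<lambda>x. (L x)\<^sup>2) has_real_derivative 2 * L x * (1 - 2 * (11/100) * x)) (at x within {0..7/9})" for x
  proof -
    have "(L has_real_derivative 1 - 2 * (11/100) * x) (at x within {0..7/9})"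
      unfolding L_def barrier_def by (auto intro!: derivative_eq_intros)
    from DERIV_power[OF this, of 2] show ?thesis by (simp add: mult_ac)
  qed
  have "(L x)\<^sup>2 - (sb x)\<^sup>2 > 0"
  proof (rule barrier_positive[OF _ _ _ x])
    show "continuous_on {0..7/9} (\<lambda>x. (L x)\<^sup>2 - (sb x)\<^sup>2)"
      unfolding L_def barrier_def by (intro continuous_intros sb_cont)
    show "(L 0)\<^sup>2 - (sb 0)\<^sup>2 > 0" unfolding sb_zero L_def barrier_def using smu_bounds[of 0] by (simp add: power2_eq_square)
    fix x :: real assume xx: "0 < x" "x \<le> 7/9" and z: "(L x)\<^sup>2 - (sb x)\<^sup>2 = 0"
    have x': "x \<in> {0..7/9}" using xx by simp
    have e: "sb x = L x" using z sb_pos[OF x'] Lp(1)[OF x'] by (simp add: power2_eq_iff_nonneg)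
    define m where "m = smu \<tau> x"
    have m: "0 < m" "m \<le> 1 / 10 ^ 9" using smu_bounds x' unfolding m_def by auto
    define res where "res = 2 * x * (5 * L x - L x ^ 3) - 3 * (1 - x\<^sup>2) * ((L x)\<^sup>2 - 1) - x * (1 + x\<^sup>2) * (2 * L x * (1 - 2 * (11/100) * x))"
    have res: "res < 0"
    proof -
      have x4: "x ^ 4 \<le> 7/9 * x ^ 3" "x ^ 5 \<le> 49/81 * x ^ 3" "x ^ 7 \<le> 1 * x ^ 3"
        using xx mult_right_mono[of x "7/9" "x ^ 3"] mult_right_mono[of "x\<^sup>2" "49/81" "x ^ 3"] mult_right_mono[of "x ^ 4" 1 "x ^ 3"]
          power_mono[of x "7/9" 2] power_le_one[of x 4]
        by (simp_all add: eval_nat_numeral)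
      have e: "res = - (6003/1000000) - 4006002/1000000000 * x + 95097/1000000 * x\<^sup>2 - 112067934/100000000 * x ^ 3
         + 164/10000 * x ^ 4 + 5873274/10000000 * x ^ 5 - 847/10000 * x ^ 6 + 2662/1000000 * x ^ 7"
        unfolding res_def L_def barrier_residual by (simp add: algebra_simps eval_nat_numeral)
      \<comment> \<open>Lets the negative cubic term, with the negative linear one, cover the
        positive quadratic term.\<close>
      have "0 \<le> x * (x - 6/100)\<^sup>2" using xx by simp
      then have "x ^ 3 \<ge> 12/100 * x\<^sup>2 - 36/10000 * x" by (simp add: algebra_simps power2_eq_square power3_eq_cube)
      moreover have "0 \<le> x ^ 6" "0 \<le> x ^ 3" "0 \<le> x\<^sup>2" "x\<^sup>2 \<le> 1" using xx by (auto simp: power_le_one)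
      ultimately show ?thesis unfolding e using x4 xx by linarith
    qed
    have N: "x * (1 + x\<^sup>2) > 0" using xx one_plus_square_pos(1)[of x] by simp
    have D: "((\<lambda>x. (L x)\<^sup>2 - (sb x)\<^sup>2) has_real_derivative 2 * L x * (1 - 2 * (11/100) * x) - sa' x) (at x within {0..7/9})"
      by (intro DERIV_diff DERIV_sb_square xx L')
    have E: "2 * L x * (1 - 2 * (11/100) * x) - sa' x = (- res + 8 * m * x * L x + 4 * m * (1 - x\<^sup>2)) / (x * (1 + x\<^sup>2))"
    proof -
      have "sa' x * (x * (1 + x\<^sup>2)) = 2 * x * ((5 - 4 * m) * L x - L x ^ 3) - 4 * m * (1 - x\<^sup>2) - 3 * (1 - x\<^sup>2) * ((L x)\<^sup>2 - 1)"
        unfolding sa'_def e m_def using xx one_plus_square_pos(2)[of x] by simp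
      then have "(2 * L x * (1 - 2 * (11/100) * x) - sa' x) * (x * (1 + x\<^sup>2)) = - res + 8 * m * x * L x + 4 * m * (1 - x\<^sup>2)"
        unfolding res_def by (simp only: left_diff_distrib) (simp add: algebra_simps)
      then show ?thesis using xx one_plus_square_pos(2)[of x] by (simp add: eq_divide_eq)
    qed
    have P: "- res + 8 * m * x * L x + 4 * m * (1 - x\<^sup>2) > 0"
    proof -
      have "0 \<le> 8 * m * x * L x" "0 \<le> 4 * m * (1 - x\<^sup>2)" using m xx Lp[OF x'] one_minus_square_pos[OF x'] by auto
      then show ?thesis using res by linarith
    qed
    show "\<exists>d>0. ((\<lambda>x. (L x)\<^sup>2 - (sb x)\<^sup>2) has_real_derivative d) (at x within {0..7/9})"
      using DERIV_cong[OF D E] divide_pos_pos[OF P N] by blast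
  qed
  then have "(sb x)\<^sup>2 < (L x)\<^sup>2" by simp
  then show ?thesis using Lp[OF x] unfolding L_def[symmetric] by (auto elim!: power2_less_imp_less)
qed

text \<open>The upper barrier is increasing on [0, 7/9] and is evaluated at the right end. Remaining
  below 3 is what makes \<open>sk\<close>, and with it v'' on the arc, positive.\<close>

lemma sb_square_less: assumes x: "x \<in> {0..7/9}" shows "(sb x)\<^sup>2 \<le> 2935/1000"
proof -
  have g: "(c - x) * (1 - k * (c + x)) = c - k * (c * c) - (x - k * x\<^sup>2)" for c k
    by (simp add: algebra_simps power2_eq_square)
  have "0 \<le> (7/9 - x) * (1 - 11/100 * (7/9 + x))" using x by (intro mult_nonneg_nonneg) auto
  then have "x - 11/100 * x\<^sup>2 \<le> 7/9 - 11/100 * (7/9 * (7/9))" unfolding g by simp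
  then have "sb x \<le> 17123/10000" using barrier_high[OF x] unfolding barrier_def by simp
  then have "(sb x)\<^sup>2 \<le> (17123/10000)\<^sup>2" using sb_pos[OF x] by (intro power_mono) auto
  then show ?thesis by (simp add: power2_eq_square)
qed

definition "sk x = 3 - 4 * smu \<tau> x - (sb x)\<^sup>2"

lemma sk_pos: assumes x: "x \<in> {0..7/9}" shows "6/100 \<le> sk x" "sk x \<le> 3"
proof -
  have "0 < smu \<tau> x" "smu \<tau> x \<le> 1 / 1000" using smu_bounds(1)[of x] smu_bounds(2)[OF x] by auto
  then show "6/100 \<le> sk x" "sk x \<le> 3"
    unfolding sk_def using sb_square_less[OF x] zero_le_power2[of "sb x"] by linarith+
qed

lemma ss_nonneg: "0 \<le> x \<Longrightarrow> 0 \<le> ss x" unfolding ss_def by simp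

lemma cc_pos: "x \<in> {0..7/9} \<Longrightarrow> 0 < cc x"
  unfolding cc_def using one_minus_square_pos[of x] one_plus_square_pos(1)[of x] by simp

lemma yy_pos: assumes x: "x \<in> {0..7/9}" shows "0 < yy \<tau> x"
  unfolding yy_def using cc_pos[OF x] ss_nonneg[of x] sb_pos[OF x] x by (simp add: add_pos_nonneg)

lemma yy_cont: "continuous_on {0..7/9} (yy \<tau>)"
  unfolding yy_def by (intro continuous_intros cc_cont ss_cont sb_cont)

text \<open>As \<open>yy\<close> is 1/v', this is the singular equation v'' = sk / (2 v yy^2)
  transported to x; the quotient by x that occurs in the equation of b has cancelled.\<close>

lemma DERIV_yy:
  assumes x: "0 < x" "x \<le> 7/9"
  shows "(yy \<tau> has_real_derivative yy \<tau> x * sk x / ((1 + x\<^sup>2) * sb x)) (at x within {0..7/9})"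
proof -
  have x': "x \<in> {0..7/9}" using x by simp
  define N b m where "N = 1 + x\<^sup>2" and "b = sb x" and "m = smu \<tau> x"
  have N: "N > 0" unfolding N_def by (rule one_plus_square_pos)
  have b: "b > 0" unfolding b_def by (rule sb_pos[OF x'])
  have D: "(yy \<tau> has_real_derivative - (2 / N) * ss x + (2 / N * cc x * b + sa' x / (2 * b) * ss x)) (at x within {0..7/9})"
    unfolding yy_def N_def b_def by (intro DERIV_add DERIV_mult DERIV_cc DERIV_ss DERIV_sb x)
  have E: "- (2 / N) * ss x + (2 / N * cc x * b + sa' x / (2 * b) * ss x) = yy \<tau> x * sk x / (N * b)"
  proof -
    have C: "cc x = (1 - x\<^sup>2) / N" and S: "ss x = 2 * x / N" unfolding cc_def ss_def N_def by auto
    have sa: "sa' x * (x * N) = N * (ss x * ((5 - 4 * m) * b - b ^ 3) - 4 * m * cc x - 3 * cc x * (b\<^sup>2 - 1))"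
    proof -
      have e: "sa' x * (x * N) = 2 * x * ((5 - 4 * m) * b - b ^ 3) - 4 * m * (1 - x\<^sup>2) - 3 * (1 - x\<^sup>2) * (b\<^sup>2 - 1)"
        unfolding sa'_def m_def b_def N_def using x one_plus_square_pos(2)[of x] by simp
      have "1 - x\<^sup>2 = N * cc x" "2 * x = N * ss x" using N unfolding C S by auto
      then show ?thesis unfolding e by (simp only:) (simp add: algebra_simps)
    qed
    have "sa' x * ss x = 2 / N * (sa' x * (x * N)) / N" unfolding S using N by simp
    also have "\<dots> = 2 / N * (ss x * ((5 - 4 * m) * b - b ^ 3) - 4 * m * cc x - 3 * cc x * (b\<^sup>2 - 1))" unfolding sa using N by simp
    finally have s2: "sa' x * ss x = 2 / N * (ss x * ((5 - 4 * m) * b - b ^ 3) - 4 * m * cc x - 3 * cc x * (b\<^sup>2 - 1))" .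
    have "- (2 / N) * ss x + (2 / N * cc x * b + sa' x / (2 * b) * ss x)
      = (- 2 * b * ss x + 2 * b * cc x * b) / (N * b) + sa' x * ss x / (2 * b)"
      using N b by (simp add: field_simps)
    also have "\<dots> = (- 2 * b * ss x + 2 * b * cc x * b + (ss x * ((5 - 4 * m) * b - b ^ 3) - 4 * m * cc x - 3 * cc x * (b\<^sup>2 - 1))) / (N * b)"
      unfolding s2 using N b by (simp add: field_simps)
    also have "- 2 * b * ss x + 2 * b * cc x * b + (ss x * ((5 - 4 * m) * b - b ^ 3) - 4 * m * cc x - 3 * cc x * (b\<^sup>2 - 1)) = yy \<tau> x * sk x"
      unfolding yy_def sk_def b_def m_def by (simp add: algebra_simps power2_eq_square power3_eq_cube)
    finally show ?thesis .
  qed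
  from DERIV_cong[OF D E] show ?thesis unfolding N_def b_def .
qed

end

section \<open>The switching condition\<close>

text \<open>With \<open>s = p / v\<close> and \<open>\<epsilon> = M\<^sup>-\<^sup>2\<close> on the line \<open>v = M + w p\<close>, \<open>2 \<epsilon> switch_F (p / v) w \<epsilon>\<close> is the integral
  of \<open>p\<close> times the Euler-Lagrange defect, so \<open>switch_F = 0\<close> says that \<open>\<psi> 0 = 0\<close>.\<close>

definition switch_n :: "real \<Rightarrow> real \<Rightarrow> real \<Rightarrow> real" where
  "switch_n s w \<epsilon> = (let j = 1 - s * w; q = (1 - s\<^sup>2) * w\<^sup>2 in
     (j * (3 * q - j\<^sup>2) - \<epsilon> * j ^ 3 * (q + j\<^sup>2)) / (1 + \<epsilon> * j\<^sup>2) ^ 3)"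

definition switch_k :: "real \<Rightarrow> real \<Rightarrow> real \<Rightarrow> real" where
  "switch_k w \<epsilon> s = s * switch_n s w \<epsilon> / sqrt (1 - s\<^sup>2)"

definition switch_F :: "real \<Rightarrow> real \<Rightarrow> real \<Rightarrow> real" where
  "switch_F \<sigma> w \<epsilon> = integral {0..\<sigma>} (switch_k w \<epsilon>)"

text \<open>The ranges cover what occurs for a tangent line at an angle in [2/3, 7/9]: p / v is at
  most \<open>cc (2/3)\<close> = 5/13, the slope lies in [0.524, 0.54], and the value of v at p = 0
  exceeds 1000. The letters j, q, d stand for M / v, (1 - s^2) w^2 and 1 + \<epsilon> j^2.\<close>

context
  fixes s w \<epsilon> :: real
  assumes s: "0 \<le> s" "s \<le> 2/5" and w: "1/2 \<le> w" "w \<le> 3/5" and e: "0 \<le> \<epsilon>" "\<epsilon> \<le> 1 / 10 ^ 6"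
begin

definition "nj = 1 - s * w"
definition "nq = (1 - s\<^sup>2) * w\<^sup>2"
definition "nd = 1 + \<epsilon> * nj\<^sup>2"
definition "nnum = nj * (3 * nq - nj\<^sup>2) - \<epsilon> * nj ^ 3 * (nq + nj\<^sup>2)"

lemma n_bounds: "76/100 \<le> nj" "nj \<le> 1" "21/100 \<le> nq" "nq \<le> 36/100" "1 \<le> nd" "nd \<le> 2"
  "0 \<le> s * w" "s * w \<le> 24/100" "84/100 \<le> 1 - s\<^sup>2" "1 - s\<^sup>2 \<le> 1"
proof -
  have p_sw: "0 \<le> s * w" "s * w \<le> 2/5 * (3/5)" using s w mult_mono'[of s "2/5" w "3/5"] by auto
  then show "0 \<le> s * w" "s * w \<le> 24/100" by auto
  show nj: "76/100 \<le> nj" "nj \<le> 1" using p_sw unfolding nj_def by auto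
  have "s\<^sup>2 \<le> (2/5)\<^sup>2" using s by (intro power_mono) auto
  then show s2: "84/100 \<le> 1 - s\<^sup>2" "1 - s\<^sup>2 \<le> 1" by (auto simp: power2_eq_square)
  have w2: "(1/2)\<^sup>2 \<le> w\<^sup>2" "w\<^sup>2 \<le> (3/5)\<^sup>2" using w by (auto intro!: power_mono)
  have "84/100 * (1/2)\<^sup>2 \<le> nq" unfolding nq_def by (rule mult_mono) (use w2 s2 in simp_all)
  moreover have "nq \<le> 1 * (3/5)\<^sup>2" unfolding nq_def by (rule mult_mono) (use w2 s2 in simp_all)
  ultimately have "84/100 * (1/2)\<^sup>2 \<le> nq" "nq \<le> 1 * (3/5)\<^sup>2" by auto
  then show "21/100 \<le> nq" "nq \<le> 36/100" by (auto simp: power2_eq_square)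
  show "1 \<le> nd" unfolding nd_def using e by simp
  have "\<epsilon> * nj\<^sup>2 \<le> 1 * 1" using e nj by (intro mult_mono) (auto simp: power_le_one)
  then show "nd \<le> 2" unfolding nd_def by simp
qed

lemma small_eps: "\<bar>t\<bar> \<le> 100 \<Longrightarrow> \<bar>\<epsilon> * t\<bar> \<le> 1 / 1000"
  using mult_mono[of \<epsilon> "1 / 10 ^ 6" "\<bar>t\<bar>" 100] e by (simp add: abs_mult)

lemma nnum_bounds: "\<bar>nnum\<bar> \<le> 2" "nnum \<ge> nj * (3 * nq - nj\<^sup>2) - 1 / 1000"
proof -
  have j2: "0 \<le> nj\<^sup>2" "nj\<^sup>2 \<le> 1" "0 \<le> nj ^ 3" "nj ^ 3 \<le> 1" using n_bounds by (auto simp: power_le_one)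
  have "\<bar>3 * nq - nj\<^sup>2\<bar> \<le> 108/100" using n_bounds(3,4) j2(1,2) by linarith
  then have "\<bar>nj * (3 * nq - nj\<^sup>2)\<bar> \<le> 1 * (108/100)" unfolding abs_mult using n_bounds(1,2) by (intro mult_mono) auto
  moreover have "\<bar>nj ^ 3 * (nq + nj\<^sup>2)\<bar> \<le> 1 * 2" unfolding abs_mult using n_bounds j2 by (intro mult_mono) auto
  then have "\<bar>\<epsilon> * (nj ^ 3 * (nq + nj\<^sup>2))\<bar> \<le> 1 / 1000" by (intro small_eps) simp
  ultimately show "\<bar>nnum\<bar> \<le> 2" "nnum \<ge> nj * (3 * nq - nj\<^sup>2) - 1 / 1000"
    unfolding nnum_def mult.assoc by linarith+
qed

lemma switch_n_eq: "switch_n s w \<epsilon> = nnum / nd ^ 3"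
  unfolding switch_n_def nnum_def nd_def nq_def nj_def Let_def ..

lemma switch_n_bound: "\<bar>switch_n s w \<epsilon>\<bar> \<le> 2"
proof -
  have "\<bar>switch_n s w \<epsilon>\<bar> = \<bar>nnum\<bar> / nd ^ 3" unfolding switch_n_eq using n_bounds by simp
  also have "\<dots> \<le> 2 / 1" using n_bounds nnum_bounds by (intro frac_le) auto
  finally show ?thesis by simp
qed

lemma DERIV_switch_quotient:
  fixes J Q :: "real \<Rightarrow> real"
  assumes J: "(J has_real_derivative J') (at x within A)" and Q: "(Q has_real_derivative Q') (at x within A)"
    and nz: "1 + \<epsilon> * (J x)\<^sup>2 \<noteq> 0"
  shows "((\<lambda>x. (J x * (3 * Q x - (J x)\<^sup>2) - \<epsilon> * (J x) ^ 3 * (Q x + (J x)\<^sup>2)) / (1 + \<epsilon> * (J x)\<^sup>2) ^ 3) has_real_derivative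
     ((J' * (3 * Q x - (J x)\<^sup>2) + J x * (3 * Q' - 2 * J x * J')
        - \<epsilon> * (3 * (J x)\<^sup>2 * J' * (Q x + (J x)\<^sup>2) + (J x) ^ 3 * (Q' + 2 * J x * J'))) * (1 + \<epsilon> * (J x)\<^sup>2) ^ 3
      - (J x * (3 * Q x - (J x)\<^sup>2) - \<epsilon> * (J x) ^ 3 * (Q x + (J x)\<^sup>2)) * (3 * (1 + \<epsilon> * (J x)\<^sup>2)\<^sup>2 * (2 * \<epsilon> * J x * J')))
     / ((1 + \<epsilon> * (J x)\<^sup>2) ^ 3 * (1 + \<epsilon> * (J x)\<^sup>2) ^ 3)) (at x within A)"
proof (rule DERIV_divide)
  show "((\<lambda>x. J x * (3 * Q x - (J x)\<^sup>2) - \<epsilon> * (J x) ^ 3 * (Q x + (J x)\<^sup>2)) has_real_derivative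
     J' * (3 * Q x - (J x)\<^sup>2) + J x * (3 * Q' - 2 * J x * J')
        - \<epsilon> * (3 * (J x)\<^sup>2 * J' * (Q x + (J x)\<^sup>2) + (J x) ^ 3 * (Q' + 2 * J x * J'))) (at x within A)"
    by (rule DERIV_cong[OF DERIV_diff[OF DERIV_mult[OF J DERIV_diff[OF DERIV_cmult[OF Q, of 3] DERIV_power[OF J, of 2]]]
        DERIV_mult[OF DERIV_cmult[OF DERIV_power[OF J, of 3], of \<epsilon>] DERIV_add[OF Q DERIV_power[OF J, of 2]]]]])
      (simp add: algebra_simps eval_nat_numeral)
  show "((\<lambda>x. (1 + \<epsilon> * (J x)\<^sup>2) ^ 3) has_real_derivative 3 * (1 + \<epsilon> * (J x)\<^sup>2)\<^sup>2 * (2 * \<epsilon> * J x * J')) (at x within A)"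
    by (rule DERIV_cong[OF DERIV_power[OF DERIV_add[OF DERIV_const DERIV_cmult[OF DERIV_power[OF J, of 2]]]]])
      (simp add: eval_nat_numeral)
qed (use nz in simp)

text \<open>At \<epsilon> = 0 the derivative is 3 s j^2 + 3 (1 - s^2) w (2 j - s w), which is
  positive because j >= 76/100 and s w <= 24/100. The terms with \<epsilon> are negligible against
  it.\<close>

lemma DERIV_switch_n_w:
  "\<exists>d. ((\<lambda>w. switch_n s w \<epsilon>) has_real_derivative d) (at w within A) \<and> 0 \<le> d \<and> d \<le> 10"
proof -
  define dn where "dn = - s * (3 * nq - nj\<^sup>2) + nj * (6 * ((1 - s\<^sup>2) * w) + 2 * nj * s)
     - \<epsilon> * (- (3 * nj\<^sup>2 * s) * (nq + nj\<^sup>2) + nj ^ 3 * (2 * ((1 - s\<^sup>2) * w) - 2 * nj * s))"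
  define dd where "dd = - (2 * \<epsilon> * nj * s)"
  have nd0: "nd > 0" using n_bounds by simp
  have "((\<lambda>w. switch_n s w \<epsilon>) has_real_derivative (dn * nd ^ 3 - nnum * (3 * nd\<^sup>2 * dd)) / (nd ^ 3 * nd ^ 3)) (at w within A)"
  proof -
    have J: "((\<lambda>w. 1 - s * w) has_real_derivative - s) (at w within A)"
      by (auto intro!: derivative_eq_intros)
    have Q: "((\<lambda>w. (1 - s\<^sup>2) * w\<^sup>2) has_real_derivative 2 * ((1 - s\<^sup>2) * w)) (at w within A)"
      by (auto intro!: derivative_eq_intros)
    have "1 + \<epsilon> * (1 - s * w)\<^sup>2 \<noteq> 0" using nd0 unfolding nd_def nj_def by simp
    from DERIV_switch_quotient[OF J Q this] show ?thesis
      unfolding switch_n_def Let_def nj_def[symmetric] nq_def[symmetric] nd_def[symmetric] nnum_def[symmetric]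
      by (rule DERIV_cong) (simp add: dn_def dd_def algebra_simps)
  qed
  moreover have "(dn * nd ^ 3 - nnum * (3 * nd\<^sup>2 * dd)) / (nd ^ 3 * nd ^ 3) = (dn * nd - 3 * (nnum * dd)) / nd ^ 4"
    using nd0 by (simp add: field_simps eval_nat_numeral)
  moreover have "0 \<le> (dn * nd - 3 * (nnum * dd)) / nd ^ 4 \<and> (dn * nd - 3 * (nnum * dd)) / nd ^ 4 \<le> 10"
  proof -
    note b = n_bounds
    have j2: "0 \<le> nj\<^sup>2" "nj\<^sup>2 \<le> 1" "0 \<le> nj ^ 3" "nj ^ 3 \<le> 1" using b by (auto simp: power_le_one)
    define c where "c = (1 - s\<^sup>2) * w"
    have c: "42/100 \<le> c" "c \<le> 6/10" unfolding c_def using b w mult_mono[of "84/100" "1 - s\<^sup>2" "1/2" w] mult_mono[of "1 - s\<^sup>2" 1 w "3/5"] by auto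
    have q: "nq = c * w" unfolding nq_def c_def by (simp add: power2_eq_square)
    have main: "- s * (3 * nq - nj\<^sup>2) + nj * (6 * c + 2 * nj * s) = 3 * (s * nj\<^sup>2) + 3 * (c * (2 * nj - s * w))"
      unfolding q by (simp add: algebra_simps power2_eq_square)
    have m1: "0 \<le> s * nj\<^sup>2" "s * nj\<^sup>2 \<le> 2/5 * 1" using s j2 mult_mono'[of s "2/5" "nj\<^sup>2" 1] by auto
    have m2: "42/100 * (128/100) \<le> c * (2 * nj - s * w)" "c * (2 * nj - s * w) \<le> 6/10 * 2"
      using b c mult_mono'[of "42/100" c "128/100" "2 * nj - s * w"] mult_mono'[of c "6/10" "2 * nj - s * w" 2] by auto
    have t1: "\<bar>(3 * nj\<^sup>2 * s) * (nq + nj\<^sup>2)\<bar> \<le> 3 * 2" unfolding abs_mult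
      using b j2 s mult_mono[of "3 * nj\<^sup>2" 3 s 1] by (intro mult_mono) (auto simp: abs_mult)
    have "\<bar>nj * s\<bar> \<le> 1 * 1" unfolding abs_mult using b s by (intro mult_mono) auto
    then have njs: "\<bar>nj * s\<bar> \<le> 1" by simp
    have t2: "\<bar>nj ^ 3 * (2 * c - 2 * nj * s)\<bar> \<le> 1 * 4" unfolding abs_mult[of "nj ^ 3"]
      using b c j2 njs by (intro mult_mono) (auto simp: mult.assoc)
    have "\<bar>- (3 * nj\<^sup>2 * s) * (nq + nj\<^sup>2) + nj ^ 3 * (2 * c - 2 * nj * s)\<bar> \<le> 100" using t1 t2 unfolding mult_minus_left by linarith
    from small_eps[OF this] main m1 m2
    have dn: "1 \<le> dn" "dn \<le> 6" unfolding dn_def c_def[symmetric] by linarith+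
    have "\<bar>- (2 * (nj * s))\<bar> \<le> 100" using njs by linarith
    from small_eps[OF this] have dd: "\<bar>dd\<bar> \<le> 1 / 1000" unfolding dd_def by (simp add: mult_ac)
    have nn: "\<bar>nnum * dd\<bar> \<le> 2 * (1 / 1000)" unfolding abs_mult using nnum_bounds dd by (intro mult_mono) auto
    have "1 * 1 \<le> dn * nd" using dn b by (intro mult_mono) auto
    then have lo: "0 \<le> dn * nd - 3 * (nnum * dd)" using nn by linarith
    have "dn * nd \<le> 6 * nd" using dn b by (intro mult_right_mono) auto
    moreover have "1 / 100 \<le> 4 * nd" using b by simp
    ultimately have hi: "dn * nd - 3 * (nnum * dd) \<le> 10 * nd" using nn by linarith
    also have "\<dots> \<le> 10 * nd ^ 4" using self_le_power[of nd 4] b by simp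
    finally show ?thesis using lo nd0 by (simp add: divide_le_eq)
  qed
  ultimately show ?thesis by auto
qed

lemma DERIV_switch_n_e:
  "\<exists>d. ((\<lambda>\<epsilon>. switch_n s w \<epsilon>) has_real_derivative d) (at \<epsilon> within A) \<and> \<bar>d\<bar> \<le> 10"
proof -
  have nd0: "nd > 0" using n_bounds by simp
  have "((\<lambda>\<epsilon>. switch_n s w \<epsilon>) has_real_derivative (- (nj ^ 3 * (nq + nj\<^sup>2)) * nd ^ 3 - nnum * (3 * nd\<^sup>2 * nj\<^sup>2)) / (nd ^ 3 * nd ^ 3)) (at \<epsilon> within A)"
    unfolding switch_n_def Let_def nj_def[symmetric] nq_def[symmetric] using nd0
    by (auto intro!: derivative_eq_intros simp: nd_def nnum_def)
  moreover have "(- (nj ^ 3 * (nq + nj\<^sup>2)) * nd ^ 3 - nnum * (3 * nd\<^sup>2 * nj\<^sup>2)) / (nd ^ 3 * nd ^ 3)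
     = (- (nj ^ 3 * (nq + nj\<^sup>2)) * nd - 3 * (nnum * nj\<^sup>2)) / nd ^ 4"
    using nd0 by (simp add: field_simps eval_nat_numeral)
  moreover have "\<bar>(- (nj ^ 3 * (nq + nj\<^sup>2)) * nd - 3 * (nnum * nj\<^sup>2)) / nd ^ 4\<bar> \<le> 10"
  proof -
    note b = n_bounds
    have j2: "0 \<le> nj\<^sup>2" "nj\<^sup>2 \<le> 1" "0 \<le> nj ^ 3" "nj ^ 3 \<le> 1" using b by (auto simp: power_le_one)
    have t0: "0 \<le> nj ^ 3 * (nq + nj\<^sup>2)" using b j2 by auto
    have "nj ^ 3 * (nq + nj\<^sup>2) \<le> 1 * (136/100)" by (rule mult_mono') (use b j2 in linarith)+
    note t = t0 this
    have u: "\<bar>nnum * nj\<^sup>2\<bar> \<le> 2 * 1" unfolding abs_mult using nnum_bounds j2 by (intro mult_mono) auto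
    have "0 \<le> nj ^ 3 * (nq + nj\<^sup>2) * nd" "nj ^ 3 * (nq + nj\<^sup>2) * nd \<le> 136/100 * nd"
      using mult_right_mono[OF t(2), of nd] mult_nonneg_nonneg[OF t(1), of nd] b(5) by linarith+
    then have "\<bar>- (nj ^ 3 * (nq + nj\<^sup>2)) * nd - 3 * (nnum * nj\<^sup>2)\<bar> \<le> 10 * nd"
      using u b(5) unfolding mult_minus_left by linarith
    also have "\<dots> \<le> 10 * nd ^ 4" using self_le_power[of nd 4] b by simp
    finally show ?thesis using nd0 by (simp add: divide_le_eq)
  qed
  ultimately show ?thesis by auto
qed

end

section \<open>Dependence of the switching function on its arguments\<close>

lemma switch_n_mono_w:
  assumes s: "0 \<le> s" "s \<le> 2/5" and w: "1/2 \<le> w2" "w2 \<le> w1" "w1 \<le> 3/5" and e: "0 \<le> \<epsilon>" "\<epsilon> \<le> 1 / 10 ^ 6"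
  shows "0 \<le> switch_n s w1 \<epsilon> - switch_n s w2 \<epsilon>" "switch_n s w1 \<epsilon> - switch_n s w2 \<epsilon> \<le> 10 * (w1 - w2)"
proof -
  have d: "\<exists>d. ((\<lambda>w. switch_n s w \<epsilon>) has_real_derivative d) (at w) \<and> 0 \<le> d \<and> d \<le> 10" if "w2 \<le> w" "w \<le> w1" for w
    by (rule DERIV_switch_n_w[OF s _ _ e]) (use w that in auto)
  have "switch_n s w2 \<epsilon> \<le> switch_n s w1 \<epsilon>"
    by (rule DERIV_nonneg_imp_nondecreasing[OF w(2)]) (use d in blast)
  then show "0 \<le> switch_n s w1 \<epsilon> - switch_n s w2 \<epsilon>" by simp
  have "10 * w2 - switch_n s w2 \<epsilon> \<le> 10 * w1 - switch_n s w1 \<epsilon>"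
  proof (rule DERIV_nonneg_imp_nondecreasing[OF w(2)])
    fix w assume "w2 \<le> w" "w \<le> w1"
    from d[OF this] obtain d where d: "((\<lambda>w. switch_n s w \<epsilon>) has_real_derivative d) (at w)" "d \<le> 10" by blast
    have "((\<lambda>w. 10 * w - switch_n s w \<epsilon>) has_real_derivative 10 - d) (at w)"
      using d(1) by (auto intro!: derivative_eq_intros)
    then show "\<exists>y. ((\<lambda>w. 10 * w - switch_n s w \<epsilon>) has_real_derivative y) (at w) \<and> 0 \<le> y" using d(2) by force
  qed
  then show "switch_n s w1 \<epsilon> - switch_n s w2 \<epsilon> \<le> 10 * (w1 - w2)" by simp
qed

lemma switch_n_lipschitz_e:
  assumes s: "0 \<le> s" "s \<le> 2/5" and w: "1/2 \<le> w" "w \<le> 3/5" and e: "0 \<le> e1" "e1 \<le> 1 / 10 ^ 6" "0 \<le> e2" "e2 \<le> 1 / 10 ^ 6"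
  shows "\<bar>switch_n s w e1 - switch_n s w e2\<bar> \<le> 10 * \<bar>e1 - e2\<bar>"
proof -
  have d: "\<forall>e\<in>{0..1 / 10 ^ 6}. \<exists>d. ((\<lambda>e. switch_n s w e) has_real_derivative d) (at e within {0..1 / 10 ^ 6}) \<and> \<bar>d\<bar> \<le> 10"
    using DERIV_switch_n_e[OF s w] by auto
  then obtain D where D: "\<And>e. e \<in> {0..1 / 10 ^ 6} \<Longrightarrow> ((\<lambda>e. switch_n s w e) has_real_derivative D e) (at e within {0..1 / 10 ^ 6}) \<and> \<bar>D e\<bar> \<le> 10"
    by metis
  have "norm (switch_n s w e1 - switch_n s w e2) \<le> 10 * norm (e1 - e2)"
    by (rule field_differentiable_bound[of "{0..1 / 10 ^ 6}" _ D]) (use D e in auto)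
  then show ?thesis by simp
qed

text \<open>The Taylor coefficient 1/2 of 1/sqrt (1 - z) is enlarged to 6/10, which covers the
  higher terms for z <= 16/100, since then (1 - z) (1 + 6/10 z)^2 >= 1.\<close>

lemma weight_bounds:
  fixes s :: real
  assumes s: "0 \<le> s" "s \<le> 2/5"
  shows "1 \<le> 1 / sqrt (1 - s\<^sup>2)" "1 / sqrt (1 - s\<^sup>2) \<le> 1 + 6/10 * s\<^sup>2" "1 / sqrt (1 - s\<^sup>2) \<le> 11/10" "0 < sqrt (1 - s\<^sup>2)"
proof -
  define z where "z = s\<^sup>2"
  have "s\<^sup>2 \<le> (2/5)\<^sup>2" using s by (intro power_mono) auto
  then have z: "0 \<le> z" "z \<le> 16/100" unfolding z_def by (auto simp: power2_eq_square)
  have p: "sqrt (1 - z) > 0" using z by simp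
  then show "0 < sqrt (1 - s\<^sup>2)" unfolding z_def .
  have "sqrt (1 - z) \<le> 1" using z by simp
  then show "1 \<le> 1 / sqrt (1 - s\<^sup>2)" using p unfolding z_def by (simp add: le_divide_eq)
  have "1 / (1 + 6/10 * z) \<le> sqrt (1 - z)"
  proof (rule real_le_rsqrt)
    have "0 \<le> z * (2/10 - 84/100 * z - 36/100 * z * z)"
    proof (rule mult_nonneg_nonneg)
      have "z * z \<le> 1 * z" using z by (intro mult_right_mono) auto
      then show "0 \<le> 2/10 - 84/100 * z - 36/100 * z * z" using z by simp
    qed (use z in auto)
    then have "1 \<le> (1 - z) * (1 + 6/10 * z)\<^sup>2" by (simp add: field_simps power2_eq_square)
    then show "(1 / (1 + 6/10 * z))\<^sup>2 \<le> 1 - z" using z by (simp add: power_divide divide_le_eq)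
  qed
  then have "1 / sqrt (1 - z) \<le> 1 + 6/10 * z" using p z by (simp add: divide_le_eq mult.commute)
  then show "1 / sqrt (1 - s\<^sup>2) \<le> 1 + 6/10 * s\<^sup>2" "1 / sqrt (1 - s\<^sup>2) \<le> 11/10" using z unfolding z_def by auto
qed

lemma weight_mult_bounds:
  fixes s :: real
  assumes s: "0 \<le> s" "s \<le> 2/5"
  shows "0 \<le> s * (1 / sqrt (1 - s\<^sup>2))" "s * (1 / sqrt (1 - s\<^sup>2)) \<le> 1/2"
proof -
  note W = weight_bounds[OF s]
  show "0 \<le> s * (1 / sqrt (1 - s\<^sup>2))" using s W by (intro mult_nonneg_nonneg) auto
  have "s * (1 / sqrt (1 - s\<^sup>2)) \<le> 2/5 * (11/10)" using s W by (intro mult_mono) auto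
  then show "s * (1 / sqrt (1 - s\<^sup>2)) \<le> 1/2" by linarith
qed

lemma switch_k_cont:
  assumes \<sigma>: "\<sigma> \<le> 2/5" and e: "0 \<le> \<epsilon>"
  shows "continuous_on {0..\<sigma>} (switch_k w \<epsilon>)"
proof -
  have 1: "sqrt (1 - s\<^sup>2) \<noteq> 0" if "s \<in> {0..\<sigma>}" for s using weight_bounds(4)[of s] that \<sigma> by auto
  have 2: "(1 + \<epsilon> * (1 - s * w)\<^sup>2) ^ 3 \<noteq> 0" for s
  proof -
    have "0 \<le> \<epsilon> * (1 - s * w)\<^sup>2" using e by simp
    then show ?thesis by (smt (verit) power_not_zero)
  qed
  show ?thesis unfolding switch_k_def switch_n_def Let_def
    by (intro continuous_intros ballI 1 2)
qed

lemma switch_k_int: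
  assumes "0 \<le> a" "\<sigma> \<le> 2/5" "0 \<le> \<epsilon>" shows "switch_k w \<epsilon> integrable_on {a..\<sigma>}"
  by (rule integrable_continuous_real[OF continuous_on_subset[OF switch_k_cont[OF assms(2,3)]]]) (use assms in auto)

lemma switch_F_mono_w:
  assumes \<sigma>: "0 \<le> \<sigma>" "\<sigma> \<le> 2/5" and w: "1/2 \<le> w2" "w2 \<le> w1" "w1 \<le> 3/5" and e: "0 \<le> \<epsilon>" "\<epsilon> \<le> 1 / 10 ^ 6"
  shows "0 \<le> switch_F \<sigma> w1 \<epsilon> - switch_F \<sigma> w2 \<epsilon>" "switch_F \<sigma> w1 \<epsilon> - switch_F \<sigma> w2 \<epsilon> \<le> 2 * (w1 - w2)"
proof -
  note i = switch_k_int[OF order_refl \<sigma>(2) e(1)]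
  have b: "switch_k w2 \<epsilon> s \<le> switch_k w1 \<epsilon> s" "switch_k w1 \<epsilon> s \<le> switch_k w2 \<epsilon> s + 5 * (w1 - w2)" if s: "s \<in> {0..\<sigma>}" for s
  proof -
    have s': "0 \<le> s" "s \<le> 2/5" using s \<sigma> by auto
    define W where "W = s * (1 / sqrt (1 - s\<^sup>2))"
    have W: "0 \<le> W" "W \<le> 1/2" unfolding W_def by (rule weight_mult_bounds[OF s'])+
    have k: "switch_k w \<epsilon> s = W * switch_n s w \<epsilon>" for w unfolding switch_k_def W_def by simp
    note n = switch_n_mono_w[OF s' w e]
    show "switch_k w2 \<epsilon> s \<le> switch_k w1 \<epsilon> s" unfolding k using n W by (intro mult_left_mono) auto
    have "W * (switch_n s w1 \<epsilon> - switch_n s w2 \<epsilon>) \<le> 1/2 * (10 * (w1 - w2))" using n W by (intro mult_mono) auto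
    then show "switch_k w1 \<epsilon> s \<le> switch_k w2 \<epsilon> s + 5 * (w1 - w2)" unfolding k by (simp add: algebra_simps)
  qed
  show "0 \<le> switch_F \<sigma> w1 \<epsilon> - switch_F \<sigma> w2 \<epsilon>"
    unfolding switch_F_def using integral_le[OF i i b(1)] by simp
  have "switch_F \<sigma> w1 \<epsilon> \<le> integral {0..\<sigma>} (\<lambda>s. switch_k w2 \<epsilon> s + 5 * (w1 - w2))"
    unfolding switch_F_def by (intro integral_le integrable_add i b(2)) auto
  also have "\<dots> = switch_F \<sigma> w2 \<epsilon> + 5 * (w1 - w2) * \<sigma>"
    unfolding switch_F_def using \<sigma> by (subst integral_add[OF i]) auto
  also have "5 * (w1 - w2) * \<sigma> \<le> 5 * (w1 - w2) * (2/5)" using \<sigma> w by (intro mult_left_mono) auto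
  finally show "switch_F \<sigma> w1 \<epsilon> - switch_F \<sigma> w2 \<epsilon> \<le> 2 * (w1 - w2)" by linarith
qed

lemma switch_F_lipschitz_e:
  assumes \<sigma>: "0 \<le> \<sigma>" "\<sigma> \<le> 2/5" and w: "1/2 \<le> w" "w \<le> 3/5" and e: "0 \<le> e1" "e1 \<le> 1 / 10 ^ 6" "0 \<le> e2" "e2 \<le> 1 / 10 ^ 6"
  shows "\<bar>switch_F \<sigma> w e1 - switch_F \<sigma> w e2\<bar> \<le> 2 * \<bar>e1 - e2\<bar>"
proof -
  note i = switch_k_int[OF order_refl \<sigma>(2) e(1)] switch_k_int[OF order_refl \<sigma>(2) e(3)]
  have b: "norm (switch_k w e1 s - switch_k w e2 s) \<le> 5 * \<bar>e1 - e2\<bar>" if s: "s \<in> {0..\<sigma>}" for s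
  proof -
    have s': "0 \<le> s" "s \<le> 2/5" using s \<sigma> by auto
    define W where "W = s * (1 / sqrt (1 - s\<^sup>2))"
    have W: "0 \<le> W" "W \<le> 1/2" unfolding W_def by (rule weight_mult_bounds[OF s'])+
    have k: "switch_k w \<epsilon> s = W * switch_n s w \<epsilon>" for \<epsilon> unfolding switch_k_def W_def by simp
    have "W * \<bar>switch_n s w e1 - switch_n s w e2\<bar> \<le> 1/2 * (10 * \<bar>e1 - e2\<bar>)"
      using switch_n_lipschitz_e[OF s' w e] W by (intro mult_mono) auto
    then show ?thesis unfolding k right_diff_distrib[symmetric] using W by (simp add: abs_mult)
  qed
  have "norm (integral {0..\<sigma>} (\<lambda>s. switch_k w e1 s - switch_k w e2 s)) \<le> integral {0..\<sigma>} (\<lambda>_. 5 * \<bar>e1 - e2\<bar>)"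
    by (rule integral_norm_bound_integral) (use b i in \<open>auto intro!: integrable_diff\<close>)
  then have "\<bar>switch_F \<sigma> w e1 - switch_F \<sigma> w e2\<bar> \<le> 5 * \<bar>e1 - e2\<bar> * \<sigma>"
    unfolding switch_F_def integral_diff[OF i] using \<sigma> by (simp add: mult_ac)
  also have "\<dots> \<le> 5 * \<bar>e1 - e2\<bar> * (2/5)" using \<sigma> by (intro mult_left_mono) auto
  finally show ?thesis by simp
qed

lemma switch_F_diff:
  assumes \<sigma>: "0 \<le> \<sigma>2" "\<sigma>2 \<le> \<sigma>1" "\<sigma>1 \<le> 2/5" and e: "0 \<le> \<epsilon>"
  shows "switch_F \<sigma>1 w \<epsilon> - switch_F \<sigma>2 w \<epsilon> = integral {\<sigma>2..\<sigma>1} (switch_k w \<epsilon>)"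
  using Henstock_Kurzweil_Integration.integral_combine[OF \<sigma>(1,2) switch_k_int[OF order_refl \<sigma>(3) e]]
  unfolding switch_F_def by (simp add: algebra_simps)

lemma switch_F_upper:
  assumes \<sigma>: "0 \<le> \<sigma>2" "\<sigma>2 \<le> \<sigma>1" "\<sigma>1 \<le> 2/5" and w: "1/2 \<le> w" "w \<le> 3/5" and e: "0 \<le> \<epsilon>" "\<epsilon> \<le> 1 / 10 ^ 6"
  shows "switch_F \<sigma>1 w \<epsilon> - switch_F \<sigma>2 w \<epsilon> \<le> \<sigma>1 - \<sigma>2"
proof -
  have "integral {\<sigma>2..\<sigma>1} (switch_k w \<epsilon>) \<le> integral {\<sigma>2..\<sigma>1} (\<lambda>_. 1)"
  proof (rule integral_le[OF switch_k_int[OF \<sigma>(1,3) e(1)]])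
    show "switch_k w \<epsilon> s \<le> 1" if "s \<in> {\<sigma>2..\<sigma>1}" for s
    proof -
      have s': "0 \<le> s" "s \<le> 2/5" using that \<sigma> by auto
      define W where "W = s * (1 / sqrt (1 - s\<^sup>2))"
      have W: "0 \<le> W" "W \<le> 1/2" unfolding W_def by (rule weight_mult_bounds[OF s'])+
      have "W * switch_n s w \<epsilon> \<le> W * 2" using switch_n_bound[OF s' w e] W by (intro mult_left_mono) auto
      moreover have "switch_k w \<epsilon> s = W * switch_n s w \<epsilon>" unfolding switch_k_def W_def by simp
      ultimately show ?thesis using W by simp
    qed
  qed auto
  then show ?thesis unfolding switch_F_diff[OF \<sigma> e(1)] using \<sigma> by simp
qed

text \<open>The integrand is positive between the two limits. Its leading factor 3 q - j^2 = (3 - 4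
  s^2) w^2 + 2 w s - 1 increases with w, and at w = 0.524 it is concave in s; the smaller of its end
  values, at s = 32/130, is just above 15/1000.\<close>

lemma switch_F_lower:
  assumes \<sigma>: "32/130 \<le> \<sigma>2" "\<sigma>2 \<le> \<sigma>1" "\<sigma>1 \<le> 5/13" and w: "524/1000 \<le> w" "w \<le> 3/5" and e: "0 \<le> \<epsilon>" "\<epsilon> \<le> 1 / 10 ^ 6"
  shows "1/500 * (\<sigma>1 - \<sigma>2) \<le> switch_F \<sigma>1 w \<epsilon> - switch_F \<sigma>2 w \<epsilon>"
proof -
  have s0: "0 \<le> \<sigma>2" "\<sigma>1 \<le> 2/5" using \<sigma> by auto
  have "integral {\<sigma>2..\<sigma>1} (\<lambda>_. 1/500) \<le> integral {\<sigma>2..\<sigma>1} (switch_k w \<epsilon>)"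
  proof (rule integral_le[OF _ switch_k_int[OF s0 e(1)]])
    show "1/500 \<le> switch_k w \<epsilon> s" if "s \<in> {\<sigma>2..\<sigma>1}" for s
    proof -
      have s: "32/130 \<le> s" "s \<le> 5/13" "0 \<le> s" "s \<le> 2/5" using that \<sigma> by auto
      have w': "1/2 \<le> w" "w \<le> 3/5" using w by auto
      note nb = n_bounds[OF s(3,4) w' e] and nu = nnum_bounds[OF s(3,4) w' e]
      define j q where "j = nj s w" and "q = nq s w"
      have "3 * q - j\<^sup>2 = 3 * w\<^sup>2 - 1 + 2 * w * s - 4 * w\<^sup>2 * s\<^sup>2"
        unfolding q_def j_def nq_def[OF s(3,4) w' e] nj_def[OF s(3,4) w' e] by (simp add: algebra_simps power2_eq_square)
      also have "\<dots> = (3 - 4 * s\<^sup>2) * w\<^sup>2 + 2 * w * s - 1" by (simp add: algebra_simps)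
      also have "\<dots> \<ge> 15/1000"
      proof -
        have "s\<^sup>2 \<le> (2/5)\<^sup>2" using s by (intro power_mono) auto
        then have a1: "(3 - 4 * s\<^sup>2) * (524/1000)\<^sup>2 \<le> (3 - 4 * s\<^sup>2) * w\<^sup>2"
          using w by (intro mult_left_mono power_mono) (auto simp: power2_eq_square)
        have a2: "2 * (524/1000) * s \<le> 2 * w * s" using w s by (intro mult_right_mono) auto
        have g: "(s - c) * (d - s) = (c + d) * s - c * d - s\<^sup>2" for c d by (simp add: algebra_simps power2_eq_square)
        have "0 \<le> (s - 32/130) * (5/13 - s)" using s by simp
        then have "s\<^sup>2 \<le> (32/130 + 5/13) * s - 32/130 * (5/13)" unfolding g by linarith
        then have "s\<^sup>2 \<le> 41/65 * s - 16/169" by simp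
        moreover have "(3 - 4 * s\<^sup>2) * (524/1000)\<^sup>2 = 823728/1000000 - 1098304/1000000 * s\<^sup>2" by (simp add: power2_eq_square)
        ultimately show ?thesis using a1 a2 s(1,2) by linarith
      qed
      finally have q: "15/1000 \<le> 3 * q - j\<^sup>2" .
      have j: "76/100 \<le> j" "j \<le> 1" unfolding j_def using nb by auto
      have "76/100 * (15/1000) \<le> j * (3 * q - j\<^sup>2)" using j q by (intro mult_mono) auto
      then have num: "1/100 \<le> nnum s w \<epsilon>" using nu(2) unfolding j_def q_def by simp
      have nd: "1 \<le> nd s w \<epsilon>" "nd s w \<epsilon> \<le> 101/100"
      proof -
        have "\<epsilon> * j\<^sup>2 \<le> 1 / 100 * 1" using e j by (intro mult_mono) (auto simp: power_le_one)
        then show "nd s w \<epsilon> \<le> 101/100" unfolding nd_def[OF s(3,4) w' e] j_def by simp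
      qed (use nb in auto)
      have "(nd s w \<epsilon>) ^ 3 \<le> (101/100) ^ 3" using nd by (intro power_mono) auto
      then have "(1/100) / ((101/100) ^ 3) \<le> nnum s w \<epsilon> / nd s w \<epsilon> ^ 3" using num nd by (intro frac_le) auto
      then have n: "9/1000 \<le> switch_n s w \<epsilon>" unfolding switch_n_eq[OF s(3,4) w' e] by (simp add: eval_nat_numeral)
      have "32/130 * 1 \<le> s * (1 / sqrt (1 - s\<^sup>2))" using s weight_bounds[OF s(3,4)] by (intro mult_mono) auto
      then have "32/130 * 1 * (9/1000) \<le> s * (1 / sqrt (1 - s\<^sup>2)) * switch_n s w \<epsilon>" by (rule mult_mono') (use n in simp_all)
      then show ?thesis unfolding switch_k_def by simp
    qed
  qed auto
  then show ?thesis unfolding switch_F_diff[OF s0(1) \<sigma>(2) s0(2) e(1)] using \<sigma> by simp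
qed

text \<open>Antiderivative of s times \<open>switch_n s w 0\<close>: the switching integral at
  \<epsilon> = 0 with the weight 1/sqrt (1 - s^2) replaced by 1.\<close>

definition switch_P :: "real \<Rightarrow> real \<Rightarrow> real" where
  "switch_P w s = (3 * w\<^sup>2 - 1) / 2 * s\<^sup>2 + (w - w ^ 3) * s ^ 3 - 3/2 * w\<^sup>2 * s ^ 4 + 4/5 * w ^ 3 * s ^ 5"

lemma switch_n_zero: "switch_n s w 0 = (1 - s * w) * (3 * w\<^sup>2 - 1 + 2 * w * s - 4 * w\<^sup>2 * s\<^sup>2)"
  unfolding switch_n_def Let_def by (simp add: algebra_simps power2_eq_square)

lemma switch_P_integral:
  assumes "0 \<le> \<sigma>"
  shows "((\<lambda>s. s * switch_n s w 0 + c * s ^ 3) has_integral switch_P w \<sigma> + c / 4 * \<sigma> ^ 4) {0..\<sigma>}"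
proof -
  have "((\<lambda>s. s * switch_n s w 0 + c * s ^ 3) has_integral (switch_P w \<sigma> + c / 4 * \<sigma> ^ 4) - (switch_P w 0 + c / 4 * 0 ^ 4)) {0..\<sigma>}"
  proof (rule fundamental_theorem_of_calculus[OF assms])
    fix s assume "s \<in> {0..\<sigma>}"
    have "((\<lambda>s. switch_P w s + c / 4 * s ^ 4) has_real_derivative
       (3 * w\<^sup>2 - 1) * s + (w - w ^ 3) * (3 * s\<^sup>2) - 3/2 * w\<^sup>2 * (4 * s ^ 3) + 4/5 * w ^ 3 * (5 * s ^ 4) + c / 4 * (4 * s ^ 3)) (at s within {0..\<sigma>})"
      unfolding switch_P_def by (auto intro!: derivative_eq_intros simp: eval_nat_numeral)
    also have "(3 * w\<^sup>2 - 1) * s + (w - w ^ 3) * (3 * s\<^sup>2) - 3/2 * w\<^sup>2 * (4 * s ^ 3) + 4/5 * w ^ 3 * (5 * s ^ 4) + c / 4 * (4 * s ^ 3)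
      = s * switch_n s w 0 + c * s ^ 3"
      unfolding switch_n_zero by (simp add: algebra_simps eval_nat_numeral)
    finally show "((\<lambda>s. switch_P w s + c / 4 * s ^ 4) has_vector_derivative s * switch_n s w 0 + c * s ^ 3) (at s within {0..\<sigma>})"
      by (simp add: has_real_derivative_iff_has_vector_derivative)
  qed
  then show ?thesis unfolding switch_P_def by simp
qed

text \<open>Monotonicity in w and the Lipschitz bound in \<epsilon> reduce the claim to w = 0.532
  and \<epsilon> = 0. Replacing the weight by 1 costs at most s^3/10 in the integrand: it matters
  only where n < 0, and there n >= - 0.151 while the weight exceeds 1 by at most 6/10 s^2. The
  polynomial that remains is at least 1/1000 at 5/13.\<close>

lemma switch_F_pos:
  assumes w: "532/1000 \<le> w" "w \<le> 3/5" and e: "0 \<le> \<epsilon>" "\<epsilon> \<le> 1 / 10 ^ 6"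
  shows "0 < switch_F (5/13) w \<epsilon>"
proof -
  define w0 :: real where "w0 = 532/1000"
  have i: "switch_k w0 0 integrable_on {0..5/13}" by (rule switch_k_int) auto
  have "integral {0..5/13} (\<lambda>s. s * switch_n s w0 0 + (- (1/10)) * s ^ 3) \<le> integral {0..5/13} (switch_k w0 0)"
  proof (rule integral_le[OF has_integral_integrable[OF switch_P_integral] i])
    fix s :: real assume "s \<in> {0..5/13}"
    then have s: "0 \<le> s" "s \<le> 2/5" "s \<le> 5/13" by auto
    note W = weight_bounds[OF s(1,2)]
    define n where "n = switch_n s w0 0"
    have k: "switch_k w0 0 s = s * (n * (1 / sqrt (1 - s\<^sup>2)))" unfolding switch_k_def n_def by simp
    have "n + (- (1/10)) * s\<^sup>2 \<le> n * (1 / sqrt (1 - s\<^sup>2))"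
    proof (cases "0 \<le> n")
      case True
      then have "n * 1 \<le> n * (1 / sqrt (1 - s\<^sup>2))" using W by (intro mult_left_mono) auto
      moreover have "0 \<le> s\<^sup>2" by simp
      ultimately show ?thesis by linarith
    next
      case False
      then have 1: "n * (1 + 6/10 * s\<^sup>2) \<le> n * (1 / sqrt (1 - s\<^sup>2))" using W by (intro mult_left_mono_neg) auto
      define j where "j = 1 - s * w0"
      have j: "0 \<le> j" "j \<le> 1" using s unfolding j_def w0_def by auto
      have "4 * w0\<^sup>2 * s * s \<le> 2 * w0 * s" using s mult_right_mono[of "4 * w0\<^sup>2 * s" "2 * w0" s] unfolding w0_def by (simp add: power2_eq_square)
      then have "- (151/1000) \<le> 3 * w0\<^sup>2 - 1 + 2 * w0 * s - 4 * w0\<^sup>2 * s\<^sup>2" unfolding w0_def by (simp add: power2_eq_square)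
      then have "j * (- (151/1000)) \<le> n" unfolding n_def switch_n_zero j_def[symmetric] using j by (intro mult_left_mono) auto
      then have "- (151/1000) \<le> n" using j by linarith
      then have "- (151/1000) * (6/10 * s\<^sup>2) \<le> n * (6/10 * s\<^sup>2)" by (intro mult_right_mono) auto
      moreover have "0 \<le> s\<^sup>2" by simp
      moreover have "n * (1 + 6/10 * s\<^sup>2) = n + n * (6/10 * s\<^sup>2)" by (simp add: algebra_simps)
      ultimately show ?thesis using 1 by linarith
    qed
    from mult_left_mono[OF this s(1)] show "s * switch_n s w0 0 + (- (1/10)) * s ^ 3 \<le> switch_k w0 0 s"
      unfolding k n_def[symmetric] by (simp add: algebra_simps eval_nat_numeral)
  qed auto
  moreover have "integral {0..5/13} (\<lambda>s. s * switch_n s w0 0 + (- (1/10)) * s ^ 3) = switch_P w0 (5/13) + (- (1/10)) / 4 * (5/13) ^ 4"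
    by (rule integral_unique[OF switch_P_integral]) simp
  moreover have "switch_P w0 (5/13) + (- (1/10)) / 4 * (5/13) ^ 4 \<ge> 1/1000"
    unfolding switch_P_def w0_def by (simp add: eval_nat_numeral)
  ultimately have "1/1000 \<le> switch_F (5/13) w0 0" unfolding switch_F_def by simp
  moreover have "\<bar>switch_F (5/13) w0 \<epsilon> - switch_F (5/13) w0 0\<bar> \<le> 2 * \<bar>\<epsilon> - 0\<bar>"
    by (rule switch_F_lipschitz_e) (use e in \<open>auto simp: w0_def\<close>)
  moreover have "0 \<le> switch_F (5/13) w \<epsilon> - switch_F (5/13) w0 \<epsilon>"
    by (rule switch_F_mono_w(1)) (use w e in \<open>auto simp: w0_def\<close>)
  ultimately show ?thesis using e by simp
qed

text \<open>The mirror image of \<open>switch_F_pos\<close>, at slope 0.5302. The weight now matters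
  only where n > 0, with n <= 15/100, and the margin is 10^-4.\<close>

lemma switch_F_neg:
  assumes w: "1/2 \<le> w" "w \<le> 5302/10000" and e: "0 \<le> \<epsilon>" "\<epsilon> \<le> 1 / 10 ^ 6"
  shows "switch_F (32/130) w \<epsilon> < 0"
proof -
  define w0 :: real where "w0 = 5302/10000"
  have i: "switch_k w0 0 integrable_on {0..32/130}" by (rule switch_k_int) auto
  have "integral {0..32/130} (switch_k w0 0) \<le> integral {0..32/130} (\<lambda>s. s * switch_n s w0 0 + 1/10 * s ^ 3)"
  proof (rule integral_le[OF i has_integral_integrable[OF switch_P_integral]])
    fix s :: real assume "s \<in> {0..32/130}"
    then have s: "0 \<le> s" "s \<le> 2/5" "s \<le> 32/130" by auto
    note W = weight_bounds[OF s(1,2)]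
    define n where "n = switch_n s w0 0"
    have k: "switch_k w0 0 s = s * (n * (1 / sqrt (1 - s\<^sup>2)))" unfolding switch_k_def n_def by simp
    have "n * (1 / sqrt (1 - s\<^sup>2)) \<le> n + 1/10 * s\<^sup>2"
    proof (cases "n \<le> 0")
      case True
      then have "n * (1 / sqrt (1 - s\<^sup>2)) \<le> n * 1" using W by (intro mult_left_mono_neg) auto
      moreover have "0 \<le> s\<^sup>2" by simp
      ultimately show ?thesis by linarith
    next
      case False
      then have 1: "n * (1 / sqrt (1 - s\<^sup>2)) \<le> n * (1 + 6/10 * s\<^sup>2)" using W by (intro mult_left_mono) auto
      define j where "j = 1 - s * w0"
      have j: "0 \<le> j" "j \<le> 1" using s unfolding j_def w0_def by auto
      have "3 * w0\<^sup>2 - 1 + 2 * w0 * s - 4 * w0\<^sup>2 * s\<^sup>2 \<le> 15/100"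
        unfolding w0_def power2_eq_square using s zero_le_square[of s] by linarith
      then have "n \<le> j * (15/100)" unfolding n_def switch_n_zero j_def[symmetric] using j by (intro mult_left_mono) auto
      then have "n \<le> 15/100" using j by linarith
      then have "n * (6/10 * s\<^sup>2) \<le> 15/100 * (6/10 * s\<^sup>2)" by (intro mult_right_mono) auto
      moreover have "0 \<le> s\<^sup>2" by simp
      moreover have "n * (1 + 6/10 * s\<^sup>2) = n + n * (6/10 * s\<^sup>2)" by (simp add: algebra_simps)
      ultimately show ?thesis using 1 by linarith
    qed
    from mult_left_mono[OF this s(1)] show "switch_k w0 0 s \<le> s * switch_n s w0 0 + 1/10 * s ^ 3"
      unfolding k n_def[symmetric] by (simp add: algebra_simps eval_nat_numeral)
  qed auto
  moreover have "integral {0..32/130} (\<lambda>s. s * switch_n s w0 0 + 1/10 * s ^ 3) = switch_P w0 (32/130) + 1/10 / 4 * (32/130) ^ 4"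
    by (rule integral_unique[OF switch_P_integral]) simp
  moreover have "switch_P w0 (32/130) + 1/10 / 4 * (32/130) ^ 4 \<le> - (1/10000)"
    unfolding switch_P_def w0_def by (simp add: eval_nat_numeral)
  ultimately have "switch_F (32/130) w0 0 \<le> - (1/10000)" unfolding switch_F_def by simp
  moreover have "\<bar>switch_F (32/130) w0 \<epsilon> - switch_F (32/130) w0 0\<bar> \<le> 2 * \<bar>\<epsilon> - 0\<bar>"
    by (rule switch_F_lipschitz_e) (use e in \<open>auto simp: w0_def\<close>)
  moreover have "0 \<le> switch_F (32/130) w0 \<epsilon> - switch_F (32/130) w \<epsilon>"
    by (rule switch_F_mono_w(1)) (use w e in \<open>auto simp: w0_def\<close>)
  ultimately show ?thesis using e by simp
qed

text \<open>\<open>eps \<tau> x = M\<^sup>-\<^sup>2\<close>, where \<open>M\<close> is the value at \<open>p = 0\<close> of the tangent line to the singular arc at \<open>x\<close>.\<close>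

definition eps :: "real \<Rightarrow> real \<Rightarrow> real" where
  "eps \<tau> x = exp (- 2 * (\<tau> - zet (sarc \<tau>) x)) * (yy \<tau> x / (yy \<tau> x - cc x))\<^sup>2"

text \<open>A zero x marks an angle at which the tangent line to the singular arc, followed back to
  p = 0, meets the condition psi 0 = 0.\<close>

definition Fhat :: "real \<Rightarrow> real \<Rightarrow> real" where
  "Fhat \<tau> x = switch_F (cc x) (1 / yy \<tau> x) (eps \<tau> x)"

lemma mid_sub: "x \<in> {2/3..7/9} \<Longrightarrow> x \<in> {0..7/9::real}" by auto

lemma cc_diff:
  assumes "x1 \<in> {2/3..7/9}" "x2 \<in> {2/3..7/9}" "x1 \<le> x2"
  shows "x2 - x1 \<le> cc x1 - cc x2" "cc x1 - cc x2 \<le> 2 * (x2 - x1)"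
proof -
  define N1 N2 where "N1 = 1 + x1\<^sup>2" and "N2 = 1 + x2\<^sup>2"
  have sq: "(2/3)\<^sup>2 \<le> x1\<^sup>2" "x1\<^sup>2 \<le> (7/9)\<^sup>2" "(2/3)\<^sup>2 \<le> x2\<^sup>2" "x2\<^sup>2 \<le> (7/9)\<^sup>2"
    using assms by (auto intro!: power_mono)
  have N: "13/9 \<le> N1" "N1 \<le> 130/81" "13/9 \<le> N2" "N2 \<le> 130/81" using sq unfolding N1_def N2_def by (auto simp: power2_eq_square)
  have "cc x1 - cc x2 = ((1 - x1\<^sup>2) * N2 - (1 - x2\<^sup>2) * N1) / (N1 * N2)"
    unfolding cc_def N1_def[symmetric] N2_def[symmetric] using N by (simp add: field_simps)
  also have "(1 - x1\<^sup>2) * N2 - (1 - x2\<^sup>2) * N1 = (x2 - x1) * (2 * (x1 + x2))"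
    unfolding N1_def N2_def by (simp add: algebra_simps power2_eq_square)
  finally have e: "cc x1 - cc x2 = (x2 - x1) * (2 * (x1 + x2) / (N1 * N2))" by simp
  have n1: "13/9 * (13/9) \<le> N1 * N2" by (rule mult_mono) (use N in simp_all)
  have n2: "N1 * N2 \<le> 130/81 * (130/81)" by (rule mult_mono) (use N in simp_all)
  have "1 * (N1 * N2) \<le> 2 * (x1 + x2)" using n2 assms by simp
  then have "1 \<le> 2 * (x1 + x2) / (N1 * N2)" using n1 by (subst pos_le_divide_eq) auto
  then have "(x2 - x1) * 1 \<le> (x2 - x1) * (2 * (x1 + x2) / (N1 * N2))" using assms by (intro mult_left_mono) auto
  then show "x2 - x1 \<le> cc x1 - cc x2" unfolding e by simp
  have "2 * (x1 + x2) \<le> 2 * (N1 * N2)" using n1 assms by simp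
  then have "2 * (x1 + x2) / (N1 * N2) \<le> 2" using n1 by (subst pos_divide_le_eq) auto
  then have "(x2 - x1) * (2 * (x1 + x2) / (N1 * N2)) \<le> (x2 - x1) * 2" using assms by (intro mult_left_mono) auto
  then show "cc x1 - cc x2 \<le> 2 * (x2 - x1)" unfolding e by simp
qed

text \<open>The ends 2/3 and 7/9 are rational points of the circle, so all comparisons at them
  remain rational.\<close>

lemma cc_ends: "cc (2/3) = 5/13" "cc (7/9) = 32/130" "ss (2/3) = 12/13" "ss (7/9) = 126/130"
  unfolding cc_def ss_def by (simp_all add: power2_eq_square)

lemma cc_mid: assumes "x \<in> {2/3..7/9}" shows "32/130 \<le> cc x" "cc x \<le> 5/13"
  using cc_diff(1)[of "2/3" x] cc_diff(1)[of x "7/9"] assms unfolding cc_ends by auto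

lemma ss_mid: assumes "x \<in> {2/3..7/9}" shows "92/100 \<le> ss x" "ss x \<le> 97/100"
proof -
  define N where "N = 1 + x\<^sup>2"
  have sq: "(2/3)\<^sup>2 \<le> x\<^sup>2" "x\<^sup>2 \<le> (7/9)\<^sup>2" using assms by (auto intro!: power_mono)
  have N: "N > 0" unfolding N_def by (rule one_plus_square_pos)
  have g: "(x - c) * (d - x) = (c + d) * x - c * d - x\<^sup>2" for c d by (simp add: algebra_simps power2_eq_square)
  have "0 \<le> (x - 2/3) * (7/9 - x)" using assms by simp
  then have "x\<^sup>2 \<le> 13/9 * x - 14/27" unfolding g by simp
  then have "92/100 * N \<le> 2 * x" unfolding N_def using assms by simp
  then show "92/100 \<le> ss x" unfolding ss_def N_def[symmetric] using N by (subst pos_le_divide_eq) auto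
  have "0 \<le> (x - 7/9)\<^sup>2" by simp
  then have "14/9 * x - 49/81 \<le> x\<^sup>2" by (simp add: power2_eq_square algebra_simps)
  then have "2 * x \<le> 97/100 * N" unfolding N_def using assms by simp
  then show "ss x \<le> 97/100" unfolding ss_def N_def[symmetric] using N by (subst pos_divide_le_eq) auto
qed

section \<open>The switching function along the singular arc\<close>

context
  fixes \<tau> :: real
  assumes \<tau>: "20 \<le> \<tau>"
begin

lemma sb_mid: assumes x: "x \<in> {2/3..7/9}" shows "16034/10000 \<le> sarc \<tau> x" "sarc \<tau> x \<le> 17123/10000"
proof -
  have x': "x \<in> {0..7/9}" using x by auto
  have g: "(c - x) * (1 - k * (c + x)) = c - k * (c * c) - (x - k * x\<^sup>2)" for c k
    by (simp add: algebra_simps power2_eq_square)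
  have "0 \<le> (7/9 - x) * (1 - 11/100 * (7/9 + x))" using x by (intro mult_nonneg_nonneg) auto
  then have "x - 11/100 * x\<^sup>2 \<le> 7/9 - 11/100 * (7/9 * (7/9))" unfolding g by simp
  then show "sarc \<tau> x \<le> 17123/10000" using barrier_high[OF \<tau> x'] unfolding barrier_def by simp
  have "(2/3 - x) * (1 - 14/100 * (2/3 + x)) \<le> 0" using x by (intro mult_nonpos_nonneg) auto
  then have "2/3 - 14/100 * (2/3 * (2/3)) \<le> x - 14/100 * x\<^sup>2" unfolding g by simp
  then show "16034/10000 \<le> sarc \<tau> x" using barrier_low[OF \<tau> x'] unfolding barrier_def by simp
qed

lemma yy_Lip_aux:
  assumes x: "0 < x" "x \<le> 7/9" and m: "2/3 \<le> x"
  shows "\<exists>d. (yy \<tau> has_real_derivative d) (at x within {2/3..7/9}) \<and> 0 \<le> d \<and> d \<le> 1"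
proof -
  have x': "x \<in> {2/3..7/9}" "x \<in> {0..7/9}" using x m by auto
  define d where "d = yy \<tau> x * sk \<tau> x / ((1 + x\<^sup>2) * sarc \<tau> x)"
  have D: "(yy \<tau> has_real_derivative d) (at x within {2/3..7/9})"
    unfolding d_def by (rule has_field_derivative_subset[OF DERIV_yy[OF \<tau> x]]) auto
  have b: "16/10 \<le> sarc \<tau> x" "sarc \<tau> x \<le> 18/10" using sb_mid[OF x'(1)] by auto
  have "(16/10)\<^sup>2 \<le> (sarc \<tau> x)\<^sup>2" using b by (intro power_mono) auto
  then have k: "0 \<le> sk \<tau> x" "sk \<tau> x \<le> 44/100"
    using sk_pos(1)[OF \<tau> x'(2)] smu_bounds(1)[OF \<tau>, of x] unfolding sk_def[OF \<tau>] by (auto simp: power2_eq_square)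
  have "ss x * sarc \<tau> x \<le> 97/100 * (18/10)" by (rule mult_mono) (use b ss_mid[OF x'(1)] in simp_all)
  then have y: "0 < yy \<tau> x" "yy \<tau> x \<le> 22/10" using yy_pos[OF \<tau> x'(2)] cc_mid[OF x'(1)] unfolding yy_def by auto
  have "yy \<tau> x * sk \<tau> x \<le> 22/10 * (44/100)" by (rule mult_mono) (use y k in simp_all)
  moreover have "1 * (16/10) \<le> (1 + x\<^sup>2) * sarc \<tau> x" by (rule mult_mono) (use b in simp_all)
  ultimately have "d \<le> 1" unfolding d_def by (subst pos_divide_le_eq) auto
  moreover have "0 \<le> d" unfolding d_def using y k b by (intro divide_nonneg_nonneg mult_nonneg_nonneg) auto
  ultimately show ?thesis using D by blast
qed

lemma yy_diff:
  assumes x: "x1 \<in> {2/3..7/9}" "x2 \<in> {2/3..7/9}" "x1 \<le> x2"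
  shows "0 \<le> yy \<tau> x2 - yy \<tau> x1" "yy \<tau> x2 - yy \<tau> x1 \<le> x2 - x1"
proof -
  have c: "continuous_on {x1..x2} (yy \<tau>)" by (rule continuous_on_subset[OF yy_cont[OF \<tau>]]) (use x in auto)
  have d: "\<exists>d. (yy \<tau> has_real_derivative d) (at x) \<and> 0 \<le> d \<and> d \<le> 1" if "x1 < x" "x < x2" for x
  proof -
    have "x \<in> interior {2/3..7/9}" using that x by auto
    then have "at x within {2/3..7/9} = at x" by (rule at_within_interior)
    then show ?thesis using yy_Lip_aux[of x] that x by auto
  qed
  have "yy \<tau> x1 \<le> yy \<tau> x2"
    by (rule DERIV_nonneg_imp_increasing_open[OF x(3) _ c]) (use d in blast)
  then show "0 \<le> yy \<tau> x2 - yy \<tau> x1" by simp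
  have "x1 - yy \<tau> x1 \<le> x2 - yy \<tau> x2"
  proof (rule DERIV_nonneg_imp_increasing_open[OF x(3)])
    fix x assume "x1 < x" "x < x2"
    from d[OF this] obtain d where d: "(yy \<tau> has_real_derivative d) (at x)" "d \<le> 1" by blast
    have "((\<lambda>x. x - yy \<tau> x) has_real_derivative 1 - d) (at x)" by (intro DERIV_diff DERIV_ident d)
    then show "\<exists>y. ((\<lambda>x. x - yy \<tau> x) has_real_derivative y) (at x) \<and> 0 \<le> y" using d(2) by force
  qed (intro continuous_intros c)
  then show "yy \<tau> x2 - yy \<tau> x1 \<le> x2 - x1" by simp
qed

text \<open>The barriers at 2/3 and 7/9. Their purpose is 1/1.87888 > 0.532 and 1/1.88617 < 0.5302,
  the thresholds of \<open>switch_F_pos\<close> and \<open>switch_F_neg\<close>.\<close>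

lemma yy_ends: "yy \<tau> (2/3) \<le> 187888/100000" "186471/100000 \<le> yy \<tau> (2/3)" "188617/100000 \<le> yy \<tau> (7/9)" "yy \<tau> (7/9) \<le> 190571/100000"
  using barrier_low[OF \<tau>, of "2/3"] barrier_high[OF \<tau>, of "2/3"] barrier_low[OF \<tau>, of "7/9"] barrier_high[OF \<tau>, of "7/9"]
  unfolding yy_def cc_ends barrier_def by (simp_all add: power2_eq_square)

lemma yy_mid: assumes x: "x \<in> {2/3..7/9}" shows "186471/100000 \<le> yy \<tau> x" "yy \<tau> x \<le> 190571/100000"
  using yy_diff(1)[of "2/3" x] yy_diff(1)[of x "7/9"] yy_ends x by auto

lemma yy_cc_mid: assumes x: "x \<in> {2/3..7/9}" shows "14/10 \<le> yy \<tau> x - cc x"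
  using yy_mid[OF x] cc_mid[OF x] by auto

lemma w_mid: assumes x: "x \<in> {2/3..7/9}" shows "524/1000 \<le> 1 / yy \<tau> x" "1 / yy \<tau> x \<le> 54/100"
  using yy_mid[OF x] by (auto simp: divide_simps)

lemma q_mid: assumes x: "x \<in> {2/3..7/9}" shows "1 \<le> yy \<tau> x / (yy \<tau> x - cc x)" "yy \<tau> x / (yy \<tau> x - cc x) \<le> 2"
  using yy_mid[OF x] cc_mid[OF x] by (auto simp: divide_simps)

lemma zet_mid: assumes x: "x \<in> {0..7/9}" shows "18 \<le> \<tau> - zet (sarc \<tau>) x"
  using arc_set_zet[OF arc_in_set[OF \<tau>] x] \<tau> by simp

lemma zet_Lip:
  assumes x: "x1 \<in> {0..7/9}" "x2 \<in> {0..7/9}"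
  shows "\<bar>zet (sarc \<tau>) x1 - zet (sarc \<tau>) x2\<bar> \<le> 21/10 * \<bar>x1 - x2\<bar>"
proof -
  have "norm (zet (sarc \<tau>) x1 - zet (sarc \<tau>) x2) \<le> 21/10 * norm (x1 - x2)"
  proof (rule field_differentiable_bound[of "{0..7/9}" _ "\<lambda>x. 2 / ((1 + x\<^sup>2) * sarc \<tau> x)"])
    show "(zet (sarc \<tau>) has_field_derivative 2 / ((1 + z\<^sup>2) * sarc \<tau> z)) (at z within {0..7/9})" if "z \<in> {0..7/9}" for z
      by (rule DERIV_zet[OF sb_cont[OF \<tau>] sb_pos[OF \<tau>] that])
    show "norm (2 / ((1 + z\<^sup>2) * sarc \<tau> z)) \<le> 21/10" if "z \<in> {0..7/9}" for z
    proof -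
      have "1 * (99/100) \<le> (1 + z\<^sup>2) * sarc \<tau> z" by (rule mult_mono) (use sb_bounds[OF \<tau> that] in simp_all)
      then have p: "99/100 \<le> (1 + z\<^sup>2) * sarc \<tau> z" by simp
      have "norm (2 / ((1 + z\<^sup>2) * sarc \<tau> z)) = 2 / ((1 + z\<^sup>2) * sarc \<tau> z)" using p by simp
      also have "\<dots> \<le> 2 / (99/100)" using p by (intro divide_left_mono) auto
      finally show ?thesis by simp
    qed
  qed (use x in auto)
  then show ?thesis by simp
qed

end

lemma exp_neg_le: fixes t :: real assumes "18 \<le> t" shows "exp (- 2 * t) \<le> 1 / 10 ^ 9"
proof -
  have "exp (- 2 * t) = 1 / exp (2 * t)" by (simp add: exp_minus inverse_eq_divide)
  also have "\<dots> \<le> 1 / 10 ^ 9" using exp_36[OF assms] by (intro divide_left_mono) auto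
  finally show ?thesis .
qed

lemma exp_neg_Lip:
  fixes s t :: real
  assumes "18 \<le> s" "18 \<le> t"
  shows "\<bar>exp (- 2 * s) - exp (- 2 * t)\<bar> \<le> 2 / 10 ^ 9 * \<bar>s - t\<bar>"
proof -
  have "norm (exp (- 2 * s) - exp (- 2 * t)) \<le> 2 / 10 ^ 9 * norm (s - t)"
  proof (rule field_differentiable_bound[of "{18..}" "\<lambda>t. exp (- 2 * t)" "\<lambda>t. - 2 * exp (- 2 * t)"])
    show "((\<lambda>t. exp (- 2 * t)) has_field_derivative - 2 * exp (- 2 * z)) (at z within {18..})" for z :: real
      by (auto intro!: derivative_eq_intros)
    show "norm (- 2 * exp (- 2 * z)) \<le> 2 / 10 ^ 9" if "z \<in> {18..}" for z :: real
      using exp_neg_le[of z] that by (simp add: abs_mult)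
  qed (use assms in auto)
  then show ?thesis by simp
qed

lemma eps_diff_aux:
  fixes q1 q2 :: real
  assumes t: "18 \<le> t1" "18 \<le> t2" and q: "1 \<le> q1" "q1 \<le> 2" "1 \<le> q2" "q2 \<le> 2"
  shows "\<bar>exp (- 2 * t1) * q1\<^sup>2 - exp (- 2 * t2) * q2\<^sup>2\<bar> \<le> 1 / 10 ^ 8 * (\<bar>t1 - t2\<bar> + \<bar>q1 - q2\<bar>)"
proof -
  define e1 e2 d where "e1 = exp (- 2 * t1)" and "e2 = exp (- 2 * t2)" and "d = q1 - q2"
  have e: "\<bar>e1 - e2\<bar> \<le> 2 / 10 ^ 9 * \<bar>t1 - t2\<bar>" "0 \<le> e2" "e2 \<le> 1 / 10 ^ 9"
    unfolding e1_def e2_def using exp_neg_Lip[OF t] exp_neg_le[OF t(2)] by auto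
  have q4: "q1\<^sup>2 \<le> 2\<^sup>2" using q by (intro power_mono) auto
  have "e1 * q1\<^sup>2 - e2 * q2\<^sup>2 = (e1 - e2) * q1\<^sup>2 + e2 * (d * (q1 + q2))"
    unfolding d_def by (simp add: algebra_simps power2_eq_square)
  then have "\<bar>e1 * q1\<^sup>2 - e2 * q2\<^sup>2\<bar> \<le> \<bar>e1 - e2\<bar> * q1\<^sup>2 + e2 * (\<bar>d\<bar> * (q1 + q2))"
    using abs_triangle_ineq[of "(e1 - e2) * q1\<^sup>2" "e2 * (d * (q1 + q2))"] e q by (simp add: abs_mult)
  also have "\<bar>e1 - e2\<bar> * q1\<^sup>2 \<le> 2 / 10 ^ 9 * \<bar>t1 - t2\<bar> * 4" by (rule mult_mono) (use e q4 in simp_all)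
  also have "e2 * (\<bar>d\<bar> * (q1 + q2)) \<le> 1 / 10 ^ 9 * (\<bar>d\<bar> * 4)"
    by (rule mult_mono) (use e q in \<open>auto intro!: mult_left_mono\<close>)
  finally have "\<bar>e1 * q1\<^sup>2 - e2 * q2\<^sup>2\<bar> \<le> 8 / 10 ^ 9 * \<bar>t1 - t2\<bar> + 4 / 10 ^ 9 * \<bar>d\<bar>" by simp
  also have "\<dots> \<le> 1 / 10 ^ 8 * (\<bar>t1 - t2\<bar> + \<bar>d\<bar>)"
  proof -
    have "8 / 10 ^ 9 * a + 4 / 10 ^ 9 * b \<le> 1 / 10 ^ 8 * (a + b)" if "0 \<le> a" "0 \<le> b" for a b :: real using that by simp
    from this[of "\<bar>t1 - t2\<bar>" "\<bar>d\<bar>"] show ?thesis by (simp only: abs_ge_zero simp_thms)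
  qed
  finally show ?thesis unfolding e1_def e2_def d_def .
qed

lemma eps_bounds:
  assumes \<tau>: "20 \<le> \<tau>" and x: "x \<in> {2/3..7/9}"
  shows "0 < eps \<tau> x" "eps \<tau> x \<le> 1 / 10 ^ 6"
proof -
  note t = zet_mid[OF \<tau> mid_sub[OF x]] and q = q_mid[OF \<tau> x]
  show "0 < eps \<tau> x" unfolding eps_def using q by (intro mult_pos_pos) auto
  have "(yy \<tau> x / (yy \<tau> x - cc x))\<^sup>2 \<le> 2\<^sup>2" using q by (intro power_mono) auto
  then have "eps \<tau> x \<le> 1 / 10 ^ 9 * 4" unfolding eps_def by (intro mult_mono exp_neg_le[OF t]) auto
  then show "eps \<tau> x \<le> 1 / 10 ^ 6" by simp
qed

lemma eps_diff:
  assumes \<tau>: "20 \<le> \<tau>1" "20 \<le> \<tau>2" and x: "x1 \<in> {2/3..7/9}" "x2 \<in> {2/3..7/9}"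
    and z: "\<bar>(\<tau>1 - zet (sarc \<tau>1) x1) - (\<tau>2 - zet (sarc \<tau>2) x2)\<bar> \<le> A" and y: "\<bar>yy \<tau>1 x1 - yy \<tau>2 x2\<bar> \<le> B" and c: "\<bar>cc x1 - cc x2\<bar> \<le> C"
  shows "\<bar>eps \<tau>1 x1 - eps \<tau>2 x2\<bar> \<le> 1 / 10 ^ 8 * (A + B + C)"
proof -
  define y1 y2 c1 c2 where "y1 = yy \<tau>1 x1" and "y2 = yy \<tau>2 x2" and "c1 = cc x1" and "c2 = cc x2"
  have yb: "14/10 \<le> y1 - c1" "14/10 \<le> y2 - c2" "y2 \<le> 191/100" "0 \<le> c2" "c2 \<le> 4/10" "186/100 \<le> y2"
    using yy_cc_mid[OF \<tau>(1) x(1)] yy_cc_mid[OF \<tau>(2) x(2)] yy_mid[OF \<tau>(2) x(2)] cc_mid[OF x(2)]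
    unfolding y1_def y2_def c1_def c2_def by auto
  have "y1 / (y1 - c1) - y2 / (y2 - c2) = (y2 * (c1 - c2) - c2 * (y1 - y2)) / ((y1 - c1) * (y2 - c2))"
    using yb by (simp add: field_simps)
  then have "\<bar>y1 / (y1 - c1) - y2 / (y2 - c2)\<bar> = \<bar>y2 * (c1 - c2) - c2 * (y1 - y2)\<bar> / ((y1 - c1) * (y2 - c2))"
    using yb by simp
  also have "\<dots> \<le> (191/100 * C + 4/10 * B) / (14/10 * (14/10))"
  proof (rule frac_le)
    have "\<bar>y2 * (c1 - c2) - c2 * (y1 - y2)\<bar> \<le> y2 * \<bar>c1 - c2\<bar> + c2 * \<bar>y1 - y2\<bar>"
      using abs_triangle_ineq4[of "y2 * (c1 - c2)" "c2 * (y1 - y2)"] yb by (simp add: abs_mult)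
    also have "\<dots> \<le> 191/100 * C + 4/10 * B"
      using yb y c unfolding y1_def y2_def c1_def c2_def by (intro add_mono mult_mono) auto
    finally show "\<bar>y2 * (c1 - c2) - c2 * (y1 - y2)\<bar> \<le> 191/100 * C + 4/10 * B" .
    show "14/10 * (14/10) \<le> (y1 - c1) * (y2 - c2)" using yb by (intro mult_mono) auto
    show "0 \<le> 191/100 * C + 4/10 * B" using y c by simp
  qed auto
  also have "\<dots> \<le> C + B" using y c by simp
  finally have q: "\<bar>y1 / (y1 - c1) - y2 / (y2 - c2)\<bar> \<le> C + B" .
  have "\<bar>eps \<tau>1 x1 - eps \<tau>2 x2\<bar> \<le> 1 / 10 ^ 8 * (\<bar>(\<tau>1 - zet (sarc \<tau>1) x1) - (\<tau>2 - zet (sarc \<tau>2) x2)\<bar> + \<bar>y1 / (y1 - c1) - y2 / (y2 - c2)\<bar>)"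
    unfolding eps_def y1_def y2_def c1_def c2_def
    by (rule eps_diff_aux[OF zet_mid[OF \<tau>(1) mid_sub[OF x(1)]] zet_mid[OF \<tau>(2) mid_sub[OF x(2)]] q_mid[OF \<tau>(1) x(1)] q_mid[OF \<tau>(2) x(2)]])
  also have "\<dots> \<le> 1 / 10 ^ 8 * (A + B + C)" using z q by (intro mult_left_mono) auto
  finally show ?thesis .
qed

lemma inverse_Lip: "1 \<le> a \<Longrightarrow> 1 \<le> b \<Longrightarrow> \<bar>1 / a - 1 / b\<bar> \<le> \<bar>a - b\<bar>" for a b :: real
proof -
  assume ab: "1 \<le> a" "1 \<le> b"
  have "\<bar>1 / a - 1 / b\<bar> = \<bar>a - b\<bar> / (a * b)" using ab by (simp add: divide_simps abs_minus_commute)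
  also have "\<dots> \<le> \<bar>a - b\<bar> / 1" using ab mult_mono[of 1 a 1 b] by (intro divide_left_mono) auto
  finally show ?thesis by simp
qed

text \<open>With growing x both \<open>cc\<close> and the slope 1/\<open>yy\<close> decrease, and
  \<open>switch_F\<close> increases in each of them. The arguments are changed one at a time; the
  change of \<open>eps\<close> costs 2/10^6 per unit of x, little against the rate 1/500 gained from
  \<open>cc\<close>.\<close>

lemma Fhat_diff:
  assumes \<tau>: "20 \<le> \<tau>" and x: "x1 \<in> {2/3..7/9}" "x2 \<in> {2/3..7/9}" "x1 \<le> x2"
  shows "1/1000 * (x2 - x1) \<le> Fhat \<tau> x1 - Fhat \<tau> x2" "Fhat \<tau> x1 - Fhat \<tau> x2 \<le> 5 * (x2 - x1)"
proof -
  define w1 w2 e1 e2 where "w1 = 1 / yy \<tau> x1" and "w2 = 1 / yy \<tau> x2" and "e1 = eps \<tau> x1" and "e2 = eps \<tau> x2"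
  note y = yy_diff[OF \<tau> x] and c = cc_diff[OF x]
  have \<sigma>: "32/130 \<le> cc x2" "cc x2 \<le> cc x1" "cc x1 \<le> 5/13" using cc_mid[OF x(1)] cc_mid[OF x(2)] c x(3) by auto
  have yb: "1 \<le> yy \<tau> x1" "1 \<le> yy \<tau> x2" using yy_mid[OF \<tau> x(1)] yy_mid[OF \<tau> x(2)] by auto
  have w: "524/1000 \<le> w2" "w2 \<le> w1" "w1 \<le> 54/100" unfolding w1_def w2_def
    using w_mid[OF \<tau> x(1)] w_mid[OF \<tau> x(2)] y yb by (auto intro!: divide_left_mono)
  have wl: "w1 - w2 \<le> x2 - x1" using inverse_Lip[OF yb] y x(3) unfolding w1_def w2_def by auto
  have e: "0 \<le> e1" "e1 \<le> 1 / 10 ^ 6" "0 \<le> e2" "e2 \<le> 1 / 10 ^ 6" unfolding e1_def e2_def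
    using eps_bounds[OF \<tau> x(1)] eps_bounds[OF \<tau> x(2)] by auto
  have "\<bar>e1 - e2\<bar> \<le> 1 / 10 ^ 8 * (21/10 * (x2 - x1) + (x2 - x1) + 2 * (x2 - x1))"
    unfolding e1_def e2_def
    by (rule eps_diff[OF \<tau> \<tau> x(1,2)]) (use zet_Lip[OF \<tau> mid_sub[OF x(2)] mid_sub[OF x(1)]] y c x(3) in auto)
  moreover have "1 / 10 ^ 8 * (21/10 * d + d + 2 * d) \<le> 1 / 10 ^ 6 * d" if "0 \<le> d" for d :: real using that by simp
  ultimately have el: "\<bar>e1 - e2\<bar> \<le> 1 / 10 ^ 6 * (x2 - x1)" using x(3) by (meson diff_ge_0_iff_ge order_trans)
  have F: "Fhat \<tau> x1 = switch_F (cc x1) w1 e1" "Fhat \<tau> x2 = switch_F (cc x2) w2 e2"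
    unfolding Fhat_def w1_def w2_def e1_def e2_def by auto
  have 1: "1/500 * (cc x1 - cc x2) \<le> switch_F (cc x1) w1 e1 - switch_F (cc x2) w1 e1"
    "switch_F (cc x1) w1 e1 - switch_F (cc x2) w1 e1 \<le> cc x1 - cc x2"
    by (rule switch_F_lower switch_F_upper; use \<sigma> w e in simp)+
  have 2: "0 \<le> switch_F (cc x2) w1 e1 - switch_F (cc x2) w2 e1" "switch_F (cc x2) w1 e1 - switch_F (cc x2) w2 e1 \<le> 2 * (w1 - w2)"
    by (rule switch_F_mono_w; use \<sigma> w e in simp)+
  have 3: "\<bar>switch_F (cc x2) w2 e1 - switch_F (cc x2) w2 e2\<bar> \<le> 2 * \<bar>e1 - e2\<bar>"
    by (rule switch_F_lipschitz_e) (use \<sigma> w e in simp_all)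
  have 4: "\<bar>switch_F (cc x2) w2 e1 - switch_F (cc x2) w2 e2\<bar> \<le> 2 / 10 ^ 6 * (x2 - x1)" using 3 el by simp
  then have "\<bar>switch_F (cc x2) w2 e1 - switch_F (cc x2) w2 e2\<bar> \<le> 1 / 1000 * (x2 - x1)" using x(3) by simp
  then have 5: "\<bar>switch_F (cc x2) w2 e1 - switch_F (cc x2) w2 e2\<bar> \<le> (x2 - x1) / 1000" by simp
  have lo: "1/1000 * d \<le> f1 - f2" if "1/500 * k \<le> f1 - g1" "0 \<le> g1 - g2" "\<bar>g2 - f2\<bar> \<le> d / 1000" "d \<le> k" for d k f1 f2 g1 g2 :: real
  proof -
    have "- (g2 - f2) \<le> d / 1000" using that(3) by (rule abs_le_D2)
    then show ?thesis using that(1,2,4) by simp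
  qed
  have hi: "f1 - f2 \<le> 5 * d" if "f1 - g1 \<le> k" "g1 - g2 \<le> 2 * e" "\<bar>g2 - f2\<bar> \<le> d / 1000" "k \<le> 2 * d" "e \<le> d" "0 \<le> d" for d k e f1 f2 g1 g2 :: real
  proof -
    have "g2 - f2 \<le> d / 1000" using that(3) by (rule abs_le_D1)
    then show ?thesis using that(1,2,4,5,6) by simp
  qed
  show "1/1000 * (x2 - x1) \<le> Fhat \<tau> x1 - Fhat \<tau> x2" unfolding F by (rule lo[OF 1(1) 2(1) 5 c(1)])
  have d: "0 \<le> x2 - x1" using x(3) by simp
  show "Fhat \<tau> x1 - Fhat \<tau> x2 \<le> 5 * (x2 - x1)" unfolding F by (rule hi[OF 1(2) 2(2) 5 c(2) wl d])
qed

lemma Fhat_tau_Lip: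
  assumes \<tau>: "20 \<le> \<tau>1" "20 \<le> \<tau>2" and x: "x \<in> {2/3..7/9}"
  shows "\<bar>yy \<tau>1 x - yy \<tau>2 x\<bar> \<le> 1 / 10 ^ 6 * \<bar>\<tau>1 - \<tau>2\<bar>" "\<bar>Fhat \<tau>1 x - Fhat \<tau>2 x\<bar> \<le> 1 / 10 ^ 5 * \<bar>\<tau>1 - \<tau>2\<bar>"
proof -
  define \<Delta> where "\<Delta> = \<bar>\<tau>1 - \<tau>2\<bar>"
  have D0: "0 \<le> \<Delta>" unfolding \<Delta>_def by simp
  have x': "x \<in> {0..7/9}" using x by auto
  have b: "\<bar>sarc \<tau>1 s - sarc \<tau>2 s\<bar> \<le> 1 / 10 ^ 6 * \<Delta>" if "s \<in> {0..7/9}" for s unfolding \<Delta>_def by (rule arc_lipschitz[OF \<tau> that])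
  have "\<bar>ss x * (sarc \<tau>1 x - sarc \<tau>2 x)\<bar> \<le> 1 * (1 / 10 ^ 6 * \<Delta>)"
    unfolding abs_mult using ss_mid[OF x] b[OF x'] by (intro mult_mono) auto
  then have y: "\<bar>yy \<tau>1 x - yy \<tau>2 x\<bar> \<le> 1 / 10 ^ 6 * \<Delta>" unfolding yy_def by (simp add: algebra_simps)
  then show "\<bar>yy \<tau>1 x - yy \<tau>2 x\<bar> \<le> 1 / 10 ^ 6 * \<bar>\<tau>1 - \<tau>2\<bar>" unfolding \<Delta>_def .
  have "\<bar>zet (sarc \<tau>1) x - zet (sarc \<tau>2) x\<bar> \<le> 21/10 * (1 / 10 ^ 6 * \<Delta>) * x"
    by (rule zet_lipschitz[OF sb_cont[OF \<tau>(1)] sb_bounds(1)[OF \<tau>(1)] sb_cont[OF \<tau>(2)] sb_bounds(1)[OF \<tau>(2)] x']) (use b x' in auto)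
  also have "\<dots> \<le> 21/10 * (1 / 10 ^ 6 * \<Delta>) * 1" using x' D0 by (intro mult_left_mono) auto
  finally have z: "\<bar>zet (sarc \<tau>1) x - zet (sarc \<tau>2) x\<bar> \<le> \<Delta>" using D0 by simp
  define w1 w2 e1 e2 where "w1 = 1 / yy \<tau>1 x" and "w2 = 1 / yy \<tau>2 x" and "e1 = eps \<tau>1 x" and "e2 = eps \<tau>2 x"
  have yb: "1 \<le> yy \<tau>1 x" "1 \<le> yy \<tau>2 x" using yy_mid[OF \<tau>(1) x] yy_mid[OF \<tau>(2) x] by auto
  have w: "1/2 \<le> w1" "w1 \<le> 3/5" "1/2 \<le> w2" "w2 \<le> 3/5" unfolding w1_def w2_def using w_mid[OF \<tau>(1) x] w_mid[OF \<tau>(2) x] by auto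
  have wl: "\<bar>w1 - w2\<bar> \<le> 1 / 10 ^ 6 * \<Delta>" using inverse_Lip[OF yb] y unfolding w1_def w2_def by linarith
  have e: "0 \<le> e1" "e1 \<le> 1 / 10 ^ 6" "0 \<le> e2" "e2 \<le> 1 / 10 ^ 6" unfolding e1_def e2_def
    using eps_bounds[OF \<tau>(1) x] eps_bounds[OF \<tau>(2) x] by auto
  have "\<bar>e1 - e2\<bar> \<le> 1 / 10 ^ 8 * (2 * \<Delta> + 1 / 10 ^ 6 * \<Delta> + 0)"
    unfolding e1_def e2_def
  proof (rule eps_diff[OF \<tau> x x _ y])
    have "(\<tau>1 - zet (sarc \<tau>1) x) - (\<tau>2 - zet (sarc \<tau>2) x) = (\<tau>1 - \<tau>2) - (zet (sarc \<tau>1) x - zet (sarc \<tau>2) x)" by simp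
    then have "\<bar>(\<tau>1 - zet (sarc \<tau>1) x) - (\<tau>2 - zet (sarc \<tau>2) x)\<bar> \<le> \<Delta> + \<bar>zet (sarc \<tau>1) x - zet (sarc \<tau>2) x\<bar>"
      unfolding \<Delta>_def using abs_triangle_ineq4 by metis
    then show "\<bar>(\<tau>1 - zet (sarc \<tau>1) x) - (\<tau>2 - zet (sarc \<tau>2) x)\<bar> \<le> 2 * \<Delta>" using z by linarith
  qed simp
  then have el: "\<bar>e1 - e2\<bar> \<le> 1 / 10 ^ 6 * \<Delta>" using D0 by simp
  have \<sigma>: "0 \<le> cc x" "cc x \<le> 2/5" using cc_mid[OF x] by auto
  have "\<bar>switch_F (cc x) w1 e1 - switch_F (cc x) w2 e1\<bar> \<le> 2 * \<bar>w1 - w2\<bar>"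
  proof (cases "w2 \<le> w1")
    case True
    then show ?thesis using switch_F_mono_w[OF \<sigma> w(3) True w(2) e(1,2)] by simp
  next
    case False
    then have "w1 \<le> w2" by simp
    then show ?thesis using switch_F_mono_w[OF \<sigma> w(1) \<open>w1 \<le> w2\<close> w(4) e(1,2)] by simp
  qed
  then have 1: "\<bar>switch_F (cc x) w1 e1 - switch_F (cc x) w2 e1\<bar> \<le> 2 * (1 / 10 ^ 6 * \<Delta>)" by (rule order_trans) (intro mult_left_mono wl, simp)
  have "\<bar>switch_F (cc x) w2 e1 - switch_F (cc x) w2 e2\<bar> \<le> 2 * \<bar>e1 - e2\<bar>"
    by (rule switch_F_lipschitz_e[OF \<sigma> w(3,4) e])
  then have 2: "\<bar>switch_F (cc x) w2 e1 - switch_F (cc x) w2 e2\<bar> \<le> 2 * (1 / 10 ^ 6 * \<Delta>)" by (rule order_trans) (intro mult_left_mono el, simp)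
  have tri: "\<bar>a - c\<bar> \<le> D + D'" if "\<bar>a - b\<bar> \<le> D" "\<bar>b - c\<bar> \<le> D'" for a b c D D' :: real using that by linarith
  have "\<bar>switch_F (cc x) w1 e1 - switch_F (cc x) w2 e2\<bar> \<le> 2 * (1 / 10 ^ 6 * \<Delta>) + 2 * (1 / 10 ^ 6 * \<Delta>)"
    by (rule tri[OF 1 2])
  also have "\<dots> \<le> 1 / 10 ^ 5 * \<Delta>" using D0 by simp
  finally show "\<bar>Fhat \<tau>1 x - Fhat \<tau>2 x\<bar> \<le> 1 / 10 ^ 5 * \<bar>\<tau>1 - \<tau>2\<bar>"
    unfolding Fhat_def w1_def w2_def e1_def e2_def \<Delta>_def .
qed

lemma switch_exists:
  assumes \<tau>: "20 \<le> \<tau>"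
  shows "\<exists>x. x \<in> {2/3..7/9} \<and> Fhat \<tau> x = 0"
proof -
  have m: "2/3 \<in> {2/3..7/9::real}" "7/9 \<in> {2/3..7/9::real}" by auto
  have "Fhat \<tau> (2/3) > 0" unfolding Fhat_def cc_ends
  proof (rule switch_F_pos)
    show "532/1000 \<le> 1 / yy \<tau> (2/3)" using yy_ends(1,2)[OF \<tau>] by (subst pos_le_divide_eq) auto
  qed (use w_mid[OF \<tau> m(1)] eps_bounds[OF \<tau> m(1)] in auto)
  moreover have "Fhat \<tau> (7/9) < 0" unfolding Fhat_def cc_ends
  proof (rule switch_F_neg)
    show "1 / yy \<tau> (7/9) \<le> 5302/10000" using yy_ends(3)[OF \<tau>] by (subst pos_divide_le_eq) auto
  qed (use w_mid[OF \<tau> m(2)] eps_bounds[OF \<tau> m(2)] in auto)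
  moreover have "continuous_on {2/3..7/9} (Fhat \<tau>)"
  proof (rule lipschitz_on_continuous_on[of 5], rule lipschitz_onI)
    fix x z :: real assume "x \<in> {2/3..7/9}" "z \<in> {2/3..7/9}"
    then show "dist (Fhat \<tau> x) (Fhat \<tau> z) \<le> 5 * dist x z"
      using Fhat_diff[OF \<tau>, of x z] Fhat_diff[OF \<tau>, of z x] by (cases "x \<le> z") (auto simp: dist_real_def abs_le_iff)
  qed simp
  ultimately show ?thesis using IVT2'[of "Fhat \<tau>" "7/9" 0 "2/3"] by force
qed

definition xr :: "real \<Rightarrow> real" where "xr \<tau> = (SOME x. x \<in> {2/3..7/9} \<and> Fhat \<tau> x = 0)"

lemma xr_mem: "20 \<le> \<tau> \<Longrightarrow> xr \<tau> \<in> {2/3..7/9}"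
  and xr_zero: "20 \<le> \<tau> \<Longrightarrow> Fhat \<tau> (xr \<tau>) = 0"
  using someI_ex[OF switch_exists[of \<tau>]] unfolding xr_def by auto

text \<open>\<open>Fhat\<close> falls in x at a rate of at least 1/1000 but moves with \<tau> at a
  rate of at most 1/10^5; the quotient is 1/100.\<close>

lemma xr_Lip:
  assumes \<tau>: "20 \<le> \<tau>1" "20 \<le> \<tau>2"
  shows "\<bar>xr \<tau>1 - xr \<tau>2\<bar> \<le> 1/100 * \<bar>\<tau>1 - \<tau>2\<bar>"
proof -
  note m = xr_mem[OF \<tau>(1)] xr_mem[OF \<tau>(2)]
  have "1/1000 * \<bar>xr \<tau>1 - xr \<tau>2\<bar> \<le> \<bar>Fhat \<tau>1 (xr \<tau>1) - Fhat \<tau>1 (xr \<tau>2)\<bar>"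
    using Fhat_diff(1)[OF \<tau>(1) m] Fhat_diff(1)[OF \<tau>(1) m(2,1)] by (cases "xr \<tau>1 \<le> xr \<tau>2") auto
  also have "\<dots> = \<bar>Fhat \<tau>1 (xr \<tau>2) - Fhat \<tau>2 (xr \<tau>2)\<bar>" unfolding xr_zero[OF \<tau>(1)] xr_zero[OF \<tau>(2)] by simp
  also have "\<dots> \<le> 1 / 10 ^ 5 * \<bar>\<tau>1 - \<tau>2\<bar>" by (rule Fhat_tau_Lip(2)[OF \<tau> m(2)])
  finally show ?thesis by simp
qed

section \<open>The trajectories\<close>

text \<open>Substitute x = X q in the quotient of the two increments. Only continuity of X is used,
  so no derivative of the inverse parametrization has to be established, and S and T may have
  boundary points.\<close>

lemma DERIV_parametric:
  fixes V P X :: "real \<Rightarrow> real"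
  assumes X: "continuous (at p within T) X" "\<And>q. q \<in> T \<Longrightarrow> X q \<in> S \<and> P (X q) = q" and p: "p \<in> T"
    and V: "(V has_real_derivative V') (at (X p) within S)" and P: "(P has_real_derivative P') (at (X p) within S)"
    and nz: "P' \<noteq> 0"
  shows "((\<lambda>q. V (X q)) has_real_derivative V' / P') (at p within T)"
proof -
  have "((\<lambda>x. (V x - V (X p)) / (x - X p) / ((P x - P (X p)) / (x - X p))) \<longlongrightarrow> V' / P') (at (X p) within S)"
    using V P nz unfolding has_field_derivative_iff by (intro tendsto_divide)
  moreover have "\<forall>\<^sub>F x in at (X p) within S. (V x - V (X p)) / (x - X p) / ((P x - P (X p)) / (x - X p)) = (V x - V (X p)) / (P x - P (X p))"
    unfolding eventually_at_filter by (rule always_eventually) auto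
  ultimately have lim: "((\<lambda>x. (V x - V (X p)) / (P x - P (X p))) \<longlongrightarrow> V' / P') (at (X p) within S)"
    by (rule Lim_transform_eventually)
  have "filterlim X (at (X p) within S) (at p within T)"
    unfolding filterlim_at
  proof
    show "(X \<longlongrightarrow> X p) (at p within T)" using X(1) by (simp add: continuous_within)
    show "\<forall>\<^sub>F q in at p within T. X q \<in> S \<and> X q \<noteq> X p"
      unfolding eventually_at_filter by (rule always_eventually) (use X(2) p in metis)
  qed
  from filterlim_compose[OF lim this]
  have "((\<lambda>q. (V (X q) - V (X p)) / (P (X q) - P (X p))) \<longlongrightarrow> V' / P') (at p within T)" .
  moreover have "\<forall>\<^sub>F q in at p within T. (V (X q) - V (X p)) / (P (X q) - P (X p)) = (V (X q) - V (X p)) / (q - p)"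
    unfolding eventually_at_filter by (rule always_eventually) (use X(2) p in auto)
  ultimately show ?thesis unfolding has_field_derivative_iff by (rule Lim_transform_eventually)
qed

text \<open>The identity 1 + y^2 - 2 c y = s^2 (1 + b^2) cancels the factor s^2 = (v^2 - p^2) / v^2
  of the denominator. In terms of b the right-hand side is therefore regular at the end point, which
  is the reason for taking b as the unknown.\<close>

lemma singular_rhs_polar:
  fixes V c s b :: real
  defines "y \<equiv> c + s * b"
  assumes V: "0 < V" and c: "0 \<le> c" "c < 1" and cs: "c\<^sup>2 + s\<^sup>2 = 1" and y: "0 < y"
  shows "singular_rhs (V * c) V (1 / y) = (3 - 4 / (1 + V\<^sup>2) - b\<^sup>2) / (2 * V * y\<^sup>2)"
proof -
  have "c\<^sup>2 < 1\<^sup>2" using c by (intro power_strict_mono) auto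
  then have "c\<^sup>2 < 1" by simp
  then have s: "s\<^sup>2 > 0" using cs by linarith
  have p: "0 \<le> V * c" "V * c < V" using V c by auto
  have a: "V\<^sup>2 - (V * c)\<^sup>2 = V\<^sup>2 * s\<^sup>2" using cs by (simp add: power_mult_distrib algebra_simps flip: distrib_left)
  define M where "M = 1 + V\<^sup>2"
  have M: "M > 0" "V\<^sup>2 = M - 1" using one_plus_square_pos[of V] by (auto simp: M_def)
  have "(1 / y)\<^sup>2 + 1 - 2 * c * (1 / y) = (1 + y\<^sup>2 - 2 * c * y) / y\<^sup>2" using y by (simp add: field_simps power2_eq_square)
  also have "1 + y\<^sup>2 - 2 * c * y = s\<^sup>2 * (1 + b\<^sup>2)"
  proof -
    have "1 + y\<^sup>2 - 2 * c * y = 1 - c\<^sup>2 + (s * b)\<^sup>2" unfolding y_def by (simp add: algebra_simps power2_eq_square)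
    then show ?thesis using cs by (simp add: power_mult_distrib algebra_simps)
  qed
  finally have g: "(1 / y)\<^sup>2 + 1 - 2 * c * (1 / y) = s\<^sup>2 * (1 + b\<^sup>2) / y\<^sup>2" .
  have "V * ((1 / y)\<^sup>2 + 1) - 2 * (V * c) * (1 / y) = V * ((1 / y)\<^sup>2 + 1 - 2 * c * (1 / y))" by (simp add: algebra_simps)
  then have "singular_rhs (V * c) V (1 / y) = - (V * (s\<^sup>2 * (1 + b\<^sup>2) / y\<^sup>2)) / (2 * (V\<^sup>2 * s\<^sup>2)) + 2 * V * (1 / y)\<^sup>2 / M"
    unfolding singular_rhs_eq[OF p] a g M_def by simp
  also have "- (V * (s\<^sup>2 * (1 + b\<^sup>2) / y\<^sup>2)) / (2 * (V\<^sup>2 * s\<^sup>2)) = - (1 + b\<^sup>2) / (2 * V * y\<^sup>2)"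
  proof -
    have "- (V * (q * a / z)) / (2 * (V\<^sup>2 * q)) = - a / (2 * V * z)" if "0 < q" "0 < z" for q a z :: real
      using that V by (simp add: field_simps power2_eq_square)
    from this[OF s zero_less_power[OF y]] show ?thesis .
  qed
  also have "2 * V * (1 / y)\<^sup>2 / M = (4 * V\<^sup>2 / M) / (2 * V * y\<^sup>2)"
    using V y M(1) by (simp add: power2_eq_square)
  also have "4 * V\<^sup>2 / M = 4 - 4 / M" unfolding M(2) using M(1) by (simp add: field_simps)
  finally show ?thesis unfolding M_def[symmetric] by (simp add: diff_divide_distrib add_divide_distrib)
qed

lemma cc_bounds: assumes "x \<in> {0..1}" shows "0 \<le> cc x" "cc x \<le> 1" "0 < x \<Longrightarrow> cc x < 1"
proof -
  have "x\<^sup>2 \<le> 1\<^sup>2" using assms by (intro power_mono) auto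
  then show "0 \<le> cc x" unfolding cc_def by simp
  show "cc x \<le> 1" "0 < x \<Longrightarrow> cc x < 1" unfolding cc_def using one_plus_square_pos(1)[of x] zero_less_power2[of x]
    by (auto simp: divide_le_eq divide_less_eq simp del: zero_less_power2)
qed

lemma cc_strict_antimono: assumes "0 \<le> x" "x < z" shows "cc z < cc x"
proof -
  have "x\<^sup>2 < z\<^sup>2" using assms by (intro power_strict_mono) auto
  moreover have "cc t = 2 / (1 + t\<^sup>2) - 1" for t unfolding cc_def using one_plus_square_pos(1)[of t] by (simp add: field_simps)
  ultimately show ?thesis using one_plus_square_pos(1)[of x] one_plus_square_pos(1)[of z]
    by (auto intro!: divide_strict_left_mono)
qed

lemma cc_at_1: "cc 1 = 0" and cc_at_0: "cc 0 = 1" and ss_at_0: "ss 0 = 0" by (simp_all add: cc_def ss_def)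

lemma cc_surj: assumes "0 \<le> t" "t \<le> 1" shows "\<exists>x\<in>{0..1}. cc x = t"
  using IVT2'[of cc 1 t 0] cc_cont assms cc_at_1 cc_at_0 by auto

lemma ss_high: assumes "x \<in> {2/3..1}" shows "92/100 \<le> ss x" "ss x \<le> 1"
proof -
  have s0: "0 \<le> ss x" using assms by (intro ss_nonneg) auto
  have c: "0 \<le> cc x" "cc x \<le> 5/13"
    using cc_bounds(1)[of x] cc_strict_antimono[of "2/3" x] cc_ends(1) assms by (cases "x = 2/3"; force)+
  have "(cc x)\<^sup>2 \<le> (5/13)\<^sup>2" using c by (intro power_mono) auto
  then have "(92/100)\<^sup>2 \<le> (ss x)\<^sup>2" using cc_ss[of x] by (simp add: power2_eq_square)
  then show "92/100 \<le> ss x" by (rule power2_le_imp_le) (rule s0)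
  have "(ss x)\<^sup>2 \<le> 1\<^sup>2" using cc_ss[of x] zero_le_power2[of "cc x"] unfolding one_power2 by linarith
  then show "ss x \<le> 1" by (rule power2_le_imp_le) simp
qed

text \<open>The trajectory with \<open>ln p\<^sub>0 = \<tau>\<close>, parametrized by the angular variable \<open>x\<close>, which decreases from 1 at
  \<open>p = 0\<close> to 0 at \<open>p = p\<^sub>0\<close>; it is affine for \<open>x \<ge> xr \<tau>\<close>. Here \<open>trY = 1 / v'\<close>, \<open>trZ = ln v\<close>, and \<open>trX\<close> inverts \<open>trP\<close>.\<close>

definition trY :: "real \<Rightarrow> real \<Rightarrow> real" where "trY \<tau> x = yy \<tau> (min x (xr \<tau>))"
definition trB :: "real \<Rightarrow> real \<Rightarrow> real" where
  "trB \<tau> x = (if x \<le> xr \<tau> then sarc \<tau> x else (yy \<tau> (xr \<tau>) - cc x) / ss x)"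
definition trZ :: "real \<Rightarrow> real \<Rightarrow> real" where "trZ \<tau> x = \<tau> - zet (trB \<tau>) x"
definition trV :: "real \<Rightarrow> real \<Rightarrow> real" where "trV \<tau> x = exp (trZ \<tau> x)"
definition trP :: "real \<Rightarrow> real \<Rightarrow> real" where "trP \<tau> x = trV \<tau> x * cc x"
definition trX :: "real \<Rightarrow> real \<Rightarrow> real" where "trX \<tau> = the_inv_into {0..1} (trP \<tau>)"

context
  fixes \<tau> :: real
  assumes \<tau>: "20 \<le> \<tau>"
begin

abbreviation "\<rho> \<equiv> xr \<tau>"

lemma \<rho>: "2/3 \<le> \<rho>" "\<rho> \<le> 7/9" using xr_mem[OF \<tau>] by auto

lemma trY_eq: assumes x: "x \<in> {0..1}" shows "cc x + ss x * trB \<tau> x = trY \<tau> x"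
proof (cases "x \<le> \<rho>")
  case True then show ?thesis unfolding trY_def trB_def yy_def by (simp add: min_def)
next
  case False
  then have "ss x > 0" using ss_high(1)[of x] x \<rho> by auto
  with False show ?thesis unfolding trY_def trB_def by (simp add: min_def)
qed

lemma trB_cont: "continuous_on {0..1} (trB \<tau>)"
  unfolding trB_def
proof (rule continuous_on_cases_le[where h = "\<lambda>x. x" and a = \<rho>])
  show "continuous_on {t \<in> {0..1}. t \<le> \<rho>} (sarc \<tau>)"
    by (rule continuous_on_subset[OF sb_cont[OF \<tau>]]) (use \<rho> in auto)
  have "ss x \<noteq> 0" if "x \<in> {t \<in> {0..1}. \<rho> \<le> t}" for x using ss_high(1)[of x] \<rho> that by auto
  then show "continuous_on {t \<in> {0..1}. \<rho> \<le> t} (\<lambda>x. (yy \<tau> \<rho> - cc x) / ss x)"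
    by (intro continuous_intros cc_cont ss_cont) blast
  show "sarc \<tau> t = (yy \<tau> \<rho> - cc t) / ss t" if "t \<in> {0..1}" "t = \<rho>" for t
    using ss_high(1)[of t] \<rho> that unfolding yy_def by auto
qed (rule continuous_on_id)

lemma trB_ge: assumes x: "x \<in> {0..1}" shows "99/100 \<le> trB \<tau> x"
proof (cases "x \<le> \<rho>")
  case True then show ?thesis unfolding trB_def using sb_bounds(1)[OF \<tau>, of x] \<rho> x by auto
next
  case False
  then have s: "92/100 \<le> ss x" "ss x \<le> 1" using ss_high[of x] x \<rho> by auto
  have "cc x \<le> cc \<rho>" using cc_strict_antimono[of \<rho> x] False \<rho> by auto
  then have "1 \<le> yy \<tau> \<rho> - cc x" using yy_cc_mid[OF \<tau> xr_mem[OF \<tau>]] by simp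
  then have "99/100 * ss x \<le> yy \<tau> \<rho> - cc x" using s by simp
  then show ?thesis unfolding trB_def using False s by (simp add: pos_le_divide_eq)
qed

lemma trB_pos: "x \<in> {0..1} \<Longrightarrow> 0 < trB \<tau> x" using trB_ge[of x] by simp

lemma trY_bounds: assumes x: "x \<in> {0..1}" shows "0 < trY \<tau> x" "trY \<tau> x \<le> 2"
proof -
  show "0 < trY \<tau> x" unfolding trY_def using yy_pos[OF \<tau>] \<rho> x by auto
  show "trY \<tau> x \<le> 2"
  proof (cases "x \<le> 2/3")
    case True
    have "continuous_on {x..2/3} (yy \<tau>)" by (rule continuous_on_subset[OF yy_cont[OF \<tau>]]) (use x in auto)
    moreover have "\<exists>d. (yy \<tau> has_real_derivative d) (at z) \<and> 0 \<le> d" if "x < z" "z < 2/3" for z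
    proof -
      have z: "0 < z" "z \<le> 7/9" "z \<in> {0..7/9}" "z \<in> interior {0..7/9}" using that x by auto
      have "0 \<le> yy \<tau> z * sk \<tau> z / ((1 + z\<^sup>2) * sarc \<tau> z)"
        using yy_pos[OF \<tau> z(3)] sk_pos(1)[OF \<tau> z(3)] sb_pos[OF \<tau> z(3)] by (intro divide_nonneg_nonneg mult_nonneg_nonneg) auto
      with DERIV_yy[OF \<tau> z(1,2)] at_within_interior[OF z(4)] show ?thesis by metis
    qed
    ultimately have "yy \<tau> x \<le> yy \<tau> (2/3)" using DERIV_nonneg_imp_increasing_open[OF True] by blast
    then show ?thesis unfolding trY_def using yy_ends(1)[OF \<tau>] True \<rho> by (simp add: min_def)
  next
    case False
    then have "min x \<rho> \<in> {2/3..7/9}" using \<rho> by auto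
    then show ?thesis unfolding trY_def using yy_mid(2)[OF \<tau>] by fastforce
  qed
qed

lemma trY_after: "\<rho> \<le> x \<Longrightarrow> trY \<tau> x = yy \<tau> \<rho>" unfolding trY_def by (simp add: min_absorb2)
lemma trY_before: "x \<le> \<rho> \<Longrightarrow> trY \<tau> x = yy \<tau> x" unfolding trY_def by (simp add: min_def)

lemma trZ_before: assumes "x \<in> {0..\<rho>}" shows "trZ \<tau> x = \<tau> - zet (sarc \<tau>) x"
proof -
  have "zet (trB \<tau>) x = zet (sarc \<tau>) x"
    unfolding zet_def by (rule integral_cong) (use assms in \<open>auto simp: trB_def\<close>)
  then show ?thesis unfolding trZ_def by simp
qed

lemma trZ_bounds: assumes x: "x \<in> {0..1}" shows "trZ \<tau> x \<le> \<tau>" "\<tau> - 21/10 \<le> trZ \<tau> x"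
  using zet_bounds[OF trB_cont trB_ge order_refl x] x unfolding trZ_def by auto

lemma trV_pos: "0 < trV \<tau> x" unfolding trV_def by simp

lemma DERIV_trV:
  assumes x: "x \<in> {0..1}"
  shows "(trV \<tau> has_real_derivative - (trV \<tau> x * (2 / ((1 + x\<^sup>2) * trB \<tau> x)))) (at x within {0..1})"
proof -
  have "((\<lambda>x. \<tau> - zet (trB \<tau>) x) has_real_derivative 0 - 2 / ((1 + x\<^sup>2) * trB \<tau> x)) (at x within {0..1})"
    by (intro DERIV_diff DERIV_const DERIV_zet[OF trB_cont trB_pos x])
  from DERIV_chain2[OF DERIV_exp this] have "((\<lambda>x. exp (\<tau> - zet (trB \<tau>) x)) has_real_derivative exp (\<tau> - zet (trB \<tau>) x) * (0 - 2 / ((1 + x\<^sup>2) * trB \<tau> x))) (at x within {0..1})" .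
  then show ?thesis unfolding trV_def trZ_def by simp
qed

definition trP' :: "real \<Rightarrow> real" where "trP' x = - (trV \<tau> x * (2 / ((1 + x\<^sup>2) * trB \<tau> x)) * trY \<tau> x)"

text \<open>\<open>trP'\<close> is \<open>trY\<close> times the derivative of \<open>trV\<close>;
  hence the parametrized curve has slope 1/\<open>trY\<close>.\<close>

lemma DERIV_trP:
  assumes x: "x \<in> {0..1}"
  shows "(trP \<tau> has_real_derivative trP' x) (at x within {0..1})"
proof -
  have D: "((\<lambda>x. trV \<tau> x * cc x) has_real_derivative
     - (trV \<tau> x * (2 / ((1 + x\<^sup>2) * trB \<tau> x))) * cc x + - (2 / (1 + x\<^sup>2)) * ss x * trV \<tau> x) (at x within {0..1})"
    by (rule DERIV_mult[OF DERIV_trV[OF x] DERIV_cc])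
  have "- (trV \<tau> x * (2 / ((1 + x\<^sup>2) * trB \<tau> x))) * cc x + - (2 / (1 + x\<^sup>2)) * ss x * trV \<tau> x = trP' x"
  proof -
    define k where "k = 2 / ((1 + x\<^sup>2) * trB \<tau> x)"
    have "2 / (1 + x\<^sup>2) = k * trB \<tau> x" unfolding k_def using trB_pos[OF x] by simp
    then show ?thesis unfolding trP'_def trY_eq[OF x, symmetric] k_def[symmetric] by (simp add: algebra_simps)
  qed
  from DERIV_cong[OF D this] show ?thesis unfolding trP_def[abs_def] .
qed

lemma trP'_neg: assumes x: "x \<in> {0..1}" shows "trP' x < 0"
  unfolding trP'_def using trB_pos[OF x] trY_bounds[OF x] trV_pos one_plus_square_pos(1)[of x]
  by (simp add: mult_pos_pos)

lemma strict_antimono_of_DERIV: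
  fixes g :: "real \<Rightarrow> real"
  assumes D: "\<And>x. x \<in> {0..1} \<Longrightarrow> (g has_real_derivative g' x) (at x within {0..1})" and neg: "\<And>x. x \<in> {0..1} \<Longrightarrow> g' x < 0"
    and xz: "0 \<le> x" "x < z" "z \<le> 1"
  shows "g z < g x"
proof (rule DERIV_neg_imp_decreasing_open[OF xz(2)])
  show "\<exists>d. (g has_real_derivative d) (at t) \<and> d < 0" if "x < t" "t < z" for t
  proof -
    have t: "t \<in> {0..1}" "t \<in> interior {0..1}" using that xz by auto
    show ?thesis using D[OF t(1)] neg[OF t(1)] at_within_interior[OF t(2)] by metis
  qed
  have "continuous_on {0..1} g" by (rule DERIV_continuous_on[OF D])
  then show "continuous_on {x..z} g" by (rule continuous_on_subset) (use xz in auto)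
qed

lemma trP_anti: "0 \<le> x \<Longrightarrow> x < z \<Longrightarrow> z \<le> 1 \<Longrightarrow> trP \<tau> z < trP \<tau> x"
  by (rule strict_antimono_of_DERIV[OF DERIV_trP trP'_neg])

lemma trV_anti: "0 \<le> x \<Longrightarrow> x < z \<Longrightarrow> z \<le> 1 \<Longrightarrow> trV \<tau> z < trV \<tau> x"
proof (rule strict_antimono_of_DERIV[OF DERIV_trV])
  show "- (trV \<tau> x * (2 / ((1 + x\<^sup>2) * trB \<tau> x))) < 0" if x: "x \<in> {0..1}" for x
    using trB_pos[OF x] trV_pos one_plus_square_pos(1)[of x] by (simp add: mult_pos_pos)
qed

lemma trP_inj: "inj_on (trP \<tau>) {0..1}"
  by (rule linorder_inj_onI) (use trP_anti in fastforce)+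

lemma trP_cont: "continuous_on {0..1} (trP \<tau>)" by (rule DERIV_continuous_on[OF DERIV_trP])
lemma trV_cont: "continuous_on {0..1} (trV \<tau>)" by (rule DERIV_continuous_on[OF DERIV_trV])

lemma trV_0: "trV \<tau> 0 = exp \<tau>" unfolding trV_def trZ_def zet_def by simp
lemma trP_ends: "trP \<tau> 0 = exp \<tau>" "trP \<tau> 1 = 0" unfolding trP_def by (simp_all add: trV_0 cc_at_0 cc_at_1)

lemma trP_le_iff: assumes "x \<in> {0..1}" "z \<in> {0..1}" shows "trP \<tau> x \<le> trP \<tau> z \<longleftrightarrow> z \<le> x"
  using trP_anti[of x z] trP_anti[of z x] assms by (cases x z rule: linorder_cases) auto

lemma trP_image: "trP \<tau> ` {0..1} = {0..exp \<tau>}"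
proof
  show "trP \<tau> ` {0..1} \<subseteq> {0..exp \<tau>}"
    using trP_le_iff[of 1] trP_le_iff[of _ 0] trP_ends by auto
  show "{0..exp \<tau>} \<subseteq> trP \<tau> ` {0..1}"
    using IVT2'[of "trP \<tau>" 1 _ 0] trP_cont trP_ends by (auto simp: image_iff) (metis atLeastAtMost_iff)
qed

lemma trX_trP: "x \<in> {0..1} \<Longrightarrow> trX \<tau> (trP \<tau> x) = x"
  unfolding trX_def by (rule the_inv_into_f_f[OF trP_inj])

lemma trX_mem: "q \<in> {0..exp \<tau>} \<Longrightarrow> trX \<tau> q \<in> {0..1} \<and> trP \<tau> (trX \<tau> q) = q"
  using trX_trP trP_image by (metis imageE)

lemma trX_cont: "continuous_on {0..exp \<tau>} (trX \<tau>)"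
  using continuous_on_inv[OF trP_cont compact_Icc, of "trX \<tau>"] trX_trP trP_image by auto

lemma trX_cont_within: assumes "p \<in> T" "T \<subseteq> {0..exp \<tau>}" shows "continuous (at p within T) (trX \<tau>)"
  using continuous_on_subset[OF trX_cont assms(2)] assms(1) continuous_on_eq_continuous_within by blast

lemma trX_le: assumes "p \<in> {0..exp \<tau>}" "q \<in> {0..exp \<tau>}" shows "trX \<tau> p \<le> trX \<tau> q \<longleftrightarrow> q \<le> p"
  using trP_le_iff[of "trX \<tau> q" "trX \<tau> p"] trX_mem[OF assms(1)] trX_mem[OF assms(2)] by auto

lemma trV_rhs:
  assumes x: "x \<in> {0..1}" "0 < x"
  shows "singular_rhs (trP \<tau> x) (trV \<tau> x) (1 / trY \<tau> x) = (3 - 4 * mfun (trZ \<tau> x) - (trB \<tau> x)\<^sup>2) / (2 * trV \<tau> x * (trY \<tau> x)\<^sup>2)"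
proof -
  have "4 / (1 + (trV \<tau> x)\<^sup>2) = 4 * mfun (trZ \<tau> x)"
    unfolding mfun_def trV_def by (simp add: exp_double)
  moreover have "singular_rhs (trV \<tau> x * cc x) (trV \<tau> x) (1 / (cc x + ss x * trB \<tau> x)) =
     (3 - 4 / (1 + (trV \<tau> x)\<^sup>2) - (trB \<tau> x)\<^sup>2) / (2 * trV \<tau> x * (cc x + ss x * trB \<tau> x)\<^sup>2)"
    by (rule singular_rhs_polar[OF trV_pos _ _ cc_ss]) (use cc_bounds[OF x(1)] x trY_eq[OF x(1)] trY_bounds(1)[OF x(1)] in auto)
  ultimately show ?thesis unfolding trP_def trY_eq[OF x(1)] by simp
qed

lemma trV_rhs_before:
  assumes x: "0 < x" "x \<le> \<rho>"
  shows "singular_rhs (trP \<tau> x) (trV \<tau> x) (1 / trY \<tau> x) = sk \<tau> x / (2 * trV \<tau> x * (trY \<tau> x)\<^sup>2)"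
proof -
  have "x \<in> {0..1}" using x \<rho> by auto
  from trV_rhs[OF this x(1)] show ?thesis
    unfolding sk_def[OF \<tau>] smu_def using trZ_before[of x] x by (simp add: trB_def)
qed

lemma exp_tau_square: "10 ^ 9 \<le> exp \<tau> * exp \<tau>"
proof -
  have "exp \<tau> * exp \<tau> = exp (2 * \<tau>)" by (simp flip: exp_add)
  then show ?thesis using exp_36[of \<tau>] \<tau> by simp
qed

text \<open>On [0, 1] \<open>zet\<close> is at most 21/10, and exp (21/10) < 9.\<close>

lemma trV_ge: assumes x: "x \<in> {0..1}" shows "exp \<tau> \<le> 9 * trV \<tau> x"
proof -
  have "exp (21/10) = exp 1 * exp 1 * exp (1/10 :: real)" by (simp flip: exp_add)
  also have "\<dots> \<le> 272/100 * (272/100) * (12/10)"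
  proof (intro mult_mono)
    show e: "exp 1 \<le> (272/100::real)" using e_less_272 by simp
    then show "exp 1 \<le> (272/100::real)" .
    show "exp (1/10) \<le> (12/10::real)" using exp_bound[of "1/10::real"] by (simp add: power2_eq_square)
  qed auto
  finally have e: "exp (21/10) \<le> (9::real)" by simp
  have "exp \<tau> = exp (\<tau> - 21/10) * exp (21/10)" by (simp flip: exp_add)
  also have "\<dots> \<le> trV \<tau> x * 9" unfolding trV_def using trZ_bounds[OF x] e by (intro mult_mono) auto
  finally show ?thesis by simp
qed

lemma trV_le: "x \<in> {0..1} \<Longrightarrow> trV \<tau> x \<le> exp \<tau>" unfolding trV_def using trZ_bounds(1) by simp

lemma zet_low: "7/15 \<le> zet (sarc \<tau>) \<rho>"
proof -
  have i: "(\<lambda>s. 2 / ((1 + s\<^sup>2) * sarc \<tau> s)) integrable_on {0..\<rho>}"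
    by (intro integrable_continuous_interval continuous_on_subset[OF zet_integrand_cont[OF sb_cont[OF \<tau>] sb_pos[OF \<tau>]]]) (use \<rho> in auto)
  have "integral {0..\<rho>} (\<lambda>s. 7/10) \<le> integral {0..\<rho>} (\<lambda>s. 2 / ((1 + s\<^sup>2) * sarc \<tau> s))"
  proof (rule integral_le[OF _ i])
    fix s assume "s \<in> {0..\<rho>}"
    then have s: "s \<in> {0..7/9}" using \<rho> by auto
    have "s\<^sup>2 \<le> (7/9)\<^sup>2" using s by (intro power_mono) auto
    then have "1 + s\<^sup>2 \<le> 130/81" by (simp add: power2_eq_square)
    then have "(1 + s\<^sup>2) * sarc \<tau> s \<le> 130/81 * (1737/1000)" using sb_bounds[OF \<tau> s] by (intro mult_mono) auto
    moreover have "0 < (1 + s\<^sup>2) * sarc \<tau> s" using one_plus_square_pos(1)[of s] sb_pos[OF \<tau> s] by simp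
    ultimately show "7/10 \<le> 2 / ((1 + s\<^sup>2) * sarc \<tau> s)" by (subst pos_le_divide_eq) auto
  qed auto
  then show ?thesis unfolding zet_def using \<rho> by simp
qed

text \<open>At the switch ln v has fallen by at least 7/15, so v <= b / 1.57, while p <= 5/13 v.
  This is the hypothesis r <= b/4 of the Jacobi argument.\<close>

lemma trP_\<rho>_le: "trP \<tau> \<rho> \<le> exp \<tau> / 4"
proof -
  have z: "7/15 \<le> \<tau> - trZ \<tau> \<rho>" using zet_low trZ_before[of \<rho>] \<rho> by simp
  have "157/100 \<le> exp (7/15::real)" using exp_lower_Taylor_quadratic[of "7/15"] by (simp add: power2_eq_square)
  also have "\<dots> \<le> exp (\<tau> - trZ \<tau> \<rho>)" using z by simp
  finally have "trV \<tau> \<rho> * (157/100) \<le> trV \<tau> \<rho> * exp (\<tau> - trZ \<tau> \<rho>)" using trV_pos by (intro mult_left_mono) (auto intro: less_imp_le)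
  also have "\<dots> = exp \<tau>" unfolding trV_def by (simp flip: exp_add)
  finally have "trV \<tau> \<rho> * (157/100) \<le> exp \<tau>" .
  moreover have "trP \<tau> \<rho> \<le> trV \<tau> \<rho> * (5/13)" unfolding trP_def using trV_pos cc_mid(2)[OF xr_mem[OF \<tau>]] by (intro mult_left_mono) (auto intro: less_imp_le)
  ultimately show ?thesis using trV_pos[of \<rho>] by simp
qed

lemma trP_\<rho>_ge: "exp \<tau> \<le> 40 * trP \<tau> \<rho>"
proof -
  have "exp \<tau> \<le> 9 * trV \<tau> \<rho>" using \<rho> by (intro trV_ge) auto
  moreover have "trV \<tau> \<rho> * (32/130) \<le> trP \<tau> \<rho>" unfolding trP_def using trV_pos cc_mid(1)[OF xr_mem[OF \<tau>]] by (intro mult_left_mono) (auto intro: less_imp_le)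
  ultimately show ?thesis using trV_pos[of \<rho>] by simp
qed

end

text \<open>The quotient of \<open>jac_Q\<close> by \<open>kin\<close> is E / v^2, where E depends
  on c = p / v, the slope, and m = v^2 / (1 + v^2), which is nearly 1. On the small box of these
  parameters |E| <= 11/10, and 0.236 * 1.1 < 0.3.\<close>

lemma jac_Q_small:
  fixes p v w r :: real
  assumes v: "100 \<le> v" and p: "0 \<le> p" "p \<le> 5/13 * v" and w: "524/1000 \<le> w" "w \<le> 54/100"
    and r: "r\<^sup>2 \<le> 236/1000 * v\<^sup>2"
  shows "r\<^sup>2 * \<bar>jac_Q p v w\<bar> \<le> 3/10 * kin p v"
proof -
  define c where "c = p / v"
  define T where "T = 1 / (1 - c\<^sup>2)"
  define m where "m = v\<^sup>2 / (1 + v\<^sup>2)"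
  define E where "E = (- (w\<^sup>2 + 1) * T / 2 + (w\<^sup>2 + 1 - 2 * c * w) * T\<^sup>2 + 2 * w\<^sup>2 * (m * (1 - 2 * m)))
     + (T - 4 * m) * (- (w\<^sup>2 + 1 - 2 * c * w) * T / 2 + 2 * w\<^sup>2 * m)"
  have v0: "0 < v" and pv: "p < v" using v p by auto
  have pc: "p = c * v" unfolding c_def using v0 by simp
  have c: "0 \<le> c" "c \<le> 5/13" unfolding c_def using p v0 by (simp_all add: pos_divide_le_eq)
  have "c\<^sup>2 \<le> (5/13)\<^sup>2" using c by (intro power_mono) auto
  then have c2: "144/169 \<le> 1 - c\<^sup>2" "1 - c\<^sup>2 \<le> 1" by (simp_all add: power2_eq_square)
  have T: "1 \<le> T" "T \<le> 169/144" unfolding T_def using c2 by (simp_all add: pos_le_divide_eq pos_divide_le_eq)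
  have \<sigma>: "v\<^sup>2 - p\<^sup>2 = v\<^sup>2 * (1 - c\<^sup>2)" unfolding pc by (simp add: power_mult_distrib algebra_simps)
  have N: "1 + v\<^sup>2 > 0" by (rule one_plus_square_pos)
  have "100\<^sup>2 \<le> v\<^sup>2" using v by (intro power_mono) auto
  then have m: "999/1000 \<le> m" "m \<le> 1" unfolding m_def using N by (simp_all add: pos_le_divide_eq pos_divide_le_eq)
  have e1: "v / (v\<^sup>2 - p\<^sup>2) = T / v" unfolding \<sigma> T_def using v0 by (simp add: power2_eq_square)
  have e2: "4 * v / (1 + v\<^sup>2) = 4 * m / v" unfolding m_def using v0 by (simp add: power2_eq_square)
  have e3: "v / (1 + v\<^sup>2) = m / v" unfolding m_def using v0 by (simp add: power2_eq_square)
  have R: "singular_rhs p v w = (- (w\<^sup>2 + 1 - 2 * c * w) * T / 2 + 2 * w\<^sup>2 * m) / v"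
  proof -
    have "singular_rhs p v w = - ((v * (w\<^sup>2 + 1) - 2 * p * w) / (v\<^sup>2 - p\<^sup>2)) / 2 + 2 * w\<^sup>2 * (v / (1 + v\<^sup>2))"
    proof -
      have "- A / (2 * t) + 2 * v * w\<^sup>2 / n = - (A / t) / 2 + 2 * w\<^sup>2 * (v / n)" for A t n :: real by (simp add: ac_simps)
      then show ?thesis unfolding singular_rhs_eq[OF p(1) pv] by blast
    qed
    also have "(v * (w\<^sup>2 + 1) - 2 * p * w) / (v\<^sup>2 - p\<^sup>2) = (w\<^sup>2 + 1 - 2 * c * w) * (v / (v\<^sup>2 - p\<^sup>2))"
      unfolding pc by (simp add: algebra_simps)
    also have "- ((w\<^sup>2 + 1 - 2 * c * w) * (v / (v\<^sup>2 - p\<^sup>2))) / 2 + 2 * w\<^sup>2 * (v / (1 + v\<^sup>2))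
      = (- (w\<^sup>2 + 1 - 2 * c * w) * T / 2 + 2 * w\<^sup>2 * m) / v"
    proof -
      have "- (g * (T / v)) / 2 + 2 * w\<^sup>2 * (m / v) = (- g * T / 2 + 2 * w\<^sup>2 * m) / v" for g
        using v0 by (simp add: field_simps)
      then show ?thesis unfolding e1 e3 .
    qed
    finally show ?thesis .
  qed
  have Rv: "singular_rhs_v p v w = (- (w\<^sup>2 + 1) * T / 2 + (w\<^sup>2 + 1 - 2 * c * w) * T\<^sup>2 + 2 * w\<^sup>2 * (m * (1 - 2 * m))) / v\<^sup>2"
  proof -
    have a: "- (w\<^sup>2 + 1) / (2 * (v\<^sup>2 - p\<^sup>2)) = (- (w\<^sup>2 + 1) * T / 2) / v\<^sup>2"
      unfolding \<sigma> T_def by simp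
    have "v * (v * (w\<^sup>2 + 1) - 2 * p * w) / (v\<^sup>2 - p\<^sup>2)\<^sup>2 = (w\<^sup>2 + 1 - 2 * c * w) * (v / (v\<^sup>2 - p\<^sup>2))\<^sup>2"
      unfolding pc by (simp add: power2_eq_square algebra_simps)
    also have "\<dots> = ((w\<^sup>2 + 1 - 2 * c * w) * T\<^sup>2) / v\<^sup>2" unfolding e1 by (simp add: power_divide)
    finally have b: "v * (v * (w\<^sup>2 + 1) - 2 * p * w) / (v\<^sup>2 - p\<^sup>2)\<^sup>2 = ((w\<^sup>2 + 1 - 2 * c * w) * T\<^sup>2) / v\<^sup>2" .
    have "1 - 2 * m = (1 - v\<^sup>2) / (1 + v\<^sup>2)" unfolding m_def using N by (simp add: field_simps)
    then have "2 * w\<^sup>2 * (m * (1 - 2 * m)) / v\<^sup>2 = 2 * w\<^sup>2 * (1 - v\<^sup>2) / ((1 + v\<^sup>2) * (1 + v\<^sup>2))"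
      unfolding m_def using v0 by simp
    then have d: "2 * w\<^sup>2 * (1 - v\<^sup>2) / (1 + v\<^sup>2)\<^sup>2 = (2 * w\<^sup>2 * (m * (1 - 2 * m))) / v\<^sup>2"
      unfolding power2_eq_square[of "1 + v\<^sup>2"] by simp
    show ?thesis unfolding singular_rhs_v_def a b d by (simp add: add_divide_distrib)
  qed
  have "jac_Q p v w = kin p v * (singular_rhs_v p v w + (v / (v\<^sup>2 - p\<^sup>2) - 4 * v / (1 + v\<^sup>2)) * singular_rhs p v w)"
    unfolding jac_Q_def kin_v_def by (simp add: algebra_simps)
  also have "singular_rhs_v p v w + (v / (v\<^sup>2 - p\<^sup>2) - 4 * v / (1 + v\<^sup>2)) * singular_rhs p v w = E / v\<^sup>2"
  proof -
    have "a / v\<^sup>2 + (t / v - m / v) * (d / v) = (a + (t - m) * d) / v\<^sup>2" for a t m d :: real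
      using v0 by (simp add: power2_eq_square field_simps)
    then show ?thesis unfolding R Rv e1 e2 E_def by blast
  qed
  finally have Q: "jac_Q p v w = kin p v * (E / v\<^sup>2)" .
  have "\<bar>E\<bar> \<le> 11/10"
  proof -
    have W: "274/1000 \<le> w\<^sup>2" "w\<^sup>2 \<le> 2916/10000"
      using power_mono[OF w(1), of 2] power_mono[OF w(2), of 2] w by (auto simp: power2_eq_square)
    have mm: "a * b \<le> A * B" if "0 \<le> a" "a \<le> A" "0 \<le> b" "b \<le> B" for a b A B :: real
      using that by (intro mult_mono) auto
    have h: "0 \<le> c * w" "c * w \<le> 5/13 * (54/100)" using c w by simp (rule mm; use c w in simp)
    have TT: "0 \<le> T * (T - 1)" "T * (T - 1) \<le> 169/144 * (25/144)" using T by simp (rule mm; use T in simp)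
    have mT: "999/1000 * 1 \<le> m * T" "m * T \<le> 1 * (169/144)" by (rule mm; use m T in simp)+
    have "999/1000 * (382/100) \<le> m * (6 * m - 1 - T)" "m * (6 * m - 1 - T) \<le> 1 * 4" by (rule mm; use m T in simp)+
    then have K3: "38/10 \<le> m * (6 * m - 1 - T)" "m * (6 * m - 1 - T) \<le> 4" by simp_all
    define K1 K2 K3 where "K1 = T * (T - 1) / 2 + 2 * (m * T)" and "K2 = K1 + T / 2" and "K3 = m * (6 * m - 1 - T)"
    have k: "1998/1000 \<le> K1" "K1 \<le> 246/100" "K2 \<le> 305/100" "0 \<le> K2"
    proof -
      define X Z where "X = T * (T - 1)" and "Z = m * T"
      have "0 \<le> X" "X \<le> 169/144 * (25/144)" "999/1000 \<le> Z" "Z \<le> 169/144"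
        using TT mT unfolding X_def[symmetric] Z_def[symmetric] by simp_all
      then show "1998/1000 \<le> K1" "K1 \<le> 246/100" "K2 \<le> 305/100" "0 \<le> K2"
        using T unfolding K2_def K1_def X_def[symmetric] Z_def[symmetric] by simp_all
    qed
    \<comment> \<open>Regrouped into products of nonnegative factors, so that each can be bounded on
      both sides by interval arithmetic.\<close>
    have E: "E = (1 + w\<^sup>2) * K1 - 2 * (c * w * K2) - 2 * (w\<^sup>2 * K3)"
      unfolding E_def K1_def K2_def K3_def by (simp add: field_simps power2_eq_square)
    have a: "1274/1000 * (1998/1000) \<le> (1 + w\<^sup>2) * K1" "(1 + w\<^sup>2) * K1 \<le> 12916/10000 * (246/100)"
      by (rule mm; use W k in simp)+
    have b: "0 \<le> c * w * K2" using h k by simp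
    have b': "c * w * K2 \<le> 5/13 * (54/100) * (305/100)" by (rule mm) (use h k in simp_all)
    have d: "274/1000 * (38/10) \<le> w\<^sup>2 * K3" "w\<^sup>2 * K3 \<le> 2916/10000 * 4" unfolding K3_def by (rule mm; use W K3 in simp)+
    have "E \<le> 11/10" "- 11/10 \<le> E" unfolding E using a b b' d by simp_all
    then show ?thesis by simp
  qed
  then have "r\<^sup>2 * \<bar>E\<bar> \<le> 236/1000 * v\<^sup>2 * (11/10)" using r by (intro mult_mono) auto
  also have "\<dots> \<le> 3/10 * v\<^sup>2" by simp
  finally have "r\<^sup>2 * \<bar>E\<bar> / v\<^sup>2 \<le> 3/10" using v0 by (simp add: pos_divide_le_eq)
  then have "kin p v * (r\<^sup>2 * \<bar>E\<bar> / v\<^sup>2) \<le> kin p v * (3/10)" using kin_pos[OF p(1) pv] by (intro mult_left_mono) auto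
  then show ?thesis unfolding Q using kin_pos[OF p(1) pv] by (simp add: abs_mult algebra_simps)
qed

text \<open>The counterpart of \<open>singular_rhs_polar\<close> with the slope kept as a parameter.
  On a line v = M + p w the quantity j is M / v.\<close>

lemma affine_rhs:
  fixes p v w :: real
  defines "s \<equiv> p / v"
  defines "j \<equiv> 1 - s * w" and "q \<equiv> (1 - s\<^sup>2) * w\<^sup>2"
  assumes p: "0 \<le> p" "p < v"
  shows "singular_rhs p v w = ((3 - 4 / (1 + v\<^sup>2)) * q - j\<^sup>2) / (2 * v * (1 - s\<^sup>2))"
    and "s\<^sup>2 < 1" and "v\<^sup>2 - p\<^sup>2 = v\<^sup>2 * (1 - s\<^sup>2)"
proof -
  have v: "0 < v" using p by simp
  have ps: "p = s * v" unfolding s_def using v by simp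
  have s: "0 \<le> s" "s < 1" unfolding s_def using p by auto
  have "s\<^sup>2 < 1\<^sup>2" using s by (intro power_strict_mono) auto
  then show s2: "s\<^sup>2 < 1" by simp
  show \<sigma>: "v\<^sup>2 - p\<^sup>2 = v\<^sup>2 * (1 - s\<^sup>2)" unfolding ps by (simp add: power_mult_distrib algebra_simps)
  define D N where "D = 1 - s\<^sup>2" and "N = 1 + v\<^sup>2"
  have N: "N > 0" "v\<^sup>2 = N - 1" unfolding N_def using one_plus_square_pos(1)[of v] by auto
  have D: "D > 0" using s2 unfolding D_def by simp
  have "v * (w\<^sup>2 + 1) - 2 * p * w = v * (j\<^sup>2 + q)" unfolding ps j_def q_def by (simp add: algebra_simps power2_eq_square)
  then have "singular_rhs p v w = - (v * (j\<^sup>2 + q)) / (2 * (v\<^sup>2 * D)) + 2 * v * w\<^sup>2 / N"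
    unfolding singular_rhs_eq[OF p] \<sigma> D_def N_def by simp
  also have "- (v * (j\<^sup>2 + q)) / (2 * (v\<^sup>2 * D)) = - (j\<^sup>2 + q) / (2 * v * D)"
  proof -
    have "- (v * a) / (2 * (v\<^sup>2 * D)) = - a / (2 * v * D)" for a using v by (simp add: power2_eq_square)
    then show ?thesis .
  qed
  also have "2 * v * w\<^sup>2 / N = (4 * v\<^sup>2 / N * (D * w\<^sup>2)) / (2 * v * D)" using v D by (simp add: power2_eq_square)
  also have "4 * v\<^sup>2 / N = 4 - 4 / N" unfolding N(2) using N(1) by (simp add: field_simps)
  also have "- (j\<^sup>2 + q) / (2 * v * D) + (4 - 4 / N) * (D * w\<^sup>2) / (2 * v * D) = (- (j\<^sup>2 + q) + (4 - 4 / N) * (D * w\<^sup>2)) / (2 * v * D)"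
    by (rule add_divide_distrib[symmetric])
  also have "- (j\<^sup>2 + q) + (4 - 4 / N) * (D * w\<^sup>2) = (3 - 4 / N) * q - j\<^sup>2"
    unfolding q_def D_def by (simp add: algebra_simps)
  finally show "singular_rhs p v w = ((3 - 4 / (1 + v\<^sup>2)) * q - j\<^sup>2) / (2 * v * (1 - s\<^sup>2))"
    unfolding N_def D_def .
qed

text \<open>The substitution s = p / v on the line v = M + p w, with ds = M / v^2 dp, carries p
  times the negative Euler-Lagrange defect into \<open>switch_k\<close>. This is the origin of the
  formula for \<open>switch_n\<close>.\<close>

lemma switch_density:
  fixes p v w M :: real
  assumes p: "0 \<le> p" "p < v" and M: "0 < M" and v: "v = M + p * w"
  shows "2 / M\<^sup>2 * (switch_k w (1 / M\<^sup>2) (p / v) * (M / v\<^sup>2)) = p * (kin p v * singular_rhs p v w)"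
proof -
  define s S j q N where "s = p / v" and "S = sqrt (1 - s\<^sup>2)" and "j = 1 - s * w" and "q = (1 - s\<^sup>2) * w\<^sup>2" and "N = 1 + v\<^sup>2"
  have v0: "0 < v" using p by simp
  have ps: "p = s * v" unfolding s_def using v0 by simp
  note r = affine_rhs(1)[OF p, of w, folded s_def] affine_rhs(2,3)[OF p, folded s_def]
  have S: "S > 0" "S\<^sup>2 = 1 - s\<^sup>2" unfolding S_def using r(2) by auto
  have N: "N > 0" unfolding N_def by (rule one_plus_square_pos)
  have j: "M = j * v" unfolding j_def v by (simp add: s_def) (use v0 v in \<open>simp add: field_simps\<close>)
  have j0: "j > 0" using M v0 unfolding j by (simp add: zero_less_mult_iff)
  define G where "G = (3 * v\<^sup>2 - 1) * q - N * j\<^sup>2"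
  have sq: "sqrt (v\<^sup>2 - p\<^sup>2) = v * S" unfolding r(3) S_def using v0 by (simp add: real_sqrt_mult)
  have K: "kin p v = 4 * v * S / N\<^sup>2" unfolding kin_def sq N_def by simp
  have R: "singular_rhs p v w = G / (N * (2 * v * S\<^sup>2))"
  proof -
    have "(3 - 4 / N) * q - j\<^sup>2 = G / N" unfolding G_def using N by (simp add: field_simps) (simp add: N_def algebra_simps)
    then show ?thesis unfolding r(1) S(2) j_def[symmetric] q_def[symmetric] N_def[symmetric] by simp
  qed
  have n: "switch_n s w (1 / M\<^sup>2) = j * G * v ^ 4 / N ^ 3"
  proof -
    have d: "1 + 1 / M\<^sup>2 * j\<^sup>2 = N / v\<^sup>2" unfolding j N_def using v0 j0 by (simp add: field_simps)
    have "j * (3 * q - j\<^sup>2) - 1 / M\<^sup>2 * j ^ 3 * (q + j\<^sup>2) = j * (3 * q - j\<^sup>2) - j * (q + j\<^sup>2) / v\<^sup>2"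
      unfolding j using v0 j0 by (simp add: power2_eq_square power3_eq_cube)
    also have "\<dots> = j * G / v\<^sup>2" unfolding G_def N_def using v0 by (simp add: field_simps)
    finally have a: "j * (3 * q - j\<^sup>2) - 1 / M\<^sup>2 * j ^ 3 * (q + j\<^sup>2) = j * G / v\<^sup>2" .
    have "switch_n s w (1 / M\<^sup>2) = (j * G / v\<^sup>2) / (N / v\<^sup>2) ^ 3"
      unfolding switch_n_def Let_def j_def[symmetric] q_def[symmetric] a d ..
    also have "\<dots> = j * G * v ^ 4 / N ^ 3" using v0 N by (simp add: power_divide power2_eq_square power3_eq_cube power4_eq_xxxx)
    finally show ?thesis .
  qed
  have "2 / M\<^sup>2 * (switch_k w (1 / M\<^sup>2) (p / v) * (M / v\<^sup>2)) = 2 / (j * v)\<^sup>2 * (s * (j * G * v ^ 4 / N ^ 3) / S * (j * v / v\<^sup>2))"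
    unfolding switch_k_def s_def[symmetric] n S_def[symmetric] unfolding j ..
  also have "\<dots> = 2 * s * v * G / (S * N ^ 3)"
    using v0 j0 by (simp add: power2_eq_square power4_eq_xxxx ac_simps)
  also have "\<dots> = p * (kin p v * singular_rhs p v w)"
    unfolding K R using v0 S(1) N by (simp add: ps power2_eq_square power3_eq_cube ac_simps)
  finally show ?thesis .
qed

text \<open>The sign is that of (3 - 4/(1 + v^2)) q - j^2, which increases along the line: 4 q / (1
  + v^2) decreases, and the increment of 3 q - j^2 is (s2 - s1) w (2 - 4 (s1 + s2) w), nonnegative
  for s <= 5/13 and w <= 54/100.\<close>

lemma affine_rhs_sign:
  fixes M w :: real
  assumes M: "0 < M" and w: "0 < w" "w \<le> 54/100" and p: "0 \<le> p" "p \<le> q" and v: "v1 = M + p * w" "v2 = M + q * w"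
    and lt: "p < v1" "q < v2" and s: "q / v2 \<le> 5/13"
    and pos: "0 \<le> singular_rhs p v1 w"
  shows "0 \<le> singular_rhs q v2 w"
proof -
  define s1 s2 where "s1 = p / v1" and "s2 = q / v2"
  have vpos: "0 < v1" "0 < v2" using p lt by auto
  have "p * v2 \<le> q * v1" unfolding v using p M by (simp add: algebra_simps mult_left_mono)
  then have s12: "0 \<le> s1" "s1 \<le> s2" "s2 \<le> 5/13" unfolding s1_def s2_def using vpos p s by (auto simp: divide_simps mult.commute)
  have v12: "v1 \<le> v2" unfolding v using p w by simp
  then have "v1\<^sup>2 \<le> v2\<^sup>2" using vpos by (intro power_mono) auto
  then have \<mu>: "4 / (1 + v2\<^sup>2) \<le> 4 / (1 + v1\<^sup>2)" using one_plus_square_pos(1)[of v1] by (intro divide_left_mono mult_pos_pos) auto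
  note r1 = affine_rhs(1)[OF p(1) lt(1), of w, folded s1_def] affine_rhs(2)[OF p(1) lt(1), folded s1_def]
  have q0: "0 \<le> q" using p by simp
  note r2 = affine_rhs(1)[OF q0 lt(2), of w, folded s2_def] affine_rhs(2)[OF q0 lt(2), folded s2_def]
  have "s1\<^sup>2 \<le> s2\<^sup>2" using s12 by (intro power_mono) auto
  then have "4 / (1 + v2\<^sup>2) * ((1 - s2\<^sup>2) * w\<^sup>2) \<le> 4 / (1 + v1\<^sup>2) * ((1 - s1\<^sup>2) * w\<^sup>2)"
    using \<mu> r2(2) one_plus_square_pos(1)[of v1] by (intro mult_mono) auto
  moreover have "3 * ((1 - s1\<^sup>2) * w\<^sup>2) - (1 - s1 * w)\<^sup>2 \<le> 3 * ((1 - s2\<^sup>2) * w\<^sup>2) - (1 - s2 * w)\<^sup>2"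
  proof -
    have "(s1 + s2) * w \<le> 10/13 * (54/100)" using s12 w by (intro mult_mono) auto
    then have "0 \<le> 2 - 4 * ((s1 + s2) * w)" by linarith
    then have "0 \<le> (s2 - s1) * (w * (2 - 4 * ((s1 + s2) * w)))" using s12(2) w(1) by (intro mult_nonneg_nonneg) linarith+
    also have "\<dots> = (3 * ((1 - s2\<^sup>2) * w\<^sup>2) - (1 - s2 * w)\<^sup>2) - (3 * ((1 - s1\<^sup>2) * w\<^sup>2) - (1 - s1 * w)\<^sup>2)"
      by (simp add: algebra_simps power2_eq_square)
    finally show ?thesis by simp
  qed
  moreover have "0 \<le> (3 - 4 / (1 + v1\<^sup>2)) * ((1 - s1\<^sup>2) * w\<^sup>2) - (1 - s1 * w)\<^sup>2"
  proof -
    have "0 < 2 * v1 * (1 - s1\<^sup>2)" using r1(2) vpos by simp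
    then show ?thesis using pos unfolding r1(1) by (meson divide_neg_pos not_le)
  qed
  ultimately have "0 \<le> (3 - 4 / (1 + v2\<^sup>2)) * ((1 - s2\<^sup>2) * w\<^sup>2) - (1 - s2 * w)\<^sup>2"
    unfolding left_diff_distrib by linarith
  then show ?thesis unfolding r2(1) using r2(2) vpos by simp
qed

section \<open>The trajectories as functions of p\<close>

definition traj :: "real \<Rightarrow> real \<Rightarrow> real" where "traj \<tau> q = trV \<tau> (trX \<tau> q)"
definition slp :: "real \<Rightarrow> real \<Rightarrow> real" where "slp \<tau> q = 1 / trY \<tau> (trX \<tau> q)"
definition p_sw :: "real \<Rightarrow> real" where "p_sw \<tau> = trP \<tau> (xr \<tau>)"
definition rhs_end :: "real \<Rightarrow> real" where "rhs_end \<tau> = sk \<tau> 0 / (2 * trV \<tau> 0 * (trY \<tau> 0)\<^sup>2)"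
text \<open>The first moment \<open>I1\<close> required by \<open>pmp_arc\<close>, written with
  \<open>switch_F\<close> so that its zero at the switch is the equation solved by
  \<open>xr\<close>.\<close>

definition switch_I :: "real \<Rightarrow> real \<Rightarrow> real" where
  "switch_I \<tau> p = 2 / (traj \<tau> 0)\<^sup>2 * switch_F (p / traj \<tau> p) (slp \<tau> (p_sw \<tau>)) (1 / (traj \<tau> 0)\<^sup>2)"

context
  fixes \<tau> :: real
  assumes \<tau>: "20 \<le> \<tau>"
begin

lemmas trX_at = trX_mem[OF \<tau>] and xr_bounds = \<rho>[OF \<tau>]

lemma xr_01: "xr \<tau> \<in> {0..1}" "0 < xr \<tau>" "xr \<tau> < 1" using xr_bounds by auto

lemma p_sw_bounds: "0 < p_sw \<tau>" "p_sw \<tau> < exp \<tau>" "p_sw \<tau> \<le> exp \<tau> / 4" "exp \<tau> \<le> 40 * p_sw \<tau>"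
  using trP_anti[OF \<tau>, of "xr \<tau>" 1] trP_anti[OF \<tau>, of 0 "xr \<tau>"] trP_ends[OF \<tau>] xr_01 trP_\<rho>_le[OF \<tau>] trP_\<rho>_ge[OF \<tau>]
  unfolding p_sw_def by auto

lemma p_sw_mem: "p_sw \<tau> \<in> {0..exp \<tau>}" using p_sw_bounds by auto

lemma trX_sw: "trX \<tau> (p_sw \<tau>) = xr \<tau>" unfolding p_sw_def by (rule trX_trP[OF \<tau> xr_01(1)])
lemma trX_ends: "trX \<tau> 0 = 1" "trX \<tau> (exp \<tau>) = 0"
  using trX_trP[OF \<tau>, of 1] trX_trP[OF \<tau>, of 0] trP_ends[OF \<tau>] by auto

lemma trX_right: assumes q: "q \<in> {p_sw \<tau>..exp \<tau>}" shows "trX \<tau> q \<in> {0..xr \<tau>}"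
proof -
  have "q \<in> {0..exp \<tau>}" using q p_sw_bounds by auto
  with trX_le[OF \<tau> this p_sw_mem] trX_at[OF this] q show ?thesis unfolding trX_sw by auto
qed

lemma trX_left: assumes q: "q \<in> {0..p_sw \<tau>}" shows "trX \<tau> q \<in> {xr \<tau>..1}"
proof -
  have "q \<in> {0..exp \<tau>}" using q p_sw_bounds by auto
  with trX_le[OF \<tau> p_sw_mem this] trX_at[OF this] q show ?thesis unfolding trX_sw by auto
qed

lemma trX_pos: assumes q: "q \<in> {0..<exp \<tau>}" shows "0 < trX \<tau> q"
proof -
  have "q \<in> {0..exp \<tau>}" using q by auto
  from trX_at[OF this] have "trX \<tau> q \<in> {0..1}" "trP \<tau> (trX \<tau> q) = q" by auto
  moreover then have "trX \<tau> q \<noteq> 0" using trP_ends(1)[OF \<tau>] q by auto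
  ultimately show ?thesis by auto
qed

lemma traj_deriv:
  assumes p: "p \<in> {0..exp \<tau>}"
  shows "(traj \<tau> has_real_derivative slp \<tau> p) (at p within {0..exp \<tau>})"
proof -
  have x: "trX \<tau> p \<in> {0..1}" using trX_at[OF p] by simp
  have "((\<lambda>q. trV \<tau> (trX \<tau> q)) has_real_derivative - (trV \<tau> (trX \<tau> p) * (2 / ((1 + (trX \<tau> p)\<^sup>2) * trB \<tau> (trX \<tau> p)))) / trP' \<tau> (trX \<tau> p)) (at p within {0..exp \<tau>})"
    by (rule DERIV_parametric[OF trX_cont_within[OF \<tau> p order_refl] trX_at p DERIV_trV[OF \<tau> x] DERIV_trP[OF \<tau> x]])
       (use trP'_neg[OF \<tau> x] in auto)
  moreover have "- (trV \<tau> (trX \<tau> p) * (2 / ((1 + (trX \<tau> p)\<^sup>2) * trB \<tau> (trX \<tau> p)))) / trP' \<tau> (trX \<tau> p) = slp \<tau> p"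
    unfolding trP'_def[OF \<tau>] slp_def using trV_pos[OF \<tau>, of "trX \<tau> p"] trB_pos[OF \<tau> x] one_plus_square_pos(2)[of "trX \<tau> p"] by simp
  ultimately show ?thesis unfolding traj_def[abs_def] by simp
qed

lemma trY_cont: "continuous_on {0..1} (trY \<tau>)"
proof -
  have "continuous_on {0..1} (yy \<tau> \<circ> (\<lambda>x. min x (xr \<tau>)))"
    by (intro continuous_on_compose continuous_intros continuous_on_subset[OF yy_cont[OF \<tau>]]) (use xr_bounds in auto)
  then show ?thesis unfolding trY_def[abs_def] o_def .
qed

lemma slp_cont: "continuous_on {0..exp \<tau>} (slp \<tau>)"
proof -
  have "continuous_on {0..exp \<tau>} (trY \<tau> \<circ> trX \<tau>)"
    by (intro continuous_on_compose trX_cont[OF \<tau>] continuous_on_subset[OF trY_cont]) (use trX_at in auto)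
  moreover have "trY \<tau> (trX \<tau> q) \<noteq> 0" if "q \<in> {0..exp \<tau>}" for q
    using trY_bounds(1)[OF \<tau>, of "trX \<tau> q"] trX_at[OF that] by auto
  ultimately show ?thesis unfolding slp_def[abs_def] o_def by (intro continuous_intros) auto
qed

lemma p_eq: "p \<in> {0..exp \<tau>} \<Longrightarrow> p = traj \<tau> p * cc (trX \<tau> p)"
  using trX_at[of p] unfolding traj_def trP_def by simp

lemma traj_pos: "0 < traj \<tau> p" unfolding traj_def by (rule trV_pos[OF \<tau>])

lemma traj_ge: "p \<in> {0..exp \<tau>} \<Longrightarrow> exp \<tau> \<le> 9 * traj \<tau> p"
  using trV_ge[OF \<tau>] trX_at unfolding traj_def by blast

lemma traj_gt: assumes p: "p \<in> {0..<exp \<tau>}" shows "p < traj \<tau> p"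
proof -
  have p': "p \<in> {0..exp \<tau>}" using p by auto
  have "cc (trX \<tau> p) < 1" using cc_bounds(3)[of "trX \<tau> p"] trX_pos[OF p] trX_at[OF p'] by auto
  then have "traj \<tau> p * cc (trX \<tau> p) < traj \<tau> p * 1" using traj_pos by (intro mult_strict_left_mono)
  then show ?thesis using p_eq[OF p'] by simp
qed

lemma slp_pos: "p \<in> {0..exp \<tau>} \<Longrightarrow> 0 < slp \<tau> p"
  using trY_bounds(1)[OF \<tau>] trX_at unfolding slp_def by simp

lemma slp_affine: "p \<in> {0..p_sw \<tau>} \<Longrightarrow> slp \<tau> p = slp \<tau> (p_sw \<tau>)"
  using trX_left[of p] trY_after[OF \<tau>, of "trX \<tau> p"] trY_after[OF \<tau>, of "xr \<tau>"] unfolding slp_def trX_sw by auto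

lemma t_rhs:
  assumes p: "p \<in> {p_sw \<tau>..<exp \<tau>}"
  shows "singular_rhs p (traj \<tau> p) (slp \<tau> p) = sk \<tau> (trX \<tau> p) / (2 * trV \<tau> (trX \<tau> p) * (trY \<tau> (trX \<tau> p))\<^sup>2)"
proof -
  have p': "p \<in> {0..exp \<tau>}" "p \<in> {0..<exp \<tau>}" "p \<in> {p_sw \<tau>..exp \<tau>}" using p p_sw_bounds by auto
  show ?thesis
    using trV_rhs_before[OF \<tau> trX_pos[OF p'(2)]] trX_right[OF p'(3)] trX_at[OF p'(1)] unfolding traj_def slp_def by simp
qed

lemma slp_sing:
  assumes p: "p \<in> {p_sw \<tau>..<exp \<tau>}"
  shows "(slp \<tau> has_real_derivative singular_rhs p (traj \<tau> p) (slp \<tau> p)) (at p within {p_sw \<tau>..exp \<tau>})"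
proof -
  define x where "x = trX \<tau> p"
  have p': "p \<in> {0..exp \<tau>}" "p \<in> {0..<exp \<tau>}" "p \<in> {p_sw \<tau>..exp \<tau>}" using p p_sw_bounds by auto
  have x: "0 < x" "x \<le> xr \<tau>" "x \<le> 7/9" "x \<in> {0..1}" "x \<in> {0..7/9}"
    unfolding x_def using trX_pos[OF p'(2)] trX_right[OF p'(3)] xr_bounds by auto
  define y' where "y' = yy \<tau> x * sk \<tau> x / ((1 + x\<^sup>2) * sarc \<tau> x)"
  have y: "yy \<tau> x > 0" by (rule yy_pos[OF \<tau> x(5)])
  have D: "(yy \<tau> has_real_derivative y') (at x within {0..xr \<tau>})"
    unfolding y'_def by (rule has_field_derivative_subset[OF DERIV_yy[OF \<tau> x(1,3)]]) (use xr_bounds in auto)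
  have D1: "((\<lambda>x. 1 / yy \<tau> x) has_real_derivative (0 * yy \<tau> x - 1 * y') / (yy \<tau> x * yy \<tau> x)) (at x within {0..xr \<tau>})"
    by (rule DERIV_divide[OF DERIV_const D]) (use y in simp)
  have DP: "(trP \<tau> has_real_derivative trP' \<tau> x) (at x within {0..xr \<tau>})"
    by (rule has_field_derivative_subset[OF DERIV_trP[OF \<tau> x(4)]]) (use xr_01 in auto)
  have par: "((\<lambda>q. 1 / yy \<tau> (trX \<tau> q)) has_real_derivative (0 * yy \<tau> x - 1 * y') / (yy \<tau> x * yy \<tau> x) / trP' \<tau> x) (at p within {p_sw \<tau>..exp \<tau>})"
    unfolding x_def
  proof (rule DERIV_parametric[where S="{0..xr \<tau>}" and P="trP \<tau>" and X="trX \<tau>" and V="\<lambda>x. 1 / yy \<tau> x"])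
    show "continuous (at p within {p_sw \<tau>..exp \<tau>}) (trX \<tau>)" by (rule trX_cont_within[OF \<tau> p'(3)]) (use p_sw_bounds in auto)
    show "trX \<tau> q \<in> {0..xr \<tau>} \<and> trP \<tau> (trX \<tau> q) = q" if q: "q \<in> {p_sw \<tau>..exp \<tau>}" for q
    proof -
      have "q \<in> {0..exp \<tau>}" using q p_sw_bounds by auto
      then show ?thesis using trX_right[OF q] trX_at by blast
    qed
    show "trP' \<tau> (trX \<tau> p) \<noteq> 0" using trP'_neg[OF \<tau> x(4)] unfolding x_def by simp
  qed (use D1 DP p' in \<open>simp_all add: x_def\<close>)
  have B: "trB \<tau> x = sarc \<tau> x" "trY \<tau> x = yy \<tau> x" using x trY_before[OF \<tau>, of x] by (simp_all add: trB_def)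
  have alg: "(0 * Y - 1 * (Y * k / (N * b))) / (Y * Y) / - (V * (2 / (N * b)) * Y) = k / (2 * V * Y\<^sup>2)"
    if "Y > 0" "N > 0" "b > 0" "V > 0" for Y N b V k :: real
    using that by (simp add: field_simps power2_eq_square)
  have "(0 * yy \<tau> x - 1 * y') / (yy \<tau> x * yy \<tau> x) / trP' \<tau> x = singular_rhs p (traj \<tau> p) (slp \<tau> p)"
    unfolding t_rhs[OF p] x_def[symmetric] trP'_def[OF \<tau>] y'_def B
    by (rule alg[OF y one_plus_square_pos(1) sb_pos[OF \<tau> x(5)] trV_pos[OF \<tau>]])
  with par have *: "((\<lambda>q. 1 / yy \<tau> (trX \<tau> q)) has_real_derivative singular_rhs p (traj \<tau> p) (slp \<tau> p)) (at p within {p_sw \<tau>..exp \<tau>})" by simp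
  show ?thesis
  proof (rule has_field_derivative_transform_within[OF *, where d=1])
    show "1 / yy \<tau> (trX \<tau> q) = slp \<tau> q" if "q \<in> {p_sw \<tau>..exp \<tau>}" for q
      using trX_right[OF that] trY_before[OF \<tau>, of "trX \<tau> q"] unfolding slp_def by simp
  qed (use p' in auto)
qed

lemma sk_cont: "continuous_on {0..7/9} (sk \<tau>)"
proof -
  have "1 + exp x \<noteq> 0" for x :: real using exp_gt_zero[of x] by linarith
  then show ?thesis
    unfolding sk_def[OF \<tau>, abs_def] smu_def mfun_def
    by (intro continuous_intros zet_cont sb_cont[OF \<tau>] sb_pos[OF \<tau>]) auto
qed

lemma t_rhs_lim: "((\<lambda>p. singular_rhs p (traj \<tau> p) (slp \<tau> p)) \<longlongrightarrow> rhs_end \<tau>) (at_left (exp \<tau>))"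
proof -
  define g where "g x = sk \<tau> x / (2 * trV \<tau> x * (trY \<tau> x)\<^sup>2)" for x
  have nz: "2 * trV \<tau> x * (trY \<tau> x)\<^sup>2 \<noteq> 0" if "x \<in> {0..xr \<tau>}" for x
    using trV_pos[OF \<tau>, of x] trY_bounds(1)[OF \<tau>, of x] that xr_01 by auto
  have g: "continuous_on {0..xr \<tau>} g" unfolding g_def
    by (intro continuous_intros continuous_on_subset[OF sk_cont] continuous_on_subset[OF trV_cont[OF \<tau>]] continuous_on_subset[OF trY_cont] ballI nz)
       (use xr_bounds in auto)
  have "continuous_on {p_sw \<tau>..exp \<tau>} (g \<circ> trX \<tau>)"
    by (intro continuous_on_compose continuous_on_subset[OF trX_cont[OF \<tau>]] continuous_on_subset[OF g]) (use trX_right p_sw_bounds in auto)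
  then have "((g \<circ> trX \<tau>) \<longlongrightarrow> (g \<circ> trX \<tau>) (exp \<tau>)) (at (exp \<tau>) within {p_sw \<tau>..exp \<tau>})"
    using p_sw_bounds(2) unfolding continuous_on_def by auto
  then have "((g \<circ> trX \<tau>) \<longlongrightarrow> rhs_end \<tau>) (at_left (exp \<tau>))"
    unfolding at_within_Icc_at_left[OF p_sw_bounds(2)] o_def trX_ends rhs_end_def g_def .
  moreover have "\<forall>\<^sub>F p in at_left (exp \<tau>). (g \<circ> trX \<tau>) p = singular_rhs p (traj \<tau> p) (slp \<tau> p)"
    unfolding eventually_at_left_field using p_sw_bounds(2) t_rhs by (intro exI[of _ "p_sw \<tau>"]) (auto simp: g_def)
  ultimately show ?thesis by (rule Lim_transform_eventually)
qed

text \<open>The constant \<kappa> of the locales: sk >= 6/100, v <= b and 1/v' <= 2 give 0.06 / (8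
  b).\<close>

lemma t_rhs_ge:
  assumes p: "p \<in> {p_sw \<tau>..<exp \<tau>}"
  shows "3 / (400 * exp \<tau>) \<le> singular_rhs p (traj \<tau> p) (slp \<tau> p)"
proof -
  define x where "x = trX \<tau> p"
  have p': "p \<in> {p_sw \<tau>..exp \<tau>}" using p by auto
  have x: "x \<in> {0..1}" "x \<in> {0..7/9}" unfolding x_def using trX_right[OF p'] xr_bounds by auto
  have "(trY \<tau> x)\<^sup>2 \<le> 2\<^sup>2" using trY_bounds[OF \<tau> x(1)] by (intro power_mono) auto
  then have "2 * trV \<tau> x * (trY \<tau> x)\<^sup>2 \<le> 2 * exp \<tau> * 4"
    using trV_le[OF \<tau> x(1)] trV_pos[OF \<tau>, of x] by (intro mult_mono) auto
  then have "(6/100) / (2 * exp \<tau> * 4) \<le> sk \<tau> x / (2 * trV \<tau> x * (trY \<tau> x)\<^sup>2)"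
    using sk_pos(1)[OF \<tau> x(2)] trV_pos[OF \<tau>, of x] trY_bounds[OF \<tau> x(1)] by (intro frac_le) auto
  then show ?thesis unfolding t_rhs[OF p] x_def[symmetric] by simp
qed

lemma bent_arc_t: "bent_arc (exp \<tau>) (p_sw \<tau>) (3 / (400 * exp \<tau>)) (rhs_end \<tau>) (traj \<tau>) (slp \<tau>)"
proof
  show "traj \<tau> (exp \<tau>) = exp \<tau>" unfolding traj_def trX_ends using trV_0[OF \<tau>] .
  show "slp \<tau> (exp \<tau>) = 1" unfolding slp_def trX_ends trY_def using xr_01
    by (simp add: yy_def cc_at_0 ss_at_0)
  show "0 < p_sw \<tau>" "p_sw \<tau> < exp \<tau>" "0 < 3 / (400 * exp \<tau>)" using p_sw_bounds(1,2) by simp_all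
  show "continuous_on {0..exp \<tau>} (slp \<tau>)" by (rule slp_cont)
  show "((\<lambda>p. singular_rhs p (traj \<tau> p) (slp \<tau> p)) \<longlongrightarrow> rhs_end \<tau>) (at_left (exp \<tau>))" by (rule t_rhs_lim)
qed (erule traj_deriv traj_gt slp_sing t_rhs_ge slp_affine)+


lemma traj_affine: assumes p: "p \<in> {0..p_sw \<tau>}" shows "traj \<tau> p = traj \<tau> 0 + p * slp \<tau> (p_sw \<tau>)"
proof -
  have "\<exists>c. \<forall>q\<in>{0..p_sw \<tau>}. traj \<tau> q - q * slp \<tau> (p_sw \<tau>) = c"
  proof (rule has_field_derivative_zero_constant)
    fix q assume q: "q \<in> {0..p_sw \<tau>}"
    then have q': "q \<in> {0..exp \<tau>}" using p_sw_bounds by auto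
    have "(traj \<tau> has_real_derivative slp \<tau> q) (at q within {0..p_sw \<tau>})"
      by (rule has_field_derivative_subset[OF traj_deriv[OF q']]) (use p_sw_bounds in auto)
    then have "((\<lambda>p. traj \<tau> p - p * slp \<tau> (p_sw \<tau>)) has_real_derivative slp \<tau> q - 1 * slp \<tau> (p_sw \<tau>)) (at q within {0..p_sw \<tau>})"
      by (intro DERIV_diff DERIV_cmult_right DERIV_ident)
    then show "((\<lambda>p. traj \<tau> p - p * slp \<tau> (p_sw \<tau>)) has_field_derivative 0) (at q within {0..p_sw \<tau>})"
      unfolding slp_affine[OF q] by simp
  qed simp
  then obtain c where c: "q \<in> {0..p_sw \<tau>} \<Longrightarrow> traj \<tau> q - q * slp \<tau> (p_sw \<tau>) = c" for q by blast
  from c[OF p] c[of 0] show ?thesis using p_sw_bounds(1) by simp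
qed

lemma slp_sw: "524/1000 \<le> slp \<tau> (p_sw \<tau>)" "slp \<tau> (p_sw \<tau>) \<le> 54/100"
  using w_mid[OF \<tau> xr_mem[OF \<tau>]] unfolding slp_def trX_sw trY_def by simp_all

lemma p_over_tv: assumes p: "p \<in> {0..p_sw \<tau>}" shows "p / traj \<tau> p = cc (trX \<tau> p)" "0 \<le> p / traj \<tau> p" "p / traj \<tau> p \<le> 5/13"
proof -
  have p': "p \<in> {0..exp \<tau>}" using p p_sw_bounds by auto
  show c: "p / traj \<tau> p = cc (trX \<tau> p)" using p_eq[OF p'] traj_pos[of p] by (metis nonzero_mult_div_cancel_left less_irrefl)
  show "0 \<le> p / traj \<tau> p" using p traj_pos[of p] by simp
  have "cc (trX \<tau> p) \<le> cc (xr \<tau>)"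
    using cc_strict_antimono[of "xr \<tau>" "trX \<tau> p"] trX_left[OF p] xr_01 by (cases "trX \<tau> p = xr \<tau>") auto
  then show "p / traj \<tau> p \<le> 5/13" unfolding c using cc_mid(2)[OF xr_mem[OF \<tau>]] by simp
qed

lemma p_sw_in: "p_sw \<tau> \<in> {0..p_sw \<tau>}" using p_sw_bounds by simp

lemma exp_large: "10 ^ 4 \<le> exp \<tau>"
proof (rule ccontr)
  assume "\<not> 10 ^ 4 \<le> exp \<tau>"
  then have "exp \<tau> * exp \<tau> < 10 ^ 4 * 10 ^ 4" by (intro mult_strict_mono) auto
  then show False using exp_tau_square[OF \<tau>] by simp
qed

text \<open>In polar terms 1 - c Y = s^2 - c s B <= s^2, because B is positive; the factor 4 is
  ample, since 1 + v^2 <= 4 v^2.\<close>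

lemma t_kin_dec:
  assumes p: "p \<in> {0..<exp \<tau>}"
  shows "(traj \<tau> p * slp \<tau> p - p) * (1 + (traj \<tau> p)\<^sup>2) \<le> 4 * traj \<tau> p * slp \<tau> p * ((traj \<tau> p)\<^sup>2 - p\<^sup>2)"
proof -
  define x V c s B Y where "x = trX \<tau> p" and "V = traj \<tau> p" and "c = cc x" and "s = ss x" and "B = trB \<tau> x" and "Y = trY \<tau> x"
  have p': "p \<in> {0..exp \<tau>}" using p by auto
  have x: "x \<in> {0..1}" unfolding x_def using trX_at[OF p'] by simp
  have V: "0 < V" unfolding V_def by (rule traj_pos)
  have pc: "p = V * c" unfolding V_def c_def x_def by (rule p_eq[OF p'])
  have Y: "c + s * B = Y" "0 < Y" unfolding c_def s_def B_def Y_def using trY_eq[OF \<tau> x] trY_bounds[OF \<tau> x] by auto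
  have n: "0 \<le> c * (s * B)" unfolding c_def s_def B_def using x by (intro mult_nonneg_nonneg cc_bounds(1) ss_nonneg[OF \<tau>] less_imp_le[OF trB_pos[OF \<tau> x]]) simp_all
  have cs: "s\<^sup>2 = 1 - c\<^sup>2" unfolding c_def s_def using cc_ss[of x] by simp
  have "1 - c * Y = s\<^sup>2 - c * (s * B)" unfolding Y(1)[symmetric] cs by (simp add: algebra_simps power2_eq_square)
  then have a: "1 - c * Y \<le> s\<^sup>2" using n by simp
  have "1 \<le> V" using exp_large traj_ge[OF p'] unfolding V_def by simp
  then have "1 \<le> V\<^sup>2" by (simp add: one_le_power)
  then have b: "1 + V\<^sup>2 \<le> 4 * V\<^sup>2" by simp
  have "(1 - c * Y) * (1 + V\<^sup>2) \<le> s\<^sup>2 * (1 + V\<^sup>2)" using a one_plus_square_pos(1)[of V] by (intro mult_right_mono) auto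
  also have "\<dots> \<le> s\<^sup>2 * (4 * V\<^sup>2)" using b by (intro mult_left_mono) auto
  finally have "V / Y * ((1 - c * Y) * (1 + V\<^sup>2)) \<le> V / Y * (s\<^sup>2 * (4 * V\<^sup>2))" using V Y(2) by (intro mult_left_mono) auto
  moreover have "V / Y * ((1 - c * Y) * N) = (V * (1 / Y) - V * c) * N" for N using Y(2) by (simp add: field_simps)
  moreover have "V / Y * (s\<^sup>2 * (4 * V\<^sup>2)) = 4 * V * (1 / Y) * (V\<^sup>2 - (V * c)\<^sup>2)" unfolding cs by (simp add: algebra_simps power_mult_distrib)
  moreover have "slp \<tau> p = 1 / Y" unfolding slp_def Y_def x_def ..
  ultimately show ?thesis unfolding V_def[symmetric] by (simp only: pc)
qed

text \<open>The defect of homogeneity is of order 1/b^3 because v >= b/9. The left side is at most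
  116640 / b^2, below 1.2 / 10^4, while the right side is at least 6/16000 because r >=
  b/40.\<close>

lemma t_small:
  assumes p: "p \<in> {p_sw \<tau>..<exp \<tau>}"
  shows "40 * exp \<tau> * (4 * (slp \<tau> p)\<^sup>2 * traj \<tau> p / (1 + (traj \<tau> p)\<^sup>2)\<^sup>2) \<le> 2 * p_sw \<tau> * (3 / (400 * exp \<tau>))"
proof -
  define b V where "b = exp \<tau>" and "V = traj \<tau> p"
  have p': "p \<in> {0..exp \<tau>}" using p p_sw_bounds by auto
  interpret A: bent_arc "exp \<tau>" "p_sw \<tau>" "3 / (400 * exp \<tau>)" "rhs_end \<tau>" "traj \<tau>" "slp \<tau>" by (rule bent_arc_t)
  have "slp \<tau> p \<le> 1" using A.w_mono[of p "exp \<tau>"] A.w_end p' by simp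
  then have "(slp \<tau> p)\<^sup>2 \<le> 1\<^sup>2" using slp_pos[OF p'] by (intro power_mono) auto
  then have w: "(slp \<tau> p)\<^sup>2 \<le> 1" by simp
  have b: "0 < b" "10 ^ 9 \<le> b\<^sup>2" unfolding b_def using exp_tau_square[OF \<tau>] by (auto simp: power2_eq_square)
  have V: "b \<le> 9 * V" "0 < V" unfolding b_def V_def using traj_ge[OF p'] traj_pos by auto
  have "V * V ^ 3 = (V\<^sup>2)\<^sup>2" by (simp add: power2_eq_square power3_eq_cube)
  also have "\<dots> \<le> (1 + V\<^sup>2)\<^sup>2" by (intro power_mono) auto
  finally have N: "V * V ^ 3 \<le> (1 + V\<^sup>2)\<^sup>2" .
  have "(slp \<tau> p)\<^sup>2 * V / (1 + V\<^sup>2)\<^sup>2 \<le> 1 * V / (V * V ^ 3)"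
    using w V N by (intro frac_le mult_right_mono) auto
  also have "\<dots> = 1 / V ^ 3" using V by simp
  also have "\<dots> \<le> 1 / (b / 9) ^ 3" using V b by (intro divide_left_mono power_mono) auto
  also have "\<dots> = 729 / b ^ 3" by (simp add: power_divide)
  finally have "40 * b * (4 * ((slp \<tau> p)\<^sup>2 * V / (1 + V\<^sup>2)\<^sup>2)) \<le> 40 * b * (4 * (729 / b ^ 3))" using b by (intro mult_left_mono) auto
  also have "\<dots> = 116640 / b\<^sup>2" using b by (simp add: power2_eq_square power3_eq_cube)
  also have "\<dots> \<le> 116640 / 10 ^ 9" using b by (intro divide_left_mono) auto
  also have "\<dots> \<le> 6 / (400 * 40)" by simp
  also have "\<dots> \<le> 2 * p_sw \<tau> * (3 / (400 * b))"
    using p_sw_bounds(4) b unfolding b_def[symmetric] by (simp add: field_simps)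
  finally show ?thesis unfolding b_def V_def by (simp add: mult.assoc)
qed

text \<open>Divided by v the inequality is scale invariant: c^2 k / (2 y^2) <= (1 - c/y) / 50, with
  c <= 5/13, k <= 0.44 and y >= 1.86.\<close>

lemma t_slope: "p_sw \<tau> * (p_sw \<tau> * singular_rhs (p_sw \<tau>) (traj \<tau> (p_sw \<tau>)) (slp \<tau> (p_sw \<tau>))) \<le> (traj \<tau> (p_sw \<tau>) - p_sw \<tau> * slp \<tau> (p_sw \<tau>)) / 50"
proof -
  define x V c y k where "x = xr \<tau>" and "V = trV \<tau> x" and "c = cc x" and "y = yy \<tau> x" and "k = sk \<tau> x"
  have x: "x \<in> {2/3..7/9}" "x \<in> {0..7/9}" unfolding x_def using xr_bounds by auto
  have Y: "trY \<tau> x = y" unfolding y_def using trY_after[OF \<tau>, of x] by (simp add: x_def)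
  have V: "0 < V" unfolding V_def by (rule trV_pos[OF \<tau>])
  have y: "186/100 \<le> y" "y \<le> 191/100" unfolding y_def using yy_mid[OF \<tau> x(1)] by auto
  have c: "0 \<le> c" "c \<le> 5/13" unfolding c_def using cc_mid[OF x(1)] by auto
  have "(16/10)\<^sup>2 \<le> (sarc \<tau> x)\<^sup>2" using sb_mid[OF \<tau> x(1)] by (intro power_mono) auto
  then have k: "0 \<le> k" "k \<le> 44/100" unfolding k_def
    using sk_pos(1)[OF \<tau> x(2)] smu_bounds(1)[OF \<tau>, of x] unfolding sk_def[OF \<tau>] by (auto simp: power2_eq_square)
  have s: "p_sw \<tau> = V * c" unfolding p_sw_def trP_def V_def c_def x_def ..
  have "p_sw \<tau> \<in> {p_sw \<tau>..<exp \<tau>}" using p_sw_bounds by simp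
  from t_rhs[OF this] have R: "singular_rhs (p_sw \<tau>) (traj \<tau> (p_sw \<tau>)) (slp \<tau> (p_sw \<tau>)) = k / (2 * V * y\<^sup>2)"
    unfolding trX_sw x_def[symmetric] V_def[symmetric] Y k_def[symmetric] .
  have "c\<^sup>2 \<le> (5/13)\<^sup>2" using c by (intro power_mono) auto
  then have "c\<^sup>2 * k \<le> (5/13)\<^sup>2 * (44/100)" using k by (intro mult_mono) auto
  moreover have "(186/100)\<^sup>2 \<le> y\<^sup>2" using y by (intro power_mono) auto
  ultimately have "c\<^sup>2 * k / (2 * y\<^sup>2) \<le> (5/13)\<^sup>2 * (44/100) / (2 * (186/100)\<^sup>2)" using k by (intro frac_le) auto
  also have "\<dots> \<le> (1 - 5/13 * (100/186)) / 50" by (simp add: power2_eq_square)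
  also have "\<dots> \<le> (1 - c * (1 / y)) / 50"
  proof -
    have "c * (1 / y) \<le> 5/13 * (100/186)" using c y by (intro mult_mono) (auto simp: divide_simps)
    then show ?thesis by simp
  qed
  finally have "V * (c\<^sup>2 * k / (2 * y\<^sup>2)) \<le> V * ((1 - c * (1 / y)) / 50)" using V by (intro mult_left_mono) auto
  moreover have "p_sw \<tau> * (p_sw \<tau> * (k / (2 * V * y\<^sup>2))) = V * (c\<^sup>2 * k / (2 * y\<^sup>2))" unfolding s using V by (simp add: power2_eq_square)
  moreover have "traj \<tau> (p_sw \<tau>) - p_sw \<tau> * slp \<tau> (p_sw \<tau>) = V * (1 - c * (1 / y))"
    unfolding traj_def slp_def trX_sw x_def[symmetric] Y V_def[symmetric] unfolding s by (simp add: algebra_simps)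
  ultimately show ?thesis unfolding R by simp
qed

text \<open>From r <= 5/13 (M + w r) and w <= 54/100 follows r <= 0.4856 M, and M is the least value
  of v on the line.\<close>

lemma p_sw_sq: assumes p: "p \<in> {0..p_sw \<tau>}" shows "(p_sw \<tau>)\<^sup>2 \<le> 236/1000 * (traj \<tau> p)\<^sup>2"
proof -
  define M w r where "M = traj \<tau> 0" and "w = slp \<tau> (p_sw \<tau>)" and "r = p_sw \<tau>"
  have M: "0 < M" unfolding M_def by (rule traj_pos)
  have w: "0 < w" "w \<le> 54/100" unfolding w_def using slp_sw by auto
  have "r \<le> 5/13 * traj \<tau> r" using p_over_tv(3)[OF p_sw_in] traj_pos[of r] unfolding r_def by (simp add: pos_divide_le_eq)
  also have "\<dots> = 5/13 * M + 5/13 * (w * r)" unfolding r_def traj_affine[OF p_sw_in] w_def M_def by (simp add: algebra_simps)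
  also have "w * r \<le> 54/100 * r" using w p_sw_bounds unfolding r_def by (intro mult_right_mono) auto
  finally have rM: "r \<le> 4856/10000 * M" using M by simp
  have "M \<le> traj \<tau> p" unfolding traj_affine[OF p] M_def using p slp_sw by simp
  then have "r \<le> 4856/10000 * traj \<tau> p" using rM by simp
  then have "r\<^sup>2 \<le> (4856/10000 * traj \<tau> p)\<^sup>2" using p_sw_bounds unfolding r_def by (intro power_mono) auto
  also have "\<dots> = (4856/10000)\<^sup>2 * (traj \<tau> p)\<^sup>2" by (rule power_mult_distrib)
  also have "\<dots> \<le> 236/1000 * (traj \<tau> p)\<^sup>2" by (intro mult_right_mono) (auto simp: power2_eq_square)
  finally show ?thesis unfolding r_def .
qed

lemma t_jac_small:
  assumes p: "p \<in> {0..p_sw \<tau>}"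
  shows "(p_sw \<tau>)\<^sup>2 * \<bar>jac_Q p (traj \<tau> p) (slp \<tau> p)\<bar> \<le> 3 / 10 * kin p (traj \<tau> p)"
proof (rule jac_Q_small)
  have p': "p \<in> {0..exp \<tau>}" using p p_sw_bounds by auto
  show "100 \<le> traj \<tau> p" using traj_ge[OF p'] exp_large by simp
  show "p \<le> 5/13 * traj \<tau> p" using p_over_tv(3)[OF p] traj_pos[of p] by (simp add: pos_divide_le_eq)
  show "524/1000 \<le> slp \<tau> p" "slp \<tau> p \<le> 54/100" unfolding slp_affine[OF p] by (rule slp_sw)+
qed (use p p_sw_sq[OF p] in auto)

lemma jacobi_arc_t: "jacobi_arc (exp \<tau>) (p_sw \<tau>) (3 / (400 * exp \<tau>)) (rhs_end \<tau>) (traj \<tau>) (slp \<tau>)"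
proof (intro jacobi_arc.intro bent_arc_t, unfold_locales)
  show "0 < slp \<tau> 0" by (rule slp_pos) simp
qed (erule t_kin_dec t_small t_jac_small | rule p_sw_bounds(3) t_slope)+

lemma t_zero: "traj \<tau> 0 = trV \<tau> (xr \<tau>) * (1 - cc (xr \<tau>) * (1 / yy \<tau> (xr \<tau>)))"
proof -
  have "traj \<tau> 0 = traj \<tau> (p_sw \<tau>) - p_sw \<tau> * slp \<tau> (p_sw \<tau>)" using traj_affine[OF p_sw_in] by simp
  also have "\<dots> = trV \<tau> (xr \<tau>) - trP \<tau> (xr \<tau>) * (1 / yy \<tau> (xr \<tau>))"
    using trY_after[OF \<tau>, of "xr \<tau>"] trX_sw by (simp add: traj_def slp_def p_sw_def)
  finally show ?thesis unfolding trP_def by (simp add: algebra_simps)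
qed

lemma eps_eq: "eps \<tau> (xr \<tau>) = 1 / (traj \<tau> 0)\<^sup>2"
proof -
  define x V c y where "x = xr \<tau>" and "V = trV \<tau> x" and "c = cc x" and "y = yy \<tau> x"
  have x: "x \<in> {2/3..7/9}" unfolding x_def using xr_bounds by auto
  have y: "0 < y" "0 < y - c" unfolding y_def c_def using yy_mid[OF \<tau> x] yy_cc_mid[OF \<tau> x] by auto
  have V: "0 < V" unfolding V_def by (rule trV_pos[OF \<tau>])
  have "exp (- 2 * (\<tau> - zet (sarc \<tau>) x)) = exp (- trZ \<tau> x) * exp (- trZ \<tau> x)"
    using trZ_before[OF \<tau>, of x] xr_01 unfolding x_def by (simp flip: exp_add)
  also have "\<dots> = 1 / V\<^sup>2" unfolding V_def trV_def by (simp add: exp_minus inverse_eq_divide power2_eq_square)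
  finally have e: "eps \<tau> x = 1 / V\<^sup>2 * (y / (y - c))\<^sup>2" unfolding eps_def y_def c_def by simp
  have "traj \<tau> 0 = V * ((y - c) / y)" unfolding t_zero using y by (simp add: x_def[symmetric] V_def[symmetric] y_def[symmetric] c_def[symmetric] diff_divide_distrib)
  then have "1 / (traj \<tau> 0)\<^sup>2 = 1 / V\<^sup>2 * (y / (y - c))\<^sup>2" using V y by (simp add: power_mult_distrib power_divide)
  then show ?thesis using e unfolding x_def by simp
qed

lemma switch_I_0: "switch_I \<tau> 0 = 0" unfolding switch_I_def switch_F_def by simp

lemma switch_I_sw: "switch_I \<tau> (p_sw \<tau>) = 0"
proof -
  have "Fhat \<tau> (xr \<tau>) = switch_F (p_sw \<tau> / traj \<tau> (p_sw \<tau>)) (slp \<tau> (p_sw \<tau>)) (1 / (traj \<tau> 0)\<^sup>2)"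
    using p_over_tv(1)[OF p_sw_in] trY_after[OF \<tau>, of "xr \<tau>"] unfolding Fhat_def eps_eq trX_sw slp_def by simp
  then show ?thesis unfolding switch_I_def xr_zero[OF \<tau>] by simp
qed

lemma switch_I_deriv:
  assumes p: "p \<in> {0..p_sw \<tau>}"
  shows "(switch_I \<tau> has_real_derivative p * (kin p (traj \<tau> p) * singular_rhs p (traj \<tau> p) (slp \<tau> p))) (at p within {0..p_sw \<tau>})"
proof -
  define M w e where "M = traj \<tau> 0" and "w = slp \<tau> (p_sw \<tau>)" and "e = 1 / (traj \<tau> 0)\<^sup>2"
  define g where "g q = q / traj \<tau> q" for q
  have p': "p \<in> {0..exp \<tau>}" "p \<in> {0..<exp \<tau>}" using p p_sw_bounds by auto
  have V: "0 < traj \<tau> p" by (rule traj_pos)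
  have g_in: "g ` {0..p_sw \<tau>} \<subseteq> {0..2/5}"
  proof
    fix s assume "s \<in> g ` {0..p_sw \<tau>}"
    then obtain q where q: "q \<in> {0..p_sw \<tau>}" "s = q / traj \<tau> q" unfolding g_def by blast
    show "s \<in> {0..2/5}" using p_over_tv(2,3)[OF q(1)] unfolding q(2) by simp
  qed
  have "(traj \<tau> has_real_derivative w) (at p within {0..p_sw \<tau>})"
    unfolding w_def slp_affine[OF p, symmetric] by (rule has_field_derivative_subset[OF traj_deriv[OF p'(1)]]) (use p_sw_bounds in auto)
  then have "((\<lambda>q. q / traj \<tau> q) has_real_derivative (1 * traj \<tau> p - p * w) / (traj \<tau> p * traj \<tau> p)) (at p within {0..p_sw \<tau>})"
    by (intro DERIV_divide DERIV_ident) (use V in auto)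
  then have G: "(g has_real_derivative M / (traj \<tau> p)\<^sup>2) (at p within {0..p_sw \<tau>})"
    using traj_affine[OF p] unfolding g_def[abs_def] M_def w_def by (simp add: power2_eq_square)
  have k: "continuous_on {0..2/5} (switch_k w e)" unfolding e_def by (rule switch_k_cont) auto
  have gp: "g p \<in> {0..2/5}" using g_in p by blast
  have "((\<lambda>\<sigma>. switch_F \<sigma> w e) has_real_derivative switch_k w e (g p)) (at (g p) within {0..2/5})"
    unfolding switch_F_def by (rule integral_has_real_derivative[OF k gp])
  from DERIV_image_chain[OF has_field_derivative_subset[OF this g_in] G]
  have "((\<lambda>q. switch_F (g q) w e) has_real_derivative switch_k w e (g p) * (M / (traj \<tau> p)\<^sup>2)) (at p within {0..p_sw \<tau>})"
    unfolding o_def .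
  from DERIV_cmult[OF this, of "2 / M\<^sup>2"]
  have "(switch_I \<tau> has_real_derivative 2 / M\<^sup>2 * (switch_k w (1 / M\<^sup>2) (p / traj \<tau> p) * (M / (traj \<tau> p)\<^sup>2))) (at p within {0..p_sw \<tau>})"
    unfolding switch_I_def[abs_def] M_def w_def e_def g_def .
  moreover have "2 / M\<^sup>2 * (switch_k w (1 / M\<^sup>2) (p / traj \<tau> p) * (M / (traj \<tau> p)\<^sup>2)) = p * (kin p (traj \<tau> p) * singular_rhs p (traj \<tau> p) w)"
    by (rule switch_density) (use p traj_gt[OF p'(2)] traj_pos traj_affine[OF p] in \<open>auto simp: M_def w_def\<close>)
  ultimately show ?thesis unfolding w_def slp_affine[OF p] by simp
qed

lemma pmp_arc_t: "pmp_arc (exp \<tau>) (p_sw \<tau>) (3 / (400 * exp \<tau>)) (rhs_end \<tau>) (traj \<tau>) (slp \<tau>) (switch_I \<tau>)"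
proof (intro pmp_arc.intro bent_arc_t, unfold_locales)
  fix p q assume pq: "0 \<le> p" "p \<le> q" "q \<le> p_sw \<tau>" and pos: "0 \<le> singular_rhs p (traj \<tau> p) (slp \<tau> p)"
  then have m: "p \<in> {0..p_sw \<tau>}" "q \<in> {0..p_sw \<tau>}" "p \<in> {0..<exp \<tau>}" "q \<in> {0..<exp \<tau>}" using p_sw_bounds by auto
  show "0 \<le> singular_rhs q (traj \<tau> q) (slp \<tau> q)"
    unfolding slp_affine[OF m(2)]
    by (rule affine_rhs_sign[OF traj_pos _ slp_sw(2) pq(1,2) traj_affine[OF m(1)] traj_affine[OF m(2)] traj_gt[OF m(3)] traj_gt[OF m(4)] p_over_tv(3)[OF m(2)]])
       (use slp_sw pos slp_affine[OF m(1)] in auto)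
qed (erule switch_I_deriv | rule switch_I_0 switch_I_sw)+

end

section \<open>The field of trajectories\<close>

text \<open>Up to x = 2/3 only the arcs are compared. Beyond, \<open>trY\<close> depends on \<tau>
  through the switching angle, at rate 1/100, and through the arc, at rate 1/10^6; dividing by ss >=
  92/100 leads back to \<open>trB\<close>.\<close>

lemma trB_diff:
  assumes \<tau>: "20 \<le> \<tau>1" "20 \<le> \<tau>2" and x: "x \<in> {0..1}"
  shows "\<bar>trB \<tau>1 x - trB \<tau>2 x\<bar> \<le> 1/50 * \<bar>\<tau>1 - \<tau>2\<bar>"
proof -
  define \<Delta> where "\<Delta> = \<bar>\<tau>1 - \<tau>2\<bar>"
  have \<Delta>: "0 \<le> \<Delta>" unfolding \<Delta>_def by simp
  note m = xr_mem[OF \<tau>(1)] xr_mem[OF \<tau>(2)]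
  have "\<bar>trB \<tau>1 x - trB \<tau>2 x\<bar> \<le> 1/50 * \<Delta>"
  proof (cases "x \<le> 2/3")
    case True
    then have "trB \<tau>1 x = sarc \<tau>1 x" "trB \<tau>2 x = sarc \<tau>2 x" using m unfolding trB_def by auto
    moreover have "\<bar>sarc \<tau>1 x - sarc \<tau>2 x\<bar> \<le> 1 / 10 ^ 6 * \<Delta>" unfolding \<Delta>_def by (rule arc_lipschitz[OF \<tau>]) (use True x in auto)
    ultimately show ?thesis using \<Delta> by simp
  next
    case False
    define a b where "a = min x (xr \<tau>1)" and "b = min x (xr \<tau>2)"
    have ab: "a \<in> {2/3..7/9}" "b \<in> {2/3..7/9}" unfolding a_def b_def using m False by auto
    have "\<bar>a - b\<bar> \<le> \<bar>xr \<tau>1 - xr \<tau>2\<bar>" unfolding a_def b_def by linarith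
    also have "\<dots> \<le> 1/100 * \<Delta>" unfolding \<Delta>_def by (rule xr_Lip[OF \<tau>])
    finally have d: "\<bar>a - b\<bar> \<le> 1/100 * \<Delta>" .
    have "\<bar>yy \<tau>1 a - yy \<tau>1 b\<bar> \<le> \<bar>a - b\<bar>"
      using yy_diff[OF \<tau>(1) ab] yy_diff[OF \<tau>(1) ab(2,1)] by (cases "a \<le> b") auto
    then have 1: "\<bar>yy \<tau>1 a - yy \<tau>1 b\<bar> \<le> 1/100 * \<Delta>" using d by (rule order_trans)
    have 2: "\<bar>yy \<tau>1 b - yy \<tau>2 b\<bar> \<le> 1 / 10 ^ 6 * \<Delta>" unfolding \<Delta>_def by (rule Fhat_tau_Lip(1)[OF \<tau> ab(2)])
    have "\<bar>yy \<tau>1 a - yy \<tau>2 b\<bar> \<le> \<bar>yy \<tau>1 a - yy \<tau>1 b\<bar> + \<bar>yy \<tau>1 b - yy \<tau>2 b\<bar>" by linarith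
    also have "\<dots> \<le> 1/100 * \<Delta> + 1 / 10 ^ 6 * \<Delta>" by (intro add_mono 1 2)
    finally have y: "\<bar>trY \<tau>1 x - trY \<tau>2 x\<bar> \<le> 1/100 * \<Delta> + 1 / 10 ^ 6 * \<Delta>" unfolding trY_def a_def b_def .
    have s: "92/100 \<le> ss x" using ss_high(1)[of x] False x by auto
    have "trY \<tau>1 x - trY \<tau>2 x = ss x * (trB \<tau>1 x - trB \<tau>2 x)"
      using trY_eq[OF \<tau>(1) x] trY_eq[OF \<tau>(2) x] by (simp add: algebra_simps)
    then have "\<bar>trY \<tau>1 x - trY \<tau>2 x\<bar> = ss x * \<bar>trB \<tau>1 x - trB \<tau>2 x\<bar>" using s by (simp add: abs_mult)
    moreover have "92/100 * \<bar>trB \<tau>1 x - trB \<tau>2 x\<bar> \<le> ss x * \<bar>trB \<tau>1 x - trB \<tau>2 x\<bar>" using s by (intro mult_right_mono) auto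
    ultimately have "92/100 * \<bar>trB \<tau>1 x - trB \<tau>2 x\<bar> \<le> 1/100 * \<Delta> + 1 / 10 ^ 6 * \<Delta>" using y by simp
    moreover have "t \<le> 1/50 * \<Delta>" if "92/100 * t \<le> 1/100 * \<Delta> + 1 / 10 ^ 6 * \<Delta>" for t using that \<Delta> by simp
    ultimately show ?thesis by blast
  qed
  then show ?thesis unfolding \<Delta>_def .
qed

text \<open>What matters is that 1/2 is below 1: at a fixed angle, that is, on a fixed ray p / v =
  const, ln v then increases strictly with \<tau>.\<close>

lemma trZ_diff:
  assumes \<tau>: "20 \<le> \<tau>1" "20 \<le> \<tau>2" and x: "x \<in> {0..1}"
  shows "\<bar>(trZ \<tau>1 x - \<tau>1) - (trZ \<tau>2 x - \<tau>2)\<bar> \<le> 1/2 * \<bar>\<tau>1 - \<tau>2\<bar>"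
proof -
  have "\<bar>zet (trB \<tau>1) x - zet (trB \<tau>2) x\<bar> \<le> 21/10 * (1/50 * \<bar>\<tau>1 - \<tau>2\<bar>) * x"
    by (rule zet_lipschitz[OF trB_cont[OF \<tau>(1)] trB_ge[OF \<tau>(1)] trB_cont[OF \<tau>(2)] trB_ge[OF \<tau>(2)] x trB_diff[OF \<tau>]])
       (use x in auto)
  also have "\<dots> \<le> 21/10 * (1/50 * \<bar>\<tau>1 - \<tau>2\<bar>) * 1" using x by (intro mult_left_mono) auto
  also have "\<dots> \<le> 1/2 * \<bar>\<tau>1 - \<tau>2\<bar>" by simp
  finally show ?thesis unfolding trZ_def by (simp add: abs_minus_commute)
qed

lemma trZ_strict_mono:
  assumes \<tau>: "20 \<le> \<tau>1" "\<tau>1 < \<tau>2" and x: "x \<in> {0..1}"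
  shows "trZ \<tau>1 x < trZ \<tau>2 x"
proof -
  have "20 \<le> \<tau>2" using \<tau> by simp
  from abs_le_D1[OF trZ_diff[OF \<tau>(1) this x]] show ?thesis using \<tau>(2) by (simp add: abs_if)
qed

lemma trV_mono:
  assumes \<tau>: "20 \<le> \<tau>1" "\<tau>1 \<le> \<tau>2" and x: "x \<in> {0..1}"
  shows "trV \<tau>1 x \<le> trV \<tau>2 x"
  using trZ_strict_mono[OF \<tau>(1) _ x] \<tau>(2) unfolding trV_def by (cases "\<tau>1 = \<tau>2") (auto intro: less_imp_le)

lemma trZ_surj:
  assumes \<tau>: "20 \<le> \<tau>0" and x: "x \<in> {0..1}" and z: "trZ \<tau>0 x \<le> z"
  shows "\<exists>\<tau>\<ge>\<tau>0. trZ \<tau> x = z"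
proof -
  \<comment> \<open>Since ln v is at least \<tau> - 21/10, the parameter z + 3 overshoots z.\<close>
  define \<tau>1 where "\<tau>1 = max \<tau>0 (z + 3)"
  have "20 \<le> \<tau>1" "z + 3 \<le> \<tau>1" using \<tau> unfolding \<tau>1_def by auto
  then have "z \<le> trZ \<tau>1 x" using trZ_bounds(2)[of \<tau>1, OF _ x] by simp
  moreover have "continuous_on {\<tau>0..\<tau>1} (\<lambda>\<tau>. trZ \<tau> x - \<tau>)"
  proof (rule lipschitz_on_continuous_on[of "1/2"], rule lipschitz_onI)
    fix s t assume "s \<in> {\<tau>0..\<tau>1}" "t \<in> {\<tau>0..\<tau>1}"
    then show "dist (trZ s x - s) (trZ t x - t) \<le> 1/2 * dist s t"
      using trZ_diff[of s t x] x \<tau> by (simp add: dist_real_def)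
  qed simp
  then have "continuous_on {\<tau>0..\<tau>1} (\<lambda>\<tau>. (trZ \<tau> x - \<tau>) + \<tau>)" by (rule continuous_on_add) (rule continuous_on_id)
  ultimately show ?thesis using IVT'[of "\<lambda>\<tau>. trZ \<tau> x" \<tau>0 z \<tau>1] z unfolding \<tau>1_def by auto
qed

text \<open>A common point fixes p / v and hence the angle; at that angle v determines
  \<tau>.\<close>

lemma traj_inj:
  assumes \<tau>: "20 \<le> \<tau>1" "20 \<le> \<tau>2" and p: "p \<in> {0..exp \<tau>1}" "p \<in> {0..exp \<tau>2}" and eq: "traj \<tau>1 p = traj \<tau>2 p"
  shows "\<tau>1 = \<tau>2"
proof -
  define x1 x2 where "x1 = trX \<tau>1 p" and "x2 = trX \<tau>2 p"
  have x: "x1 \<in> {0..1}" "x2 \<in> {0..1}" unfolding x1_def x2_def using trX_mem[OF \<tau>(1) p(1)] trX_mem[OF \<tau>(2) p(2)] by auto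
  have "traj \<tau>1 p * cc x1 = traj \<tau>1 p * cc x2"
    using p_eq[OF \<tau>(1) p(1)] p_eq[OF \<tau>(2) p(2)] unfolding x1_def x2_def eq by simp
  then have "cc x1 = cc x2" using traj_pos[OF \<tau>(1), of p] by simp
  then have "x1 = x2" using cc_strict_antimono[of x1 x2] cc_strict_antimono[of x2 x1] x by (cases x1 x2 rule: linorder_cases) auto
  then have "trV \<tau>1 x1 = trV \<tau>2 x1" using eq unfolding traj_def x1_def x2_def by simp
  then have "trZ \<tau>1 x1 = trZ \<tau>2 x1" unfolding trV_def by simp
  then show ?thesis using trZ_strict_mono[OF \<tau>(1) _ x(1), of \<tau>2] trZ_strict_mono[OF \<tau>(2) _ x(1), of \<tau>1]
    by (cases \<tau>1 \<tau>2 rule: linorder_cases) auto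
qed

text \<open>If the trajectory of \<tau>1 were lower at p, its ratio p / v would not be smaller and
  its angle not larger. But v decreases with the angle and increases with \<tau>, so it would not be
  lower.\<close>

lemma traj_mem_region:
  assumes \<tau>: "20 \<le> \<tau>0" "\<tau>0 \<le> \<tau>1" and p: "p \<in> {0..exp \<tau>1}"
  shows "(p, traj \<tau>1 p) \<in> region_above (exp \<tau>0) (traj \<tau>0)"
proof -
  have \<tau>1: "20 \<le> \<tau>1" using \<tau> by simp
  define x where "x = trX \<tau>1 p"
  have x: "x \<in> {0..1}" unfolding x_def using trX_mem[OF \<tau>1 p] by simp
  have py: "p \<le> traj \<tau>1 p" using p_eq[OF \<tau>1 p] traj_pos[OF \<tau>1, of p] cc_bounds(2)[OF x] unfolding x_def
    by (metis mult.right_neutral mult_left_mono less_imp_le)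
  have "traj \<tau>0 p \<le> traj \<tau>1 p" if "p \<le> exp \<tau>0"
  proof (rule ccontr)
    assume less: "\<not> traj \<tau>0 p \<le> traj \<tau>1 p"
    have p0: "p \<in> {0..exp \<tau>0}" using p that by auto
    define x0 where "x0 = trX \<tau>0 p"
    have x0: "x0 \<in> {0..1}" unfolding x0_def using trX_mem[OF \<tau>(1) p0] by simp
    have e: "traj \<tau>0 p * cc x0 = traj \<tau>1 p * cc x"
      using p_eq[OF \<tau>(1) p0] p_eq[OF \<tau>1 p] unfolding x_def x0_def by simp
    have "x \<le> x0"
    proof (rule ccontr)
      assume "\<not> x \<le> x0"
      then have "cc x < cc x0" using cc_strict_antimono[of x0 x] x0 by auto
      then have "traj \<tau>1 p * cc x < traj \<tau>1 p * cc x0" using traj_pos[OF \<tau>1, of p] by simp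
      also have "\<dots> \<le> traj \<tau>0 p * cc x0" using less cc_bounds(1)[OF x0] by (intro mult_right_mono) auto
      finally show False using e by simp
    qed
    then have "trV \<tau>0 x0 \<le> trV \<tau>0 x" using trV_anti[OF \<tau>(1), of x x0] x x0 by (cases "x = x0") auto
    also have "\<dots> \<le> trV \<tau>1 x" by (rule trV_mono[OF \<tau> x])
    finally show False using less unfolding traj_def x_def x0_def by simp
  qed
  then show ?thesis unfolding region_above_def using p py by auto
qed

lemma region_mem_tv:
  assumes \<tau>: "20 \<le> \<tau>0" and mem: "(p, y) \<in> region_above (exp \<tau>0) (traj \<tau>0)"
  shows "\<exists>\<tau>1\<ge>\<tau>0. p \<in> {0..exp \<tau>1} \<and> traj \<tau>1 p = y"
proof -
  have p: "0 \<le> p" "p \<le> y" and above: "p \<le> exp \<tau>0 \<Longrightarrow> traj \<tau>0 p \<le> y" using mem unfolding region_above_def by auto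
  have y: "0 < y"
  proof (cases "p = 0")
    case True then show ?thesis using above traj_pos[OF \<tau>, of p] by auto
  qed (use p in auto)
  have "0 \<le> p / y" "p / y \<le> 1" using p y by auto
  then obtain x where x: "x \<in> {0..1}" "cc x = p / y" using cc_surj by blast
  have pc: "p = y * cc x" using x(2) y by simp
  \<comment> \<open>The lowest trajectory meets the ray through (p, y) at or below the point.
    Otherwise p <= \<open>trP \<tau>0 x\<close> <= exp \<tau>0, so that p lies in the domain of that
    trajectory and its value at p is at most y; this forces the two angles to coincide.\<close>
  have "trV \<tau>0 x \<le> y"
  proof (rule ccontr)
    assume less: "\<not> trV \<tau>0 x \<le> y"
    then have "p \<le> trP \<tau>0 x" unfolding pc trP_def using cc_bounds(1)[OF x(1)] by (intro mult_right_mono) auto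
    moreover have "trP \<tau>0 x \<le> exp \<tau>0" using trP_image[OF \<tau>] x(1) by auto
    ultimately have pm: "p \<in> {0..exp \<tau>0}" and "p \<le> trP \<tau>0 x" using p by auto
    define x0 where "x0 = trX \<tau>0 p"
    have x0: "x0 \<in> {0..1}" "trP \<tau>0 x0 = p" unfolding x0_def using trX_mem[OF \<tau> pm] by auto
    have le: "x \<le> x0" using trP_le_iff[OF \<tau> x0(1) x(1)] \<open>p \<le> trP \<tau>0 x\<close> x0(2) by simp
    have v: "traj \<tau>0 p \<le> y" using above pm by simp
    have "x0 \<le> x"
    proof (rule ccontr)
      assume "\<not> x0 \<le> x"
      then have "cc x0 < cc x" using cc_strict_antimono[of x x0] x(1) by auto
      then have "traj \<tau>0 p * cc x0 < traj \<tau>0 p * cc x" using traj_pos[OF \<tau>, of p] by simp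
      also have "\<dots> \<le> y * cc x" using v cc_bounds(1)[OF x(1)] by (intro mult_right_mono)
      finally show False using p_eq[OF \<tau> pm] pc unfolding x0_def by simp
    qed
    then have "x0 = x" using le by simp
    then show False using v less unfolding traj_def x0_def by simp
  qed
  then have "trZ \<tau>0 x \<le> ln y" unfolding trV_def using y by (simp add: ln_ge_iff)
  from trZ_surj[OF \<tau> x(1) this] obtain \<tau>1 where \<tau>1: "\<tau>0 \<le> \<tau>1" "trZ \<tau>1 x = ln y" by blast
  have \<tau>1': "20 \<le> \<tau>1" using \<tau> \<tau>1 by simp
  have V: "trV \<tau>1 x = y" unfolding trV_def \<tau>1(2) using y by simp
  have P: "trP \<tau>1 x = p" unfolding trP_def V pc ..
  have "p \<in> {0..exp \<tau>1}" using trP_image[OF \<tau>1'] x(1) P by auto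
  moreover have "traj \<tau>1 p = y" unfolding traj_def using trX_trP[OF \<tau>1' x(1)] P V by simp
  ultimately show ?thesis using \<tau>1 by blast
qed

text \<open>Disjointness and bijectivity both rest on the rays p / v = const, along which the family
  is ordered by \<tau> and reaches every higher point.\<close>

theorem mainTheorem2:
  shows "\<exists>P0>0. \<exists>v :: real \<Rightarrow> real \<Rightarrow> real.
    (\<forall>p0\<ge>P0.
       admissible p0 (v p0) \<and> convex_on {0..p0} (v p0) \<and>
       (\<exists>\<phi> \<psi>. PMP p0 (v p0) \<phi> \<psi> \<and>
          (\<exists>r. 0 < r \<and> r < p0 \<and>
             (\<forall>p\<in>{0..r}. (D1 p0 (v p0) has_real_derivative 0) (at p within {0..r})) \<and>
             \<not> singular_on {0..r} \<psi> \<and>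
             singular_on {r..p0} \<psi> \<and>
             (\<forall>p\<in>{r..<p0}. (D1 p0 (v p0) has_real_derivative
                  singular_rhs p (v p0 p) (D1 p0 (v p0) p)) (at p within {r..p0})))) \<and>
       (\<exists>\<xi>. jacobi_solution p0 (v p0) \<xi> \<and>
          (\<forall>\<eta>. jacobi_solution p0 (v p0) \<eta> \<longrightarrow> (\<forall>p\<in>{0..p0}. \<eta> p = \<xi> p)) \<and>
          (\<forall>p\<in>{0..<p0}. \<xi> p \<noteq> 0))) \<and>
    disjoint_family_on (\<lambda>p0. graph_on p0 (v p0)) {P0..} \<and>
    bij_betw (\<lambda>(p0, p). (p, v p0 p)) {(p0, p). P0 \<le> p0 \<and> p \<in> {0..p0}} (region_above P0 (v P0))"
proof (intro exI[of _ "exp 20 :: real"] conjI exI[of _ "\<lambda>p0. traj (ln p0)"])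
  \<comment> \<open>The construction uses the parameter \<tau> = ln p0 and holds for \<tau> >= 20;
    hence the threshold exp 20.\<close>
  let ?v = "\<lambda>p0. traj (ln p0)"
  have L: "20 \<le> ln p0" "exp (ln p0) = p0" if "exp 20 \<le> p0" for p0 :: real
  proof -
    have "0 < p0" using that exp_gt_zero[of "20::real"] by linarith
    then show "20 \<le> ln p0" "exp (ln p0) = p0" using that by (simp_all add: ln_ge_iff)
  qed
  show "(0::real) < exp 20" by simp
  show "\<forall>p0\<ge>exp 20.
       admissible p0 (?v p0) \<and> convex_on {0..p0} (?v p0) \<and>
       (\<exists>\<phi> \<psi>. PMP p0 (?v p0) \<phi> \<psi> \<and>
          (\<exists>r. 0 < r \<and> r < p0 \<and>
             (\<forall>p\<in>{0..r}. (D1 p0 (?v p0) has_real_derivative 0) (at p within {0..r})) \<and>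
             \<not> singular_on {0..r} \<psi> \<and>
             singular_on {r..p0} \<psi> \<and>
             (\<forall>p\<in>{r..<p0}. (D1 p0 (?v p0) has_real_derivative
                  singular_rhs p (?v p0 p) (D1 p0 (?v p0) p)) (at p within {r..p0})))) \<and>
       (\<exists>\<xi>. jacobi_solution p0 (?v p0) \<xi> \<and>
          (\<forall>\<eta>. jacobi_solution p0 (?v p0) \<eta> \<longrightarrow> (\<forall>p\<in>{0..p0}. \<eta> p = \<xi> p)) \<and>
          (\<forall>p\<in>{0..<p0}. \<xi> p \<noteq> 0))"
  proof (intro allI impI)
    fix p0 :: real assume "exp 20 \<le> p0"
    note l = L[OF this]
    note P = pmp_arc.pmp_conclusion[OF pmp_arc_t[OF l(1)], unfolded l(2)]
    note J = jacobi_arc.jacobi_conclusion[OF jacobi_arc_t[OF l(1)], unfolded l(2)]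
    show "admissible p0 (?v p0) \<and> convex_on {0..p0} (?v p0) \<and>
       (\<exists>\<phi> \<psi>. PMP p0 (?v p0) \<phi> \<psi> \<and>
          (\<exists>r. 0 < r \<and> r < p0 \<and>
             (\<forall>p\<in>{0..r}. (D1 p0 (?v p0) has_real_derivative 0) (at p within {0..r})) \<and>
             \<not> singular_on {0..r} \<psi> \<and>
             singular_on {r..p0} \<psi> \<and>
             (\<forall>p\<in>{r..<p0}. (D1 p0 (?v p0) has_real_derivative
                  singular_rhs p (?v p0 p) (D1 p0 (?v p0) p)) (at p within {r..p0})))) \<and>
       (\<exists>\<xi>. jacobi_solution p0 (?v p0) \<xi> \<and>
          (\<forall>\<eta>. jacobi_solution p0 (?v p0) \<eta> \<longrightarrow> (\<forall>p\<in>{0..p0}. \<eta> p = \<xi> p)) \<and>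
          (\<forall>p\<in>{0..<p0}. \<xi> p \<noteq> 0))"
      by (rule conjI[OF conjunct1[OF P] conjI[OF conjunct1[OF conjunct2[OF P]] conjI[OF conjunct2[OF conjunct2[OF P]] J]]])
  qed
  have inj: "a = b" if ab: "exp 20 \<le> a" "exp 20 \<le> b" "p \<in> {0..a}" "p \<in> {0..b}" "?v a p = ?v b p" for a b p :: real
  proof -
    note la = L[OF ab(1)] and lb = L[OF ab(2)]
    have "ln a = ln b" by (rule traj_inj[OF la(1) lb(1) _ _ ab(5)]) (use ab(3,4) la(2) lb(2) in simp_all)
    then show ?thesis using la(2) lb(2) by metis
  qed
  show "disjoint_family_on (\<lambda>p0. graph_on p0 (?v p0)) {exp 20..}"
    unfolding disjoint_family_on_def
  proof (intro ballI impI)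
    fix a b :: real assume ab: "a \<in> {exp 20..}" "b \<in> {exp 20..}" "a \<noteq> b"
    have "z \<notin> graph_on b (?v b)" if "z \<in> graph_on a (?v a)" for z
    proof
      assume "z \<in> graph_on b (?v b)"
      with that obtain p where "p \<in> {0..a}" "p \<in> {0..b}" "?v a p = ?v b p" unfolding graph_on_def by blast
      with inj[of a b p] ab show False by simp
    qed
    then show "graph_on a (?v a) \<inter> graph_on b (?v b) = {}" by blast
  qed
  show "bij_betw (\<lambda>(p0, p). (p, ?v p0 p)) {(p0, p). exp 20 \<le> p0 \<and> p \<in> {0..p0}} (region_above (exp 20) (?v (exp 20)))"
    unfolding bij_betw_def
  proof
    show "inj_on (\<lambda>(p0, p). (p, ?v p0 p)) {(p0, p). exp 20 \<le> p0 \<and> p \<in> {0..p0}}"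
    proof (rule inj_onI)
      fix z z' :: "real \<times> real"
      assume z: "z \<in> {(p0, p). exp 20 \<le> p0 \<and> p \<in> {0..p0}}" "z' \<in> {(p0, p). exp 20 \<le> p0 \<and> p \<in> {0..p0}}"
        and eq: "(case z of (p0, p) \<Rightarrow> (p, ?v p0 p)) = (case z' of (p0, p) \<Rightarrow> (p, ?v p0 p))"
      obtain a p b q where zz: "z = (a, p)" "z' = (b, q)" by (cases z, cases z') blast
      have pq: "p = q" "?v a p = ?v b p" using eq by (auto simp: zz)
      have "a = b" by (rule inj[OF _ _ _ _ pq(2)]) (use z pq(1) in \<open>auto simp: zz\<close>)
      then show "z = z'" using pq zz by simp
    qed
    show "(\<lambda>(p0, p). (p, ?v p0 p)) ` {(p0, p). exp 20 \<le> p0 \<and> p \<in> {0..p0}} = region_above (exp 20) (?v (exp 20))"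
    proof
      show "(\<lambda>(p0, p). (p, ?v p0 p)) ` {(p0, p). exp 20 \<le> p0 \<and> p \<in> {0..p0}} \<subseteq> region_above (exp 20) (?v (exp 20))"
      proof
        fix z assume "z \<in> (\<lambda>(p0, p). (p, ?v p0 p)) ` {(p0, p). exp 20 \<le> p0 \<and> p \<in> {0..p0}}"
        then obtain p0 p where z: "z = (p, ?v p0 p)" "exp 20 \<le> p0" "p \<in> {0..p0}" by auto
        note l = L[OF z(2)]
        have "(p, traj (ln p0) p) \<in> region_above (exp 20) (traj 20)"
          by (rule traj_mem_region[OF order_refl l(1)]) (use z(3) l(2) in simp)
        then show "z \<in> region_above (exp 20) (?v (exp 20))" unfolding z(1) by simp
      qed
      show "region_above (exp 20) (?v (exp 20)) \<subseteq> (\<lambda>(p0, p). (p, ?v p0 p)) ` {(p0, p). exp 20 \<le> p0 \<and> p \<in> {0..p0}}"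
      proof
        fix z assume "z \<in> region_above (exp 20) (?v (exp 20))"
        moreover obtain p y where z: "z = (p, y)" by (cases z)
        ultimately have "(p, y) \<in> region_above (exp 20) (traj 20)" by simp
        from region_mem_tv[OF order_refl this] obtain \<tau> where t: "20 \<le> \<tau>" "p \<in> {0..exp \<tau>}" "traj \<tau> p = y" by blast
        show "z \<in> (\<lambda>(p0, p). (p, ?v p0 p)) ` {(p0, p). exp 20 \<le> p0 \<and> p \<in> {0..p0}}"
          by (rule image_eqI[of _ _ "(exp \<tau>, p)"]) (use t z in auto)
      qed
    qed
  qed
qed

end
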